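(* Let $G,N$ be Banach--Lie groups with Lie algebras $\mathfrak g,\mathfrak n$, and let $\pi: G\to \mathrm{Aut}(N)$ be a homomorphism defining a continuous action of $G$ on $N$. Let $I=[0,1]$. Then the half-Lie group $H:=N\rtimes_{\pi}G$, with $\mathfrak h:=T_1H=\mathfrak n\times\mathfrak g$, is $R$-regular, i.e. for every $\gamma\in R(I,\mathfrak h)$ there exists a unique $\eta=:\mathrm{Evol}_H(\gamma)\in AC_R(I,H)$ with $\delta(\eta)=\gamma$ and $\eta(0)=1_H$, and the map $\mathrm{Evol}_H: R(I,\mathfrak h)\to AC_R(I,H)$ is continuous.
   Context: Manifolds, Lie groups and smooth maps are over $\mathbb R$, modelled on locally convex spaces (Michal--Bastiani calculus: $f$ is $C^k$ if it is continuous and all iterated directional derivatives up to order $k$ exist and are jointly continuous). A Banach (Fr\'echet) Lie group is a group with a smooth manifold structure modelled on a Banach (Fr\'echet) space with smooth group operations. Setting: $\mathrm{Aut}(N)$ is the group of Lie group automorphisms of $N$; "$\pi$ defines a continuous action" means that $G\times N\to N$, $(g,n)\mapsto \pi(g)n$, is continuous. $H=N\rtimes_\pi G$ is the product manifold $N\times G$ with multiplication $(n_1,g_1)(n_2,g_2)=(n_1\cdot\pi(g_1)n_2,\,g_1g_2)$; it is a topological group whose left multiplications $\lambda_h: x\mapsto hx$ are smooth (a "half-Lie group": a topological group with a Banach manifold structure whose left multiplications are smooth). Right multiplications are in general only continuous. Let $I=[a,b]$ and let $E$ be a Fr\'echet space. A step function $I\to E$ is one that is constant on each open interval $]t_{j-1},t_j[$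 of some finite partition $a=t_0<\dots<t_n=b$; a regulated function is a uniform limit of a sequence of step functions. $R(I,E)$ is the space of classes $[\gamma]$ (modulo almost everywhere equality) of regulated functions, with the topology defined by the seminorms $[\gamma]\mapsto \operatorname{ess\,sup}_{t\in I} q(\gamma(t))$, $q$ a continuous seminorm on $E$. $AC_R(I,E)$ is the space of continuous $\eta: I\to E$ for which there is $[\gamma]\in R(I,E)$ with $\eta(s)=\eta(a)+\int_a^s\gamma(t)\,dt$ for all $s\in I$ (weak integral); $\eta':=[\gamma]$ is then unique, and $AC_R(I,E)$ is topologized by the isomorphism $\eta\mapsto(\eta(a),\eta')$ onto $E\times R(I,E)$. For a manifold $M$ modelled on $E$, $AC_R(I,M)$ is the set of continuous $\eta: I\to M$ for which there are a partition $a=t_0<\dots<t_n=b$ and charts $\varphi_j:U_j\to V_j\subseteq E$ with $\eta([t_{j-1},t_j])\subseteq U_j$ and $\varphi_j\circ\eta|_{[t_{j-1},t_j]}\in AC_R([t_{j-1},t_j],E)$. For a Fr\'echet--Lie group $\Gamma$, $AC_R(I,\Gamma)$ is a group under pointwise multiplication and carries the unique Lie group structure such that, for every chart $\varphi:U\to V$ of $\Gamma$ with $1\in U=U^{-1}$, the set $AC_R(I,U)=\{\eta\in AC_R(I,\Gamma) : \eta(I)\subseteq U\}$ is open and $\eta\mapsto\varphi\circ\eta$ is a diffeomorphism onto $AC_R(I,V)=\{\eta\in AC_R(I,E):\eta(I)\subseteq V\}$. $AC_R(I,H)=AC_R(I,N)\times AC_R(I,G)$ carries the product topology. Logarithmic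 derivative: for $\eta\in AC_R(I,H)$, $\delta(\eta)\in R(I,\mathfrak h)$ is the class of $t\mapsto T(\lambda_{\eta(t)^{-1}})\dot\eta(t)$, where $\dot\eta(t)\in T_{\eta(t)}H$ is obtained in charts from the derivatives $(\varphi_j\circ\eta)'$. *)

theory Defs
  imports "HOL-Analysis.Analysis" "HOL-Probability.Essential_Supremum" "HOL-Algebra.Bij"
begin

section \<open>Regulated functions\<close>

text \<open>A partition of \<open>[a,b]\<close> is given by the finite set of its points;
  \<open>consecutive P u v\<close> says that \<open>[u,v]\<close> is one of the intervals \<open>[t\<^sub>j\<^sub>-\<^sub>1,t\<^sub>j]\<close>.\<close>

definition partition_of :: "real \<Rightarrow> real \<Rightarrow> real set \<Rightarrow> bool" where
  "partition_of a b P \<longleftrightarrow> finite P \<and> P \<subseteq> {a..b} \<and> a \<in> P \<and> b \<in> P"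

definition consecutive :: "real set \<Rightarrow> real \<Rightarrow> real \<Rightarrow> bool" where
  "consecutive P u v \<longleftrightarrow> u \<in> P \<and> v \<in> P \<and> u < v \<and> {u<..<v} \<inter> P = {}"

definition step_on :: "real \<Rightarrow> real \<Rightarrow> (real \<Rightarrow> 'e) \<Rightarrow> bool" where
  "step_on a b f \<longleftrightarrow>
     (\<exists>P. partition_of a b P \<and> (\<forall>u v. consecutive P u v \<longrightarrow> f constant_on {u<..<v}))"

definition regulated_on :: "real \<Rightarrow> real \<Rightarrow> (real \<Rightarrow> 'e::real_normed_vector) \<Rightarrow> bool" where
  "regulated_on a b f \<longleftrightarrow>
     (\<exists>s. (\<forall>n. step_on a b (s n)) \<and> uniform_limit {a..b} s f sequentially)"

lemma consecutive_cover:
  assumes P: "partition_of a b P" and uv: "a \<le> u" "u \<le> v" "v \<le> b"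
    and gap: "{u<..<v} \<inter> P = {}" and ne: "u < v \<or> u \<notin> P"
  obtains u' v' where "consecutive P u' v'" "u' \<le> u" "v \<le> v'"
proof -
  let ?A = "{p\<in>P. p \<le> u}" and ?B = "{p\<in>P. v \<le> p}"
  have A: "finite ?A" "?A \<noteq> {}" and B: "finite ?B" "?B \<noteq> {}"
    using P uv by (auto simp: partition_of_def)
  have 1: "Max ?A \<in> ?A" "Min ?B \<in> ?B"
    using Max_in[OF A] Min_in[OF B] by auto
  have 2: "p \<le> Max ?A \<or> Min ?B \<le> p" if "p \<in> P" for p
  proof -
    have "p \<notin> {u<..<v}" using gap that by blast
    then have "p \<le> u \<or> v \<le> p" by auto
    then show ?thesis using A B that by (auto intro: Max_ge Min_le)
  qed
  define x y where xy: "x = Max ?A" "y = Min ?B"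
  have 3: "x \<in> P" "x \<le> u" "y \<in> P" "v \<le> y" using 1 by (auto simp: xy)
  have 4: "x < y"
    using 3 ne uv by (cases "u < v") (auto simp: less_le)
  have "p \<le> x \<or> y \<le> p" if "p \<in> P" for p using 2[OF that] by (simp add: xy)
  then have "consecutive P x y"
    unfolding consecutive_def using 3 4 by (force simp: not_less[symmetric])
  with 3 that show ?thesis by blast
qed

lemma step_on_combine:
  assumes f: "step_on a b f" and g: "step_on a b g"
  shows "step_on a b (\<lambda>t. h (f t) (g t))"
proof -
  obtain P Q where P: "partition_of a b P" "\<And>u v. consecutive P u v \<Longrightarrow> f constant_on {u<..<v}"
    and Q: "partition_of a b Q" "\<And>u v. consecutive Q u v \<Longrightarrow> g constant_on {u<..<v}"
    using f g unfolding step_on_def by blast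
  have "(\<lambda>t. h (f t) (g t)) constant_on {u<..<v}" if uv: "consecutive (P \<union> Q) u v" for u v
  proof -
    have *: "a \<le> u" "u \<le> v" "v \<le> b" "u < v" "{u<..<v} \<inter> P = {}" "{u<..<v} \<inter> Q = {}"
      using uv P(1) Q(1) by (auto simp: consecutive_def partition_of_def)
    obtain u1 v1 where 1: "consecutive P u1 v1" "u1 \<le> u" "v \<le> v1"
      using consecutive_cover[OF P(1)] * by metis
    obtain u2 v2 where 2: "consecutive Q u2 v2" "u2 \<le> u" "v \<le> v2"
      using consecutive_cover[OF Q(1)] * by metis
    obtain c where c: "\<And>t. u1 < t \<Longrightarrow> t < v1 \<Longrightarrow> f t = c"
      using P(2)[OF 1(1)] unfolding constant_on_def by auto
    obtain d where d: "\<And>t. u2 < t \<Longrightarrow> t < v2 \<Longrightarrow> g t = d"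
      using Q(2)[OF 2(1)] unfolding constant_on_def by auto
    show ?thesis
      unfolding constant_on_def using 1 2 by (intro exI[of _ "h c d"]) (auto simp: c d)
  qed
  moreover have "partition_of a b (P \<union> Q)"
    using P(1) Q(1) by (auto simp: partition_of_def)
  ultimately show ?thesis unfolding step_on_def by blast
qed

lemma step_on_const: "a \<le> b \<Longrightarrow> step_on a b (\<lambda>t. c)"
  unfolding step_on_def partition_of_def constant_on_def
  by (intro exI[of _ "{a,b}"]) auto

lemma regulated_on_const: "a \<le> b \<Longrightarrow> regulated_on a b (\<lambda>t. c)"
  unfolding regulated_on_def
  by (intro exI[of _ "\<lambda>n t. c"]) (auto simp: step_on_const intro: uniform_limit_const)

lemma regulated_on_add:
  assumes "regulated_on a b f" "regulated_on a b g"
  shows "regulated_on a b (\<lambda>t. f t + g t)"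
proof -
  obtain s r where "\<And>n. step_on a b (s n)" "uniform_limit {a..b} s f sequentially"
    "\<And>n. step_on a b (r n)" "uniform_limit {a..b} r g sequentially"
    using assms unfolding regulated_on_def by blast
  then show ?thesis unfolding regulated_on_def
    by (intro exI[of _ "\<lambda>n t. s n t + r n t"])
       (auto intro: step_on_combine[where h = "(+)"] uniform_limit_add)
qed

lemma regulated_on_scaleR:
  assumes "regulated_on a b f"
  shows "regulated_on a b (\<lambda>t. c *\<^sub>R f t)"
proof -
  obtain s where "\<And>n. step_on a b (s n)" "uniform_limit {a..b} s f sequentially"
    using assms unfolding regulated_on_def by blast
  then show ?thesis unfolding regulated_on_def
    by (intro exI[of _ "\<lambda>n t. c *\<^sub>R s n t"])
       (auto intro: step_on_combine[where h = "\<lambda>x _. c *\<^sub>R x"]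
          bounded_linear.uniform_limit[OF bounded_linear_scaleR_right])
qed

lemma regulated_on_uminus: "regulated_on a b f \<Longrightarrow> regulated_on a b (\<lambda>t. - f t)"
  using regulated_on_scaleR[of a b f "-1"] by simp

lemma regulated_on_diff:
  "regulated_on a b f \<Longrightarrow> regulated_on a b g \<Longrightarrow> regulated_on a b (\<lambda>t. f t - g t)"
  using regulated_on_add[OF _ regulated_on_uminus, of a b f g] by simp

lemma step_on_finite_cover:
  assumes P: "partition_of a b P" and t: "t \<in> {a..b}"
  shows "t \<in> P \<or> (\<exists>u v. consecutive P u v \<and> t \<in> {u<..<v})"
proof (cases "t \<in> P")
  case False
  with t obtain u v where "consecutive P u v" "u \<le> t" "t \<le> v"
    using consecutive_cover[OF P, of t t] by auto
  moreover from this False have "u \<noteq> t" "t \<noteq> v" by (auto simp: consecutive_def)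
  ultimately show ?thesis by force
qed simp

lemma step_on_finite_range:
  assumes "step_on a b f" shows "finite (f ` {a..b})"
proof -
  obtain P where P: "partition_of a b P" "\<And>u v. consecutive P u v \<Longrightarrow> f constant_on {u<..<v}"
    using assms unfolding step_on_def by blast
  then obtain c where c: "\<And>u v t. consecutive P u v \<Longrightarrow> t \<in> {u<..<v} \<Longrightarrow> f t = c u v"
    unfolding constant_on_def by metis
  have "f ` {a..b} \<subseteq> f ` P \<union> case_prod c ` (P \<times> P)"
  proof (rule image_subsetI)
    fix t assume "t \<in> {a..b}"
    then consider "t \<in> P" | u v where "consecutive P u v" "t \<in> {u<..<v}"
      using step_on_finite_cover[OF P(1)] by blast
    then show "f t \<in> f ` P \<union> case_prod c ` (P \<times> P)"
    proof cases
      case 2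
      then have "u \<in> P" "v \<in> P" "f t = c u v" using c by (auto simp: consecutive_def)
      then show ?thesis by force
    qed auto
  qed
  moreover have "finite P" using P(1) by (simp add: partition_of_def)
  ultimately show ?thesis by (meson finite_SigmaI finite_UnI finite_imageI finite_subset)
qed

lemma regulated_on_bounded:
  assumes "regulated_on a b f" shows "\<exists>K. \<forall>t\<in>{a..b}. norm (f t) \<le> K"
proof -
  obtain s where s: "\<And>n. step_on a b (s n)" "uniform_limit {a..b} s f sequentially"
    using assms unfolding regulated_on_def by blast
  from s(2) have "\<forall>\<^sub>F n in sequentially. \<forall>t\<in>{a..b}. dist (s n t) (f t) < 1"
    by (rule uniform_limitD) simp
  then obtain n where "\<forall>t\<in>{a..b}. dist (s n t) (f t) < 1"
    unfolding eventually_sequentially by blast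
  then have n: "\<And>t. t \<in> {a..b} \<Longrightarrow> dist (s n t) (f t) < 1" by blast
  have "bounded (s n ` {a..b})"
    using step_on_finite_range[OF s(1)] by (rule finite_imp_bounded)
  then obtain K where K: "\<And>t. t \<in> {a..b} \<Longrightarrow> norm (s n t) \<le> K"
    unfolding bounded_iff by blast
  have "norm (f t) \<le> K + 1" if "t \<in> {a..b}" for t
  proof -
    have "norm (f t) \<le> norm (s n t) + norm (f t - s n t)"
      by (metis add.commute diff_add_cancel norm_triangle_ineq)
    also have "norm (f t - s n t) \<le> 1"
      using n[OF that] by (simp add: dist_norm norm_minus_commute)
    finally show ?thesis using K[OF that] by linarith
  qed
  then show ?thesis by blast
qed

lemma step_on_norm_measurable:
  assumes "step_on a b f" shows "(\<lambda>t. norm (f t)) \<in> borel_measurable (lebesgue_on {a..b})"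
proof -
  obtain P where P: "partition_of a b P" "\<And>u v. consecutive P u v \<Longrightarrow> f constant_on {u<..<v}"
    using assms unfolding step_on_def by blast
  have finP: "finite P" using P(1) by (simp add: partition_of_def)
  let ?C = "(\<lambda>p. {p}) ` P \<union> (\<lambda>(u,v). {u<..<v}) ` {(u,v). consecutive P u v}"
  have "finite {(u,v). consecutive P u v}"
    by (rule finite_subset[of _ "P \<times> P"]) (auto simp: finP consecutive_def)
  then have fin: "finite ?C" using finP by auto
  show ?thesis
  proof (rule measurable_piecewise_restrict[where C = ?C])
    show "countable ?C" using fin by (rule countable_finite)
    show "W \<inter> space (lebesgue_on {a..b}) \<in> sets (lebesgue_on {a..b})" if "W \<in> ?C" for W
    proof -
      have "W \<in> sets lebesgue" using that by auto
      then show ?thesis by (auto simp: sets_restrict_space)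
    qed
    show "space (lebesgue_on {a..b}) \<subseteq> \<Union> ?C"
      using step_on_finite_cover[OF P(1)] by fastforce
    show "(\<lambda>t. norm (f t)) \<in> borel_measurable (restrict_space (lebesgue_on {a..b}) W)"
      if W: "W \<in> ?C" for W
    proof -
      have "\<exists>c. \<forall>t\<in>W. f t = c" using W P(2) unfolding constant_on_def by auto
      then obtain c where "\<And>t. t \<in> W \<Longrightarrow> f t = c" by blast
      then show ?thesis
        by (subst measurable_cong[where g = "\<lambda>_. norm c"]) (auto simp: space_restrict_space)
    qed
  qed
qed

lemma regulated_on_norm_measurable:
  assumes "regulated_on a b f"
  shows "(\<lambda>t. norm (f t)) \<in> borel_measurable (lebesgue_on {a..b})"
proof -
  obtain s where s: "\<And>n. step_on a b (s n)" "uniform_limit {a..b} s f sequentially"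
    using assms unfolding regulated_on_def by blast
  show ?thesis
  proof (rule borel_measurable_LIMSEQ_real)
    fix t assume "t \<in> space (lebesgue_on {a..b})"
    then have "(\<lambda>n. s n t) \<longlonglongrightarrow> f t"
      using tendsto_uniform_limitI[OF s(2)] by auto
    then show "(\<lambda>n. norm (s n t)) \<longlonglongrightarrow> norm (f t)" by (rule tendsto_norm)
  qed (use step_on_norm_measurable[OF s(1)] in auto)
qed

section \<open>The normed space \<open>R([0,1],E)\<close>\<close>

quotient_type (overloaded) 'e regR = "real \<Rightarrow> 'e::real_normed_vector" / partial:
  "\<lambda>f g. regulated_on 0 1 f \<and> regulated_on 0 1 g \<and> (AE t in lebesgue_on {0..1}. f t = g t)"
  morphisms rep_regR abs_regR
proof (rule part_equivpI)
  show "\<exists>f. regulated_on 0 1 f \<and> regulated_on 0 1 f \<and>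
      (AE t in lebesgue_on {0..1}. f t = (f t :: 'e))"
    by (intro exI[of _ "\<lambda>t. 0"]) (simp add: regulated_on_const)
  show "symp (\<lambda>f g. regulated_on 0 1 f \<and> regulated_on 0 1 g \<and>
      (AE t in lebesgue_on {0..1}. f t = (g t :: 'e)))"
    by (rule sympI) (auto elim: eventually_mono)
  show "transp (\<lambda>f g. regulated_on 0 1 f \<and> regulated_on 0 1 g \<and>
      (AE t in lebesgue_on {0..1}. f t = (g t :: 'e)))"
    by (rule transpI) (auto elim: eventually_elim2)
qed

definition essnorm :: "(real \<Rightarrow> 'e::real_normed_vector) \<Rightarrow> ereal" where
  "essnorm f = esssup (lebesgue_on {0..1}) (\<lambda>t. ereal (norm (f t)))"

lemma emeasure_unit: "emeasure (lebesgue_on {0..1::real}) (space (lebesgue_on {0..1})) = 1"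
  by (simp add: emeasure_restrict_space)

lemma essnorm_nonneg: "0 \<le> essnorm f"
proof (cases "(\<lambda>t. ereal (norm (f t))) \<in> borel_measurable (lebesgue_on {0..1})")
  case True
  have "0 = esssup (lebesgue_on {0..1::real}) (\<lambda>t. 0::ereal)"
    by (subst esssup_const) (use emeasure_unit in auto)
  also have "\<dots> \<le> essnorm f" unfolding essnorm_def by (rule esssup_mono) auto
  finally show ?thesis .
qed (simp add: essnorm_def esssup_non_measurable)

lemma ereal_norm_measurable:
  assumes "regulated_on 0 1 f"
  shows "(\<lambda>t. ereal (norm (f t))) \<in> borel_measurable (lebesgue_on {0..1})"
  using regulated_on_norm_measurable[OF assms] by (rule borel_measurable_ereal)

lemma essnorm_cong:
  assumes "regulated_on 0 1 f" "regulated_on 0 1 g" "AE t in lebesgue_on {0..1}. f t = g t"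
  shows "essnorm f = essnorm g"
  unfolding essnorm_def
  by (rule esssup_AE_cong) (use assms ereal_norm_measurable in \<open>auto elim: eventually_mono\<close>)

lemma essnorm_finite:
  assumes "regulated_on 0 1 f" shows "\<bar>essnorm f\<bar> \<noteq> \<infinity>"
proof -
  obtain K where K: "\<forall>t\<in>{0..1}. norm (f t) \<le> K" using regulated_on_bounded[OF assms] by blast
  have "essnorm f \<le> ereal K" unfolding essnorm_def
    by (rule esssup_I[OF ereal_norm_measurable[OF assms]]) (rule AE_I2, use K in auto)
  then show ?thesis using essnorm_nonneg[of f] by (cases "essnorm f") auto
qed

lemma essnorm_zero_iff:
  assumes "regulated_on 0 1 f"
  shows "essnorm f = 0 \<longleftrightarrow> (AE t in lebesgue_on {0..1}. f t = 0)"
proof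
  assume 0: "essnorm f = 0"
  show "AE t in lebesgue_on {0..1}. f t = 0"
    using esssup_AE[of "\<lambda>t. ereal (norm (f t))" "lebesgue_on {0..1}"]
    unfolding essnorm_def[symmetric] 0 by eventually_elim auto
next
  assume "AE t in lebesgue_on {0..1}. f t = 0"
  then have "essnorm f \<le> 0" unfolding essnorm_def
    by (intro esssup_I[OF ereal_norm_measurable[OF assms]]) (auto elim: eventually_mono)
  then show "essnorm f = 0" using essnorm_nonneg[of f] by (rule antisym)
qed

lemma essnorm_add:
  assumes "regulated_on 0 1 f" "regulated_on 0 1 g"
  shows "essnorm (\<lambda>t. f t + g t) \<le> essnorm f + essnorm g"
proof -
  have "essnorm (\<lambda>t. f t + g t) \<le>
      esssup (lebesgue_on {0..1}) (\<lambda>t. ereal (norm (f t)) + ereal (norm (g t)))"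
    unfolding essnorm_def
    by (rule esssup_mono[OF ereal_norm_measurable[OF regulated_on_add[OF assms]]])
       (simp add: norm_triangle_ineq)
  also have "\<dots> \<le> essnorm f + essnorm g" unfolding essnorm_def by (rule esssup_add)
  finally show ?thesis .
qed

lemma essnorm_scaleR:
  assumes "regulated_on 0 1 f"
  shows "essnorm (\<lambda>t. c *\<^sub>R f t) = ereal \<bar>c\<bar> * essnorm f"
proof (cases "c = 0")
  case True
  then show ?thesis using essnorm_zero_iff[OF regulated_on_const[of 0 1 0]]
    by (simp add: zero_ereal_def[symmetric])
next
  case False
  then show ?thesis unfolding essnorm_def
    by (subst esssup_cmult[symmetric]) auto
qed

instantiation regR :: (real_normed_vector) real_normed_vector
begin

lift_definition zero_regR :: "'a regR" is "\<lambda>t. 0"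
  by (simp add: regulated_on_const)

lift_definition plus_regR :: "'a regR \<Rightarrow> 'a regR \<Rightarrow> 'a regR" is "\<lambda>f g t. f t + g t"
  by (auto intro: regulated_on_add elim: eventually_elim2)

lift_definition uminus_regR :: "'a regR \<Rightarrow> 'a regR" is "\<lambda>f t. - f t"
  by (auto intro: regulated_on_uminus elim: eventually_mono)

lift_definition minus_regR :: "'a regR \<Rightarrow> 'a regR \<Rightarrow> 'a regR" is "\<lambda>f g t. f t - g t"
  by (auto intro: regulated_on_diff elim: eventually_elim2)

lift_definition scaleR_regR :: "real \<Rightarrow> 'a regR \<Rightarrow> 'a regR" is "\<lambda>c f t. c *\<^sub>R f t"
  by (auto intro: regulated_on_scaleR elim: eventually_mono)

lift_definition norm_regR :: "'a regR \<Rightarrow> real" is "\<lambda>f. real_of_ereal (essnorm f)"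
  by (auto dest: essnorm_cong)

definition dist_regR :: "'a regR \<Rightarrow> 'a regR \<Rightarrow> real" where
  "dist_regR x y = norm (x - y)"

definition sgn_regR :: "'a regR \<Rightarrow> 'a regR" where
  "sgn_regR x = inverse (norm x) *\<^sub>R x"

definition uniformity_regR :: "('a regR \<times> 'a regR) filter" where
  "uniformity_regR = (INF e\<in>{0<..}. principal {(x, y). dist x y < e})"

definition open_regR :: "'a regR set \<Rightarrow> bool" where
  "open_regR U \<longleftrightarrow> (\<forall>x\<in>U. \<forall>\<^sub>F (x', y) in uniformity. x' = x \<longrightarrow> y \<in> U)"

instance
proof
  fix x y z :: "'a regR" and r s :: real
  show "x + y + z = x + (y + z)"
    by transfer (simp add: regulated_on_add add.assoc)
  show "x + y = y + x"
    by transfer (simp add: regulated_on_add add.commute)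
  show "0 + x = x"
    by transfer (simp add: regulated_on_add regulated_on_const)
  show "- x + x = 0"
    by transfer (simp add: regulated_on_const)
  show "x - y = x + - y"
    by transfer (simp add: regulated_on_diff)
  show "r *\<^sub>R (x + y) = r *\<^sub>R x + r *\<^sub>R y"
    by transfer (auto simp: scaleR_add_right intro!: regulated_on_add regulated_on_scaleR)
  show "(r + s) *\<^sub>R x = r *\<^sub>R x + s *\<^sub>R x"
    by transfer (auto simp: scaleR_add_left intro!: regulated_on_add regulated_on_scaleR)
  show "r *\<^sub>R s *\<^sub>R x = (r * s) *\<^sub>R x"
    by transfer (auto intro!: regulated_on_scaleR)
  show "1 *\<^sub>R x = x"
    by transfer simp
  show "norm x = 0 \<longleftrightarrow> x = 0"
  proof transfer
    fix f :: "real \<Rightarrow> 'a"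
    assume "regulated_on 0 1 f \<and> regulated_on 0 1 f \<and> (AE t in lebesgue_on {0..1}. f t = f t)"
    then have f: "regulated_on 0 1 f" by simp
    then show "real_of_ereal (essnorm f) = 0 \<longleftrightarrow> regulated_on 0 1 f \<and>
        regulated_on 0 1 (\<lambda>t. 0::'a) \<and> (AE t in lebesgue_on {0..1}. f t = 0)"
      using essnorm_zero_iff[OF f] essnorm_finite[OF f]
      by (auto simp: real_of_ereal_eq_0 regulated_on_const)
  qed
  show "norm (x + y) \<le> norm x + norm y"
  proof transfer
    fix f g :: "real \<Rightarrow> 'a"
    assume "regulated_on 0 1 f \<and> regulated_on 0 1 f \<and> (AE t in lebesgue_on {0..1}. f t = f t)"
      and "regulated_on 0 1 g \<and> regulated_on 0 1 g \<and> (AE t in lebesgue_on {0..1}. g t = g t)"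
    then have fg: "regulated_on 0 1 f" "regulated_on 0 1 g" by simp_all
    show "real_of_ereal (essnorm (\<lambda>t. f t + g t)) \<le>
        real_of_ereal (essnorm f) + real_of_ereal (essnorm g)"
      using essnorm_add[OF fg] essnorm_finite[OF fg(1)] essnorm_finite[OF fg(2)]
        essnorm_finite[OF regulated_on_add[OF fg]]
      by (cases "essnorm f"; cases "essnorm g"; cases "essnorm (\<lambda>t. f t + g t)") auto
  qed
  show "norm (r *\<^sub>R x) = \<bar>r\<bar> * norm x"
    by transfer (simp add: essnorm_scaleR)
qed (simp_all add: dist_regR_def sgn_regR_def uniformity_regR_def open_regR_def)

end

lemma regulated_on_rep_regR: "regulated_on 0 1 (rep_regR c)"
  using Quotient3_rep_reflp[OF Quotient3_regR, of c] by simp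

section \<open>Absolutely continuous functions into normed spaces\<close>

text \<open>For regulated functions with values in a Banach space, the Henstock--Kurzweil integral
  exists and coincides with the weak integral.\<close>

definition has_reg_derivative ::
    "(real \<Rightarrow> 'e::real_normed_vector) \<Rightarrow> (real \<Rightarrow> 'e) \<Rightarrow> real \<Rightarrow> real \<Rightarrow> bool" where
  "has_reg_derivative \<eta> \<gamma> a b \<longleftrightarrow> continuous_on {a..b} \<eta> \<and> regulated_on a b \<gamma> \<and>
     (\<forall>s\<in>{a..b}. (\<gamma> has_integral (\<eta> s - \<eta> a)) {a..s})"

definition AC_on :: "real \<Rightarrow> real \<Rightarrow> (real \<Rightarrow> 'e::real_normed_vector) \<Rightarrow> bool" where
  "AC_on a b \<eta> \<longleftrightarrow> (\<exists>\<gamma>. has_reg_derivative \<eta> \<gamma> a b)"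

text \<open>The isomorphism \<open>\<eta> \<mapsto> (\<eta>(0),\<eta>')\<close> from \<open>AC\<^sub>R([0,1],E)\<close> onto \<open>E \<times> R([0,1],E)\<close>.\<close>

definition AC_coord :: "(real \<Rightarrow> 'e::real_normed_vector) \<Rightarrow> 'e \<times> 'e regR" where
  "AC_coord \<eta> = (\<eta> 0, THE c. has_reg_derivative \<eta> (rep_regR c) 0 1)"

lemma AE_lebesgue_on_negligible:
  assumes "AE t in lebesgue_on {0..1::real}. P t"
  obtains Z where "negligible Z" "\<And>t. t \<in> {0..1} - Z \<Longrightarrow> P t"
proof -
  have "AE t in lebesgue. t \<in> {0..1} \<longrightarrow> P t"
    using assms by (simp add: AE_restrict_space_iff)
  then obtain Z where Z: "{t. \<not> (t \<in> {0..1} \<longrightarrow> P t)} \<subseteq> Z" "Z \<in> null_sets lebesgue"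
    by (auto elim!: AE_E simp: null_sets_def)
  then show ?thesis using that[of Z] by (auto simp: negligible_iff_null_sets)
qed

lemma regulated_integral_zero:
  fixes h :: "real \<Rightarrow> 'e::banach"
  assumes h: "regulated_on 0 1 h" and int: "\<And>s. s \<in> {0..1} \<Longrightarrow> (h has_integral 0) {0..s}"
  shows "AE t in lebesgue_on {0..1}. h t = 0"
proof -
  obtain s where s: "\<And>n. step_on 0 1 (s n)" "uniform_limit {0..1} s h sequentially"
    using h unfolding regulated_on_def by blast
  then obtain P where P: "\<And>n. partition_of 0 1 (P n)"
    "\<And>n u v. consecutive (P n) u v \<Longrightarrow> s n constant_on {u<..<v}"
    unfolding step_on_def by metis
  have 0: "(h has_integral 0) {u..v}" if uv: "0 \<le> u" "u \<le> v" "v \<le> 1" for u v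
  proof -
    have v: "(h has_integral 0) {0..v}" using int uv by auto
    then have "h integrable_on {u..v}"
      using uv by (auto intro: integrable_on_subinterval)
    then obtain y where y: "(h has_integral y) {u..v}" by blast
    have "(h has_integral (0 + y)) {0..v}"
      by (rule has_integral_combine[of 0 u v]) (use uv int y in auto)
    from has_integral_unique[OF v this] y show ?thesis by simp
  qed
  have "h t = 0" if t: "t \<in> {0..1}" "t \<notin> (\<Union>n. P n)" for t
  proof -
    have "norm (h t) \<le> e" if e: "e > 0" for e
    proof -
      have "\<forall>\<^sub>F n in sequentially. \<forall>t\<in>{0..1}. dist (s n t) (h t) < e / 2"
        by (rule uniform_limitD[OF s(2)]) (use e in simp)
      then obtain n where "\<forall>t\<in>{0..1}. dist (s n t) (h t) < e / 2"
        unfolding eventually_sequentially by blast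
      then have n: "norm (h t - s n t) \<le> e / 2" if "t \<in> {0..1}" for t
        using that by (metis dist_norm dist_commute less_imp_le)
      obtain u v where uv: "consecutive (P n) u v" "t \<in> {u<..<v}"
        using step_on_finite_cover[OF P(1) t(1), of n] t(2) by blast
      then obtain c where c: "\<And>r. r \<in> {u<..<v} \<Longrightarrow> s n r = c"
        using P(2) unfolding constant_on_def by meson
      have b: "0 \<le> u" "u < v" "v \<le> 1"
        using uv(1) P(1)[of n] by (auto simp: consecutive_def partition_of_def)
      define p q where "p = (2 * u + v) / 3" and "q = (u + 2 * v) / 3"
      have pq: "u < p" "p < q" "q < v" using b by (auto simp: p_def q_def)
      have i: "(h has_integral 0) {p..q}" using pq b by (intro 0) auto
      have 1: "((\<lambda>r. h r - c) has_integral (0 - (q - p) *\<^sub>R c)) (cbox p q)"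
        using has_integral_diff[OF i has_integral_const_real[of c p q]] pq by simp
      have 2: "norm (h r - c) \<le> e / 2" if "r \<in> cbox p q" for r
        using n[of r] c[of r] that pq b by simp
      have "norm (0 - (q - p) *\<^sub>R c) \<le> e / 2 * measure lborel (cbox p q)"
        by (rule has_integral_bound[OF _ 1 2]) (use e in simp_all)
      then have "(q - p) * norm c \<le> (q - p) * (e / 2)" using pq by (simp add: mult.commute)
      then have "norm c \<le> e / 2" using pq by simp
      moreover have "norm (h t - c) \<le> e / 2" using n[OF t(1)] c[OF uv(2)] by simp
      moreover have "norm (h t) \<le> norm c + norm (h t - c)"
        by (metis add.commute diff_add_cancel norm_triangle_ineq)
      ultimately show ?thesis by simp
    qed
    then have "norm (h t) \<le> 0" by (rule field_le_epsilon[of _ 0, simplified])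
    then show ?thesis by simp
  qed
  moreover have "AE t in lebesgue_on {0..1::real}. t \<notin> (\<Union>n. P n)"
  proof -
    have "countable (\<Union>n. P n)" using P(1) by (auto simp: partition_of_def intro: countable_finite)
    then have "(\<Union>n. P n) \<in> null_sets lebesgue"
      using countable_imp_null_set_lborel null_sets_completionI by blast
    then have "AE t in lebesgue. t \<notin> (\<Union>n. P n)" by (rule AE_not_in)
    then show ?thesis by (subst AE_restrict_space_iff) (auto elim: eventually_mono)
  qed
  ultimately show ?thesis
    by (subst AE_restrict_space_iff) (auto simp: AE_restrict_space_iff elim!: eventually_mono)
qed

lemma has_reg_derivative_unique:
  fixes \<eta> :: "real \<Rightarrow> 'e::banach"
  assumes "has_reg_derivative \<eta> \<gamma> 0 1" "has_reg_derivative \<eta> \<gamma>' 0 1"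
  shows "AE t in lebesgue_on {0..1}. \<gamma> t = \<gamma>' t"
proof -
  have "AE t in lebesgue_on {0..1}. \<gamma> t - \<gamma>' t = 0"
  proof (rule regulated_integral_zero)
    show "regulated_on 0 1 (\<lambda>t. \<gamma> t - \<gamma>' t)"
      using assms by (auto simp: has_reg_derivative_def intro: regulated_on_diff)
    fix s :: real assume "s \<in> {0..1}"
    then have "((\<lambda>t. \<gamma> t - \<gamma>' t) has_integral ((\<eta> s - \<eta> 0) - (\<eta> s - \<eta> 0))) {0..s}"
      using assms unfolding has_reg_derivative_def by (intro has_integral_diff) auto
    then show "((\<lambda>t. \<gamma> t - \<gamma>' t) has_integral 0) {0..s}" by simp
  qed
  then show ?thesis by simp
qed

lemma has_reg_derivative_abs_regR:
  assumes "has_reg_derivative \<eta> \<gamma> 0 1"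
  shows "has_reg_derivative \<eta> (rep_regR (abs_regR \<gamma>)) 0 1"
proof -
  have \<gamma>: "regulated_on 0 1 \<gamma>" using assms by (simp add: has_reg_derivative_def)
  have "AE t in lebesgue_on {0..1}. rep_regR (abs_regR \<gamma>) t = \<gamma> t"
    using rep_abs_rsp_left[OF Quotient3_regR, of \<gamma> \<gamma>] \<gamma> by simp
  then obtain Z where Z: "negligible Z" "\<And>t. t \<in> {0..1} - Z \<Longrightarrow> rep_regR (abs_regR \<gamma>) t = \<gamma> t"
    by (rule AE_lebesgue_on_negligible) blast
  have "(rep_regR (abs_regR \<gamma>) has_integral (\<eta> s - \<eta> 0)) {0..s}" if "s \<in> {0..1}" for s
    by (rule has_integral_spike[OF Z(1), where f = \<gamma>])
       (use Z(2) that assms in \<open>auto simp: has_reg_derivative_def\<close>)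
  then show ?thesis using assms by (simp add: has_reg_derivative_def regulated_on_rep_regR)
qed

lemma AC_on_AC_coord:
  fixes \<eta> :: "real \<Rightarrow> 'e::banach"
  assumes "AC_on 0 1 \<eta>"
  shows "has_reg_derivative \<eta> (rep_regR (snd (AC_coord \<eta>))) 0 1"
proof -
  obtain \<gamma> where \<gamma>: "has_reg_derivative \<eta> \<gamma> 0 1" using assms by (auto simp: AC_on_def)
  have "c = c'" if "has_reg_derivative \<eta> (rep_regR c) 0 1" "has_reg_derivative \<eta> (rep_regR c') 0 1"
    for c c'
    using has_reg_derivative_unique[OF that]
    by (intro Quotient3_rel_rep[OF Quotient3_regR, THEN iffD1]) (simp add: regulated_on_rep_regR)
  then have "\<exists>!c. has_reg_derivative \<eta> (rep_regR c) 0 1"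
    using has_reg_derivative_abs_regR[OF \<gamma>] by blast
  then show ?thesis unfolding AC_coord_def snd_conv by (rule theI')
qed

lemma AC_coord_eq_imp:
  fixes \<eta> \<zeta> :: "real \<Rightarrow> 'e::banach"
  assumes "AC_on 0 1 \<eta>" "AC_on 0 1 \<zeta>" "AC_coord \<eta> = AC_coord \<zeta>" "t \<in> {0..1}"
  shows "\<eta> t = \<zeta> t"
proof -
  have "\<eta> t - \<eta> 0 = \<zeta> t - \<zeta> 0"
    using AC_on_AC_coord[OF assms(1)] AC_on_AC_coord[OF assms(2)] assms(3,4)
    unfolding has_reg_derivative_def by (metis has_integral_unique)
  moreover have "\<eta> 0 = \<zeta> 0" using assms(3) by (simp add: AC_coord_def)
  ultimately show ?thesis by simp
qed

section \<open>Smooth maps, manifolds, and Lie groups\<close>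

text \<open>Iterated directional derivative \<open>D\<^bsub>v(j-1)\<^esub> \<cdots> D\<^bsub>v(0)\<^esub> f\<close>.
  The directions form an infinite sequence, of which only the first \<open>j\<close> terms matter; this avoids
  a type depending on \<open>j\<close>. Joint continuity on \<open>U \<times> E\<^sup>j\<close> is the same as joint continuity on
  \<open>U \<times> (nat \<Rightarrow> E)\<close> with respect to the product topology.\<close>

definition dir_deriv ::
    "('a::real_normed_vector \<Rightarrow> 'b::real_normed_vector) \<Rightarrow> 'a \<Rightarrow> 'a \<Rightarrow> 'b" where
  "dir_deriv f x v = vector_derivative (\<lambda>s. f (x + s *\<^sub>R v)) (at 0)"

primrec iter_dir_deriv ::
    "nat \<Rightarrow> ('a::real_normed_vector \<Rightarrow> 'b::real_normed_vector) \<Rightarrow> (nat \<Rightarrow> 'a) \<Rightarrow> 'a \<Rightarrow> 'b" where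
  "iter_dir_deriv 0 f v = f"
| "iter_dir_deriv (Suc j) f v = (\<lambda>x. dir_deriv (iter_dir_deriv j f v) x (v j))"

definition Ck_on ::
    "nat \<Rightarrow> 'a set \<Rightarrow> ('a::real_normed_vector \<Rightarrow> 'b::real_normed_vector) \<Rightarrow> bool" where
  "Ck_on k U f \<longleftrightarrow>
     (\<forall>j<k. \<forall>x\<in>U. \<forall>v. (\<lambda>s. iter_dir_deriv j f v (x + s *\<^sub>R v j)) differentiable (at 0)) \<and>
     (\<forall>j\<le>k. continuous_on (U \<times> UNIV) (\<lambda>(x, v). iter_dir_deriv j f v x))"

definition smooth_on ::
    "'a set \<Rightarrow> ('a::real_normed_vector \<Rightarrow> 'b::real_normed_vector) \<Rightarrow> bool" where
  "smooth_on U f \<longleftrightarrow> (\<forall>k. Ck_on k U f)"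

text \<open>A chart is given by its domain together with a map that is relevant only on this domain.\<close>

type_synonym ('m, 'e) chart = "'m set \<times> ('m \<Rightarrow> 'e)"

definition compatible ::
    "('m, 'e::real_normed_vector) chart \<Rightarrow> ('m, 'e) chart \<Rightarrow> bool" where
  "compatible c d \<longleftrightarrow> (case (c, d) of ((U, \<phi>), (V, \<psi>)) \<Rightarrow>
     open (\<phi> ` (U \<inter> V)) \<and> smooth_on (\<phi> ` (U \<inter> V)) (\<psi> \<circ> inv_into U \<phi>) \<and>
     open (\<psi> ` (U \<inter> V)) \<and> smooth_on (\<psi> ` (U \<inter> V)) (\<phi> \<circ> inv_into V \<psi>))"

definition points :: "('m, 'e) chart set \<Rightarrow> 'm set" where
  "points A = (\<Union>(U, \<phi>)\<in>A. U)"

definition manifold_topology :: "('m, 'e::real_normed_vector) chart set \<Rightarrow> 'm topology" where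
  "manifold_topology A =
     topology (\<lambda>W. W \<subseteq> points A \<and> (\<forall>(U, \<phi>)\<in>A. open (\<phi> ` (W \<inter> U))))"

definition smooth_manifold :: "('m, 'e::real_normed_vector) chart set \<Rightarrow> bool" where
  "smooth_manifold A \<longleftrightarrow>
     (\<forall>(U, \<phi>)\<in>A. inj_on \<phi> U \<and> open (\<phi> ` U)) \<and>
     (\<forall>c\<in>A. \<forall>d\<in>A. compatible c d) \<and>
     Hausdorff_space (manifold_topology A)"

text \<open>The charts of the manifold, that is, the elements of the maximal atlas.\<close>

definition charts :: "('m, 'e::real_normed_vector) chart set \<Rightarrow> ('m, 'e) chart set" where
  "charts A = {(U, \<phi>). U \<subseteq> points A \<and> inj_on \<phi> U \<and> open (\<phi> ` U) \<and>
                 (\<forall>c\<in>A. compatible (U, \<phi>) c)}"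

definition smooth_map ::
    "('m, 'e::real_normed_vector) chart set \<Rightarrow> ('n, 'f::real_normed_vector) chart set \<Rightarrow>
     ('m \<Rightarrow> 'n) \<Rightarrow> bool" where
  "smooth_map A B f \<longleftrightarrow>
     continuous_map (manifold_topology A) (manifold_topology B) f \<and>
     (\<forall>(U, \<phi>)\<in>A. \<forall>(V, \<psi>)\<in>B. smooth_on (\<phi> ` (U \<inter> f -` V)) (\<psi> \<circ> f \<circ> inv_into U \<phi>))"

definition prod_chart :: "('m, 'e) chart \<Rightarrow> ('n, 'f) chart \<Rightarrow> ('m \<times> 'n, 'e \<times> 'f) chart" where
  "prod_chart c d = (fst c \<times> fst d, map_prod (snd c) (snd d))"

definition prod_atlas ::
    "('m, 'e) chart set \<Rightarrow> ('n, 'f) chart set \<Rightarrow> ('m \<times> 'n, 'e \<times> 'f) chart set" where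
  "prod_atlas A B = (\<lambda>(c, d). prod_chart c d) ` (A \<times> B)"

record ('m, 'e) mgroup = "'m monoid" +
  atlas :: "('m, 'e) chart set"

abbreviation group_topology :: "('m, 'e::real_normed_vector) mgroup \<Rightarrow> 'm topology" where
  "group_topology L \<equiv> manifold_topology (atlas L)"

definition Lie_group :: "('m, 'e::real_normed_vector) mgroup \<Rightarrow> bool" where
  "Lie_group L \<longleftrightarrow> group L \<and> smooth_manifold (atlas L) \<and> points (atlas L) = carrier L \<and>
     smooth_map (prod_atlas (atlas L) (atlas L)) (atlas L) (\<lambda>(x, y). x \<otimes>\<^bsub>L\<^esub> y) \<and>
     smooth_map (atlas L) (atlas L) (\<lambda>x. inv\<^bsub>L\<^esub> x)"

definition Lie_Aut :: "('m, 'e::real_normed_vector) mgroup \<Rightarrow> ('m \<Rightarrow> 'm) monoid" where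
  "Lie_Aut L = (AutoGroup L)\<lparr>carrier := {f \<in> auto L. smooth_map (atlas L) (atlas L) f \<and>
     smooth_map (atlas L) (atlas L) (inv_into (carrier L) f)}\<rparr>"

definition semidirect ::
    "('n, 'e) mgroup \<Rightarrow> ('g, 'f) mgroup \<Rightarrow> ('g \<Rightarrow> 'n \<Rightarrow> 'n) \<Rightarrow> ('n \<times> 'g, 'e \<times> 'f) mgroup" where
  "semidirect N G \<pi> =
     \<lparr>carrier = carrier N \<times> carrier G,
      mult = (\<lambda>(n1, g1) (n2, g2). (n1 \<otimes>\<^bsub>N\<^esub> \<pi> g1 n2, g1 \<otimes>\<^bsub>G\<^esub> g2)),
      one = (\<one>\<^bsub>N\<^esub>, \<one>\<^bsub>G\<^esub>),
      atlas = prod_atlas (atlas N) (atlas G)\<rparr>"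

section \<open>Absolutely continuous functions into manifolds and Lie groups\<close>

definition AC :: "('m, 'e::real_normed_vector) chart set \<Rightarrow> (real \<Rightarrow> 'm) set" where
  "AC A = {\<eta> \<in> extensional {0..1}.
     continuous_map (top_of_set {0..1}) (manifold_topology A) \<eta> \<and>
     (\<exists>P. partition_of 0 1 P \<and> (\<forall>u v. consecutive P u v \<longrightarrow>
        (\<exists>(U, \<phi>)\<in>charts A. \<eta> ` {u..v} \<subseteq> U \<and> AC_on u v (\<phi> \<circ> \<eta>))))}"

definition AC_in :: "('m, 'e::real_normed_vector) chart set \<Rightarrow> 'm set \<Rightarrow> (real \<Rightarrow> 'm) set" where
  "AC_in A U = {\<eta> \<in> AC A. \<eta> ` {0..1} \<subseteq> U}"

definition pw_mult :: "('m, 'e) mgroup \<Rightarrow> (real \<Rightarrow> 'm) \<Rightarrow> (real \<Rightarrow> 'm) \<Rightarrow> (real \<Rightarrow> 'm)" where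
  "pw_mult L \<eta> \<zeta> = (\<lambda>t\<in>{0..1}. \<eta> t \<otimes>\<^bsub>L\<^esub> \<zeta> t)"

definition symmetric_charts :: "('m, 'e::real_normed_vector) mgroup \<Rightarrow> ('m, 'e) chart set" where
  "symmetric_charts L =
     {(U, \<phi>) \<in> charts (atlas L). \<one>\<^bsub>L\<^esub> \<in> U \<and> (\<lambda>x. inv\<^bsub>L\<^esub> x) ` U = U}"

definition AC_chart ::
    "('m, 'e::real_normed_vector) mgroup \<Rightarrow> ('m, 'e) chart \<Rightarrow> (real \<Rightarrow> 'm, 'e \<times> 'e regR) chart" where
  "AC_chart L c = (AC_in (atlas L) (fst c), \<lambda>\<eta>. AC_coord (snd c \<circ> \<eta>))"

text \<open>The Lie group structures on \<open>AC\<^sub>R([0,1],L)\<close> for which \<open>AC\<^sub>R([0,1],U)\<close> is open and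
  \<open>\<eta> \<mapsto> \<phi> \<circ> \<eta>\<close> is a diffeomorphism onto the open subset \<open>AC\<^sub>R([0,1],V)\<close> of \<open>AC\<^sub>R([0,1],E)\<close>,
  for each chart \<open>\<phi> : U \<rightarrow> V\<close> with \<open>1 \<in> U = U\<^sup>-\<^sup>1\<close>.\<close>

definition AC_Lie_structure ::
    "('m, 'e::real_normed_vector) mgroup \<Rightarrow> (real \<Rightarrow> 'm, 'e \<times> 'e regR) mgroup \<Rightarrow> bool" where
  "AC_Lie_structure L \<Lambda> \<longleftrightarrow> Lie_group \<Lambda> \<and> carrier \<Lambda> = AC (atlas L) \<and>
     (\<forall>\<eta>\<in>AC (atlas L). \<forall>\<zeta>\<in>AC (atlas L). \<eta> \<otimes>\<^bsub>\<Lambda>\<^esub> \<zeta> = pw_mult L \<eta> \<zeta>) \<and>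
     (\<forall>c\<in>symmetric_charts L. AC_chart L c \<in> charts (atlas \<Lambda>))"

text \<open>The topology defined by the charts \<open>\<eta> \<cdot> AC\<^sub>R([0,1],U) \<rightarrow> AC\<^sub>R([0,1],V)\<close>,
  \<open>\<eta> \<cdot> \<zeta> \<mapsto> \<phi> \<circ> \<zeta>\<close>. It is the topology of the Lie group structure above, see
  \<open>AC_topology_Lie_structure\<close> below.\<close>

definition AC_topology :: "('m, 'e::real_normed_vector) mgroup \<Rightarrow> (real \<Rightarrow> 'm) topology" where
  "AC_topology L = topology (\<lambda>W. W \<subseteq> AC (atlas L) \<and>
     (\<forall>\<eta>\<in>AC (atlas L). \<forall>c\<in>symmetric_charts L.
        open (snd (AC_chart L c) ` {\<zeta> \<in> fst (AC_chart L c). pw_mult L \<eta> \<zeta> \<in> W})))"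

lemma istopology_manifold:
  assumes inj: "\<And>U \<phi>. (U, \<phi>) \<in> A \<Longrightarrow> inj_on \<phi> U"
  shows "istopology (\<lambda>W. W \<subseteq> points A \<and> (\<forall>(U, \<phi>)\<in>A. open (\<phi> ` (W \<inter> U))))"
  unfolding istopology_def
proof (intro conjI allI impI)
  fix W1 W2
  assume *: "W1 \<subseteq> points A \<and> (\<forall>(U, \<phi>)\<in>A. open (\<phi> ` (W1 \<inter> U)))"
    "W2 \<subseteq> points A \<and> (\<forall>(U, \<phi>)\<in>A. open (\<phi> ` (W2 \<inter> U)))"
  show "W1 \<inter> W2 \<subseteq> points A" using * by blast
  show "\<forall>(U, \<phi>)\<in>A. open (\<phi> ` (W1 \<inter> W2 \<inter> U))"
  proof clarify
    fix U \<phi> assume c: "(U, \<phi>) \<in> A"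
    have "\<phi> ` (W1 \<inter> W2 \<inter> U) = \<phi> ` (W1 \<inter> U) \<inter> \<phi> ` (W2 \<inter> U)"
      by (subst inj_on_image_Int[OF inj[OF c], symmetric]) (auto intro: arg_cong[where f = "image \<phi>"])
    then show "open (\<phi> ` (W1 \<inter> W2 \<inter> U))" using * c by auto
  qed
next
  fix K assume *: "\<forall>W\<in>K. W \<subseteq> points A \<and> (\<forall>(U, \<phi>)\<in>A. open (\<phi> ` (W \<inter> U)))"
  show "\<Union> K \<subseteq> points A" using * by blast
  show "\<forall>(U, \<phi>)\<in>A. open (\<phi> ` (\<Union> K \<inter> U))"
  proof clarify
    fix U \<phi> assume "(U, \<phi>) \<in> A"
    moreover have "\<phi> ` (\<Union> K \<inter> U) = (\<Union>W\<in>K. \<phi> ` (W \<inter> U))" by auto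
    ultimately show "open (\<phi> ` (\<Union> K \<inter> U))" using * by (auto intro!: open_UN)
  qed
qed

lemma openin_manifold_topology_inj:
  assumes "\<And>U \<phi>. (U, \<phi>) \<in> A \<Longrightarrow> inj_on \<phi> U"
  shows "openin (manifold_topology A) W \<longleftrightarrow>
     W \<subseteq> points A \<and> (\<forall>(U, \<phi>)\<in>A. open (\<phi> ` (W \<inter> U)))"
proof -
  have "istopology (\<lambda>W. W \<subseteq> points A \<and> (\<forall>(U, \<phi>)\<in>A. open (\<phi> ` (W \<inter> U))))"
    by (rule istopology_manifold) (rule assms)
  then show ?thesis unfolding manifold_topology_def by (subst topology_inverse') auto
qed

lemma openin_manifold_topology:
  assumes "smooth_manifold A"
  shows "openin (manifold_topology A) W \<longleftrightarrow>
     W \<subseteq> points A \<and> (\<forall>(U, \<phi>)\<in>A. open (\<phi> ` (W \<inter> U)))"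
  by (rule openin_manifold_topology_inj) (use assms in \<open>auto simp: smooth_manifold_def\<close>)

lemma topspace_manifold_topology:
  assumes "smooth_manifold A" shows "topspace (manifold_topology A) = points A"
proof -
  have "openin (manifold_topology A) (points A)"
    unfolding openin_manifold_topology[OF assms]
  proof (intro conjI)
    show "\<forall>(U, \<phi>)\<in>A. open (\<phi> ` (points A \<inter> U))"
    proof clarify
      fix U \<phi> assume c: "(U, \<phi>) \<in> A"
      then have "points A \<inter> U = U" by (auto simp: points_def)
      then show "open (\<phi> ` (points A \<inter> U))" using c assms by (auto simp: smooth_manifold_def)
    qed
  qed simp
  then show ?thesis
    using openin_manifold_topology[OF assms, of "topspace (manifold_topology A)"]
    by (auto dest: openin_subset)
qed

lemma smooth_on_imp_continuous_on:
  assumes "smooth_on U f" shows "continuous_on U f"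
proof -
  have "continuous_on (U \<times> UNIV) (\<lambda>(x, v). iter_dir_deriv 0 f v x)"
    using assms unfolding smooth_on_def Ck_on_def by blast
  then have "continuous_on (U \<times> (UNIV :: (nat \<Rightarrow> 'a) set)) (\<lambda>p. f (fst p))"
    by (simp add: case_prod_beta)
  then have "continuous_on U ((\<lambda>p. f (fst p)) \<circ> (\<lambda>x. (x, (\<lambda>_. 0) :: nat \<Rightarrow> 'a)))"
    by (intro continuous_on_compose continuous_intros) (auto elim: continuous_on_subset)
  then show ?thesis by (simp add: o_def)
qed

lemma Ck_on_subset: "Ck_on k U f \<Longrightarrow> V \<subseteq> U \<Longrightarrow> Ck_on k V f"
  unfolding Ck_on_def by (blast intro: continuous_on_subset)

lemma smooth_on_subset: "smooth_on U f \<Longrightarrow> V \<subseteq> U \<Longrightarrow> smooth_on V f"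
  unfolding smooth_on_def by (blast intro: Ck_on_subset)

lemma eventually_line_in_open:
  fixes x v :: "'a::real_normed_vector"
  assumes "open U" "x \<in> U" shows "\<forall>\<^sub>F s in nhds 0. x + s *\<^sub>R v \<in> U"
proof -
  have "isCont (\<lambda>s. x + s *\<^sub>R v) 0" by (intro continuous_intros)
  then have "((\<lambda>s. x + s *\<^sub>R v) \<longlongrightarrow> x + 0 *\<^sub>R v) (nhds 0)"
    using tendsto_at_iff_tendsto_nhds[of "\<lambda>s. x + s *\<^sub>R v" 0] by (simp add: isCont_def)
  then show ?thesis using assms by (auto dest!: topological_tendstoD)
qed

lemma iter_dir_deriv_cong:
  assumes "open U" "\<And>x. x \<in> U \<Longrightarrow> f x = g x" "x \<in> U"
  shows "iter_dir_deriv j f v x = iter_dir_deriv j g v x"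
  using assms(3)
proof (induction j arbitrary: x)
  case (Suc j)
  have "\<forall>\<^sub>F s in nhds 0. iter_dir_deriv j f v (x + s *\<^sub>R v j) = iter_dir_deriv j g v (x + s *\<^sub>R v j)"
    using eventually_line_in_open[OF assms(1) Suc.prems, of "v j"]
    by eventually_elim (rule Suc.IH)
  then show ?case
    by (simp add: dir_deriv_def) (rule vector_derivative_cong_eq, auto)
qed (use assms in simp)

lemma smooth_on_cong:
  assumes f: "smooth_on U f" and U: "open U" and eq: "\<And>x. x \<in> U \<Longrightarrow> f x = g x"
  shows "smooth_on U g"
  unfolding smooth_on_def Ck_on_def
proof (intro allI conjI ballI impI)
  fix k j :: nat and x and v :: "nat \<Rightarrow> 'a" assume "j < k" and x: "x \<in> U"
  then have "(\<lambda>s. iter_dir_deriv j f v (x + s *\<^sub>R v j)) differentiable (at 0)"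
    using f unfolding smooth_on_def Ck_on_def by blast
  then obtain D where
    D: "((\<lambda>s. iter_dir_deriv j f v (x + s *\<^sub>R v j)) has_derivative D) (at 0)"
    unfolding differentiable_def by blast
  have ev: "\<forall>\<^sub>F s in nhds 0.
      iter_dir_deriv j f v (x + s *\<^sub>R v j) = iter_dir_deriv j g v (x + s *\<^sub>R v j)"
    using eventually_line_in_open[OF U x, of "v j"]
    by eventually_elim (rule iter_dir_deriv_cong[OF U eq])
  have "((\<lambda>s. iter_dir_deriv j g v (x + s *\<^sub>R v j)) has_derivative D) (at 0)"
    by (rule has_derivative_transform_eventually[OF D])
       (use ev eventually_nhds_x_imp_x[OF ev] in \<open>auto simp: eventually_nhds_conv_at\<close>)
  then show "(\<lambda>s. iter_dir_deriv j g v (x + s *\<^sub>R v j)) differentiable (at 0)"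
    unfolding differentiable_def by blast
next
  fix k j assume "j \<le> (k::nat)"
  then have "continuous_on (U \<times> UNIV) (\<lambda>(x, v). iter_dir_deriv j f v x)"
    using f unfolding smooth_on_def Ck_on_def by blast
  then show "continuous_on (U \<times> UNIV) (\<lambda>(x, v). iter_dir_deriv j g v x)"
    by (rule continuous_on_eq) (auto intro: iter_dir_deriv_cong[OF U eq])
qed

lemma chart_image_open:
  assumes A: "smooth_manifold A" and c: "(U, \<phi>) \<in> charts A"
    and W: "openin (manifold_topology A) W"
  shows "open (\<phi> ` (W \<inter> U))"
proof -
  have U: "U \<subseteq> points A" "inj_on \<phi> U" using c by (auto simp: charts_def)
  have "open (\<phi> ` (W \<inter> U \<inter> V))" if d: "(V, \<psi>) \<in> A" for V \<psi>
  proof -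
    have o: "open (\<phi> ` (U \<inter> V))" and s: "smooth_on (\<phi> ` (U \<inter> V)) (\<psi> \<circ> inv_into U \<phi>)"
      using c d by (fastforce simp: charts_def compatible_def)+
    have i: "inj_on \<psi> V" using A d by (auto simp: smooth_manifold_def)
    have "open (\<psi> ` (W \<inter> V))" using W d unfolding openin_manifold_topology[OF A] by auto
    then have "open (\<phi> ` (U \<inter> V) \<inter> (\<psi> \<circ> inv_into U \<phi>) -` (\<psi> ` (W \<inter> V)))"
      using smooth_on_imp_continuous_on[OF s] o continuous_open_preimage by blast
    also have "\<phi> ` (U \<inter> V) \<inter> (\<psi> \<circ> inv_into U \<phi>) -` (\<psi> ` (W \<inter> V)) = \<phi> ` (W \<inter> U \<inter> V)"
    proof safe
      fix x z assume "x \<in> U" "x \<in> V" "z \<in> W" "z \<in> V"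
        "(\<psi> \<circ> inv_into U \<phi>) (\<phi> x) = \<psi> z"
      then have "x = z" using i U by (auto dest: inj_onD)
      then show "\<phi> x \<in> \<phi> ` (W \<inter> U \<inter> V)" using \<open>x \<in> U\<close> \<open>x \<in> V\<close> \<open>z \<in> W\<close> by auto
    qed (use U in auto)
    finally show ?thesis .
  qed
  then have "open (\<Union>(V, \<psi>)\<in>A. \<phi> ` (W \<inter> U \<inter> V))" by (auto intro!: open_UN)
  also have "(\<Union>(V, \<psi>)\<in>A. \<phi> ` (W \<inter> U \<inter> V)) = \<phi> ` (W \<inter> U)"
    using U by (fastforce simp: points_def)
  finally show ?thesis .
qed

lemma chart_preimage_open:
  assumes A: "smooth_manifold A" and c: "(U, \<phi>) \<in> charts A" and Y: "open Y"
  shows "openin (manifold_topology A) (U \<inter> \<phi> -` Y)"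
  unfolding openin_manifold_topology[OF A]
proof (intro conjI)
  show "U \<inter> \<phi> -` Y \<subseteq> points A" using c by (auto simp: charts_def)
  show "\<forall>(V, \<psi>)\<in>A. open (\<psi> ` (U \<inter> \<phi> -` Y \<inter> V))"
  proof clarify
    fix V \<psi> assume d: "(V, \<psi>) \<in> A"
    have o: "open (\<psi> ` (U \<inter> V))" and s: "smooth_on (\<psi> ` (U \<inter> V)) (\<phi> \<circ> inv_into V \<psi>)"
      using c d by (fastforce simp: charts_def compatible_def)+
    have i: "inj_on \<psi> V" using A d by (auto simp: smooth_manifold_def)
    have "open (\<psi> ` (U \<inter> V) \<inter> (\<phi> \<circ> inv_into V \<psi>) -` Y)"
      using smooth_on_imp_continuous_on[OF s] o Y continuous_open_preimage by blast
    also have "\<psi> ` (U \<inter> V) \<inter> (\<phi> \<circ> inv_into V \<psi>) -` Y = \<psi> ` (U \<inter> \<phi> -` Y \<inter> V)"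
      using i by auto
    finally show "open (\<psi> ` (U \<inter> \<phi> -` Y \<inter> V))" .
  qed
qed

lemma atlas_subset_charts: "smooth_manifold A \<Longrightarrow> A \<subseteq> charts A"
  by (force simp: smooth_manifold_def charts_def points_def)

lemma chart_domain_open:
  "smooth_manifold A \<Longrightarrow> (U, \<phi>) \<in> charts A \<Longrightarrow> openin (manifold_topology A) U"
  using chart_preimage_open[of A U \<phi> UNIV] by simp

lemma chart_restrict:
  assumes A: "smooth_manifold A" and c: "(U, \<phi>) \<in> A"
    and W: "openin (manifold_topology A) W" "W \<subseteq> U"
  shows "(W, \<phi>) \<in> charts A"
proof -
  have c': "(U, \<phi>) \<in> charts A" using atlas_subset_charts[OF A] c by blast
  have U: "inj_on \<phi> U" "U \<subseteq> points A" using c' by (auto simp: charts_def)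
  then have W': "inj_on \<phi> W" using W(2) by (metis inj_on_subset)
  have inv: "inv_into W \<phi> y = inv_into U \<phi> y" if "y \<in> \<phi> ` W" for y
  proof -
    from that obtain z where "z \<in> W" "y = \<phi> z" by blast
    then show ?thesis using U(1) W' W(2) by auto
  qed
  have "compatible (W, \<phi>) (V, \<psi>)" if d: "(V, \<psi>) \<in> A" for V \<psi>
  proof -
    have d': "(V, \<psi>) \<in> charts A" using atlas_subset_charts[OF A] d by blast
    have UV: "smooth_on (\<phi> ` (U \<inter> V)) (\<psi> \<circ> inv_into U \<phi>)"
      "smooth_on (\<psi> ` (U \<inter> V)) (\<phi> \<circ> inv_into V \<psi>)"
      using A c d by (fastforce simp: smooth_manifold_def compatible_def)+
    have WV: "openin (manifold_topology A) (W \<inter> V)"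
      using W(1) chart_domain_open[OF A d'] by blast
    have "W \<inter> V \<inter> U = W \<inter> V" "W \<inter> V \<inter> V = W \<inter> V" using W(2) by auto
    then have o: "open (\<phi> ` (W \<inter> V))" "open (\<psi> ` (W \<inter> V))"
      using chart_image_open[OF A c' WV] chart_image_open[OF A d' WV] by simp_all
    have "smooth_on (\<phi> ` (W \<inter> V)) (\<psi> \<circ> inv_into W \<phi>)"
      by (rule smooth_on_cong[OF smooth_on_subset[OF UV(1)] o(1)]) (use W(2) inv in auto)
    moreover have "smooth_on (\<psi> ` (W \<inter> V)) (\<phi> \<circ> inv_into V \<psi>)"
      by (rule smooth_on_subset[OF UV(2)]) (use W(2) in auto)
    ultimately show ?thesis using o by (simp add: compatible_def)
  qed
  moreover have "open (\<phi> ` W)"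
    using chart_image_open[OF A c' W(1)] W(2) by (simp add: Int_absorb2)
  ultimately show ?thesis using W W' U by (auto simp: charts_def)
qed

lemma Lie_group_symmetric_chart:
  assumes L: "Lie_group L" shows "\<exists>c. c \<in> symmetric_charts L"
proof -
  interpret group L using L by (simp add: Lie_group_def)
  have A: "smooth_manifold (atlas L)" "points (atlas L) = carrier L"
    using L by (auto simp: Lie_group_def)
  obtain U \<phi> where c: "(U, \<phi>) \<in> atlas L" "\<one>\<^bsub>L\<^esub> \<in> U"
    using A(2) one_closed by (fastforce simp: points_def)
  have U: "U \<subseteq> carrier L" using c A(2) by (auto simp: points_def)
  have oU: "openin (group_topology L) U"
    using chart_domain_open[OF A(1)] atlas_subset_charts[OF A(1)] c by blast
  have "continuous_map (group_topology L) (group_topology L) (\<lambda>x. inv\<^bsub>L\<^esub> x)"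
    using L by (simp add: Lie_group_def smooth_map_def)
  from openin_continuous_map_preimage[OF this oU]
  have "openin (group_topology L) (U \<inter> {x \<in> carrier L. inv\<^bsub>L\<^esub> x \<in> U})"
    using oU by (simp add: topspace_manifold_topology[OF A(1)] A(2) openin_Int)
  from chart_restrict[OF A(1) c(1) this]
  have "(U \<inter> {x \<in> carrier L. inv\<^bsub>L\<^esub> x \<in> U}, \<phi>) \<in> charts (atlas L)" by simp
  moreover have "(\<lambda>x. inv\<^bsub>L\<^esub> x) ` (U \<inter> {x \<in> carrier L. inv\<^bsub>L\<^esub> x \<in> U}) =
      U \<inter> {x \<in> carrier L. inv\<^bsub>L\<^esub> x \<in> U}" (is "_ ` ?S = ?S")
  proof safe
    fix x assume "x \<in> U" "x \<in> carrier L" "inv\<^bsub>L\<^esub> x \<in> U"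
    then show "x \<in> (\<lambda>x. inv\<^bsub>L\<^esub> x) ` ?S" by (intro image_eqI[of _ _ "inv\<^bsub>L\<^esub> x"]) auto
  qed auto
  ultimately show ?thesis using c(2) by (fastforce simp: symmetric_charts_def)
qed

lemma Lie_group_left_translation:
  assumes L: "Lie_group L" and a: "a \<in> carrier L"
  shows "continuous_map (group_topology L) (group_topology L) (\<lambda>x. a \<otimes>\<^bsub>L\<^esub> x)"
proof -
  have A: "smooth_manifold (atlas L)" "points (atlas L) = carrier L"
    using L by (auto simp: Lie_group_def)
  let ?PA = "prod_atlas (atlas L) (atlas L)"
  have inj: "inj_on \<phi> U" if "(U, \<phi>) \<in> atlas L" for U \<phi>
    using that A(1) by (auto simp: smooth_manifold_def)
  have injP: "inj_on \<phi> U" if "(U, \<phi>) \<in> ?PA" for U \<phi>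
    using that by (auto simp: prod_atlas_def prod_chart_def intro!: map_prod_inj_on inj)
  have oP: "openin (manifold_topology ?PA) W \<longleftrightarrow>
      W \<subseteq> points ?PA \<and> (\<forall>(U, \<phi>)\<in>?PA. open (\<phi> ` (W \<inter> U)))" for W
    by (rule openin_manifold_topology_inj) (rule injP)
  obtain U \<phi> where c: "(U, \<phi>) \<in> atlas L" "a \<in> U"
    using A(2) a by (fastforce simp: points_def)
  have mc: "continuous_map (manifold_topology ?PA) (group_topology L) (\<lambda>(x, y). x \<otimes>\<^bsub>L\<^esub> y)"
    using L by (simp add: Lie_group_def smooth_map_def)
  have open_slice: "openin (group_topology L) {x \<in> carrier L. (a, x) \<in> W}"
    if W: "openin (manifold_topology ?PA) W" for W
    unfolding openin_manifold_topology[OF A(1)] A(2)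
  proof (intro conjI)
    show "\<forall>(V, \<psi>)\<in>atlas L. open (\<psi> ` ({x \<in> carrier L. (a, x) \<in> W} \<inter> V))"
    proof clarify
      fix V \<psi> assume d: "(V, \<psi>) \<in> atlas L"
      have V: "V \<subseteq> carrier L" using d A(2) by (auto simp: points_def)
      have "(U \<times> V, map_prod \<phi> \<psi>) \<in> ?PA"
        unfolding prod_atlas_def using c d by (force simp: prod_chart_def)
      then have "open (map_prod \<phi> \<psi> ` (W \<inter> U \<times> V))"
        using W unfolding oP by blast
      then have "open ((\<lambda>y. (\<phi> a, y)) -` (map_prod \<phi> \<psi> ` (W \<inter> U \<times> V)))"
        by (intro open_vimage continuous_intros)
      also have "(\<lambda>y. (\<phi> a, y)) -` (map_prod \<phi> \<psi> ` (W \<inter> U \<times> V)) =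
          \<psi> ` ({x \<in> carrier L. (a, x) \<in> W} \<inter> V)"
        using V c inj[OF c(1)] by (fastforce dest: inj_onD)
      finally show "open (\<psi> ` ({x \<in> carrier L. (a, x) \<in> W} \<inter> V))" .
    qed
  qed auto
  interpret group L using L by (simp add: Lie_group_def)
  show ?thesis
    unfolding continuous_map_alt topspace_manifold_topology[OF A(1)] A(2)
  proof (intro conjI allI impI)
    fix W assume "openin (group_topology L) W"
    then have "openin (manifold_topology ?PA)
        ((\<lambda>(x, y). x \<otimes>\<^bsub>L\<^esub> y) -` W \<inter> topspace (manifold_topology ?PA))"
      using mc unfolding continuous_map_alt by blast
    from open_slice[OF this]
    have "openin (group_topology L) {x \<in> carrier L.
        (a, x) \<in> (\<lambda>(x, y). x \<otimes>\<^bsub>L\<^esub> y) -` W \<inter> topspace (manifold_topology ?PA)}" .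
    moreover have "(a, x) \<in> topspace (manifold_topology ?PA)" if "x \<in> carrier L" for x
    proof -
      have "openin (manifold_topology ?PA) (points ?PA)"
        unfolding oP
      proof (intro conjI)
        show "\<forall>(U, \<phi>)\<in>?PA. open (\<phi> ` (points ?PA \<inter> U))"
        proof clarify
          fix U \<phi> assume d: "(U, \<phi>) \<in> ?PA"
          then have "points ?PA \<inter> U = U" by (auto simp: points_def)
          moreover have "open (\<phi> ` U)"
          proof -
            obtain U1 \<phi>1 U2 \<phi>2 where "(U1, \<phi>1) \<in> atlas L" "(U2, \<phi>2) \<in> atlas L"
              "U = U1 \<times> U2" "\<phi> = map_prod \<phi>1 \<phi>2"
              using d by (auto simp: prod_atlas_def prod_chart_def)
            then show ?thesis using A(1)
              by (auto simp: smooth_manifold_def map_prod_surj_on[OF refl refl] intro!: open_Times)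
          qed
          ultimately show "open (\<phi> ` (points ?PA \<inter> U))" by simp
        qed
      qed simp
      then have "points ?PA \<subseteq> topspace (manifold_topology ?PA)" by (rule openin_subset)
      moreover have "(a, x) \<in> points ?PA"
      proof -
        obtain V \<psi> where "(V, \<psi>) \<in> atlas L" "x \<in> V"
          using A(2) \<open>x \<in> carrier L\<close> by (fastforce simp: points_def)
        with c show ?thesis by (force simp: points_def prod_atlas_def prod_chart_def)
      qed
      ultimately show ?thesis by blast
    qed
    ultimately show "openin (group_topology L) ((\<lambda>x. a \<otimes>\<^bsub>L\<^esub> x) -` W \<inter> carrier L)"
      by (auto elim!: back_subst[of "openin (group_topology L)"])
  qed (use a in auto)
qed

theorem AC_topology_Lie_structure:
  assumes L: "Lie_group L" and S: "AC_Lie_structure L \<Lambda>"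
  shows "AC_topology L = group_topology \<Lambda>"
proof -
  let ?A = "AC (atlas L)"
  have G: "Lie_group \<Lambda>" and car: "carrier \<Lambda> = ?A"
    and mult: "\<And>\<eta> \<zeta>. \<eta> \<in> ?A \<Longrightarrow> \<zeta> \<in> ?A \<Longrightarrow> \<eta> \<otimes>\<^bsub>\<Lambda>\<^esub> \<zeta> = pw_mult L \<eta> \<zeta>"
    and ch: "\<And>c. c \<in> symmetric_charts L \<Longrightarrow> AC_chart L c \<in> charts (atlas \<Lambda>)"
    using S by (auto simp: AC_Lie_structure_def)
  have M: "smooth_manifold (atlas \<Lambda>)" "points (atlas \<Lambda>) = ?A" and grp: "group \<Lambda>"
    using G car by (auto simp: Lie_group_def)
  interpret \<Lambda>: group \<Lambda> by (rule grp)
  have tr: "openin (group_topology \<Lambda>) {\<zeta> \<in> ?A. \<eta> \<otimes>\<^bsub>\<Lambda>\<^esub> \<zeta> \<in> W}"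
    if "openin (group_topology \<Lambda>) W" "\<eta> \<in> ?A" for \<eta> W
    using openin_continuous_map_preimage[OF Lie_group_left_translation[OF G] that(1), of \<eta>] that(2)
    by (simp add: topspace_manifold_topology[OF M(1)] M(2) car)
  have sub: "fst (AC_chart L c) \<subseteq> ?A" for c by (auto simp: AC_chart_def AC_in_def)
  have "openin (group_topology \<Lambda>) W \<longleftrightarrow> W \<subseteq> ?A \<and> (\<forall>\<eta>\<in>?A. \<forall>c\<in>symmetric_charts L.
      open (snd (AC_chart L c) ` {\<zeta> \<in> fst (AC_chart L c). pw_mult L \<eta> \<zeta> \<in> W}))" (is "_ \<longleftrightarrow> ?R")
    for W
  proof
    assume W: "openin (group_topology \<Lambda>) W"
    have "open (snd (AC_chart L c) ` {\<zeta> \<in> fst (AC_chart L c). pw_mult L \<eta> \<zeta> \<in> W})"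
      if \<eta>: "\<eta> \<in> ?A" and c: "c \<in> symmetric_charts L" for \<eta> c
    proof -
      have "open (snd (AC_chart L c) ` ({\<zeta> \<in> ?A. \<eta> \<otimes>\<^bsub>\<Lambda>\<^esub> \<zeta> \<in> W} \<inter> fst (AC_chart L c)))"
        by (rule chart_image_open[OF M(1) _ tr[OF W \<eta>]]) (use ch[OF c] in simp)
      also have "{\<zeta> \<in> ?A. \<eta> \<otimes>\<^bsub>\<Lambda>\<^esub> \<zeta> \<in> W} \<inter> fst (AC_chart L c) =
          {\<zeta> \<in> fst (AC_chart L c). pw_mult L \<eta> \<zeta> \<in> W}"
        using sub[of c] mult[OF \<eta>] by auto
      finally show ?thesis .
    qed
    moreover have "W \<subseteq> ?A" using openin_subset[OF W]
      by (simp add: topspace_manifold_topology[OF M(1)] M(2))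
    ultimately show ?R by blast
  next
    assume R: ?R
    obtain c where c: "c \<in> symmetric_charts L" using Lie_group_symmetric_chart[OF L] by blast
    let ?U = "fst (AC_chart L c)" and ?\<Phi> = "snd (AC_chart L c)"
    have cc: "(?U, ?\<Phi>) \<in> charts (atlas \<Lambda>)" using ch[OF c] by simp
    have inj: "inj_on ?\<Phi> ?U" using cc by (auto simp: charts_def)
    have one: "\<one>\<^bsub>\<Lambda>\<^esub> \<in> ?U"
    proof -
      interpret group L using L by (simp add: Lie_group_def)
      let ?e = "\<one>\<^bsub>\<Lambda>\<^esub>"
      have e: "?e \<in> ?A" using \<Lambda>.one_closed car by simp
      have pw: "pw_mult L ?e ?e = ?e" using mult[OF e e] e car by auto
      have *: "?e t \<otimes>\<^bsub>L\<^esub> ?e t = ?e t" if "t \<in> {0..1}" for t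
      proof -
        have "pw_mult L ?e ?e t = ?e t \<otimes>\<^bsub>L\<^esub> ?e t" using that by (simp add: pw_mult_def)
        then show ?thesis by (simp add: pw)
      qed
      have "?e t \<in> carrier L" if "t \<in> {0..1}" for t
      proof -
        have "continuous_map (top_of_set {0..1}) (group_topology L) ?e"
          using e by (simp add: AC_def)
        then have "?e t \<in> topspace (group_topology L)"
          using that by (auto simp: continuous_map_def)
        then show ?thesis
          using L by (simp add: Lie_group_def topspace_manifold_topology)
      qed
      then have "?e t = \<one>\<^bsub>L\<^esub>" if "t \<in> {0..1}" for t
        using *[OF that] that r_cancel_one by auto
      then show ?thesis using e c
        by (auto simp: AC_chart_def AC_in_def symmetric_charts_def)
    qed
    show "openin (group_topology \<Lambda>) W"
    proof (subst openin_subopen, intro ballI)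
      fix \<eta> assume \<eta>: "\<eta> \<in> W"
      then have \<eta>A: "\<eta> \<in> ?A" using R by blast
      let ?Z = "{\<zeta> \<in> ?U. pw_mult L \<eta> \<zeta> \<in> W}"
      have "openin (group_topology \<Lambda>) (?U \<inter> ?\<Phi> -` (?\<Phi> ` ?Z))"
        using R \<eta>A c by (intro chart_preimage_open[OF M(1) cc]) blast
      also have "?U \<inter> ?\<Phi> -` (?\<Phi> ` ?Z) = ?Z" using inj by (auto dest: inj_onD)
      finally have oZ: "openin (group_topology \<Lambda>) ?Z" .
      have inv\<eta>: "inv\<^bsub>\<Lambda>\<^esub> \<eta> \<in> ?A" using \<eta>A car \<Lambda>.inv_closed by auto
      have "openin (group_topology \<Lambda>) {\<zeta> \<in> ?A. inv\<^bsub>\<Lambda>\<^esub> \<eta> \<otimes>\<^bsub>\<Lambda>\<^esub> \<zeta> \<in> ?Z}" (is "openin _ ?N")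
        by (rule tr[OF oZ inv\<eta>])
      moreover have "\<eta> \<in> ?N"
        using \<eta> \<eta>A one mult[OF \<eta>A] sub[of c] car by (auto simp flip: mult[OF \<eta>A])
      moreover have "?N \<subseteq> W"
      proof clarify
        fix \<zeta> assume \<zeta>: "\<zeta> \<in> ?A" "pw_mult L \<eta> (inv\<^bsub>\<Lambda>\<^esub> \<eta> \<otimes>\<^bsub>\<Lambda>\<^esub> \<zeta>) \<in> W"
        have "pw_mult L \<eta> (inv\<^bsub>\<Lambda>\<^esub> \<eta> \<otimes>\<^bsub>\<Lambda>\<^esub> \<zeta>) = \<eta> \<otimes>\<^bsub>\<Lambda>\<^esub> (inv\<^bsub>\<Lambda>\<^esub> \<eta> \<otimes>\<^bsub>\<Lambda>\<^esub> \<zeta>)"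
          using mult[OF \<eta>A] inv\<eta> \<zeta>(1) \<Lambda>.m_closed car by metis
        also have "\<dots> = \<zeta>" using \<eta>A \<zeta>(1) unfolding car[symmetric] by (simp add: \<Lambda>.m_assoc[symmetric])
        finally show "\<zeta> \<in> W" using \<zeta>(2) by simp
      qed
      ultimately show "\<exists>T. openin (group_topology \<Lambda>) T \<and> \<eta> \<in> T \<and> T \<subseteq> W" by blast
    qed
  qed
  then have "AC_topology L = topology (openin (group_topology \<Lambda>))"
    unfolding AC_topology_def by presburger
  then show ?thesis by (simp add: openin_inverse)
qed

section \<open>Logarithmic derivatives and evolution\<close>

text \<open>The tangent map \<open>T\<^sub>p f\<close>, read in a chart \<open>c\<close> around \<open>p\<close> and a chart \<open>d\<close> around \<open>f p\<close>,
  each of which identifies the tangent space with the model space.\<close>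

definition tangent_map ::
    "('m, 'e::real_normed_vector) chart \<Rightarrow> ('n, 'f::real_normed_vector) chart \<Rightarrow>
     ('m \<Rightarrow> 'n) \<Rightarrow> 'm \<Rightarrow> 'e \<Rightarrow> 'f" where
  "tangent_map c d f p w = dir_deriv (snd d \<circ> f \<circ> inv_into (fst c) (snd c)) (snd c p) w"

text \<open>\<open>\<delta>(\<eta>) = \<gamma>\<close>, where \<open>T\<^sub>1H\<close> is identified with the model space by means of the chart \<open>\<kappa>\<close>
  around \<open>1\<close>. On an interval \<open>[u,v]\<close> mapped by \<open>\<eta>\<close> into the domain of a chart \<open>\<phi>\<close>, the velocity
  of \<open>\<eta>\<close> is represented in this chart by the derivative \<open>\<gamma>'\<close> of \<open>\<phi> \<circ> \<eta>\<close>.\<close>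

definition has_log_derivative ::
    "('m, 'e::real_normed_vector) mgroup \<Rightarrow> ('m, 'e) chart \<Rightarrow> (real \<Rightarrow> 'm) \<Rightarrow> 'e regR \<Rightarrow> bool" where
  "has_log_derivative H \<kappa> \<eta> \<gamma> \<longleftrightarrow>
     (\<exists>P. partition_of 0 1 P \<and> (\<forall>u v. consecutive P u v \<longrightarrow>
        (\<exists>(U, \<phi>)\<in>charts (atlas H). \<exists>\<gamma>'. \<eta> ` {u..v} \<subseteq> U \<and>
           has_reg_derivative (\<phi> \<circ> \<eta>) \<gamma>' u v \<and>
           (AE t in lebesgue_on {u..v}. rep_regR \<gamma> t =
              tangent_map (U, \<phi>) \<kappa> (\<lambda>x. inv\<^bsub>H\<^esub> (\<eta> t) \<otimes>\<^bsub>H\<^esub> x) (\<eta> t) (\<gamma>' t)))))"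

definition is_evolution ::
    "('m, 'e::real_normed_vector) mgroup \<Rightarrow> ('m, 'e) chart \<Rightarrow> 'e regR \<Rightarrow> (real \<Rightarrow> 'm) \<Rightarrow> bool" where
  "is_evolution H \<kappa> \<gamma> \<eta> \<longleftrightarrow>
     \<eta> \<in> AC (atlas H) \<and> has_log_derivative H \<kappa> \<eta> \<gamma> \<and> \<eta> 0 = \<one>\<^bsub>H\<^esub>"

definition Evol ::
    "('m, 'e::real_normed_vector) mgroup \<Rightarrow> ('m, 'e) chart \<Rightarrow> 'e regR \<Rightarrow> (real \<Rightarrow> 'm)" where
  "Evol H \<kappa> \<gamma> = (THE \<eta>. is_evolution H \<kappa> \<gamma> \<eta>)"

text \<open>The product topology under the identification
  \<open>AC\<^sub>R([0,1],N \<rtimes> G) = AC\<^sub>R([0,1],N) \<times> AC\<^sub>R([0,1],G)\<close>.\<close>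

definition AC_semidirect_topology ::
    "('n, 'e::real_normed_vector) mgroup \<Rightarrow> ('g, 'f::real_normed_vector) mgroup \<Rightarrow>
     ('g \<Rightarrow> 'n \<Rightarrow> 'n) \<Rightarrow> (real \<Rightarrow> 'n \<times> 'g) topology" where
  "AC_semidirect_topology N G \<pi> =
     pullback_topology (AC (atlas (semidirect N G \<pi>)))
       (\<lambda>\<eta>. (\<lambda>t\<in>{0..1}. fst (\<eta> t), \<lambda>t\<in>{0..1}. snd (\<eta> t)))
       (prod_topology (AC_topology N) (AC_topology G))"

end

theory Submission
  imports Defs
begin

text \<open>For \<open>\<eta> = (\<alpha>, \<beta>)\<close> in \<open>H\<close> one has \<open>\<delta>(\<eta>) = (d\<pi>(\<beta>)\<^sup>-\<^sup>1 \<delta>(\<alpha>), \<delta>(\<beta>))\<close>. Hence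
  \<open>Evol\<^sub>H(\<gamma>\<^sub>1, \<gamma>\<^sub>2)\<close> is the pair of \<open>\<beta> = Evol\<^sub>G(\<gamma>\<^sub>2)\<close> and \<open>\<alpha> = Evol\<^sub>N(d\<pi>(\<beta>) \<gamma>\<^sub>1)\<close>, and
  the merely continuous maps \<open>g \<mapsto> \<pi>(g) n\<close> are never differentiated. The twisted control
  \<open>d\<pi>(\<beta>) \<gamma>\<^sub>1\<close> is regulated and depends continuously on \<open>(\<gamma>\<^sub>1, \<gamma>\<^sub>2)\<close> because \<open>g \<mapsto> d\<pi>(g)\<close> is locally
  bounded and strongly continuous. In a Banach--Lie group the evolution exists by Picard iteration
  on intervals of uniform length, and it depends continuously on the control since the chart
  velocity of \<open>\<eta>\<^sub>0\<^sup>-\<^sup>1 \<eta>\<close> is controlled by Gronwall's inequality. Only local Lipschitz continuity of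
  first derivatives is needed, so all smooth maps are handled through the class \<open>C11_at\<close>.\<close>

section \<open>Regulated functions and their primitives\<close>

text \<open>Since the action is only continuous in \<open>g\<close>, its derivative at the unit has
  to be recovered from values of the action itself. The map \<open>\<pi> g\<close> carries a
  solution with constant logarithmic derivative \<open>v\<close> to one with logarithmic derivative
  \<open>daction g v\<close>, and the remainder of the latter in a chart is quadratic in time,
  uniformly for \<open>g\<close> near the unit. A difference quotient at one small fixed time
  therefore approximates \<open>daction g v\<close>, and continuity of the action at a single point
  of \<open>N\<close> is enough. Strong continuity is weaker than norm continuity. Where the twisted
  control must be regulated, approximate one-sided limits provide a fixed vector to compare with;
  where it must depend continuously on the data, a step function with finitely many values does.
  Logarithmic derivatives are read from the increments
  \<open>inv (\<eta> t) \<otimes> \<eta> s\<close> in one chart at the unit, on which automorphisms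
  act directly. A single estimate, \<open>evolution_stability\<close>, yields uniqueness, continuity
  into the topology on \<open>AC\<close>, and closeness of the curves in \<open>G\<close> that twist
  the control.\<close>

lemma constant_if_zero_derivative_off_countable:
  fixes f :: "real \<Rightarrow> 'e::real_normed_vector"
  assumes ab: "a \<le> b" and cont: "continuous_on {a..b} f" and D: "countable D"
    and deriv: "\<And>t. t \<in> {a<..<b} - D \<Longrightarrow> (f has_vector_derivative 0) (at t)"
  shows "f b = f a"
proof (rule ccontr)
  assume ne: "f b \<noteq> f a"
  then have "a < b" using ab by (cases "a = b") auto
  define d where "d = norm (f b - f a)"
  have d: "d > 0" using ne by (simp add: d_def)
  \<comment> \<open>With this slope, \<open>h\<close> rises from 0 at \<open>a\<close> to
    \<open>d / 2\<close> at \<open>b\<close>.\<close>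
  define e where "e = d / 2 / (b - a)"
  have e: "e > 0" using d \<open>a < b\<close> by (simp add: e_def)
  define h where "h t = norm (f t - f a) - e * (t - a)" for t
  have ha: "h a = 0" by (simp add: h_def)
  have "e * (b - a) = d / 2" using \<open>a < b\<close> unfolding e_def by (subst nonzero_eq_divide_eq[symmetric]) auto
  then have hb: "h b = d / 2" by (simp add: h_def d_def)
  have hc: "continuous_on {a..b} h" unfolding h_def by (intro continuous_intros cont)
  \<comment> \<open>The image of a countable set is countable, so some level \<open>y\<close>
    between 0 and \<open>d / 2\<close> is not taken by \<open>h\<close> on \<open>D\<close>.\<close>
  have "uncountable ({0<..<d/2} - h ` D)"
    using D d by (intro uncountable_minus_countable) (auto simp: uncountable_open_interval)
  then have "{0<..<d/2} - h ` D \<noteq> {}" by (metis countable_empty)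
  then obtain y where "y \<in> {0<..<d/2} - h ` D" by blast
  then have y: "0 < y" "y < d/2" "y \<notin> h ` D" by auto
  \<comment> \<open>At the last point \<open>t\<close> with \<open>h t \<le> y\<close> the value is
    exactly \<open>y\<close>, so \<open>t\<close> lies outside \<open>D\<close> and the derivative
    vanishes there. Then \<open>f\<close> grows more slowly than the slope \<open>e\<close>,
    \<open>h\<close> drops to the right of \<open>t\<close>, and \<open>t\<close> was not the last
    such point.\<close>
  define T where "T = {t \<in> {a..b}. h t \<le> y}"
  have "closed T" unfolding T_def
    by (rule continuous_on_closed_Collect_le) (auto intro!: hc continuous_intros)
  moreover have aT: "a \<in> T" using ha y ab by (simp add: T_def)
  moreover have bdd: "bdd_above T" by (auto simp: T_def bdd_above_def)
  ultimately have tT: "Sup T \<in> T" using closed_contains_Sup by blast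
  define t where "t = Sup T"
  have t: "t \<in> {a..b}" "h t \<le> y" using tT by (auto simp: T_def t_def)
  have up: "s \<le> t" if "s \<in> T" for s using that bdd by (simp add: t_def cSup_upper)
  have "\<exists>x\<ge>t. x \<le> b \<and> h x = y"
    by (rule IVT') (use t y hb hc in \<open>auto elim: continuous_on_subset\<close>)
  then obtain x where x: "t \<le> x" "x \<le> b" "h x = y" by blast
  then have "x \<in> T" using t by (auto simp: T_def)
  then have "x = t" using up x by fastforce
  then have ht: "h t = y" using x by simp
  have tab: "a < t" "t < b" using ht ha hb y t by (cases "t = a"; cases "t = b"; auto)+
  have "t \<notin> D" using ht y by blast
  then have "(f has_derivative (\<lambda>_. 0)) (at t)"
    using deriv[of t] tab by (simp add: has_vector_derivative_def)
  then obtain \<delta> where \<delta>: "\<delta> > 0" "\<And>s. norm (s - t) < \<delta> \<Longrightarrow> norm (f s - f t) \<le> (e / 2) * norm (s - t)"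
    unfolding has_derivative_at_alt using e by (metis diff_zero half_gt_zero)
  define s where "s = min b (t + \<delta> / 2)"
  have s: "t < s" "s \<le> b" "norm (s - t) < \<delta>" using tab \<delta>(1) by (auto simp: s_def min_def)
  have "norm (f s - f a) \<le> norm (f s - f t) + norm (f t - f a)"
    by (metis add.commute norm_triangle_sub diff_add_cancel norm_triangle_ineq4 add_diff_eq norm_triangle_ineq)
  then have "h s \<le> h t + norm (f s - f t) - e * (s - t)" by (simp add: h_def algebra_simps)
  also have "\<dots> \<le> h t - (e / 2) * (s - t)"
  proof -
    have "norm (f s - f t) \<le> (e / 2) * (s - t)" using \<delta>(2)[OF s(3)] s by simp
    moreover have "e * (s - t) = (e / 2) * (s - t) + (e / 2) * (s - t)" by (simp flip: distrib_right)
    ultimately show ?thesis by linarith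
  qed
  also have "\<dots> < y" using ht e s by simp
  finally have "s \<in> T" using s tab by (auto simp: T_def)
  then show False using up s by fastforce
qed

section \<open>Step functions, one-sided oscillation and regulated functions\<close>

lemma step_on_join:
  assumes f: "step_on a b f" and g: "step_on b c g"
  shows "step_on a c (\<lambda>s. if s < b then f s else g s)"
proof -
  obtain P Q where P: "partition_of a b P" "\<And>u v. consecutive P u v \<Longrightarrow> f constant_on {u<..<v}"
    and Q: "partition_of b c Q" "\<And>u v. consecutive Q u v \<Longrightarrow> g constant_on {u<..<v}"
    using f g unfolding step_on_def by blast
  have "(\<lambda>s. if s < b then f s else g s) constant_on {u<..<v}" if uv: "consecutive (P \<union> Q) u v" for u v
  proof -
    have b: "b \<in> P" "b \<in> Q" "P \<subseteq> {a..b}" "Q \<subseteq> {b..c}" using P Q by (auto simp: partition_of_def)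
    \<comment> \<open>The point \<open>b\<close> belongs to both partitions, so no piece of their
      union straddles it.\<close>
    then have "v \<le> b \<or> b \<le> u" using uv by (force simp: consecutive_def)
    then show ?thesis
    proof
      assume v: "v \<le> b"
      then have "consecutive P u v" using uv b by (fastforce simp: consecutive_def)
      from P(2)[OF this] show ?thesis using v by (auto simp: constant_on_def)
    next
      assume u: "b \<le> u"
      then have "consecutive Q u v" using uv b by (fastforce simp: consecutive_def)
      from Q(2)[OF this] show ?thesis using u by (auto simp: constant_on_def)
    qed
  qed
  moreover have "partition_of a c (P \<union> Q)"
    using P(1) Q(1) by (force simp: partition_of_def)
  ultimately show ?thesis unfolding step_on_def by blast
qed

lemma step_on_three:
  assumes "u \<le> t" "t \<le> v"
  shows "step_on u v (\<lambda>s. if s < t then x else if s = t then z else y)"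
  unfolding step_on_def
proof (intro exI conjI allI impI)
  show "partition_of u v {u,t,v}" using assms by (auto simp: partition_of_def)
  fix p q assume "consecutive {u,t,v} p q"
  then have "q \<le> t \<or> t \<le> p" by (force simp: consecutive_def)
  then show "(\<lambda>s. if s < t then x else if s = t then z else y) constant_on {p<..<q}"
  proof
    assume "q \<le> t"
    then show ?thesis by (auto simp: constant_on_def intro!: exI[of _ x])
  next
    assume "t \<le> p"
    then show ?thesis by (auto simp: constant_on_def intro!: exI[of _ y])
  qed
qed

text \<open>The partition is finite, so all partition points other than \<open>t\<close> keep some
  distance \<open>d\<close> from \<open>t\<close>, and \<open>f\<close> is constant on either side
  within that distance.\<close>

lemma step_on_one_sided:
  assumes "step_on a b f" and t: "t \<in> {a..b}"
  shows "\<exists>d>0. \<exists>x y. (\<forall>s\<in>{a..b}. t - d < s \<and> s < t \<longrightarrow> f s = x) \<and>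
                   (\<forall>s\<in>{a..b}. t < s \<and> s < t + d \<longrightarrow> f s = y)"
proof -
  obtain P where P: "partition_of a b P" "\<And>u v. consecutive P u v \<Longrightarrow> f constant_on {u<..<v}"
    using assms unfolding step_on_def by blast
  have "finite P" using P(1) by (simp add: partition_of_def)
  then obtain d where d: "d > 0" "\<And>p. p \<in> P \<Longrightarrow> p \<noteq> t \<Longrightarrow> d \<le> dist t p"
    using finite_set_avoid[of P t] by blast
  have "\<exists>x. \<forall>s\<in>{a..b}. t - d < s \<and> s < t \<longrightarrow> f s = x"
  proof (cases "a < t")
    case True
    define u where "u = max a (t - d)"
    have gap: "{u<..<t} \<inter> P = {}" using d(2) by (force simp: u_def dist_real_def)
    obtain u' v' where 1: "consecutive P u' v'" "u' \<le> u" "t \<le> v'"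
      by (rule consecutive_cover[OF P(1), of u t]) (use t True d(1) gap in \<open>auto simp: u_def\<close>)
    then obtain x where x: "\<And>s. s \<in> {u'<..<v'} \<Longrightarrow> f s = x"
      using P(2)[OF 1(1)] unfolding constant_on_def by meson
    have pa: "a \<in> P" using P(1) by (auto simp: partition_of_def)
    have "f s = x" if "s \<in> {a..b}" "t - d < s" "s < t" for s
    \<comment> \<open>At the partition point \<open>a\<close> the value of \<open>f\<close> is
      arbitrary, but such a point is too far from \<open>t\<close> to occur.\<close>
    proof (cases "s = a")
      case False
      then show ?thesis using x[of s] 1 that by (auto simp: u_def)
    next
      case True
      then have "d \<le> dist t a" using d(2)[OF pa] that by auto
      then show ?thesis using that True by (auto simp: dist_real_def)
    qed
    then show ?thesis by blast
  qed (auto intro!: exI[of _ undefined])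
  moreover have "\<exists>y. \<forall>s\<in>{a..b}. t < s \<and> s < t + d \<longrightarrow> f s = y"
  proof (cases "t < b")
    case True
    define v where "v = min b (t + d)"
    have gap: "{t<..<v} \<inter> P = {}" using d(2) by (force simp: v_def dist_real_def)
    obtain u' v' where 1: "consecutive P u' v'" "u' \<le> t" "v \<le> v'"
      by (rule consecutive_cover[OF P(1), of t v]) (use t True d(1) gap in \<open>auto simp: v_def\<close>)
    then obtain x where x: "\<And>s. s \<in> {u'<..<v'} \<Longrightarrow> f s = x"
      using P(2)[OF 1(1)] unfolding constant_on_def by meson
    have pb: "b \<in> P" using P(1) by (auto simp: partition_of_def)
    have "f s = x" if "s \<in> {a..b}" "t < s" "s < t + d" for s
    proof (cases "s = b")
      case False
      then show ?thesis using x[of s] 1 that by (auto simp: v_def)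
    next
      case True
      then have "d \<le> dist t b" using d(2)[OF pb] that by auto
      then show ?thesis using that True by (auto simp: dist_real_def)
    qed
    then show ?thesis by blast
  qed (auto intro!: exI[of _ undefined])
  ultimately show ?thesis using d(1) by blast
qed

lemma step_approximation:
  assumes "regulated_on a b f" "e > 0"
  obtains g where "step_on a b g" "\<And>s. s \<in> {a..b} \<Longrightarrow> norm (f s - g s) \<le> e"
proof -
  obtain s where s: "\<And>n. step_on a b (s n)" "uniform_limit {a..b} s f sequentially"
    using assms unfolding regulated_on_def by blast
  from uniform_limitD[OF s(2) assms(2)] obtain n where "\<forall>t\<in>{a..b}. dist (s n t) (f t) < e"
    unfolding eventually_sequentially by blast
  then show ?thesis using that[OF s(1)] by (metis dist_norm dist_commute less_imp_le)
qed

text \<open>Replaces convergent sequences by one approximation for each tolerance, which is easier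
  to construct locally.\<close>

lemma regulated_on_iff_step_approximation:
  "regulated_on a b f \<longleftrightarrow> (\<forall>e>0. \<exists>g. step_on a b g \<and> (\<forall>s\<in>{a..b}. norm (f s - g s) \<le> e))"
proof
  assume *: "\<forall>e>0. \<exists>g. step_on a b g \<and> (\<forall>s\<in>{a..b}. norm (f s - g s) \<le> e)"
  have "\<exists>g. step_on a b g \<and> (\<forall>s\<in>{a..b}. norm (f s - g s) \<le> 1 / real (Suc n))" for n
    using * by (metis of_nat_0_less_iff zero_less_Suc zero_less_divide_1_iff)
  then obtain g where g: "\<And>n. step_on a b (g n)"
    "\<And>n s. s \<in> {a..b} \<Longrightarrow> norm (f s - g n s) \<le> 1 / real (Suc n)" by metis
  have "uniform_limit {a..b} g f sequentially"
  proof (rule uniform_limitI)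
    fix e :: real assume "e > 0"
    then have "\<forall>\<^sub>F n in sequentially. 1 / real (Suc n) < e"
      by (intro order_tendstoD(2)[OF LIMSEQ_Suc[OF lim_1_over_n]])
    then show "\<forall>\<^sub>F n in sequentially. \<forall>x\<in>{a..b}. dist (g n x) (f x) < e"
    proof eventually_elim
      case (elim n)
      show ?case
      proof
        fix x assume x: "x \<in> {a..b}"
        have "dist (g n x) (f x) \<le> 1 / real (Suc n)"
          using g(2)[OF x, of n] by (metis dist_norm dist_commute)
        then show "dist (g n x) (f x) < e" using elim by linarith
      qed
    qed
  qed
  then show "regulated_on a b f" using g(1) unfolding regulated_on_def by blast
qed (metis step_approximation)

lemma regulated_on_one_sided:
  assumes "regulated_on a b f" and t: "t \<in> {a..b}" and e: "e > 0"
  shows "\<exists>d>0. \<exists>x y. (\<forall>s\<in>{a..b}. t - d < s \<and> s < t \<longrightarrow> norm (f s - x) \<le> e) \<and>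
                   (\<forall>s\<in>{a..b}. t < s \<and> s < t + d \<longrightarrow> norm (f s - y) \<le> e)"
proof -
  obtain g where g: "step_on a b g" "\<And>s. s \<in> {a..b} \<Longrightarrow> norm (f s - g s) \<le> e"
    by (rule step_approximation[OF assms(1) e]) blast
  show ?thesis using step_on_one_sided[OF g(1) t] g(2) by metis
qed

text \<open>Together with \<open>regulated_on_one_sided\<close> this characterises regulated
  functions by one-sided oscillation: the vectors \<open>x\<close> and \<open>y\<close> may change
  with \<open>e\<close> and are only approximate one-sided limits. The step functions found near
  each point are joined by compactness, in the form of the bisection principle
  \<open>Bolzano\<close>.\<close>

lemma regulated_onI:
  fixes f :: "real \<Rightarrow> 'e::real_normed_vector"
  assumes ab: "a \<le> b" and loc: "\<And>t e. t \<in> {a..b} \<Longrightarrow> e > 0 \<Longrightarrow>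
      \<exists>d>0. \<exists>x y. (\<forall>s\<in>{a..b}. t - d < s \<and> s < t \<longrightarrow> norm (f s - x) \<le> e) \<and>
                   (\<forall>s\<in>{a..b}. t < s \<and> s < t + d \<longrightarrow> norm (f s - y) \<le> e)"
  shows "regulated_on a b f"
  unfolding regulated_on_iff_step_approximation
proof (intro allI impI)
  fix e :: real assume e: "e > 0"
  let ?P = "\<lambda>u v. a \<le> u \<longrightarrow> v \<le> b \<longrightarrow> (\<exists>g. step_on u v g \<and> (\<forall>s\<in>{u..v}. norm (f s - g s) \<le> e))"
  have "?P a b"
  proof (rule Bolzano[where P = ?P, OF ab])
    fix p q r assume *: "?P p q" "?P q r" "p \<le> q" "q \<le> r"
    show "?P p r"
    proof (intro impI)
      assume "a \<le> p" "r \<le> b"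
      then obtain g1 g2 where g: "step_on p q g1" "\<And>s. s \<in> {p..q} \<Longrightarrow> norm (f s - g1 s) \<le> e"
        "step_on q r g2" "\<And>s. s \<in> {q..r} \<Longrightarrow> norm (f s - g2 s) \<le> e" using * by force
      show "\<exists>g. step_on p r g \<and> (\<forall>s\<in>{p..r}. norm (f s - g s) \<le> e)"
        by (rule exI[of _ "\<lambda>s. if s < q then g1 s else g2 s"])
          (use g step_on_join[OF g(1,3)] in auto)
    qed
  next
    fix t assume t: "a \<le> t" "t \<le> b"
    then obtain d x y where d: "d > 0" "\<And>s. s \<in> {a..b} \<Longrightarrow> t - d < s \<Longrightarrow> s < t \<Longrightarrow> norm (f s - x) \<le> e"
      "\<And>s. s \<in> {a..b} \<Longrightarrow> t < s \<Longrightarrow> s < t + d \<Longrightarrow> norm (f s - y) \<le> e"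
      using loc[OF _ e, of t] by force
    have "?P u v" if "u \<le> t" "t \<le> v" "v - u < d" for u v
    proof (intro impI)
      assume "a \<le> u" "v \<le> b"
      \<comment> \<open>One value on each side of \<open>t\<close> suffices; the value at
        \<open>t\<close> itself is kept, since the one-sided bounds say nothing about it.\<close>
      then show "\<exists>g. step_on u v g \<and> (\<forall>s\<in>{u..v}. norm (f s - g s) \<le> e)"
        by (intro exI[of _ "\<lambda>s. if s < t then x else if s = t then f t else y"])
          (use that d e step_on_three[OF that(1,2), of x "f t" y] in auto)
    qed
    then show "\<exists>d>0. \<forall>u v. u \<le> t \<and> t \<le> v \<and> v - u < d \<longrightarrow> ?P u v" using d(1) by blast
  qed
  then show "\<exists>g. step_on a b g \<and> (\<forall>s\<in>{a..b}. norm (f s - g s) \<le> e)" by simp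
qed

text \<open>The one-sided criterion is inherited by subintervals, which avoids restricting
  partitions.\<close>

lemma regulated_on_subinterval:
  assumes f: "regulated_on a b f" and uv: "a \<le> u" "u \<le> v" "v \<le> b"
  shows "regulated_on u v f"
proof (rule regulated_onI[OF uv(2)])
  fix t e :: real assume t: "t \<in> {u..v}" "e > 0"
  have sub: "{u..v} \<subseteq> {a..b}" using uv by auto
  show "\<exists>d>0. \<exists>x y. (\<forall>s\<in>{u..v}. t - d < s \<and> s < t \<longrightarrow> norm (f s - x) \<le> e) \<and>
                   (\<forall>s\<in>{u..v}. t < s \<and> s < t + d \<longrightarrow> norm (f s - y) \<le> e)"
    using regulated_on_one_sided[OF f, of t e] t sub by (meson subsetD)
qed

lemma regulated_on_join:
  fixes f :: "real \<Rightarrow> 'e::real_normed_vector"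
  assumes f: "regulated_on a b f" and g: "regulated_on b c g"
  shows "regulated_on a c (\<lambda>s. if s < b then f s else g s)"
  unfolding regulated_on_iff_step_approximation
proof (intro allI impI)
  fix e :: real assume e: "e > 0"
  obtain f' where f': "step_on a b f'" "\<And>s. s \<in> {a..b} \<Longrightarrow> norm (f s - f' s) \<le> e"
    by (rule step_approximation[OF f e]) blast
  obtain g' where g': "step_on b c g'" "\<And>s. s \<in> {b..c} \<Longrightarrow> norm (g s - g' s) \<le> e"
    by (rule step_approximation[OF g e]) blast
  show "\<exists>h. step_on a c h \<and> (\<forall>s\<in>{a..c}. norm ((if s < b then f s else g s) - h s) \<le> e)"
    by (rule exI[of _ "\<lambda>s. if s < b then f' s else g' s"])
      (use f' g' step_on_join[OF f'(1) g'(1)] in auto)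
qed

text \<open>Strong continuity of \<open>T\<close> is enough because on each side of \<open>t\<close>
  the argument \<open>f s\<close> stays close to one vector \<open>z\<close>: in
  \<open>T s (f s - z) + (T s z - T t z)\<close> the local bound controls the first term and
  continuity at the fixed vector \<open>z\<close> the second. The operators
  \<open>daction (\<beta> t)\<close> form a family of this kind.\<close>

lemma regulated_on_linear_family:
  fixes T :: "real \<Rightarrow> 'e::real_normed_vector \<Rightarrow> 'f::real_normed_vector"
  assumes ab: "a \<le> b" and f: "regulated_on a b f"
    and lin: "\<And>t. t \<in> {a..b} \<Longrightarrow> linear (T t)"
    and bd: "\<And>t. t \<in> {a..b} \<Longrightarrow> \<exists>d>0. \<exists>K. \<forall>s\<in>{a..b}. \<bar>s - t\<bar> < d \<longrightarrow> (\<forall>x. norm (T s x) \<le> K * norm x)"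
    and cont: "\<And>x. continuous_on {a..b} (\<lambda>t. T t x)"
  shows "regulated_on a b (\<lambda>t. T t (f t))"
proof (rule regulated_onI[OF ab])
  fix t e :: real assume t: "t \<in> {a..b}" and e: "e > 0"
  obtain d0 K0 where d0: "d0 > 0" "\<And>s x. s \<in> {a..b} \<Longrightarrow> \<bar>s - t\<bar> < d0 \<Longrightarrow> norm (T s x) \<le> K0 * norm x"
    using bd[OF t] by blast
  define K where "K = max K0 1"
  have K: "norm (T s x) \<le> K * norm x" if "s \<in> {a..b}" "\<bar>s - t\<bar> < d0" for s x
    using d0(2)[OF that, of x] mult_right_mono[of K0 K "norm x"] by (simp add: K_def)
  have K1: "K \<ge> 1" by (simp add: K_def)
  have "e / (2 * K) > 0" using e K1 by simp
  from regulated_on_one_sided[OF f t this] obtain d1 x y where d1: "d1 > 0"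
    "\<And>s. s \<in> {a..b} \<Longrightarrow> t - d1 < s \<Longrightarrow> s < t \<Longrightarrow> norm (f s - x) \<le> e / (2 * K)"
    "\<And>s. s \<in> {a..b} \<Longrightarrow> t < s \<Longrightarrow> s < t + d1 \<Longrightarrow> norm (f s - y) \<le> e / (2 * K)" by blast
  have "\<exists>d>0. \<forall>s\<in>{a..b}. \<bar>s - t\<bar> < d \<longrightarrow> norm (T s z - T t z) \<le> e / 2" for z
    using cont[of z] t e unfolding continuous_on_iff dist_norm real_norm_def
    by (metis half_gt_zero less_imp_le)
  then obtain D where D: "\<And>z. D z > 0"
    "\<And>z s. s \<in> {a..b} \<Longrightarrow> \<bar>s - t\<bar> < D z \<Longrightarrow> norm (T s z - T t z) \<le> e / 2" by metis
  define d where "d = min (min d0 d1) (min (D x) (D y))"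
  have est: "norm (T s (f s) - T t z) \<le> e"
    if s: "s \<in> {a..b}" "\<bar>s - t\<bar> < d" and z: "norm (f s - z) \<le> e / (2 * K)" "z = x \<or> z = y" for s z
  proof -
    have "norm (T s (f s - z)) \<le> K * (e / (2 * K))"
      using K[of s "f s - z"] mult_left_mono[OF z(1), of K] s K1 by (auto simp: d_def)
    then have 1: "norm (T s (f s - z)) \<le> e / 2" using K1 by simp
    have 2: "norm (T s z - T t z) \<le> e / 2" using D(2) s z(2) by (auto simp: d_def)
    have "T s (f s) - T t z = T s (f s - z) + (T s z - T t z)"
      using linear_diff[OF lin[OF s(1)]] by simp
    moreover have "norm (T s (f s - z) + (T s z - T t z)) \<le> e"
      using 1 2 by (intro norm_triangle_le) linarith
    ultimately show ?thesis by metis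
  qed
  show "\<exists>d>0. \<exists>x y. (\<forall>s\<in>{a..b}. t - d < s \<and> s < t \<longrightarrow> norm (T s (f s) - x) \<le> e) \<and>
                   (\<forall>s\<in>{a..b}. t < s \<and> s < t + d \<longrightarrow> norm (T s (f s) - y) \<le> e)"
  proof (rule exI[of _ d], rule conjI, use d0 d1 D in \<open>simp add: d_def\<close>,
      rule exI[of _ "T t x"], rule exI[of _ "T t y"], intro conjI ballI impI)
    fix s assume s: "s \<in> {a..b}"
    show "norm (T s (f s) - T t x) \<le> e" if "t - d < s \<and> s < t"
      by (rule est[OF s _ d1(2)[OF s]]) (use that in \<open>auto simp: d_def\<close>)
    show "norm (T s (f s) - T t y) \<le> e" if "t < s \<and> s < t + d"
      by (rule est[OF s _ d1(3)[OF s]]) (use that in \<open>auto simp: d_def\<close>)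
  qed
qed

text \<open>A norm-continuous family is bounded on the compact interval and in particular strongly
  continuous.\<close>

lemma regulated_on_blinfun:
  fixes T :: "real \<Rightarrow> 'e::real_normed_vector \<Rightarrow>\<^sub>L 'f::real_normed_vector"
  assumes ab: "a \<le> b" and T: "continuous_on {a..b} T" and f: "regulated_on a b f"
  shows "regulated_on a b (\<lambda>t. blinfun_apply (T t) (f t))"
proof (rule regulated_on_linear_family[where T = "\<lambda>t. blinfun_apply (T t)", OF ab f])
  fix t assume t: "t \<in> {a..b}"
  show "linear (blinfun_apply (T t))" by (rule bounded_linear.linear[OF blinfun.bounded_linear_right])
  have "bounded (T ` {a..b})" using T by (intro compact_imp_bounded compact_continuous_image) auto
  then obtain K where K: "\<And>s. s \<in> {a..b} \<Longrightarrow> norm (T s) \<le> K" unfolding bounded_iff by blast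
  have K': "norm (T s x) \<le> K * norm x" if "s \<in> {a..b}" for s x
    using norm_blinfun[of "T s" x] mult_right_mono[OF K[OF that], of "norm x"] by simp
  show "\<exists>d>0. \<exists>K. \<forall>s\<in>{a..b}. \<bar>s - t\<bar> < d \<longrightarrow> (\<forall>x. norm (blinfun_apply (T s) x) \<le> K * norm x)"
    using K' zero_less_one by blast
next
  show "continuous_on {a..b} (\<lambda>t. blinfun_apply (T t) x)" for x
    by (intro continuous_intros T)
qed

lemma regulated_on_bounded_linear:
  assumes "bounded_linear L" "a \<le> b" "regulated_on a b f"
  shows "regulated_on a b (\<lambda>t. L (f t))"
  using regulated_on_blinfun[OF assms(2) continuous_on_const assms(3), of "Blinfun L"]
  by (simp add: bounded_linear_Blinfun_apply[OF assms(1)])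

section \<open>Integrals of regulated functions and the fundamental theorem off a countable
  set\<close>

lemma step_on_integrable:
  fixes f :: "real \<Rightarrow> 'e::banach"
  assumes ab: "a \<le> b" and f: "step_on a b f" shows "f integrable_on {a..b}"
proof -
  let ?P = "\<lambda>u v. a \<le> u \<longrightarrow> v \<le> b \<longrightarrow> f integrable_on {u..v}"
  have "?P a b"
  proof (rule Bolzano[where P = ?P, OF ab])
    fix p q r assume "?P p q" "?P q r" "p \<le> q" "q \<le> r"
    then show "?P p r"
      using Henstock_Kurzweil_Integration.integrable_combine[of p q r f] by linarith
  next
    fix t assume t: "a \<le> t" "t \<le> b"
    then obtain d x y where d: "d > 0" "\<And>s. s \<in> {a..b} \<Longrightarrow> t - d < s \<Longrightarrow> s < t \<Longrightarrow> f s = x"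
      "\<And>s. s \<in> {a..b} \<Longrightarrow> t < s \<Longrightarrow> s < t + d \<Longrightarrow> f s = y"
      using step_on_one_sided[OF f, of t] by force
    have "f integrable_on {u..v}" if uv: "u \<le> t" "t \<le> v" "v - u < d" "a \<le> u" "v \<le> b" for u v
    proof (rule Henstock_Kurzweil_Integration.integrable_combine[OF uv(1,2)])
      show "f integrable_on {u..t}"
        by (rule integrable_spike_finite[of "{t}" _ _ "\<lambda>_. x"]) (use d uv in auto)
      show "f integrable_on {t..v}"
        by (rule integrable_spike_finite[of "{t}" _ _ "\<lambda>_. y"]) (use d uv in auto)
    qed
    then show "\<exists>d>0. \<forall>u v. u \<le> t \<and> t \<le> v \<and> v - u < d \<longrightarrow> ?P u v" using d(1) by blast
  qed
  then show ?thesis by simp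
qed

lemma regulated_on_integrable:
  fixes f :: "real \<Rightarrow> 'e::banach"
  assumes ab: "a \<le> b" and f: "regulated_on a b f" shows "f integrable_on {a..b}"
proof -
  have "f integrable_on cbox a b"
  proof (rule integrable_uniform_limit)
    fix e :: real assume "e > 0"
    then obtain g where "step_on a b g" "\<And>s. s \<in> {a..b} \<Longrightarrow> norm (f s - g s) \<le> e"
      by (rule step_approximation[OF f]) blast
    then show "\<exists>g. (\<forall>x\<in>cbox a b. norm (f x - g x) \<le> e) \<and> g integrable_on cbox a b"
      using step_on_integrable[OF ab, of g] by (intro exI[of _ g]) auto
  qed
  then show ?thesis by simp
qed

text \<open>\<open>D\<close> consists of all points of the countably many partitions. Elsewhere
  every approximating step function is constant near \<open>t\<close>, and a uniform limit of such
  functions is continuous at \<open>t\<close>.\<close>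

lemma regulated_on_continuous_off_countable:
  assumes f: "regulated_on a b f"
  obtains D where "countable D" "\<And>t. t \<in> {a<..<b} - D \<Longrightarrow> isCont f t"
proof -
  obtain s where s: "\<And>n. step_on a b (s n)" "uniform_limit {a..b} s f sequentially"
    using f unfolding regulated_on_def by blast
  then obtain P where P: "\<And>n. partition_of a b (P n)"
    "\<And>n u v. consecutive (P n) u v \<Longrightarrow> s n constant_on {u<..<v}"
    unfolding step_on_def by metis
  show ?thesis
  proof
    show "countable (\<Union>n. P n)" using P(1) by (auto simp: partition_of_def intro: countable_finite)
    fix t assume t: "t \<in> {a<..<b} - (\<Union>n. P n)"
    have "\<exists>c. \<forall>\<^sub>F r in nhds t. s n r = c" for n
    proof -
      obtain u v where uv: "consecutive (P n) u v" "t \<in> {u<..<v}"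
        using step_on_finite_cover[OF P(1), of t n] t by auto
      then obtain c where "\<forall>r\<in>{u<..<v}. s n r = c" using P(2) unfolding constant_on_def by meson
      moreover have "\<forall>\<^sub>F r in nhds t. r \<in> {u<..<v}" using uv(2) by (intro eventually_nhds_in_open) auto
      ultimately show ?thesis by (auto elim!: eventually_mono)
    qed
    then obtain c where c: "\<And>n. \<forall>\<^sub>F r in nhds t. s n r = c n" by metis
    show "isCont f t"
      unfolding isCont_def
    proof (rule tendstoI)
      fix e :: real assume e: "e > 0"
      then have "\<forall>\<^sub>F n in sequentially. \<forall>x\<in>{a..b}. dist (s n x) (f x) < e / 2"
        by (intro uniform_limitD[OF s(2)]) simp
      then obtain n where n: "\<And>x. x \<in> {a..b} \<Longrightarrow> dist (s n x) (f x) < e / 2"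
        unfolding eventually_sequentially by blast
      have "\<forall>\<^sub>F r in nhds t. r \<in> {a<..<b}" using t by (intro eventually_nhds_in_open) auto
      then have "\<forall>\<^sub>F r in nhds t. dist (f r) (f t) < e"
        using c[of n]
      proof eventually_elim
        case (elim r)
        then have "dist (s n t) (f r) < e / 2"
          using n[of r] eventually_nhds_x_imp_x[OF c[of n]] by auto
        then show ?case using n[of t] t dist_triangle_half_r[of "s n t" "f r" e "f t"] by auto
      qed
      then show "\<forall>\<^sub>F r in at t. dist (f r) (f t) < e" by (simp add: eventually_nhds_conv_at)
    qed
  qed
qed

lemma integral_regulated_derivative:
  fixes f :: "real \<Rightarrow> 'e::banach"
  assumes ab: "a \<le> b" and f: "regulated_on a b f" and t: "t \<in> {a<..<b}" "isCont f t"
  shows "((\<lambda>s. integral {a..s} f) has_vector_derivative f t) (at t)"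
proof -
  have "((\<lambda>s. integral {a..s} f) has_vector_derivative f t) (at t within {a..b})"
    using integral_has_vector_derivative_continuous_at[OF regulated_on_integrable[OF ab f], of t "{}"] t
    by (auto intro: continuous_at_imp_continuous_at_within)
  then have "((\<lambda>s. integral {a..s} f) has_vector_derivative f t) (at t within {a<..<b})"
    by (rule has_vector_derivative_within_subset) auto
  then show ?thesis using at_within_open[of t "{a<..<b}"] t(1) by auto
qed

text \<open>The primitive is differentiable wherever \<gamma> is continuous, that is, off a
  countable set.\<close>

lemma has_reg_derivative_imp_derivative:
  fixes \<eta> :: "real \<Rightarrow> 'e::banach"
  assumes ab: "a \<le> b" and \<eta>: "has_reg_derivative \<eta> \<gamma> a b"
  obtains D where "countable D" "\<And>t. t \<in> {a<..<b} - D \<Longrightarrow> (\<eta> has_vector_derivative \<gamma> t) (at t)"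
proof -
  have \<gamma>: "regulated_on a b \<gamma>" using \<eta> by (simp add: has_reg_derivative_def)
  obtain D where D: "countable D" "\<And>t. t \<in> {a<..<b} - D \<Longrightarrow> isCont \<gamma> t"
    by (rule regulated_on_continuous_off_countable[OF \<gamma>]) blast
  have "(\<eta> has_vector_derivative \<gamma> t) (at t)" if t: "t \<in> {a<..<b} - D" for t
  proof -
    have "((\<lambda>s. \<eta> a + integral {a..s} \<gamma>) has_vector_derivative \<gamma> t) (at t)"
      using integral_regulated_derivative[OF ab \<gamma> _ D(2)[OF t]] t
      by (auto intro!: derivative_eq_intros)
    then show ?thesis
    proof (rule has_vector_derivative_transform_within_open[where S = "{a<..<b}"])
      show "\<eta> a + integral {a..s} \<gamma> = \<eta> s" if "s \<in> {a<..<b}" for s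
      proof -
        have "integral {a..s} \<gamma> = \<eta> s - \<eta> a"
          by (rule integral_unique) (use \<eta> that in \<open>auto simp: has_reg_derivative_def\<close>)
        then show ?thesis by simp
      qed
    qed (use t in auto)
  qed
  then show ?thesis using that[OF D(1)] by blast
qed

text \<open>Converse of \<open>has_reg_derivative_imp_derivative\<close>. It matters that the
  exceptional set is countable and not just null: the Cantor function is continuous with derivative
  0 off a null set, but not constant. With both directions at hand, chain and gluing rules reduce to
  pointwise differentiation.\<close>

lemma has_reg_derivativeI:
  fixes \<eta> :: "real \<Rightarrow> 'e::banach"
  assumes cont: "continuous_on {a..b} \<eta>" and \<gamma>: "regulated_on a b \<gamma>"
    and D: "countable D" "\<And>t. t \<in> {a<..<b} - D \<Longrightarrow> (\<eta> has_vector_derivative \<gamma> t) (at t)"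
  shows "has_reg_derivative \<eta> \<gamma> a b"
  unfolding has_reg_derivative_def
proof (intro conjI cont \<gamma> ballI)
  fix s assume s: "s \<in> {a..b}"
  then have as: "a \<le> s" "a \<le> b" by auto
  have \<gamma>s: "regulated_on a s \<gamma>" by (rule regulated_on_subinterval[OF \<gamma>]) (use s in auto)
  obtain D' where D': "countable D'" "\<And>t. t \<in> {a<..<s} - D' \<Longrightarrow> isCont \<gamma> t"
    by (rule regulated_on_continuous_off_countable[OF \<gamma>s]) blast
  have int: "\<gamma> integrable_on {a..s}" by (rule regulated_on_integrable[OF as(1) \<gamma>s])
  let ?f = "\<lambda>t. \<eta> t - integral {a..t} \<gamma>"
  have "?f s = ?f a"
  proof (rule constant_if_zero_derivative_off_countable[where f = ?f, OF as(1)])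
    show "continuous_on {a..s} ?f"
      by (intro continuous_intros indefinite_integral_continuous_1[OF int])
        (use s in \<open>auto intro: continuous_on_subset[OF cont]\<close>)
    show "countable (D \<union> D')" using D(1) D'(1) by simp
    fix t assume t: "t \<in> {a<..<s} - (D \<union> D')"
    have "(?f has_vector_derivative (\<gamma> t - \<gamma> t)) (at t)"
      by (rule has_vector_derivative_diff[OF D(2) integral_regulated_derivative[OF as(1) \<gamma>s]])
        (use t s D'(2) in auto)
    then show "(?f has_vector_derivative 0) (at t)" by simp
  qed
  then have "integral {a..s} \<gamma> = \<eta> s - \<eta> a" by (simp add: algebra_simps)
  then show "(\<gamma> has_integral (\<eta> s - \<eta> a)) {a..s}" using int by (metis integrable_integral)
qed

lemma has_reg_derivative_subinterval:
  fixes \<eta> :: "real \<Rightarrow> 'e::banach"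
  assumes \<eta>: "has_reg_derivative \<eta> \<gamma> a b" and uv: "a \<le> u" "u \<le> v" "v \<le> b"
  shows "has_reg_derivative \<eta> \<gamma> u v"
proof -
  have ab: "a \<le> b" using uv by simp
  obtain D where D: "countable D" "\<And>t. t \<in> {a<..<b} - D \<Longrightarrow> (\<eta> has_vector_derivative \<gamma> t) (at t)"
    by (rule has_reg_derivative_imp_derivative[OF ab \<eta>]) blast
  have "continuous_on {a..b} \<eta>" "regulated_on a b \<gamma>" using \<eta> by (auto simp: has_reg_derivative_def)
  then show ?thesis
    by (intro has_reg_derivativeI[OF _ _ D(1)])
      (use D(2) uv in \<open>auto intro: continuous_on_subset regulated_on_subinterval\<close>)
qed

lemma has_reg_derivative_join:
  fixes \<eta> :: "real \<Rightarrow> 'e::banach"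
  assumes 1: "has_reg_derivative \<eta> \<gamma>1 a b" and 2: "has_reg_derivative \<eta> \<gamma>2 b c"
    and abc: "a \<le> b" "b \<le> c"
  shows "has_reg_derivative \<eta> (\<lambda>s. if s < b then \<gamma>1 s else \<gamma>2 s) a c"
proof -
  obtain D1 where D1: "countable D1" "\<And>t. t \<in> {a<..<b} - D1 \<Longrightarrow> (\<eta> has_vector_derivative \<gamma>1 t) (at t)"
    by (rule has_reg_derivative_imp_derivative[OF abc(1) 1]) blast
  obtain D2 where D2: "countable D2" "\<And>t. t \<in> {b<..<c} - D2 \<Longrightarrow> (\<eta> has_vector_derivative \<gamma>2 t) (at t)"
    by (rule has_reg_derivative_imp_derivative[OF abc(2) 2]) blast
  have "continuous_on ({a..b} \<union> {b..c}) \<eta>"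
    using 1 2 by (intro continuous_on_closed_Un) (auto simp: has_reg_derivative_def)
  moreover have "{a..b} \<union> {b..c} = {a..c}" using abc by auto
  ultimately show ?thesis
    by (intro has_reg_derivativeI[where D = "insert b (D1 \<union> D2)"] regulated_on_join)
      (use 1 2 D1 D2 in \<open>auto simp: has_reg_derivative_def\<close>)
qed

text \<open>Lets exceptional sets be handled as negligible sets, the notion used by the integral,
  and united freely with countable ones.\<close>

lemma AE_lebesgue_on_iff_negligible:
  "(AE t in lebesgue_on {u..v::real}. P t) \<longleftrightarrow> (\<exists>Z. negligible Z \<and> (\<forall>t\<in>{u..v} - Z. P t))"
proof
  assume "AE t in lebesgue_on {u..v}. P t"
  then have "AE t in lebesgue. t \<in> {u..v} \<longrightarrow> P t" by (simp add: AE_restrict_space_iff)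
  then obtain Z where Z: "{t. \<not> (t \<in> {u..v} \<longrightarrow> P t)} \<subseteq> Z" "Z \<in> null_sets lebesgue"
    by (auto elim!: AE_E simp: null_sets_def)
  then show "\<exists>Z. negligible Z \<and> (\<forall>t\<in>{u..v} - Z. P t)"
    by (intro exI[of _ Z]) (auto simp: negligible_iff_null_sets)
next
  assume "\<exists>Z. negligible Z \<and> (\<forall>t\<in>{u..v} - Z. P t)"
  then obtain Z where Z: "Z \<in> null_sets lebesgue" "\<And>t. t \<in> {u..v} - Z \<Longrightarrow> P t"
    by (auto simp: negligible_iff_null_sets)
  from AE_not_in[OF Z(1)] have "AE t in lebesgue. t \<in> {u..v} \<longrightarrow> P t"
    by eventually_elim (use Z(2) in auto)
  then show "AE t in lebesgue_on {u..v}. P t" by (simp add: AE_restrict_space_iff)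
qed

lemma has_reg_derivative_spike:
  fixes \<eta> :: "real \<Rightarrow> 'e::banach"
  assumes \<eta>: "has_reg_derivative \<eta> \<gamma> a b" and \<gamma>': "regulated_on a b \<gamma>'"
    and Z: "negligible Z" "\<And>t. t \<in> {a<..<b} - Z \<Longrightarrow> \<gamma>' t = \<gamma> t"
  shows "has_reg_derivative \<eta> \<gamma>' a b"
  unfolding has_reg_derivative_def
proof (intro conjI \<gamma>' ballI)
  fix s assume s: "s \<in> {a..b}"
  show "(\<gamma>' has_integral \<eta> s - \<eta> a) {a..s}"
  proof (rule has_integral_spike[where f = \<gamma>])
    \<comment> \<open>Both endpoints join the exceptional set, because agreement is assumed only in
      the interior.\<close>
    show "negligible (insert a (insert b Z))" using Z(1) by simp
  qed (use \<eta> s Z(2) in \<open>auto simp: has_reg_derivative_def\<close>)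
qed (use \<eta> in \<open>simp add: has_reg_derivative_def\<close>)

lemma has_reg_derivative_norm_bound:
  fixes \<eta> :: "real \<Rightarrow> 'e::banach"
  assumes \<eta>: "has_reg_derivative \<eta> \<gamma> a b" and s: "s \<in> {a..b}" and g: "g integrable_on {a..s}"
    and Z: "negligible Z" "\<And>t. t \<in> {a<..<s} - Z \<Longrightarrow> norm (\<gamma> t) \<le> g t"
    and nn: "\<And>t. t \<in> {a..s} \<Longrightarrow> 0 \<le> g t"
  shows "norm (\<eta> s - \<eta> a) \<le> integral {a..s} g"
proof -
  \<comment> \<open>Setting the derivative to 0 at the exceptional points leaves the integral
    unchanged and turns the bound into one valid at every point, as the integral inequality
    demands.\<close>
  define f where "f t = (if t \<in> Z \<or> t = a \<or> t = s then 0 else \<gamma> t)" for t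
  have f: "(f has_integral (\<eta> s - \<eta> a)) {a..s}"
  proof (rule has_integral_spike[where f = \<gamma> and S = "insert a (insert s Z)"])
    show "(\<gamma> has_integral (\<eta> s - \<eta> a)) {a..s}" using \<eta> s by (auto simp: has_reg_derivative_def)
  qed (use Z(1) in \<open>auto simp: f_def\<close>)
  then have "norm (integral {a..s} f) \<le> integral {a..s} g"
    by (intro integral_norm_bound_integral g) (use Z(2) nn in \<open>auto simp: f_def\<close>)
  then show ?thesis using f by (simp add: integral_unique)
qed

section \<open>Locally Lipschitz differentiable maps\<close>

text \<open>As a total operator-valued map it can itself be continuous or Lipschitz in the operator
  norm; its value is meaningful only where \<open>f\<close> is differentiable.\<close>

definition fderiv :: "('a::real_normed_vector \<Rightarrow> 'b::real_normed_vector) \<Rightarrow> 'a \<Rightarrow> 'a \<Rightarrow>\<^sub>L 'b" where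
  "fderiv f x = Blinfun (\<lambda>v. frechet_derivative f (at x) v)"

lemma has_derivative_imp_fderiv:
  assumes "(f has_derivative f') (at x)"
  shows "blinfun_apply (fderiv f x) = f'"
proof -
  have "frechet_derivative f (at x) = f'" using frechet_derivative_at[OF assms] by simp
  then show ?thesis
    using has_derivative_bounded_linear[OF assms] by (simp add: fderiv_def bounded_linear_Blinfun_apply)
qed

text \<open>Frechet differentiability near \<open>x\<close> with Lipschitz derivative there. The
  radius is hidden inside the definition, so the domains of charts can be tracked by neighbourhood
  filters at a point.\<close>

definition C11_at :: "('a::real_normed_vector \<Rightarrow> 'b::real_normed_vector) \<Rightarrow> 'a \<Rightarrow> bool" where
  "C11_at f x \<longleftrightarrow> (\<exists>r>0. \<exists>K. (\<forall>y\<in>ball x r. (f has_derivative fderiv f y) (at y)) \<and>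
     (\<forall>y\<in>ball x r. \<forall>z\<in>ball x r. norm (fderiv f y - fderiv f z) \<le> K * norm (y - z)))"

lemma C11_atI:
  assumes r: "r > 0" and D: "\<And>y. y \<in> ball x r \<Longrightarrow> (f has_derivative blinfun_apply (f' y)) (at y)"
    and L: "\<And>y z. y \<in> ball x r \<Longrightarrow> z \<in> ball x r \<Longrightarrow> norm (f' y - f' z) \<le> K * norm (y - z)"
  shows "C11_at f x"
proof -
  have eq: "fderiv f y = f' y" if "y \<in> ball x r" for y
    using has_derivative_imp_fderiv[OF D[OF that]] by (simp add: blinfun_apply_inject)
  show ?thesis unfolding C11_at_def
    by (rule exI[of _ r], rule conjI, rule r, rule exI[of _ K]) (auto simp: eq D L)
qed

text \<open>Shrinking the radius and enlarging the constant makes one \<open>K\<close> serve both as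
  bound and as Lipschitz constant of the derivative.\<close>

lemma C11_atE:
  assumes "C11_at f x" "\<rho> > 0"
  obtains r K where "r > 0" "r \<le> \<rho>" "K \<ge> 0"
    "\<And>y. y \<in> ball x r \<Longrightarrow> (f has_derivative fderiv f y) (at y)"
    "\<And>y z. y \<in> ball x r \<Longrightarrow> z \<in> ball x r \<Longrightarrow> norm (fderiv f y - fderiv f z) \<le> K * norm (y - z)"
    "\<And>y. y \<in> ball x r \<Longrightarrow> norm (fderiv f y) \<le> K"
proof -
  obtain r K where r: "r > 0" "\<And>y. y \<in> ball x r \<Longrightarrow> (f has_derivative fderiv f y) (at y)"
    "\<And>y z. y \<in> ball x r \<Longrightarrow> z \<in> ball x r \<Longrightarrow> norm (fderiv f y - fderiv f z) \<le> K * norm (y - z)"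
    using assms(1) unfolding C11_at_def by blast
  define s where "s = min r \<rho>"
  define M where "M = max 0 (max K (\<bar>K\<bar> * r + norm (fderiv f x)))"
  have sub: "ball x s \<subseteq> ball x r" by (auto simp: s_def)
  have bd: "norm (fderiv f y) \<le> M" if y: "y \<in> ball x s" for y
  proof -
    have "norm (fderiv f y - fderiv f x) \<le> K * norm (y - x)" using r(1,3) y sub by auto
    also have "\<dots> \<le> \<bar>K\<bar> * r"
      using y by (intro mult_mono) (auto simp: s_def dist_norm norm_minus_commute)
    finally have "norm (fderiv f y) \<le> \<bar>K\<bar> * r + norm (fderiv f x)"
      using norm_triangle_sub[of "fderiv f y" "fderiv f x"] by linarith
    then show ?thesis by (simp add: M_def)
  qed
  have "norm (fderiv f y - fderiv f z) \<le> M * norm (y - z)" if "y \<in> ball x s" "z \<in> ball x s" for y z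
  proof -
    have "K * norm (y - z) \<le> M * norm (y - z)" by (rule mult_right_mono) (auto simp: M_def)
    then show ?thesis using r(3)[of y z] that sub by (meson order_trans subsetD)
  qed
  moreover have "s > 0" "s \<le> \<rho>" "M \<ge> 0" using r(1) assms(2) by (auto simp: s_def M_def)
  ultimately show ?thesis using that[of s M] r(2) bd sub by blast
qed

lemma C11_at_has_derivative: "C11_at f x \<Longrightarrow> (f has_derivative fderiv f x) (at x)"
  by (auto elim: C11_atE[where \<rho> = 1])

lemma C11_at_isCont: "C11_at f x \<Longrightarrow> isCont f x"
  using C11_at_has_derivative has_derivative_continuous by blast

lemma C11_at_eventually:
  assumes "C11_at f x" shows "\<forall>\<^sub>F y in nhds x. C11_at f y"
proof -
  obtain r K where r: "r > 0" "\<And>y. y \<in> ball x r \<Longrightarrow> (f has_derivative fderiv f y) (at y)"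
    "\<And>y z. y \<in> ball x r \<Longrightarrow> z \<in> ball x r \<Longrightarrow> norm (fderiv f y - fderiv f z) \<le> K * norm (y - z)"
    using assms unfolding C11_at_def by blast
  have "C11_at f y" if y: "y \<in> ball x r" for y
  proof (rule C11_atI[where f' = "fderiv f" and r = "r - dist x y" and K = K])
    have sub: "z \<in> ball x r" if "z \<in> ball y (r - dist x y)" for z
      using that dist_triangle[of x z y] by simp
    show "(f has_derivative fderiv f z) (at z)" if "z \<in> ball y (r - dist x y)" for z
      using r(2) sub that by blast
    show "norm (fderiv f z - fderiv f w) \<le> K * norm (z - w)"
      if "z \<in> ball y (r - dist x y)" "w \<in> ball y (r - dist x y)" for z w
      using r(3) sub that by blast
  qed (use y in simp)
  then show ?thesis using r(1) by (auto intro: eventually_mono[OF eventually_nhds_ball])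
qed

lemma C11_at_cong:
  assumes f: "C11_at f x" and eq: "\<forall>\<^sub>F y in nhds x. f y = g y"
  shows "C11_at g x"
proof -
  obtain e where e: "e > 0" "\<And>y. y \<in> ball x e \<Longrightarrow> f y = g y"
    using eq unfolding eventually_nhds_metric by (auto simp: dist_commute)
  obtain r K where r: "r > 0" "r \<le> e" "\<And>y. y \<in> ball x r \<Longrightarrow> (f has_derivative fderiv f y) (at y)"
    "\<And>y z. y \<in> ball x r \<Longrightarrow> z \<in> ball x r \<Longrightarrow> norm (fderiv f y - fderiv f z) \<le> K * norm (y - z)"
    by (rule C11_atE[OF f e(1)]) metis
  show ?thesis
  proof (rule C11_atI[OF r(1) _ r(4)])
    fix y assume y: "y \<in> ball x r"
    show "(g has_derivative fderiv f y) (at y)"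
      by (rule has_derivative_transform_within_open[OF r(3)[OF y] open_ball y]) (use e r(2) in auto)
  qed
qed

lemma C11_at_bounded_linear:
  assumes "bounded_linear f" shows "C11_at f x"
proof (rule C11_atI[where f' = "\<lambda>_. Blinfun f" and r = 1 and K = 0])
  show "(f has_derivative blinfun_apply (Blinfun f)) (at y)" for y
    using assms by (simp add: bounded_linear_Blinfun_apply bounded_linear_imp_has_derivative)
qed auto

lemma C11_at_const: "C11_at (\<lambda>_. c) x"
  by (rule C11_atI[where f' = "\<lambda>_. 0" and r = 1 and K = 0]) (auto simp: zero_blinfun.rep_eq)

lemma C11_at_Pair:
  assumes f: "C11_at f x" and g: "C11_at g x"
  shows "C11_at (\<lambda>y. (f y, g y)) x"
proof -
  obtain r K where r: "r > 0" "\<And>y. y \<in> ball x r \<Longrightarrow> (f has_derivative fderiv f y) (at y)"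
    "\<And>y z. y \<in> ball x r \<Longrightarrow> z \<in> ball x r \<Longrightarrow> norm (fderiv f y - fderiv f z) \<le> K * norm (y - z)"
    by (rule C11_atE[OF f zero_less_one]) metis
  obtain s M where s: "s > 0" "s \<le> r" "\<And>y. y \<in> ball x s \<Longrightarrow> (g has_derivative fderiv g y) (at y)"
    "\<And>y z. y \<in> ball x s \<Longrightarrow> z \<in> ball x s \<Longrightarrow> norm (fderiv g y - fderiv g z) \<le> M * norm (y - z)"
    by (rule C11_atE[OF g r(1)]) metis
  define h where "h y = Blinfun (\<lambda>v. (fderiv f y v, fderiv g y v))" for y
  have h: "blinfun_apply (h y) = (\<lambda>v. (fderiv f y v, fderiv g y v))" for y
    unfolding h_def by (rule bounded_linear_Blinfun_apply)
      (intro bounded_linear_Pair blinfun.bounded_linear_right)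
  show ?thesis
  proof (rule C11_atI[OF s(1), where f' = h and K = "K + M"])
    fix y assume y: "y \<in> ball x s"
    show "((\<lambda>y. (f y, g y)) has_derivative blinfun_apply (h y)) (at y)"
      unfolding h by (intro has_derivative_Pair r s) (use y s(2) in auto)
    fix z assume z: "z \<in> ball x s"
    have 1: "norm (fderiv f y - fderiv f z) \<le> K * norm (y - z)" using r(3) y z s(2) by auto
    have 2: "norm (fderiv g y - fderiv g z) \<le> M * norm (y - z)" by (rule s(4)[OF y z])
    show "norm (h y - h z) \<le> (K + M) * norm (y - z)"
    proof (rule norm_blinfun_bound)
      show "0 \<le> (K + M) * norm (y - z)"
        using order_trans[OF norm_ge_zero 1] order_trans[OF norm_ge_zero 2]
        by (simp add: distrib_right)
      fix v
      have "norm ((h y - h z) v) \<le> norm ((fderiv f y - fderiv f z) v) + norm ((fderiv g y - fderiv g z) v)"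
        by (simp add: h blinfun.diff_left norm_Pair_le)
      also have "\<dots> \<le> norm (fderiv f y - fderiv f z) * norm v + norm (fderiv g y - fderiv g z) * norm v"
        by (intro add_mono norm_blinfun)
      also have "\<dots> \<le> (K * norm (y - z)) * norm v + (M * norm (y - z)) * norm v"
        by (intro add_mono mult_right_mono 1 2) auto
      finally show "norm ((h y - h z) v) \<le> (K + M) * norm (y - z) * norm v"
        by (simp add: algebra_simps)
    qed
  qed
qed

lemma C11_at_compose:
  assumes f: "C11_at f x" and g: "C11_at g (f x)"
  shows "C11_at (g \<circ> f) x"
proof -
  obtain s M where s: "s > 0" "M \<ge> 0" "\<And>y. y \<in> ball (f x) s \<Longrightarrow> (g has_derivative fderiv g y) (at y)"
    "\<And>y z. y \<in> ball (f x) s \<Longrightarrow> z \<in> ball (f x) s \<Longrightarrow> norm (fderiv g y - fderiv g z) \<le> M * norm (y - z)"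
    "\<And>y. y \<in> ball (f x) s \<Longrightarrow> norm (fderiv g y) \<le> M"
    by (rule C11_atE[OF g zero_less_one]) metis
  obtain e where e: "e > 0" "\<And>y. y \<in> ball x e \<Longrightarrow> f y \<in> ball (f x) s"
    using C11_at_isCont[OF f] s(1) unfolding continuous_at_eps_delta
    by (metis dist_commute mem_ball)
  obtain r K where r: "r > 0" "r \<le> e" "K \<ge> 0"
    "\<And>y. y \<in> ball x r \<Longrightarrow> (f has_derivative fderiv f y) (at y)"
    "\<And>y z. y \<in> ball x r \<Longrightarrow> z \<in> ball x r \<Longrightarrow> norm (fderiv f y - fderiv f z) \<le> K * norm (y - z)"
    "\<And>y. y \<in> ball x r \<Longrightarrow> norm (fderiv f y) \<le> K"
    by (rule C11_atE[OF f e(1)]) metis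
  have fs: "f y \<in> ball (f x) s" if "y \<in> ball x r" for y using e(2) that r(2) by auto
  have lip: "norm (f y - f z) \<le> K * norm (y - z)" if "y \<in> ball x r" "z \<in> ball x r" for y z
  proof (rule differentiable_bound[of "ball x r" f "\<lambda>y. blinfun_apply (fderiv f y)"])
    show "(f has_derivative fderiv f w) (at w within ball x r)" if "w \<in> ball x r" for w
      using r(4)[OF that] has_derivative_at_withinI by blast
    show "onorm (blinfun_apply (fderiv f w)) \<le> K" if "w \<in> ball x r" for w
      using r(6)[OF that] by (simp add: norm_blinfun.rep_eq)
  qed (use that in auto)
  show ?thesis
  \<comment> \<open>The difference of two operator products splits into two terms.
    \<open>M * K * K\<close> combines the Lipschitz constants of the derivative of \<open>g\<close>
    and of \<open>f\<close> with the bound on the derivative of \<open>f\<close>;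
    \<open>M * K\<close> combines the bound on the derivative of \<open>g\<close> with the Lipschitz
    constant of the derivative of \<open>f\<close>.\<close>
  proof (rule C11_atI[OF r(1), where f' = "\<lambda>y. fderiv g (f y) o\<^sub>L fderiv f y" and K = "M * K * K + M * K"])
    fix y assume y: "y \<in> ball x r"
    have "((g \<circ> f) has_derivative (blinfun_apply (fderiv g (f y)) \<circ> blinfun_apply (fderiv f y))) (at y)"
      by (rule diff_chain_at[OF r(4)[OF y] s(3)[OF fs[OF y]]])
    moreover have "blinfun_apply (fderiv g (f y)) \<circ> blinfun_apply (fderiv f y) =
        blinfun_apply (fderiv g (f y) o\<^sub>L fderiv f y)" by (rule ext) simp
    ultimately show "((g \<circ> f) has_derivative blinfun_apply (fderiv g (f y) o\<^sub>L fderiv f y)) (at y)"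
      by (simp only:)
    fix z assume z: "z \<in> ball x r"
    have eq: "(fderiv g (f y) o\<^sub>L fderiv f y) - (fderiv g (f z) o\<^sub>L fderiv f z) =
       ((fderiv g (f y) - fderiv g (f z)) o\<^sub>L fderiv f y) + (fderiv g (f z) o\<^sub>L (fderiv f y - fderiv f z))"
      by (rule blinfun_eqI) (simp add: blinfun.bilinear_simps)
    have "norm ((fderiv g (f y) - fderiv g (f z)) o\<^sub>L fderiv f y) \<le> norm (fderiv g (f y) - fderiv g (f z)) * norm (fderiv f y)"
      by (rule norm_blinfun_compose)
    also have "\<dots> \<le> (M * (K * norm (y - z))) * K"
    proof (intro mult_mono r(6)[OF y])
      have "M * norm (f y - f z) \<le> M * (K * norm (y - z))" by (intro mult_left_mono lip y z s(2))
      then show "norm (fderiv g (f y) - fderiv g (f z)) \<le> M * (K * norm (y - z))"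
        using s(4)[OF fs[OF y] fs[OF z]] by linarith
    qed (use s r in auto)
    finally have 1: "norm ((fderiv g (f y) - fderiv g (f z)) o\<^sub>L fderiv f y) \<le> M * K * K * norm (y - z)"
      by (simp add: algebra_simps)
    have "norm (fderiv g (f z) o\<^sub>L (fderiv f y - fderiv f z)) \<le> norm (fderiv g (f z)) * norm (fderiv f y - fderiv f z)"
      by (rule norm_blinfun_compose)
    also have "\<dots> \<le> M * (K * norm (y - z))"
      by (intro mult_mono s(5)[OF fs[OF z]] r(5)[OF y z] s(2)) auto
    finally show "norm ((fderiv g (f y) o\<^sub>L fderiv f y) - (fderiv g (f z) o\<^sub>L fderiv f z)) \<le> (M * K * K + M * K) * norm (y - z)"
      unfolding eq using 1 by (intro norm_triangle_le) (simp add: algebra_simps)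
  qed
qed

lemma C11_at_fst: "C11_at fst x" and C11_at_snd: "C11_at snd x" and C11_at_id: "C11_at (\<lambda>x. x) y"
  by (auto intro!: C11_at_bounded_linear bounded_linear_fst bounded_linear_snd bounded_linear_ident)

subsection \<open>Michal--Bastiani smooth maps between normed spaces\<close>

lemma dir_deriv_has_vector_derivative:
  assumes "(\<lambda>s. f (x + s *\<^sub>R v)) differentiable (at 0)"
  shows "((\<lambda>s. f (x + s *\<^sub>R v)) has_vector_derivative dir_deriv f x v) (at 0)"
  using assms vector_derivative_works unfolding dir_deriv_def by blast

lemma has_derivative_imp_dir_deriv:
  assumes "(f has_derivative f') (at x)"
  shows "dir_deriv f x v = f' v"
proof -
  have "((\<lambda>s. x + s *\<^sub>R v) has_derivative (\<lambda>s. s *\<^sub>R v)) (at 0)"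
    by (auto intro!: derivative_eq_intros)
  moreover have "(f has_derivative f') (at (x + 0 *\<^sub>R v))" using assms by simp
  ultimately have "((\<lambda>s. f (x + s *\<^sub>R v)) has_derivative (\<lambda>s. f' (s *\<^sub>R v))) (at 0)"
    by (rule has_derivative_compose)
  then have "((\<lambda>s. f (x + s *\<^sub>R v)) has_vector_derivative f' v) (at 0)"
    using linear_scale[OF has_derivative_linear[OF assms]] by (simp add: has_vector_derivative_def)
  then show ?thesis unfolding dir_deriv_def by (rule vector_derivative_at)
qed

lemma line_derivative:
  fixes f :: "'a::real_normed_vector \<Rightarrow> 'b::real_normed_vector"
  assumes "((\<lambda>s. f ((x + t *\<^sub>R v) + s *\<^sub>R v)) has_vector_derivative d) (at 0)"
  shows "((\<lambda>s. f (x + s *\<^sub>R v)) has_vector_derivative d) (at t)"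
proof -
  have "((\<lambda>s. s - t) has_vector_derivative 1) (at t)" by (auto intro!: derivative_eq_intros)
  moreover have "((\<lambda>s. f ((x + t *\<^sub>R v) + s *\<^sub>R v)) has_vector_derivative d) (at (t - t))" using assms by simp
  ultimately have "((\<lambda>s. f ((x + t *\<^sub>R v) + s *\<^sub>R v)) \<circ> (\<lambda>s. s - t) has_vector_derivative (1 *\<^sub>R d)) (at t)"
    by (rule vector_diff_chain_at)
  moreover have "x + t *\<^sub>R v + (s - t) *\<^sub>R v = x + s *\<^sub>R v" for s
    by (simp add: scaleR_left_diff_distrib)
  then have "(\<lambda>s. f ((x + t *\<^sub>R v) + s *\<^sub>R v)) \<circ> (\<lambda>s. s - t) = (\<lambda>s. f (x + s *\<^sub>R v))"
    by (simp add: o_def add.assoc)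
  ultimately show ?thesis by simp
qed

lemma segment_mean_value:
  fixes g :: "real \<Rightarrow> 'b::real_normed_vector"
  assumes "\<And>s. s \<in> {0..1} \<Longrightarrow> (g has_vector_derivative g' s) (at s)"
    and "\<And>s. s \<in> {0..1} \<Longrightarrow> norm (g' s) \<le> B"
  shows "norm (g 1 - g 0) \<le> B"
proof -
  have "norm (g 1 - g 0) \<le> B * norm (1 - 0 :: real)"
  proof (rule differentiable_bound[of "{0..1}" g "\<lambda>s h. h *\<^sub>R g' s"])
    show "(g has_derivative (\<lambda>h. h *\<^sub>R g' s)) (at s within {0..1})" if "s \<in> {0..1}" for s
      using assms(1)[OF that] by (auto simp: has_vector_derivative_def intro: has_derivative_at_withinI)
    show "onorm (\<lambda>h. h *\<^sub>R g' s) \<le> B" if "s \<in> {0..1}" for s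
      using assms(2)[OF that] by (auto simp: onorm_scaleR_left[OF bounded_linear_ident] onorm_id)
  qed auto
  then show ?thesis by simp
qed

lemma dir_deriv_scale:
  assumes "(\<lambda>s. f (x + s *\<^sub>R v)) differentiable (at 0)"
  shows "dir_deriv f x (c *\<^sub>R v) = c *\<^sub>R dir_deriv f x v"
proof -
  have "((\<lambda>s. s * c) has_vector_derivative c) (at 0)" by (auto intro!: derivative_eq_intros)
  moreover have "((\<lambda>s. f (x + s *\<^sub>R v)) has_vector_derivative dir_deriv f x v) (at (0 * c))"
    using dir_deriv_has_vector_derivative[OF assms] by simp
  ultimately have "((\<lambda>s. f (x + s *\<^sub>R v)) \<circ> (\<lambda>s. s * c) has_vector_derivative (c *\<^sub>R dir_deriv f x v)) (at 0)"
    by (rule vector_diff_chain_at)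
  then have "((\<lambda>s. f (x + s *\<^sub>R (c *\<^sub>R v))) has_vector_derivative (c *\<^sub>R dir_deriv f x v)) (at 0)"
    by (simp add: o_def)
  then show ?thesis unfolding dir_deriv_def[of f x "c *\<^sub>R v"] by (rule vector_derivative_at)
qed

lemma eq_0_if_norm_le_small:
  fixes E :: "'a::real_normed_vector"
  assumes "d > 0" "\<And>s. 0 < s \<Longrightarrow> s < d \<Longrightarrow> norm E \<le> s * M"
  shows "E = 0"
proof -
  have "((\<lambda>s. s * M) \<longlongrightarrow> 0 * M) (at_right 0)" by (intro tendsto_intros)
  moreover have "\<forall>\<^sub>F s in at_right 0. norm E \<le> s * M"
    unfolding eventually_at_right_field using assms by blast
  ultimately have "norm E \<le> 0 * M"
    by (intro tendsto_lowerbound[of _ _ "at_right 0"]) auto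
  then show ?thesis by simp
qed

text \<open>The bridge from Michal--Bastiani to Frechet calculus. Joint continuity of the second
  directional derivative at \<open>(x0, 0, 0)\<close> bounds it for short directions, and
  homogeneity extends the bound to all lengths. Mean value estimates then make the first derivative
  Lipschitz in the point and the remainder quadratic, from which linearity and Frechet
  differentiability follow.\<close>

theorem Ck_on_2_imp_C11_at:
  fixes f :: "'a::real_normed_vector \<Rightarrow> 'b::real_normed_vector"
  assumes U: "open U" "x0 \<in> U" and f: "Ck_on 2 U f"
  shows "C11_at f x0"
proof -
  define df where "df x v = dir_deriv f x v" for x v
  define D2 where "D2 x a b = dir_deriv (\<lambda>x. df x a) x b" for x a b
  \<comment> \<open>Encodes a pair of directions as the sequence \<open>a, b, b, ...\<close>
    expected by \<open>iter_dir_deriv\<close>.\<close>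
  define emb :: "'a \<Rightarrow> 'a \<Rightarrow> nat \<Rightarrow> 'a" where "emb a b n = (if n = 0 then a else b)" for a b n
  have d1: "(\<lambda>s. f (x + s *\<^sub>R v)) differentiable (at 0)" if "x \<in> U" for x v
  proof -
    have "(\<lambda>s. iter_dir_deriv 0 f (\<lambda>_. v) (x + s *\<^sub>R v)) differentiable (at 0)"
      using f that unfolding Ck_on_def by (metis zero_less_numeral)
    then show ?thesis by simp
  qed
  have d2: "(\<lambda>s. df (x + s *\<^sub>R w) v) differentiable (at 0)" if "x \<in> U" for x v w
  proof -
    have "(\<lambda>s. iter_dir_deriv 1 f (emb v w) (x + s *\<^sub>R (emb v w) 1)) differentiable (at 0)"
      using f that unfolding Ck_on_def by (meson one_less_numeral_iff semiring_norm(76))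
    then show ?thesis by (simp add: emb_def df_def)
  qed
  have emb: "continuous_on A (\<lambda>p. (fst p, emb (fst (snd p)) (snd (snd p))))" for A :: "('a \<times> 'a \<times> 'a) set"
  proof (intro continuous_on_Pair continuous_on_coordinatewise_then_product)
    show "continuous_on A (\<lambda>p. emb (fst (snd p)) (snd (snd p)) i)" for i
      by (cases "i = 0") (auto simp: emb_def intro!: continuous_intros)
  qed (intro continuous_intros)
  have iter: "continuous_on (U \<times> UNIV) (\<lambda>p. iter_dir_deriv j f (emb (fst (snd p)) (snd (snd p))) (fst p))"
    if "j \<le> 2" for j
  proof -
    have "continuous_on (U \<times> UNIV) (\<lambda>(x, v). iter_dir_deriv j f v x)"
      using f that unfolding Ck_on_def by blast
    then have "continuous_on (U \<times> UNIV) (\<lambda>p. case (fst p, emb (fst (snd p)) (snd (snd p))) of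
        (x, v) \<Rightarrow> iter_dir_deriv j f v x)" by (rule continuous_on_compose2[OF _ emb]) auto
    then show ?thesis by simp
  qed
  have c1: "continuous_on (U \<times> UNIV) (\<lambda>p :: 'a \<times> 'a \<times> 'a. df (fst p) (fst (snd p)))"
    using iter[of 1] by (simp add: emb_def df_def)
  have c2: "continuous_on (U \<times> UNIV) (\<lambda>p. D2 (fst p) (fst (snd p)) (snd (snd p)))"
    using iter[of 2] by (simp add: emb_def df_def[abs_def] D2_def numeral_2_eq_2)
  have scale1: "df x (c *\<^sub>R v) = c *\<^sub>R df x v" if "x \<in> U" for x c v
    unfolding df_def by (rule dir_deriv_scale[OF d1[OF that]])
  have scale2: "D2 x v (c *\<^sub>R w) = c *\<^sub>R D2 x v w" if "x \<in> U" for x c v w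
    unfolding D2_def by (rule dir_deriv_scale[OF d2[OF that]])
  have tri: "dist (x, a, b) (x0, 0, 0) \<le> dist x x0 + norm a + norm b" for x a b :: 'a
    using norm_Pair_le[of "x - x0" "(a, b)"] norm_Pair_le[of a b] by (simp add: dist_norm)
  have zero: "D2 x0 0 0 = 0" "df x0 0 = 0" using scale2[OF U(2), of 0 0 0] scale1[OF U(2), of 0 0] by simp_all
  have x0: "(x0, 0, 0) \<in> U \<times> (UNIV :: ('a \<times> 'a) set)" using U by simp
  obtain r1 where r1: "r1 > 0" "\<forall>p\<in>U \<times> UNIV. dist p (x0, 0, 0) < r1 \<longrightarrow>
      dist (D2 (fst p) (fst (snd p)) (snd (snd p))) (D2 x0 0 0) < 1"
    using c2[unfolded continuous_on_iff, rule_format, OF x0 zero_less_one] by auto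
  have r1: "r1 > 0" "\<And>x a b. x \<in> U \<Longrightarrow> dist (x, a, b) (x0, 0, 0) < r1 \<Longrightarrow> norm (D2 x a b) < 1"
  proof -
    fix x a b :: 'a assume "x \<in> U" "dist (x, a, b) (x0, 0, 0) < r1"
    then show "norm (D2 x a b) < 1" using r1(2)[rule_format, of "(x, a, b)"] by (simp add: zero)
  qed (rule r1(1))
  obtain r2 where r2: "r2 > 0" "\<forall>p\<in>U \<times> (UNIV :: ('a \<times> 'a) set). dist p (x0, 0, 0) < r2 \<longrightarrow>
      dist (df (fst p) (fst (snd p))) (df x0 0) < 1"
    using c1[unfolded continuous_on_iff, rule_format, OF x0 zero_less_one] by auto
  have r2: "r2 > 0" "\<And>x a (b :: 'a). x \<in> U \<Longrightarrow> dist (x, a, b) (x0, 0, 0) < r2 \<Longrightarrow> norm (df x a) < 1"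
  proof -
    fix x a b :: 'a assume "x \<in> U" "dist (x, a, b) (x0, 0, 0) < r2"
    then show "norm (df x a) < 1" using r2(2)[rule_format, of "(x, a, b)"] by (simp add: zero)
  qed (rule r2(1))
  obtain r3 where r3: "r3 > 0" "ball x0 r3 \<subseteq> U" using U by (auto simp: open_contains_ball)
  \<comment> \<open>Three summands of size at most \<rho>, the displacement of the base point and
    two directions, have to fit into \<open>r1\<close> and into \<open>r2\<close>.\<close>
  define \<rho> where "\<rho> = min r3 (min (r1 / 3) (r2 / 3))"
  have \<rho>: "\<rho> > 0" using r1 r2 r3 by (simp add: \<rho>_def)
  have \<rho>3: "3 * \<rho> \<le> r1" "3 * \<rho> \<le> r2" by (auto simp: \<rho>_def)
  have inU: "x \<in> U" if "x \<in> ball x0 \<rho>" for x using r3 that by (auto simp: \<rho>_def)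
  \<comment> \<open>Only the second direction is rescaled here, by \<open>scale2\<close>. The first
    one is kept short and rescaled later, in \<open>lip\<close>, by homogeneity of
    \<open>df\<close>.\<close>
  have b2: "norm (D2 x v w) \<le> norm w / \<rho>" if x: "x \<in> ball x0 \<rho>" and v: "norm v \<le> \<rho>" for x v w
  proof (cases "w = 0")
    case True
    then show ?thesis using scale2[OF inU[OF x], of v 0 0] by simp
  next
    case False
    let ?w = "(\<rho> / norm w) *\<^sub>R w"
    have "norm ?w = \<rho>" using False \<rho> by simp
    then have "dist (x, v, ?w) (x0, 0, 0) < r1"
      using tri[of x v ?w] x v \<rho>3(1) unfolding mem_ball dist_commute[of x0 x] by linarith
    from r1(2)[OF inU[OF x] this] have "(\<rho> / norm w) * norm (D2 x v w) < 1"
      unfolding scale2[OF inU[OF x]] using \<rho> False by simp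
    then show ?thesis using \<rho> False by (simp add: field_simps)
  qed
  have seg: "z + s *\<^sub>R (y - z) \<in> ball x0 \<rho>" if "y \<in> ball x0 \<rho>" "z \<in> ball x0 \<rho>" "s \<in> {0..1}" for y z s
  proof -
    have "(1 - s) *\<^sub>R z + s *\<^sub>R y \<in> ball x0 \<rho>"
      using that by (intro convexD_alt[OF convex_ball]) auto
    then show ?thesis by (simp add: algebra_simps)
  qed
  have lip0: "norm (df y v - df z v) \<le> norm (y - z) / \<rho>"
    if y: "y \<in> ball x0 \<rho>" and z: "z \<in> ball x0 \<rho>" and v: "norm v \<le> \<rho>" for y z v
  proof -
    have "norm (df (z + 1 *\<^sub>R (y - z)) v - df (z + 0 *\<^sub>R (y - z)) v) \<le> norm (y - z) / \<rho>"
    proof (rule segment_mean_value[where g = "\<lambda>s. df (z + s *\<^sub>R (y - z)) v"])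
      fix s :: real assume s: "s \<in> {0..1}"
      note zs = seg[OF y z s]
      show "((\<lambda>s. df (z + s *\<^sub>R (y - z)) v) has_vector_derivative D2 (z + s *\<^sub>R (y - z)) v (y - z)) (at s)"
        unfolding D2_def
        by (rule line_derivative[of "\<lambda>x. df x v"], rule dir_deriv_has_vector_derivative[OF d2[OF inU[OF zs]]])
      show "norm (D2 (z + s *\<^sub>R (y - z)) v (y - z)) \<le> norm (y - z) / \<rho>" by (rule b2[OF zs v])
    qed
    then show ?thesis by simp
  qed
  define K where "K = 1 / (\<rho> * \<rho>)"
  have K: "K > 0" using \<rho> by (simp add: K_def)
  have scale_to: "norm E \<le> C / \<rho> * norm v"
    if "v \<noteq> 0" "norm ((\<rho> / norm v) *\<^sub>R E) \<le> C" for E :: 'b and C and v :: 'a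
    using that \<rho> by (simp add: field_simps)
  have lip: "norm (df y v - df z v) \<le> K * norm (y - z) * norm v"
    if y: "y \<in> ball x0 \<rho>" and z: "z \<in> ball x0 \<rho>" for y z v
  proof (cases "v = 0")
    case True
    then show ?thesis using scale1[OF inU[OF y], of 0 0] scale1[OF inU[OF z], of 0 0] by simp
  next
    case False
    have "norm (df y ((\<rho> / norm v) *\<^sub>R v) - df z ((\<rho> / norm v) *\<^sub>R v)) \<le> norm (y - z) / \<rho>"
      by (rule lip0[OF y z]) (use False \<rho> in simp)
    then have "norm ((\<rho> / norm v) *\<^sub>R (df y v - df z v)) \<le> norm (y - z) / \<rho>"
      unfolding scale1[OF inU[OF y]] scale1[OF inU[OF z]] by (simp only: scaleR_diff_right)
    from scale_to[OF False this] show ?thesis by (simp add: K_def)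
  qed
  have bd: "norm (df x v) \<le> 1 / \<rho> * norm v" if x: "x \<in> ball x0 \<rho>" for x v
  proof (cases "v = 0")
    case True
    then show ?thesis using scale1[OF inU[OF x], of 0 0] by simp
  next
    case False
    let ?v = "(\<rho> / norm v) *\<^sub>R v"
    have "norm ?v = \<rho>" using False \<rho> by simp
    then have "dist (x, ?v, 0 :: 'a) (x0, 0, 0) < r2"
      using tri[of x ?v 0] x \<rho>3(2) norm_zero[where 'a = 'a] \<rho> unfolding mem_ball dist_commute[of x0 x] by linarith
    from r2(2)[OF inU[OF x] this] have "norm ((\<rho> / norm v) *\<^sub>R df x v) \<le> 1"
      unfolding scale1[OF inU[OF x]] by simp
    from scale_to[OF False this] show ?thesis .
  qed
  \<comment> \<open>Along the segment, \<open>f\<close> minus its linearization at \<open>z\<close>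
    has a derivative that \<open>lip\<close> bounds by a multiple of the squared length, so the
    remainder is quadratic.\<close>
  have rem: "norm (f y - f z - df z (y - z)) \<le> K * norm (y - z) * norm (y - z)"
    if y: "y \<in> ball x0 \<rho>" and z: "z \<in> ball x0 \<rho>" for y z
  proof -
    let ?g = "\<lambda>s. f (z + s *\<^sub>R (y - z)) - s *\<^sub>R df z (y - z)"
    have "norm (?g 1 - ?g 0) \<le> K * norm (y - z) * norm (y - z)"
    proof (rule segment_mean_value[where g = ?g])
      fix s :: real assume s: "s \<in> {0..1}"
      note zs = seg[OF y z s]
      have "((\<lambda>s. f (z + s *\<^sub>R (y - z))) has_vector_derivative df (z + s *\<^sub>R (y - z)) (y - z)) (at s)"
        unfolding df_def
        by (rule line_derivative, rule dir_deriv_has_vector_derivative[OF d1[OF inU[OF zs]]])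
      then show "(?g has_vector_derivative (df (z + s *\<^sub>R (y - z)) (y - z) - df z (y - z))) (at s)"
        by (auto intro!: derivative_eq_intros)
      have "norm (df (z + s *\<^sub>R (y - z)) (y - z) - df z (y - z)) \<le> K * norm (s *\<^sub>R (y - z)) * norm (y - z)"
        using lip[OF zs z, of "y - z"] by simp
      also have "\<dots> \<le> K * norm (y - z) * norm (y - z)"
        using s K by (intro mult_right_mono mult_left_mono) (auto simp: mult_left_le_one_le)
      finally show "norm (df (z + s *\<^sub>R (y - z)) (y - z) - df z (y - z)) \<le> K * norm (y - z) * norm (y - z)" .
    qed
    then show ?thesis by (simp add: algebra_simps)
  qed
  have rem': "norm (f (z + s *\<^sub>R u) - f z - s *\<^sub>R df z u) \<le> s * s * (K * norm u * norm u)"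
    if "z \<in> ball x0 \<rho>" "z + s *\<^sub>R u \<in> ball x0 \<rho>" "s > 0" for z s u
    using rem[OF that(2,1)] that(3) by (simp add: scale1[OF inU[OF that(1)]] mult_ac)
  \<comment> \<open>Passing from \<open>z\<close> to \<open>z + s *\<^sub>R (v + w)\<close> directly
    or through \<open>z + s *\<^sub>R v\<close> gives the same increment of \<open>f\<close>. Each
    linearization errs by a multiple of \<open>s * s\<close>, so the defect of additivity is at most
    a multiple of \<open>s\<close> for all small \<open>s\<close>, hence 0.\<close>
  have add: "df z (v + w) = df z v + df z w" if z: "z \<in> ball x0 \<rho>" for z v w
  proof -
    let ?E = "df z (v + w) - df z v - df z w"
    define M where "M = K * norm (v + w) * norm (v + w) + K * norm w * norm w + K * norm v * norm v + K * norm v * norm w"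
    define d where "d = (\<rho> - dist x0 z) / (norm v + norm w + 1)"
    have nn: "norm v + norm w + 1 > 0" by (simp add: add_nonneg_pos)
    have d: "d > 0" using z nn by (simp add: d_def)
    have "?E = 0"
    proof (rule eq_0_if_norm_le_small[OF d])
      fix s :: real assume s: "0 < s" "s < d"
      have small: "z + s *\<^sub>R u \<in> ball x0 \<rho>" if "norm u \<le> norm v + norm w + 1" for u
      proof -
        have "s * (norm v + norm w + 1) < \<rho> - dist x0 z"
          using s(2) nn by (simp add: d_def pos_less_divide_eq)
        moreover have "s * norm u \<le> s * (norm v + norm w + 1)" using that s(1) by simp
        moreover have "dist x0 (z + s *\<^sub>R u) \<le> dist x0 z + s * norm u"
          using dist_triangle[of x0 "z + s *\<^sub>R u" z] s(1) by (simp add: dist_norm)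
        ultimately show ?thesis by simp
      qed
      have zv: "z + s *\<^sub>R v \<in> ball x0 \<rho>" by (rule small) simp
      have "norm (v + w) \<le> norm v + norm w + 1" using norm_triangle_ineq[of v w] by simp
      note zvw = small[OF this]
      let ?a = "f (z + s *\<^sub>R (v + w)) - f z - s *\<^sub>R df z (v + w)"
      let ?b = "f (z + s *\<^sub>R (v + w)) - f (z + s *\<^sub>R v) - s *\<^sub>R df (z + s *\<^sub>R v) w"
      let ?c = "f (z + s *\<^sub>R v) - f z - s *\<^sub>R df z v"
      let ?d = "df (z + s *\<^sub>R v) w - df z w"
      have a: "norm ?a \<le> s * s * (K * norm (v + w) * norm (v + w))"
        by (rule rem'[OF z zvw s(1)])
      have b: "norm ?b \<le> s * s * (K * norm w * norm w)"
        using rem'[of "z + s *\<^sub>R v" s w] zv zvw s(1) by (simp add: scaleR_add_right add.assoc)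
      have c: "norm ?c \<le> s * s * (K * norm v * norm v)"
        by (rule rem'[OF z zv s(1)])
      have "norm ?d \<le> s * (K * norm v * norm w)"
        using lip[OF zv z, of w] s(1) by (simp add: mult_ac)
      then have d: "norm (s *\<^sub>R ?d) \<le> s * s * (K * norm v * norm w)"
        using s(1) by (simp add: mult.assoc mult_left_mono)
      have "s *\<^sub>R ?E = (?b - ?a) + (?c + s *\<^sub>R ?d)" by (simp add: algebra_simps)
      then have "norm (s *\<^sub>R ?E) \<le> norm ?b + norm ?a + (norm ?c + norm (s *\<^sub>R ?d))"
        by (simp only:) (intro norm_triangle_mono norm_triangle_ineq4 norm_triangle_ineq)
      also have "\<dots> \<le> s * s * M" using a b c d by (simp add: M_def algebra_simps)
      finally have "s * norm ?E \<le> s * (s * M)" using s(1) by simp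
      then show "norm ?E \<le> s * M" using s(1) by (rule mult_left_le_imp_le)
    qed
    then show ?thesis by (simp add: algebra_simps)
  qed
  have bl: "bounded_linear (df z)" if z: "z \<in> ball x0 \<rho>" for z
    by (rule bounded_linear_intro[where K = "1 / \<rho>"])
      (use add[OF z] scale1[OF inU[OF z]] bd[OF z] in \<open>simp_all add: mult.commute\<close>)
  show ?thesis
  proof (rule C11_atI[OF \<rho>, where f' = "\<lambda>z. Blinfun (df z)" and K = K])
    fix z assume z: "z \<in> ball x0 \<rho>"
    note bz = bounded_linear_Blinfun_apply[OF bl[OF z]]
    show "(f has_derivative blinfun_apply (Blinfun (df z))) (at z)"
      unfolding bz has_derivative_at_alt
    proof (intro conjI bl[OF z] allI impI)
      fix e :: real assume e: "e > 0"
      define d where "d = min (\<rho> - dist x0 z) (e / K)"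
      have "norm (f y - f z - df z (y - z)) \<le> e * norm (y - z)" if y: "norm (y - z) < d" for y
      proof -
        have "dist x0 y \<le> dist x0 z + norm (y - z)"
          using dist_triangle[of x0 y z] by (simp add: dist_norm norm_minus_commute)
        then have "y \<in> ball x0 \<rho>" using y by (simp add: d_def)
        from rem[OF this z] have "norm (f y - f z - df z (y - z)) \<le> K * norm (y - z) * norm (y - z)" .
        also have "\<dots> \<le> e * norm (y - z)"
          using y K by (intro mult_right_mono) (auto simp: d_def field_simps)
        finally show ?thesis .
      qed
      moreover have "d > 0" using z e K by (simp add: d_def)
      ultimately show "\<exists>d>0. \<forall>y. norm (y - z) < d \<longrightarrow> norm (f y - f z - df z (y - z)) \<le> e * norm (y - z)"
        by blast
    qed
    fix y assume y: "y \<in> ball x0 \<rho>"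
    show "norm (Blinfun (df z) - Blinfun (df y)) \<le> K * norm (z - y)"
    proof (rule norm_blinfun_bound)
      show "norm ((Blinfun (df z) - Blinfun (df y)) v) \<le> K * norm (z - y) * norm v" for v
        using lip[OF z y] by (simp add: blinfun.diff_left bz bounded_linear_Blinfun_apply[OF bl[OF y]])
    qed (use K in simp)
  qed
qed

corollary smooth_on_imp_C11_at: "smooth_on U f \<Longrightarrow> open U \<Longrightarrow> x \<in> U \<Longrightarrow> C11_at f x"
  using Ck_on_2_imp_C11_at unfolding smooth_on_def by blast

section \<open>Smoothness of products of maps\<close>

lemma iter_dir_deriv_has_vector_derivative:
  assumes "smooth_on U f" "x \<in> U"
  shows "((\<lambda>s. iter_dir_deriv j f v (x + s *\<^sub>R v j)) has_vector_derivative iter_dir_deriv (Suc j) f v x) (at 0)"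
proof -
  have "(\<lambda>s. iter_dir_deriv j f v (x + s *\<^sub>R v j)) differentiable (at 0)"
    using assms unfolding smooth_on_def Ck_on_def by blast
  from dir_deriv_has_vector_derivative[OF this] show ?thesis by simp
qed

text \<open>Both claims run through one induction: differentiability of the \<open>j\<close>-th
  iterated derivative yields the formula for the next one, and that formula, valid on an open set,
  yields its differentiability.\<close>

lemma iter_dir_deriv_map_prod_derivative:
  assumes U: "open U" "open V" and f: "smooth_on U f" and g: "smooth_on V g"
  shows "x \<in> U \<Longrightarrow> y \<in> V \<Longrightarrow>
      iter_dir_deriv j (map_prod f g) v (x, y) = (iter_dir_deriv j f (fst \<circ> v) x, iter_dir_deriv j g (snd \<circ> v) y)"
    and "x \<in> U \<Longrightarrow> y \<in> V \<Longrightarrow> ((\<lambda>s. iter_dir_deriv j (map_prod f g) v ((x, y) + s *\<^sub>R v j)) has_vector_derivative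
      (iter_dir_deriv (Suc j) f (fst \<circ> v) x, iter_dir_deriv (Suc j) g (snd \<circ> v) y)) (at 0)"
proof (induction j arbitrary: x y)
  case 0
  {
    case 1
    then show ?case by simp
  next
    case 2
    from iter_dir_deriv_has_vector_derivative[OF f 2(1), of 0 "fst \<circ> v"]
      iter_dir_deriv_has_vector_derivative[OF g 2(2), of 0 "snd \<circ> v"]
    show ?case by (cases "v 0") (auto simp: has_vector_derivative_def scaleR_Pair intro!: has_derivative_Pair)
  }
next
  case (Suc j)
  have eq: "iter_dir_deriv (Suc j) (map_prod f g) v (x, y) = (iter_dir_deriv (Suc j) f (fst \<circ> v) x, iter_dir_deriv (Suc j) g (snd \<circ> v) y)"
    if "x \<in> U" "y \<in> V" for x y
  proof -
    have "iter_dir_deriv (Suc j) (map_prod f g) v (x, y) =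
        vector_derivative (\<lambda>s. iter_dir_deriv j (map_prod f g) v ((x, y) + s *\<^sub>R v j)) (at 0)"
      by (simp add: dir_deriv_def)
    then show ?thesis by (simp only: vector_derivative_at[OF Suc.IH(2)[OF that]])
  qed
  {
    case 1
    then show ?case by (rule eq)
  next
    case 2
    let ?D = "(iter_dir_deriv (Suc (Suc j)) f (fst \<circ> v) x, iter_dir_deriv (Suc (Suc j)) g (snd \<circ> v) y)"
    let ?p = "\<lambda>s. (iter_dir_deriv (Suc j) f (fst \<circ> v) (x + s *\<^sub>R fst (v (Suc j))),
        iter_dir_deriv (Suc j) g (snd \<circ> v) (y + s *\<^sub>R snd (v (Suc j))))"
    have D: "(?p has_vector_derivative ?D) (at 0)"
      using has_derivative_Pair[OF iter_dir_deriv_has_vector_derivative[OF f 2(1), of "Suc j" "fst \<circ> v", unfolded has_vector_derivative_def]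
        iter_dir_deriv_has_vector_derivative[OF g 2(2), of "Suc j" "snd \<circ> v", unfolded has_vector_derivative_def]]
      by (simp add: has_vector_derivative_def scaleR_Pair del: iter_dir_deriv.simps)
    have ev: "\<forall>\<^sub>F s in nhds 0. ?p s = iter_dir_deriv (Suc j) (map_prod f g) v ((x, y) + s *\<^sub>R v (Suc j))"
      using eventually_line_in_open[OF U(1) 2(1), of "fst (v (Suc j))"]
        eventually_line_in_open[OF U(2) 2(2), of "snd (v (Suc j))"]
    proof eventually_elim
      case (elim s)
      have "(x, y) + s *\<^sub>R v (Suc j) = (x + s *\<^sub>R fst (v (Suc j)), y + s *\<^sub>R snd (v (Suc j)))"
        by (cases "v (Suc j)") (simp add: scaleR_Pair)
      then show ?case using eq[OF elim] by (simp del: iter_dir_deriv.simps)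
    qed
    show ?case
      using D unfolding has_vector_derivative_def
      by (rule has_derivative_transform_eventually)
        (use ev eventually_nhds_x_imp_x[OF ev] in \<open>auto simp: eventually_nhds_conv_at simp del: iter_dir_deriv.simps\<close>)
  }
qed

lemma continuous_on_comp_sequence:
  fixes h :: "'a::topological_space \<Rightarrow> 'b::topological_space"
  assumes "continuous_on UNIV h"
  shows "continuous_on A (\<lambda>q :: 'c::topological_space \<times> (nat \<Rightarrow> 'a). h \<circ> snd q)"
proof (rule continuous_on_coordinatewise_then_product)
  fix i
  have "continuous_on UNIV (\<lambda>v :: nat \<Rightarrow> 'a. v i)" by (rule continuous_on_product_coordinates)
  then have "continuous_on A (\<lambda>q :: 'c \<times> (nat \<Rightarrow> 'a). snd q i)"
    by (rule continuous_on_compose2) (auto intro: continuous_on_snd continuous_on_id)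
  from continuous_on_compose2[OF assms this subset_UNIV]
  show "continuous_on A (\<lambda>q. (h \<circ> snd q) i)" by simp
qed

text \<open>Compatibility of product charts asks for smooth transition maps, so here all orders of
  differentiation are treated and not only the C11 estimate.\<close>

lemma smooth_on_map_prod:
  fixes f :: "'a::real_normed_vector \<Rightarrow> 'b::real_normed_vector"
    and g :: "'c::real_normed_vector \<Rightarrow> 'd::real_normed_vector"
  assumes U: "open U" "open V" and f: "smooth_on U f" and g: "smooth_on V g"
  shows "smooth_on (U \<times> V) (map_prod f g)"
  unfolding smooth_on_def Ck_on_def
proof (intro allI conjI ballI impI)
  fix j and p and v :: "nat \<Rightarrow> 'a \<times> 'c" assume "p \<in> U \<times> V"
  then show "(\<lambda>s. iter_dir_deriv j (map_prod f g) v (p + s *\<^sub>R v j)) differentiable (at 0)"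
    using iter_dir_deriv_map_prod_derivative(2)[OF U f g, THEN differentiableI_vector, of "fst p" "snd p"]
    by auto
next
  fix j :: nat
  have 1: "continuous_on (U \<times> UNIV) (\<lambda>(x, v). iter_dir_deriv j f v x)"
    "continuous_on (V \<times> UNIV) (\<lambda>(x, v). iter_dir_deriv j g v x)"
    using f g unfolding smooth_on_def Ck_on_def by blast+
  let ?S = "(U \<times> V) \<times> (UNIV :: (nat \<Rightarrow> 'a \<times> 'c) set)"
  have p1: "continuous_on ?S (\<lambda>q. (fst (fst q), fst \<circ> snd q))"
    by (rule continuous_on_Pair, intro continuous_intros, rule continuous_on_comp_sequence, intro continuous_intros)
  have p2: "continuous_on ?S (\<lambda>q. (snd (fst q), snd \<circ> snd q))"
    by (rule continuous_on_Pair, intro continuous_intros, rule continuous_on_comp_sequence, intro continuous_intros)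
  have "continuous_on ?S (\<lambda>q. case (fst (fst q), fst \<circ> snd q) of (x, v) \<Rightarrow> iter_dir_deriv j f v x)"
    by (rule continuous_on_compose2[OF 1(1) p1]) auto
  moreover have "continuous_on ?S (\<lambda>q. case (snd (fst q), snd \<circ> snd q) of (x, v) \<Rightarrow> iter_dir_deriv j g v x)"
    by (rule continuous_on_compose2[OF 1(2) p2]) auto
  ultimately have "continuous_on ?S (\<lambda>q. (iter_dir_deriv j f (fst \<circ> snd q) (fst (fst q)),
      iter_dir_deriv j g (snd \<circ> snd q) (snd (fst q))))"
    unfolding prod.case by (rule continuous_on_Pair)
  then show "continuous_on ((U \<times> V) \<times> UNIV) (\<lambda>(p, v). iter_dir_deriv j (map_prod f g) v p)"
  proof (rule continuous_on_eq)
    fix q assume "q \<in> ?S"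
    then obtain x y v where q: "q = ((x, y), v)" "x \<in> U" "y \<in> V" by auto
    show "(iter_dir_deriv j f (fst \<circ> snd q) (fst (fst q)), iter_dir_deriv j g (snd \<circ> snd q) (snd (fst q))) =
        (case q of (p, v) \<Rightarrow> iter_dir_deriv j (map_prod f g) v p)"
      unfolding q(1) by (simp only: fst_conv snd_conv prod.case iter_dir_deriv_map_prod_derivative(1)[OF U f g q(2,3)])
  qed
qed

section \<open>Locally Lipschitz differentiable maps between manifolds\<close>

lemma C11_at_filterlim: "C11_at f x \<Longrightarrow> filterlim f (nhds (f x)) (nhds x)"
  using C11_at_isCont[of f x] by (simp add: isCont_def tendsto_at_iff_tendsto_nhds)

lemma C11_at_isCont_fderiv:
  assumes "C11_at f x" shows "isCont (fderiv f) x"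
proof -
  obtain r K where r: "r > 0" "K \<ge> 0"
    "\<And>y z. y \<in> ball x r \<Longrightarrow> z \<in> ball x r \<Longrightarrow> norm (fderiv f y - fderiv f z) \<le> K * norm (y - z)"
    by (rule C11_atE[OF assms zero_less_one]) metis
  have "K-lipschitz_on (ball x r) (fderiv f)"
    by (rule lipschitz_onI) (use r in \<open>auto simp: dist_norm\<close>)
  then have "continuous_on (ball x r) (fderiv f)" by (rule lipschitz_on_continuous_on)
  then show ?thesis using r(1) by (simp add: continuous_on_eq_continuous_at)
qed

lemma fderiv_compose:
  assumes "C11_at f x" "C11_at g (f x)"
  shows "fderiv (g \<circ> f) x = fderiv g (f x) o\<^sub>L fderiv f x"
proof -
  have "((g \<circ> f) has_derivative (blinfun_apply (fderiv g (f x)) \<circ> blinfun_apply (fderiv f x))) (at x)"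
    by (rule diff_chain_at) (use assms C11_at_has_derivative in auto)
  from has_derivative_imp_fderiv[OF this] show ?thesis
    by (intro blinfun_eqI) simp
qed

lemma fderiv_cong:
  assumes f: "C11_at f x" and eq: "\<forall>\<^sub>F y in nhds x. f y = g y"
  shows "fderiv f x = fderiv g x"
proof -
  have "(g has_derivative fderiv f x) (at x)"
    by (rule has_derivative_transform_eventually[OF C11_at_has_derivative[OF f]])
      (use eq eventually_nhds_x_imp_x[OF eq] in \<open>auto simp: eventually_nhds_conv_at\<close>)
  from has_derivative_imp_fderiv[OF this] show ?thesis by (simp add: blinfun_apply_inject)
qed

lemma fderiv_id: "fderiv (\<lambda>x. x) x = id_blinfun"
  by (rule blinfun_eqI) (simp add: has_derivative_imp_fderiv[OF has_derivative_ident])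

lemma vector_derivative_chain_C11:
  assumes f: "C11_at f (x t)" and x: "(x has_vector_derivative v) (at t within S)"
  shows "((\<lambda>s. f (x s)) has_vector_derivative fderiv f (x t) v) (at t within S)"
proof -
  have "(f has_derivative fderiv f (x t)) (at (x t) within x ` S)"
    using C11_at_has_derivative[OF f] has_derivative_at_withinI by blast
  from diff_chain_within[OF x[unfolded has_vector_derivative_def] this]
  show ?thesis by (simp add: has_vector_derivative_def o_def blinfun.scaleR_right)
qed

text \<open>One pair of charts from the maximal atlases is enough; \<open>C11_map_at_charts\<close>
  passes to any other. The eventual condition keeps \<open>f\<close> inside the target chart near
  \<open>x\<close>, so that the local representative is meaningful.\<close>

definition C11_map_at ::
    "('m, 'e::real_normed_vector) chart set \<Rightarrow> ('n, 'f::real_normed_vector) chart set \<Rightarrow>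
     ('m \<Rightarrow> 'n) \<Rightarrow> 'm \<Rightarrow> bool" where
  "C11_map_at A B f x \<longleftrightarrow> (\<exists>(U, \<phi>)\<in>charts A. \<exists>(V, \<psi>)\<in>charts B. x \<in> U \<and>
     (\<forall>\<^sub>F y in nhds (\<phi> x). f (inv_into U \<phi> y) \<in> V) \<and> C11_at (\<psi> \<circ> f \<circ> inv_into U \<phi>) (\<phi> x))"

lemma C11_map_atI:
  assumes "(U, \<phi>) \<in> charts A" "(V, \<psi>) \<in> charts B" "x \<in> U"
    "\<forall>\<^sub>F y in nhds (\<phi> x). f (inv_into U \<phi> y) \<in> V" "C11_at (\<psi> \<circ> f \<circ> inv_into U \<phi>) (\<phi> x)"
  shows "C11_map_at A B f x"
  unfolding C11_map_at_def
  by (rule bexI[OF _ assms(1)], unfold prod.case, rule bexI[OF _ assms(2)], unfold prod.case)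
    (use assms in simp)

lemma chart_inj: "(U, \<phi>) \<in> charts A \<Longrightarrow> inj_on \<phi> U"
  by (simp add: charts_def)

lemma chart_inv_into: "(U, \<phi>) \<in> charts A \<Longrightarrow> x \<in> U \<Longrightarrow> inv_into U \<phi> (\<phi> x) = x"
  by (simp add: charts_def)

lemma chart_open_image: "(U, \<phi>) \<in> charts A \<Longrightarrow> open (\<phi> ` U)"
  by (simp add: charts_def)

lemma chart_points: "(U, \<phi>) \<in> charts A \<Longrightarrow> U \<subseteq> points A"
  by (simp add: charts_def)

lemma chart_eventually:
  assumes "(U, \<phi>) \<in> charts A" "x \<in> U"
  shows "\<forall>\<^sub>F y in nhds (\<phi> x). inv_into U \<phi> y \<in> U \<and> \<phi> (inv_into U \<phi> y) = y"
proof -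
  have "\<forall>\<^sub>F y in nhds (\<phi> x). y \<in> \<phi> ` U"
    using assms by (intro eventually_nhds_in_open chart_open_image) auto
  then show ?thesis by eventually_elim (auto simp: inv_into_into f_inv_into_f)
qed

lemma chart_around:
  assumes "smooth_manifold A" "x \<in> points A"
  obtains U \<phi> where "(U, \<phi>) \<in> A" "(U, \<phi>) \<in> charts A" "x \<in> U"
  using assms atlas_subset_charts[OF assms(1)] unfolding points_def by fast

text \<open>Members of the maximal atlas are by definition compatible with the charts of the atlas,
  not with each other. The transition map is therefore factored through a chart of the atlas around
  \<open>x\<close>.\<close>

lemma chart_transition:
  assumes A: "smooth_manifold A" and c: "(U, \<phi>) \<in> charts A" and d: "(V, \<psi>) \<in> charts A"
    and x: "x \<in> U" "x \<in> V"
  shows "\<forall>\<^sub>F y in nhds (\<phi> x). y \<in> \<phi> ` (U \<inter> V)" and "C11_at (\<psi> \<circ> inv_into U \<phi>) (\<phi> x)"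
proof -
  have "open (\<phi> ` (V \<inter> U))" by (rule chart_image_open[OF A c chart_domain_open[OF A d]])
  then show "\<forall>\<^sub>F y in nhds (\<phi> x). y \<in> \<phi> ` (U \<inter> V)"
    using x by (intro eventually_nhds_in_open) (auto simp: Int_commute)
  obtain W \<theta> where e: "(W, \<theta>) \<in> A" "(W, \<theta>) \<in> charts A" "x \<in> W"
    by (rule chart_around[OF A, of x]) (use c x chart_points in blast)
  have 1: "open (\<phi> ` (U \<inter> W))" "smooth_on (\<phi> ` (U \<inter> W)) (\<theta> \<circ> inv_into U \<phi>)"
    using c e(1) by (fastforce simp: charts_def compatible_def)+
  have 2: "open (\<theta> ` (V \<inter> W))" "smooth_on (\<theta> ` (V \<inter> W)) (\<psi> \<circ> inv_into W \<theta>)"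
    using d e(1) by (fastforce simp: charts_def compatible_def)+
  have fx: "(\<theta> \<circ> inv_into U \<phi>) (\<phi> x) = \<theta> x" using chart_inv_into[OF c x(1)] by simp
  have "C11_at ((\<psi> \<circ> inv_into W \<theta>) \<circ> (\<theta> \<circ> inv_into U \<phi>)) (\<phi> x)"
    by (intro C11_at_compose smooth_on_imp_C11_at[OF 1(2,1)] smooth_on_imp_C11_at[OF 2(2,1)])
      (use x e(3) fx in auto)
  moreover have "\<forall>\<^sub>F y in nhds (\<phi> x). y \<in> \<phi> ` (U \<inter> W)"
    using 1(1) x(1) e(3) by (intro eventually_nhds_in_open) auto
  then have "\<forall>\<^sub>F y in nhds (\<phi> x). ((\<psi> \<circ> inv_into W \<theta>) \<circ> (\<theta> \<circ> inv_into U \<phi>)) y = (\<psi> \<circ> inv_into U \<phi>) y"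
    by eventually_elim (use chart_inv_into[OF c] chart_inv_into[OF e(2)] in auto)
  ultimately show "C11_at (\<psi> \<circ> inv_into U \<phi>) (\<phi> x)" by (rule C11_at_cong)
qed

text \<open>The representative in the new charts is the old one placed between two transition maps;
  the filter conditions guarantee that chart maps and their inverses cancel near the point.\<close>

lemma C11_map_at_charts:
  assumes A: "smooth_manifold A" and B: "smooth_manifold B" and f: "C11_map_at A B f x"
    and c': "(U', \<phi>') \<in> charts A" "x \<in> U'" and d': "(V', \<psi>') \<in> charts B" "f x \<in> V'"
  shows "\<forall>\<^sub>F y in nhds (\<phi>' x). f (inv_into U' \<phi>' y) \<in> V'"
    and "C11_at (\<psi>' \<circ> f \<circ> inv_into U' \<phi>') (\<phi>' x)"
proof -
  obtain U \<phi> V \<psi> where c: "(U, \<phi>) \<in> charts A" "x \<in> U" and d: "(V, \<psi>) \<in> charts B"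
    and ev: "\<forall>\<^sub>F y in nhds (\<phi> x). f (inv_into U \<phi> y) \<in> V"
    and C: "C11_at (\<psi> \<circ> f \<circ> inv_into U \<phi>) (\<phi> x)"
    using f unfolding C11_map_at_def by blast
  have fxV: "f x \<in> V" using eventually_nhds_x_imp_x[OF ev] chart_inv_into[OF c] by simp
  note T = chart_transition[OF A c'(1) c(1) c'(2) c(2)]
  note R = chart_transition[OF B d d'(1) fxV d'(2)]
  have Tx: "(\<phi> \<circ> inv_into U' \<phi>') (\<phi>' x) = \<phi> x" using chart_inv_into[OF c'] by simp
  have Cx: "(\<psi> \<circ> f \<circ> inv_into U \<phi>) (\<phi> x) = \<psi> (f x)" using chart_inv_into[OF c] by simp
  have limT: "filterlim (\<phi> \<circ> inv_into U' \<phi>') (nhds (\<phi> x)) (nhds (\<phi>' x))"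
    using C11_at_filterlim[OF T(2)] unfolding Tx .
  have "filterlim (\<psi> \<circ> f \<circ> inv_into U \<phi>) (nhds (\<psi> (f x))) (nhds (\<phi> x))"
    using C11_at_filterlim[OF C] unfolding Cx .
  from eventually_compose_filterlim[OF R(1) this]
  have "\<forall>\<^sub>F y in nhds (\<phi> x). (\<psi> \<circ> f \<circ> inv_into U \<phi>) y \<in> \<psi> ` (V \<inter> V')" .
  with ev have ev2: "\<forall>\<^sub>F y in nhds (\<phi> x). f (inv_into U \<phi> y) \<in> V \<inter> V'"
    by eventually_elim (use chart_inj[OF d] in \<open>auto dest: inj_onD\<close>)
  have eq: "\<forall>\<^sub>F y in nhds (\<phi>' x). inv_into U \<phi> ((\<phi> \<circ> inv_into U' \<phi>') y) = inv_into U' \<phi>' y"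
    using T(1) by eventually_elim (use chart_inv_into[OF c(1)] chart_inv_into[OF c'(1)] in auto)
  from eventually_compose_filterlim[OF ev2 limT] eq
  have ev3: "\<forall>\<^sub>F y in nhds (\<phi>' x). f (inv_into U' \<phi>' y) \<in> V \<inter> V'"
    by eventually_elim simp
  then show "\<forall>\<^sub>F y in nhds (\<phi>' x). f (inv_into U' \<phi>' y) \<in> V'" by eventually_elim simp
  have "C11_at ((\<psi>' \<circ> inv_into V \<psi>) \<circ> ((\<psi> \<circ> f \<circ> inv_into U \<phi>) \<circ> (\<phi> \<circ> inv_into U' \<phi>'))) (\<phi>' x)"
    using R(2) C T(2) Cx Tx by (intro C11_at_compose) (simp_all only: o_apply)
  moreover have "\<forall>\<^sub>F y in nhds (\<phi>' x).
      ((\<psi>' \<circ> inv_into V \<psi>) \<circ> ((\<psi> \<circ> f \<circ> inv_into U \<phi>) \<circ> (\<phi> \<circ> inv_into U' \<phi>'))) y = (\<psi>' \<circ> f \<circ> inv_into U' \<phi>') y"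
    using eq ev3 by eventually_elim (use chart_inv_into[OF d] in simp)
  ultimately show "C11_at (\<psi>' \<circ> f \<circ> inv_into U' \<phi>') (\<phi>' x)" by (rule C11_at_cong)
qed

lemma C11_map_atD_points:
  assumes "C11_map_at A B f x" shows "x \<in> points A" "f x \<in> points B"
proof -
  obtain U \<phi> V \<psi> where c: "(U, \<phi>) \<in> charts A" "x \<in> U" and d: "(V, \<psi>) \<in> charts B"
    and ev: "\<forall>\<^sub>F y in nhds (\<phi> x). f (inv_into U \<phi> y) \<in> V"
    using assms unfolding C11_map_at_def by blast
  show "x \<in> points A" using c chart_points by blast
  have "f x \<in> V" using eventually_nhds_x_imp_x[OF ev] chart_inv_into[OF c] by simp
  then show "f x \<in> points B" using d chart_points by blast
qed

lemma C11_map_at_compose: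
  assumes A: "smooth_manifold A" and B: "smooth_manifold B" and C: "smooth_manifold C"
    and f: "C11_map_at A B f x" and g: "C11_map_at B C g (f x)"
  shows "C11_map_at A C (\<lambda>x. g (f x)) x"
proof -
  obtain U \<phi> where c: "(U, \<phi>) \<in> charts A" "x \<in> U"
    using chart_around[OF A C11_map_atD_points(1)[OF f]] by metis
  obtain V \<psi> where d: "(V, \<psi>) \<in> charts B" "f x \<in> V"
    using chart_around[OF B C11_map_atD_points(2)[OF f]] by metis
  obtain W \<theta> where e: "(W, \<theta>) \<in> charts C" "g (f x) \<in> W"
    using chart_around[OF C C11_map_atD_points(2)[OF g]] by metis
  note F = C11_map_at_charts[OF A B f c d] and G = C11_map_at_charts[OF B C g d e]
  have Fx: "(\<psi> \<circ> f \<circ> inv_into U \<phi>) (\<phi> x) = \<psi> (f x)" using chart_inv_into[OF c] by simp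
  have lim: "filterlim (\<psi> \<circ> f \<circ> inv_into U \<phi>) (nhds (\<psi> (f x))) (nhds (\<phi> x))"
    using C11_at_filterlim[OF F(2)] unfolding Fx .
  have eq: "\<forall>\<^sub>F y in nhds (\<phi> x). inv_into V \<psi> ((\<psi> \<circ> f \<circ> inv_into U \<phi>) y) = f (inv_into U \<phi> y)"
    using F(1) by eventually_elim (use chart_inv_into[OF d(1)] in simp)
  have 1: "\<forall>\<^sub>F y in nhds (\<phi> x). g (f (inv_into U \<phi> y)) \<in> W"
    using eventually_compose_filterlim[OF G(1) lim] eq by eventually_elim simp
  have "C11_at ((\<theta> \<circ> g \<circ> inv_into V \<psi>) \<circ> (\<psi> \<circ> f \<circ> inv_into U \<phi>)) (\<phi> x)"
    using F(2) G(2) Fx by (intro C11_at_compose) (simp_all only:)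
  moreover have "\<forall>\<^sub>F y in nhds (\<phi> x). ((\<theta> \<circ> g \<circ> inv_into V \<psi>) \<circ> (\<psi> \<circ> f \<circ> inv_into U \<phi>)) y =
      (\<theta> \<circ> (\<lambda>x. g (f x)) \<circ> inv_into U \<phi>) y"
    using eq by eventually_elim simp
  ultimately have "C11_at (\<theta> \<circ> (\<lambda>x. g (f x)) \<circ> inv_into U \<phi>) (\<phi> x)" by (rule C11_at_cong)
  then show ?thesis unfolding C11_map_at_def using c e 1 by blast
qed

text \<open>\<open>smooth_map\<close> gives smooth representatives on sets that are open only
  because \<open>f\<close> is continuous; this is where the preimage of the chart domain
  enters.\<close>

lemma smooth_map_imp_C11_map_at:
  assumes A: "smooth_manifold A" and B: "smooth_manifold B" and f: "smooth_map A B f" and x: "x \<in> points A"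
  shows "C11_map_at A B f x"
proof -
  have cont: "continuous_map (manifold_topology A) (manifold_topology B) f"
    using f by (simp add: smooth_map_def)
  then have fx: "f x \<in> points B"
    using x by (auto simp: continuous_map_def topspace_manifold_topology[OF A] topspace_manifold_topology[OF B])
  obtain U \<phi> where c: "(U, \<phi>) \<in> A" "(U, \<phi>) \<in> charts A" "x \<in> U" by (rule chart_around[OF A x])
  obtain V \<psi> where d: "(V, \<psi>) \<in> B" "(V, \<psi>) \<in> charts B" "f x \<in> V" by (rule chart_around[OF B fx])
  have "openin (manifold_topology A) {x \<in> topspace (manifold_topology A). f x \<in> V}"
    by (rule openin_continuous_map_preimage[OF cont chart_domain_open[OF B d(2)]])
  from chart_image_open[OF A c(2) this]
  have "open (\<phi> ` ({x \<in> points A. f x \<in> V} \<inter> U))" by (simp add: topspace_manifold_topology[OF A])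
  also have "{x \<in> points A. f x \<in> V} \<inter> U = U \<inter> f -` V" using chart_points[OF c(2)] by auto
  finally have o: "open (\<phi> ` (U \<inter> f -` V))" .
  have s: "smooth_on (\<phi> ` (U \<inter> f -` V)) (\<psi> \<circ> f \<circ> inv_into U \<phi>)"
    using f c(1) d(1) by (fastforce simp: smooth_map_def)
  have C: "C11_at (\<psi> \<circ> f \<circ> inv_into U \<phi>) (\<phi> x)"
    by (rule smooth_on_imp_C11_at[OF s o]) (use c d in auto)
  have "\<forall>\<^sub>F y in nhds (\<phi> x). y \<in> \<phi> ` (U \<inter> f -` V)"
    using o c d by (intro eventually_nhds_in_open) auto
  then have "\<forall>\<^sub>F y in nhds (\<phi> x). f (inv_into U \<phi> y) \<in> V"
    by eventually_elim (use chart_inv_into[OF c(2)] in auto)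
  then show ?thesis unfolding C11_map_at_def using c d C by blast
qed

lemma C11_map_at_const:
  assumes A: "smooth_manifold A" and B: "smooth_manifold B" and x: "x \<in> points A" and y: "y \<in> points B"
  shows "C11_map_at A B (\<lambda>_. y) x"
proof -
  obtain U \<phi> where c: "(U, \<phi>) \<in> A" "(U, \<phi>) \<in> charts A" "x \<in> U" by (rule chart_around[OF A x])
  obtain V \<psi> where d: "(V, \<psi>) \<in> B" "(V, \<psi>) \<in> charts B" "y \<in> V" by (rule chart_around[OF B y])
  have "C11_at (\<psi> \<circ> (\<lambda>_. y) \<circ> inv_into U \<phi>) (\<phi> x)" using C11_at_const[of "\<psi> y"] by (simp add: o_def)
  then show ?thesis unfolding C11_map_at_def using c d by fastforce
qed

lemma C11_map_at_id:
  assumes A: "smooth_manifold A" and x: "x \<in> points A"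
  shows "C11_map_at A A (\<lambda>x. x) x"
proof -
  obtain U \<phi> where c: "(U, \<phi>) \<in> A" "(U, \<phi>) \<in> charts A" "x \<in> U" by (rule chart_around[OF A x])
  note ev = chart_eventually[OF c(2,3)]
  have "C11_at (\<phi> \<circ> (\<lambda>x. x) \<circ> inv_into U \<phi>) (\<phi> x)"
    by (rule C11_at_cong[OF C11_at_id]) (use ev in \<open>auto elim: eventually_mono\<close>)
  moreover have "\<forall>\<^sub>F y in nhds (\<phi> x). inv_into U \<phi> y \<in> U" using ev by eventually_elim simp
  ultimately show ?thesis unfolding C11_map_at_def using c by fast
qed

subsection \<open>Product manifolds\<close>

lemma inv_into_map_prod:
  assumes "inj_on \<phi> U" "inj_on \<psi> V" "x \<in> \<phi> ` U" "y \<in> \<psi> ` V"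
  shows "inv_into (U \<times> V) (map_prod \<phi> \<psi>) (x, y) = (inv_into U \<phi> x, inv_into V \<psi> y)"
proof (rule inv_into_f_eq)
  show "inj_on (map_prod \<phi> \<psi>) (U \<times> V)" by (rule map_prod_inj_on[OF assms(1,2)])
qed (use assms(3,4) in \<open>auto simp: inv_into_into f_inv_into_f\<close>)

lemma points_prod_atlas: "points (prod_atlas A B) = points A \<times> points B"
  by (force simp: points_def prod_atlas_def prod_chart_def)

lemma in_prod_atlas_iff:
  "(W, \<theta>) \<in> prod_atlas A B \<longleftrightarrow>
     (\<exists>(U, \<phi>)\<in>A. \<exists>(V, \<psi>)\<in>B. W = U \<times> V \<and> \<theta> = map_prod \<phi> \<psi>)"
  unfolding prod_atlas_def prod_chart_def split_beta image_iff by auto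

lemma compatible_prod_chart:
  fixes \<phi> \<phi>' :: "'m \<Rightarrow> 'e::real_normed_vector" and \<psi> \<psi>' :: "'n \<Rightarrow> 'f::real_normed_vector"
  assumes "inj_on \<phi> U" "inj_on \<psi> V" "inj_on \<phi>' U'" "inj_on \<psi>' V'"
    and c: "compatible (U, \<phi>) (U', \<phi>')" and d: "compatible (V, \<psi>) (V', \<psi>')"
  shows "compatible (U \<times> V, map_prod \<phi> \<psi>) (U' \<times> V', map_prod \<phi>' \<psi>')"
proof -
  have I: "(U \<times> V) \<inter> (U' \<times> V') = (U \<inter> U') \<times> (V \<inter> V')" by auto
  have *: "smooth_on (f ` X \<times> g ` Y) (map_prod f' g' \<circ> inv_into (U1 \<times> V1) (map_prod f g))"
    if "smooth_on (f ` X) (f' \<circ> inv_into U1 f)" "smooth_on (g ` Y) (g' \<circ> inv_into V1 g)"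
      "open (f ` X)" "open (g ` Y)" "X \<subseteq> U1" "Y \<subseteq> V1" "inj_on f U1" "inj_on g V1"
    for f f' :: "'m \<Rightarrow> 'e" and g g' :: "'n \<Rightarrow> 'f" and X Y U1 V1
  proof (rule smooth_on_cong[OF smooth_on_map_prod[OF that(3,4,1,2)]])
    show "open (f ` X \<times> g ` Y)" using that by (intro open_Times)
    fix p assume "p \<in> f ` X \<times> g ` Y"
    then obtain x y where p: "p = (x, y)" "x \<in> f ` X" "y \<in> g ` Y" by auto
    then have "x \<in> f ` U1" "y \<in> g ` V1" using that by auto
    from inv_into_map_prod[OF that(7,8) this]
    show "map_prod (f' \<circ> inv_into U1 f) (g' \<circ> inv_into V1 g) p =
        (map_prod f' g' \<circ> inv_into (U1 \<times> V1) (map_prod f g)) p" by (simp add: p)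
  qed
  show ?thesis
    using c d assms(1-4) unfolding compatible_def prod.case I map_prod_surj_on[OF refl refl]
    by (auto intro!: open_Times *)
qed

lemma prod_chart_in_charts:
  assumes A: "smooth_manifold A" and B: "smooth_manifold B"
    and c: "(U, \<phi>) \<in> charts A" and d: "(V, \<psi>) \<in> charts B"
  shows "(U \<times> V, map_prod \<phi> \<psi>) \<in> charts (prod_atlas A B)"
  unfolding charts_def mem_Collect_eq prod.case
proof (intro conjI ballI)
  show "U \<times> V \<subseteq> points (prod_atlas A B)"
    using chart_points[OF c] chart_points[OF d] by (auto simp: points_prod_atlas)
  show "inj_on (map_prod \<phi> \<psi>) (U \<times> V)" by (intro map_prod_inj_on chart_inj[OF c] chart_inj[OF d])
  show "open (map_prod \<phi> \<psi> ` (U \<times> V))"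
    unfolding map_prod_surj_on[OF refl refl] by (intro open_Times chart_open_image[OF c] chart_open_image[OF d])
  fix e assume "e \<in> prod_atlas A B"
  then obtain U' \<phi>' V' \<psi>' where e: "(U', \<phi>') \<in> A" "(V', \<psi>') \<in> B" "e = (U' \<times> V', map_prod \<phi>' \<psi>')"
    by (cases e) (auto simp: in_prod_atlas_iff)
  have "compatible (U, \<phi>) (U', \<phi>')" "compatible (V, \<psi>) (V', \<psi>')"
    using c d e by (auto simp: charts_def)
  then show "compatible (U \<times> V, map_prod \<phi> \<psi>) e"
    unfolding e(3) using c d A B e(1,2)
    by (intro compatible_prod_chart) (auto simp: charts_def smooth_manifold_def)
qed

text \<open>Smooth multiplication is continuous for the topology of the product atlas, while the
  action and pairs of curves are continuous for the product topology. The identification lets them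
  be combined.\<close>

lemma manifold_topology_prod_atlas:
  assumes A: "smooth_manifold A" and B: "smooth_manifold B"
  shows "manifold_topology (prod_atlas A B) = prod_topology (manifold_topology A) (manifold_topology B)"
  unfolding topology_eq
proof
  fix W
  have inj: "inj_on \<theta> X" if "(X, \<theta>) \<in> prod_atlas A B" for X \<theta>
    using that A B by (auto simp: in_prod_atlas_iff smooth_manifold_def intro!: map_prod_inj_on)
  have oP: "openin (manifold_topology (prod_atlas A B)) W \<longleftrightarrow> W \<subseteq> points (prod_atlas A B) \<and>
      (\<forall>(X, \<theta>)\<in>prod_atlas A B. open (\<theta> ` (W \<inter> X)))" for W
    by (rule openin_manifold_topology_inj) (rule inj)
  show "openin (manifold_topology (prod_atlas A B)) W \<longleftrightarrow>
      openin (prod_topology (manifold_topology A) (manifold_topology B)) W"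
  proof
    assume W: "openin (manifold_topology (prod_atlas A B)) W"
    show "openin (prod_topology (manifold_topology A) (manifold_topology B)) W"
      unfolding openin_prod_topology_alt
    proof (intro allI impI)
      fix x y assume xy: "(x, y) \<in> W"
      then have "x \<in> points A" "y \<in> points B" using W unfolding oP points_prod_atlas by auto
      then obtain U \<phi> V \<psi> where c: "(U, \<phi>) \<in> A" "(U, \<phi>) \<in> charts A" "x \<in> U"
        and d: "(V, \<psi>) \<in> B" "(V, \<psi>) \<in> charts B" "y \<in> V"
        using chart_around[OF A] chart_around[OF B] by metis
      have "(U \<times> V, map_prod \<phi> \<psi>) \<in> prod_atlas A B" using c d by (auto simp: in_prod_atlas_iff)
      then have "open (map_prod \<phi> \<psi> ` (W \<inter> U \<times> V))" using W unfolding oP by blast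
      moreover have "(\<phi> x, \<psi> y) \<in> map_prod \<phi> \<psi> ` (W \<inter> U \<times> V)" using xy c d by force
      ultimately obtain S T where ST: "open S" "open T" "(\<phi> x, \<psi> y) \<in> S \<times> T"
        "S \<times> T \<subseteq> map_prod \<phi> \<psi> ` (W \<inter> U \<times> V)" unfolding open_prod_def by meson
      have "(U \<inter> \<phi> -` S) \<times> (V \<inter> \<psi> -` T) \<subseteq> W"
      proof clarify
        fix a b assume ab: "a \<in> U" "\<phi> a \<in> S" "b \<in> V" "\<psi> b \<in> T"
        then have "(\<phi> a, \<psi> b) \<in> map_prod \<phi> \<psi> ` (W \<inter> U \<times> V)" using ST(4) by blast
        then obtain a' b' where "(a', b') \<in> W" "a' \<in> U" "b' \<in> V" "\<phi> a = \<phi> a'" "\<psi> b = \<psi> b'" by auto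
        then show "(a, b) \<in> W" using ab chart_inj[OF c(2)] chart_inj[OF d(2)] by (metis inj_onD)
      qed
      then show "\<exists>U V. openin (manifold_topology A) U \<and> openin (manifold_topology B) V \<and>
          x \<in> U \<and> y \<in> V \<and> U \<times> V \<subseteq> W"
        using chart_preimage_open[OF A c(2) ST(1)] chart_preimage_open[OF B d(2) ST(2)] c d ST(3)
        by (intro exI[of _ "U \<inter> \<phi> -` S"] exI[of _ "V \<inter> \<psi> -` T"]) auto
    qed
  next
    assume W: "openin (prod_topology (manifold_topology A) (manifold_topology B)) W"
    show "openin (manifold_topology (prod_atlas A B)) W"
      unfolding oP
    proof (intro conjI)
      show "W \<subseteq> points (prod_atlas A B)"
        using openin_subset[OF W]
        by (simp add: points_prod_atlas topspace_manifold_topology[OF A] topspace_manifold_topology[OF B])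
      show "\<forall>(X, \<theta>)\<in>prod_atlas A B. open (\<theta> ` (W \<inter> X))"
      proof clarify
        fix X \<theta> assume "(X, \<theta>) \<in> prod_atlas A B"
        then obtain U \<phi> V \<psi> where c: "(U, \<phi>) \<in> A" and d: "(V, \<psi>) \<in> B"
          and X: "X = U \<times> V" "\<theta> = map_prod \<phi> \<psi>" by (auto simp: in_prod_atlas_iff)
        note c' = subsetD[OF atlas_subset_charts[OF A] c] and d' = subsetD[OF atlas_subset_charts[OF B] d]
        show "open (\<theta> ` (W \<inter> X))"
          unfolding open_prod_def
        proof
          fix p assume "p \<in> \<theta> ` (W \<inter> X)"
          then obtain x y where xy: "(x, y) \<in> W" "x \<in> U" "y \<in> V" "p = (\<phi> x, \<psi> y)" by (auto simp: X)
          obtain U' V' where UV: "openin (manifold_topology A) U'" "openin (manifold_topology B) V'"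
            "x \<in> U'" "y \<in> V'" "U' \<times> V' \<subseteq> W" using W[unfolded openin_prod_topology_alt, rule_format, OF xy(1)] by metis
          have "\<phi> ` (U' \<inter> U) \<times> \<psi> ` (V' \<inter> V) \<subseteq> \<theta> ` (W \<inter> X)" using UV(5) by (force simp: X)
          then show "\<exists>S T. open S \<and> open T \<and> p \<in> S \<times> T \<and> S \<times> T \<subseteq> \<theta> ` (W \<inter> X)"
            using chart_image_open[OF A c' UV(1)] chart_image_open[OF B d' UV(2)] xy UV(3,4)
            by (intro exI[of _ "\<phi> ` (U' \<inter> U)"] exI[of _ "\<psi> ` (V' \<inter> V)"]) auto
        qed
      qed
    qed
  qed
qed

lemma smooth_manifold_prod_atlas:
  assumes A: "smooth_manifold A" and B: "smooth_manifold B"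
  shows "smooth_manifold (prod_atlas A B)"
  unfolding smooth_manifold_def
proof (intro conjI)
  have sub: "prod_atlas A B \<subseteq> charts (prod_atlas A B)"
  proof
    fix e assume "e \<in> prod_atlas A B"
    then obtain U' \<phi>' V' \<psi>' where e: "(U', \<phi>') \<in> A" "(V', \<psi>') \<in> B" "e = (U' \<times> V', map_prod \<phi>' \<psi>')"
      by (cases e) (auto simp: in_prod_atlas_iff)
    then show "e \<in> charts (prod_atlas A B)"
      using atlas_subset_charts[OF A] atlas_subset_charts[OF B] by (auto intro!: prod_chart_in_charts[OF A B])
  qed
  then show "\<forall>(U, \<phi>)\<in>prod_atlas A B. inj_on \<phi> U \<and> open (\<phi> ` U)"
    by (auto simp: charts_def)
  show "\<forall>c\<in>prod_atlas A B. \<forall>d\<in>prod_atlas A B. compatible c d"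
    using sub by (auto simp: charts_def)
  show "Hausdorff_space (manifold_topology (prod_atlas A B))"
    unfolding manifold_topology_prod_atlas[OF A B]
    using A B by (simp add: Hausdorff_space_prod_topology smooth_manifold_def)
qed

lemma C11_map_at_Pair:
  assumes A: "smooth_manifold A" and B: "smooth_manifold B" and C: "smooth_manifold C"
    and f: "C11_map_at A B f x" and g: "C11_map_at A C g x"
  shows "C11_map_at A (prod_atlas B C) (\<lambda>x. (f x, g x)) x"
proof -
  obtain U \<phi> where c: "(U, \<phi>) \<in> charts A" "x \<in> U"
    using chart_around[OF A C11_map_atD_points(1)[OF f]] by metis
  obtain V \<psi> where d: "(V, \<psi>) \<in> charts B" "f x \<in> V"
    using chart_around[OF B C11_map_atD_points(2)[OF f]] by metis
  obtain W \<theta> where e: "(W, \<theta>) \<in> charts C" "g x \<in> W"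
    using chart_around[OF C C11_map_atD_points(2)[OF g]] by metis
  note F = C11_map_at_charts[OF A B f c d] and G = C11_map_at_charts[OF A C g c e]
  have "C11_at (map_prod \<psi> \<theta> \<circ> (\<lambda>x. (f x, g x)) \<circ> inv_into U \<phi>) (\<phi> x)"
    using C11_at_Pair[OF F(2) G(2)] by (simp add: o_def)
  moreover have "\<forall>\<^sub>F y in nhds (\<phi> x). (f (inv_into U \<phi> y), g (inv_into U \<phi> y)) \<in> V \<times> W"
    using F(1) G(1) by eventually_elim simp
  ultimately show ?thesis unfolding C11_map_at_def
    using c prod_chart_in_charts[OF B C d(1) e(1)] by blast
qed

lemma C11_map_at_fst:
  assumes A: "smooth_manifold A" and B: "smooth_manifold B" and x: "x \<in> points (prod_atlas A B)"
  shows "C11_map_at (prod_atlas A B) A fst x" and "C11_map_at (prod_atlas A B) B snd x"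
proof -
  have "fst x \<in> points A" "snd x \<in> points B" using x by (auto simp: points_prod_atlas)
  then obtain U \<phi> V \<psi> where c: "(U, \<phi>) \<in> charts A" "fst x \<in> U" and d: "(V, \<psi>) \<in> charts B" "snd x \<in> V"
    using chart_around[OF A] chart_around[OF B] by metis
  note e = prod_chart_in_charts[OF A B c(1) d(1)]
  have x': "x \<in> U \<times> V" using c d by (cases x) auto
  have "\<forall>\<^sub>F y in nhds (map_prod \<phi> \<psi> x). y \<in> \<phi> ` U \<times> \<psi> ` V"
    using chart_open_image[OF c(1)] chart_open_image[OF d(1)] c d
    by (intro eventually_nhds_in_open open_Times) (auto simp: map_prod_def split: prod.splits)
  then have ev: "\<forall>\<^sub>F y in nhds (map_prod \<phi> \<psi> x). y \<in> \<phi> ` U \<times> \<psi> ` V \<and>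
      inv_into (U \<times> V) (map_prod \<phi> \<psi>) y = (inv_into U \<phi> (fst y), inv_into V \<psi> (snd y))"
    by eventually_elim (auto simp: inv_into_map_prod[OF chart_inj[OF c(1)] chart_inj[OF d(1)]])
  have 1: "C11_at (\<phi> \<circ> fst \<circ> inv_into (U \<times> V) (map_prod \<phi> \<psi>)) (map_prod \<phi> \<psi> x)"
    by (rule C11_at_cong[OF C11_at_fst]) (use ev in \<open>auto elim!: eventually_mono simp: f_inv_into_f\<close>)
  have 2: "C11_at (\<psi> \<circ> snd \<circ> inv_into (U \<times> V) (map_prod \<phi> \<psi>)) (map_prod \<phi> \<psi> x)"
    by (rule C11_at_cong[OF C11_at_snd]) (use ev in \<open>auto elim!: eventually_mono simp: f_inv_into_f\<close>)
  have 3: "\<forall>\<^sub>F y in nhds (map_prod \<phi> \<psi> x). fst (inv_into (U \<times> V) (map_prod \<phi> \<psi>) y) \<in> U"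
    "\<forall>\<^sub>F y in nhds (map_prod \<phi> \<psi> x). snd (inv_into (U \<times> V) (map_prod \<phi> \<psi>) y) \<in> V"
    using ev by (auto elim!: eventually_mono simp: chart_inv_into[OF c(1)] chart_inv_into[OF d(1)])
  show "C11_map_at (prod_atlas A B) A fst x" by (rule C11_map_atI[OF e c(1) x' 3(1) 1])
  show "C11_map_at (prod_atlas A B) B snd x" by (rule C11_map_atI[OF e d(1) x' 3(2) 2])
qed

section \<open>Absolutely continuous curves in manifolds\<close>

text \<open>Bisection replaces a Lebesgue number: partitions of two adjacent intervals share the
  common endpoint, so every piece of their union is a piece of one of them.\<close>

lemma partition_exists:
  assumes ab: "a \<le> b"
    and loc: "\<And>t. t \<in> {a..b} \<Longrightarrow>
      \<exists>d>0. \<forall>u v. a \<le> u \<and> u \<le> t \<and> t \<le> v \<and> v \<le> b \<and> v - u < d \<longrightarrow> Q u v"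
  shows "\<exists>P. partition_of a b P \<and> (\<forall>u v. consecutive P u v \<longrightarrow> Q u v)"
proof -
  let ?R = "\<lambda>x y. a \<le> x \<longrightarrow> y \<le> b \<longrightarrow> (\<exists>P. partition_of x y P \<and> (\<forall>u v. consecutive P u v \<longrightarrow> Q u v))"
  have "?R a b"
  proof (rule Bolzano[where P = ?R, OF ab])
    fix x y z assume 1: "?R x y" and 2: "?R y z" and le: "x \<le> y" "y \<le> z"
    show "?R x z"
    proof (intro impI)
      assume "a \<le> x" "z \<le> b"
      then obtain P P' where P: "partition_of x y P" "\<And>u v. consecutive P u v \<Longrightarrow> Q u v"
        and P': "partition_of y z P'" "\<And>u v. consecutive P' u v \<Longrightarrow> Q u v"
        using 1 2 le by (meson order_trans)
      have y: "y \<in> P" "y \<in> P'" "P \<subseteq> {x..y}" "P' \<subseteq> {y..z}" using P P' by (auto simp: partition_of_def)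
      have "Q u v" if uv: "consecutive (P \<union> P') u v" for u v
      proof -
        have "v \<le> y \<or> y \<le> u" using uv y by (force simp: consecutive_def)
        then show ?thesis
        proof
          assume "v \<le> y"
          then have "consecutive P u v" using uv y by (fastforce simp: consecutive_def)
          then show ?thesis by (rule P(2))
        next
          assume "y \<le> u"
          then have "consecutive P' u v" using uv y by (fastforce simp: consecutive_def)
          then show ?thesis by (rule P'(2))
        qed
      qed
      moreover have "partition_of x z (P \<union> P')" using P(1) P'(1) le by (force simp: partition_of_def)
      ultimately show "\<exists>P. partition_of x z P \<and> (\<forall>u v. consecutive P u v \<longrightarrow> Q u v)" by blast
    qed
  next
    fix t assume t: "a \<le> t" "t \<le> b"
    then obtain d where d: "d > 0" "\<And>u v. a \<le> u \<Longrightarrow> u \<le> t \<Longrightarrow> t \<le> v \<Longrightarrow> v \<le> b \<Longrightarrow> v - u < d \<Longrightarrow> Q u v"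
      using loc[of t] by auto
    have "?R x y" if "x \<le> t" "t \<le> y" "y - x < d" for x y
    proof (intro impI exI[of _ "{x,y}"] conjI allI)
      show "partition_of x y {x,y}" using that by (auto simp: partition_of_def)
      fix u v assume "a \<le> x" "y \<le> b" "consecutive {x,y} u v"
      then have "u = x" "v = y" using that by (auto simp: consecutive_def)
      then show "Q u v" using d(2) that \<open>a \<le> x\<close> \<open>y \<le> b\<close> by simp
    qed
    then show "\<exists>d>0. \<forall>x y. x \<le> t \<and> t \<le> y \<and> y - x < d \<longrightarrow> ?R x y" using d(1) by blast
  qed
  then show ?thesis by simp
qed

text \<open>An induction over the pieces of a partition without enumerating them: bisection reaches
  intervals so short that at most one partition point \<open>t\<close> lies inside, and the two
  sides are joined at \<open>t\<close>.\<close>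

lemma partition_join_induct:
  assumes P: "partition_of a b P" and ab: "a < b" and pq: "a \<le> p" "p \<le> q" "q \<le> b"
    and join: "\<And>x y z. Q x y \<Longrightarrow> Q y z \<Longrightarrow> p \<le> x \<Longrightarrow> x \<le> y \<Longrightarrow> y \<le> z \<Longrightarrow> z \<le> q \<Longrightarrow> Q x z"
    and piece: "\<And>u v x y. consecutive P u v \<Longrightarrow> u \<le> x \<Longrightarrow> x \<le> y \<Longrightarrow> y \<le> v \<Longrightarrow> p \<le> x \<Longrightarrow> y \<le> q \<Longrightarrow> Q x y"
  shows "Q p q"
proof -
  let ?R = "\<lambda>x y. p \<le> x \<longrightarrow> y \<le> q \<longrightarrow> Q x y"
  have "?R p q"
  proof (rule Bolzano[where P = ?R, OF pq(2)])
    fix x y z assume "?R x y" "?R y z" "x \<le> y" "y \<le> z"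
    then show "?R x z" using join by (meson order_trans)
  next
    fix t assume t: "p \<le> t" "t \<le> q"
    then have tab: "a \<le> t" "t \<le> b" using pq by auto
    have finP: "finite P" using P by (simp add: partition_of_def)
    then obtain d where d: "d > 0" "\<And>p. p \<in> P \<Longrightarrow> p \<noteq> t \<Longrightarrow> d \<le> dist t p"
      using finite_set_avoid[of P t] by blast
    have gap: "{x<..<y} \<inter> P = {}" if "t - d < x" "y < t + d" "y \<le> t \<or> t \<le> x" for x y
      using that d(2) by (force simp: dist_real_def)
    \<comment> \<open>An interval handed over by the bisection may start or end at \<open>t\<close>.
      The degenerate piece at \<open>t\<close> is then obtained from an adjacent piece of the
      partition, which exists because \<open>a < b\<close>.\<close>
    have Qtt: "Q t t"
    proof (cases "t < b")
      case True
      define v where "v = min b (t + d / 2)"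
      have v: "t < v" "v \<le> b" "v < t + d" using True d(1) by (auto simp: v_def min_def)
      have g: "{t<..<v} \<inter> P = {}" by (rule gap) (use v d(1) in auto)
      obtain u' v' where "consecutive P u' v'" "u' \<le> t" "v \<le> v'"
        by (rule consecutive_cover[OF P tab(1) _ v(2) g]) (use v in auto)
      then show ?thesis using piece t v by force
    next
      case False
      then have tb: "t = b" using tab by simp
      define u where "u = max a (t - d / 2)"
      have u: "u < t" "a \<le> u" "t - d < u" using tb ab d(1) by (auto simp: u_def max_def)
      have g: "{u<..<t} \<inter> P = {}" by (rule gap) (use u d(1) in auto)
      obtain u' v' where "consecutive P u' v'" "u' \<le> u" "t \<le> v'"
        by (rule consecutive_cover[OF P u(2) _ tab(2) g]) (use u in auto)
      then show ?thesis using piece t u by force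
    qed
    have "Q x y" if xy: "x \<le> t" "t \<le> y" "y - x < d" "p \<le> x" "y \<le> q" for x y
    proof -
      have 1: "Q x t"
      proof (cases "x = t")
        case False
        have g: "{x<..<t} \<inter> P = {}" by (rule gap) (use xy d(1) in auto)
        obtain u' v' where "consecutive P u' v'" "u' \<le> x" "t \<le> v'"
          by (rule consecutive_cover[OF P _ xy(1) tab(2) g]) (use False xy pq in auto)
        then show ?thesis using piece xy t by blast
      qed (use Qtt in simp)
      have 2: "Q t y"
      proof (cases "t = y")
        case False
        have g: "{t<..<y} \<inter> P = {}" by (rule gap) (use xy d(1) in auto)
        obtain u' v' where "consecutive P u' v'" "u' \<le> t" "y \<le> v'"
          by (rule consecutive_cover[OF P tab(1) xy(2) _ g]) (use False xy pq in auto)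
        then show ?thesis using piece xy t by blast
      qed (use Qtt in simp)
      show ?thesis using join[OF 1 2] xy by simp
    qed
    then show "\<exists>d>0. \<forall>x y. x \<le> t \<and> t \<le> y \<and> y - x < d \<longrightarrow> ?R x y" using d(1) by blast
  qed
  then show ?thesis by simp
qed

lemma curve_neighbourhood:
  assumes \<eta>: "continuous_map (top_of_set {a..b::real}) X \<eta>" and W: "openin X W" and t: "t \<in> {a..b}" "\<eta> t \<in> W"
  shows "\<exists>d>0. \<forall>s\<in>{a..b}. \<bar>s - t\<bar> < d \<longrightarrow> \<eta> s \<in> W"
proof -
  have "openin (top_of_set {a..b}) {s \<in> {a..b}. \<eta> s \<in> W}"
    using openin_continuous_map_preimage[OF \<eta> W] by simp
  then obtain d where "d > 0" "\<forall>s\<in>{a..b}. dist s t < d \<longrightarrow> s \<in> {s \<in> {a..b}. \<eta> s \<in> W}"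
    unfolding openin_euclidean_subtopology_iff using t by blast
  then show ?thesis by (auto simp: dist_real_def)
qed

lemma curve_in_chart_continuous:
  assumes A: "smooth_manifold A" and c: "(U, \<phi>) \<in> charts A"
    and \<eta>: "continuous_map (top_of_set {a..b::real}) (manifold_topology A) \<eta>"
    and sub: "S \<subseteq> {a..b}" "\<eta> ` S \<subseteq> U"
  shows "continuous_on S (\<phi> \<circ> \<eta>)"
  unfolding continuous_on_topological
proof (intro ballI allI impI)
  fix t Y assume t: "t \<in> S" and Y: "open Y" "(\<phi> \<circ> \<eta>) t \<in> Y"
  have "\<eta> t \<in> U \<inter> \<phi> -` Y" using t Y sub by auto
  then obtain d where d: "d > 0" "\<forall>s\<in>{a..b}. \<bar>s - t\<bar> < d \<longrightarrow> \<eta> s \<in> U \<inter> \<phi> -` Y"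
    using curve_neighbourhood[OF \<eta> chart_preimage_open[OF A c Y(1)], of t] t sub by blast
  show "\<exists>B. open B \<and> t \<in> B \<and> (\<forall>s\<in>S. s \<in> B \<longrightarrow> (\<phi> \<circ> \<eta>) s \<in> Y)"
    using d sub by (intro exI[of _ "ball t d"]) (auto simp: dist_real_def abs_minus_commute)
qed

text \<open>Off a countable set the chain rule is pointwise; the new derivative is regulated because
  the derivative of \<open>F\<close> is norm-continuous along \<open>x\<close>.\<close>

lemma has_reg_derivative_chain:
  fixes x :: "real \<Rightarrow> 'e::banach" and F :: "'e \<Rightarrow> 'f::banach"
  assumes uv: "u \<le> v" and x: "has_reg_derivative x \<gamma> u v" and F: "\<And>t. t \<in> {u..v} \<Longrightarrow> C11_at F (x t)"
  shows "has_reg_derivative (F \<circ> x) (\<lambda>t. fderiv F (x t) (\<gamma> t)) u v"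
proof -
  have cont: "continuous_on {u..v} x" and \<gamma>: "regulated_on u v \<gamma>" using x by (auto simp: has_reg_derivative_def)
  obtain D where D: "countable D" "\<And>t. t \<in> {u<..<v} - D \<Longrightarrow> (x has_vector_derivative \<gamma> t) (at t)"
    by (rule has_reg_derivative_imp_derivative[OF uv x]) blast
  show ?thesis
  proof (rule has_reg_derivativeI[OF _ _ D(1)])
    show "continuous_on {u..v} (F \<circ> x)"
      by (rule continuous_on_compose[OF cont])
        (auto intro!: continuous_at_imp_continuous_on C11_at_isCont F)
    have "continuous_on {u..v} (fderiv F \<circ> x)"
      by (rule continuous_on_compose[OF cont])
        (auto intro!: continuous_at_imp_continuous_on C11_at_isCont_fderiv F)
    then show "regulated_on u v (\<lambda>t. fderiv F (x t) (\<gamma> t))"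
      using regulated_on_blinfun[OF uv _ \<gamma>] by (simp add: o_def)
    show "(F \<circ> x has_vector_derivative fderiv F (x t) (\<gamma> t)) (at t)" if "t \<in> {u<..<v} - D" for t
      using vector_derivative_chain_C11[OF F D(2)[OF that]] that by (auto simp: o_def)
  qed
qed

lemma has_reg_derivative_cong:
  assumes "has_reg_derivative x \<gamma> u v" "\<And>t. t \<in> {u..v} \<Longrightarrow> x t = y t" "u \<le> v"
  shows "has_reg_derivative y \<gamma> u v"
  using assms unfolding has_reg_derivative_def by (auto elim!: continuous_on_eq)

lemma AC_on_chain:
  fixes x :: "real \<Rightarrow> 'e::banach" and F :: "'e \<Rightarrow> 'f::banach"
  assumes uv: "u \<le> v" and x: "AC_on u v x" and F: "\<And>t. t \<in> {u..v} \<Longrightarrow> C11_at F (x t)"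
    and y: "\<And>t. t \<in> {u..v} \<Longrightarrow> F (x t) = y t"
  shows "AC_on u v y"
proof -
  obtain \<gamma> where "has_reg_derivative x \<gamma> u v" using x by (auto simp: AC_on_def)
  from has_reg_derivative_chain[OF uv this F]
  have "has_reg_derivative (F \<circ> x) (\<lambda>t. fderiv F (x t) (\<gamma> t)) u v" by simp
  from has_reg_derivative_cong[OF this _ uv] y show ?thesis by (auto simp: AC_on_def)
qed

lemma AC_on_subinterval:
  fixes x :: "real \<Rightarrow> 'e::banach"
  shows "AC_on a b x \<Longrightarrow> a \<le> u \<Longrightarrow> u \<le> v \<Longrightarrow> v \<le> b \<Longrightarrow> AC_on u v x"
  unfolding AC_on_def using has_reg_derivative_subinterval by blast

lemma AC_on_join:
  fixes x :: "real \<Rightarrow> 'e::banach"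
  shows "AC_on a b x \<Longrightarrow> AC_on b c x \<Longrightarrow> a \<le> b \<Longrightarrow> b \<le> c \<Longrightarrow> AC_on a c x"
  unfolding AC_on_def using has_reg_derivative_join by blast

text \<open>Membership in \<open>AC\<close> provides some charts on some partition. Transition maps
  carry absolute continuity over to the given chart on each piece, and the pieces are
  joined.\<close>

lemma AC_chart_AC_on:
  fixes A :: "('m, 'e::banach) chart set"
  assumes A: "smooth_manifold A" and \<eta>: "\<eta> \<in> AC A" and c: "(U, \<phi>) \<in> charts A"
    and pq: "0 \<le> p" "p \<le> q" "q \<le> 1" and U: "\<eta> ` {p..q} \<subseteq> U"
  shows "AC_on p q (\<phi> \<circ> \<eta>)"
proof -
  obtain P where P: "partition_of 0 1 P"
    "\<And>u v. consecutive P u v \<Longrightarrow> \<exists>(V, \<psi>)\<in>charts A. \<eta> ` {u..v} \<subseteq> V \<and> AC_on u v (\<psi> \<circ> \<eta>)"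
    using \<eta> unfolding AC_def by blast
  show ?thesis
  proof (rule partition_join_induct[where Q = "\<lambda>x y. AC_on x y (\<phi> \<circ> \<eta>)", OF P(1) zero_less_one pq])
    fix x y z assume "AC_on x y (\<phi> \<circ> \<eta>)" "AC_on y z (\<phi> \<circ> \<eta>)" "x \<le> y" "y \<le> z"
    then show "AC_on x z (\<phi> \<circ> \<eta>)" by (rule AC_on_join)
  next
    fix u v x y assume uv: "consecutive P u v" and xy: "u \<le> x" "x \<le> y" "y \<le> v" "p \<le> x" "y \<le> q"
    obtain V \<psi> where d: "(V, \<psi>) \<in> charts A" "\<eta> ` {u..v} \<subseteq> V" "AC_on u v (\<psi> \<circ> \<eta>)"
      using P(2)[OF uv] by blast
    show "AC_on x y (\<phi> \<circ> \<eta>)"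
    proof (rule AC_on_chain[OF xy(2) AC_on_subinterval[OF d(3) xy(1-3)]])
      fix t assume t: "t \<in> {x..y}"
      then have tU: "\<eta> t \<in> U" "\<eta> t \<in> V" using U d(2) xy by auto
      show "C11_at (\<phi> \<circ> inv_into V \<psi>) ((\<psi> \<circ> \<eta>) t)"
        using chart_transition(2)[OF A d(1) c tU(2,1)] by simp
      show "(\<phi> \<circ> inv_into V \<psi>) ((\<psi> \<circ> \<eta>) t) = (\<phi> \<circ> \<eta>) t"
        using chart_inv_into[OF d(1) tU(2)] by simp
    qed
  qed
qed

lemma AC_continuous_map: "\<eta> \<in> AC A \<Longrightarrow> continuous_map (top_of_set {0..1}) (manifold_topology A) \<eta>"
  and AC_extensional: "\<eta> \<in> AC A \<Longrightarrow> \<eta> \<in> extensional {0..1}"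
  by (simp_all add: AC_def)

lemma AC_points:
  assumes "smooth_manifold A" "\<eta> \<in> AC A" "t \<in> {0..1}" shows "\<eta> t \<in> points A"
  using AC_continuous_map[OF assms(2)] assms(3)
  by (auto simp: continuous_map_def topspace_manifold_topology[OF assms(1)])

lemma ACI:
  fixes A :: "('m, 'e::banach) chart set"
  assumes A: "smooth_manifold A" and ext: "\<eta> \<in> extensional {0..1}"
    and cont: "continuous_map (top_of_set {0..1}) (manifold_topology A) \<eta>"
    and loc: "\<And>t U \<phi>. t \<in> {0..1} \<Longrightarrow> (U, \<phi>) \<in> charts A \<Longrightarrow> \<eta> t \<in> U \<Longrightarrow>
      \<exists>d>0. \<forall>u v. 0 \<le> u \<and> u \<le> t \<and> t \<le> v \<and> v \<le> 1 \<and> v - u < d \<longrightarrow> \<eta> ` {u..v} \<subseteq> U \<longrightarrow> AC_on u v (\<phi> \<circ> \<eta>)"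
  shows "\<eta> \<in> AC A"
proof -
  have "\<exists>P. partition_of 0 1 P \<and> (\<forall>u v. consecutive P u v \<longrightarrow>
      (\<exists>(U, \<phi>)\<in>charts A. \<eta> ` {u..v} \<subseteq> U \<and> AC_on u v (\<phi> \<circ> \<eta>)))"
  proof (rule partition_exists)
    fix t :: real assume t: "t \<in> {0..1}"
    then have "\<eta> t \<in> points A"
      using cont by (auto simp: continuous_map_def topspace_manifold_topology[OF A])
    then obtain U \<phi> where c: "(U, \<phi>) \<in> charts A" "\<eta> t \<in> U" using chart_around[OF A] by metis
    obtain d1 where d1: "d1 > 0" "\<forall>s\<in>{0..1}. \<bar>s - t\<bar> < d1 \<longrightarrow> \<eta> s \<in> U"
      using curve_neighbourhood[OF cont chart_domain_open[OF A c(1)] t c(2)] by blast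
    obtain d2 where d2: "d2 > 0" "\<And>u v. 0 \<le> u \<Longrightarrow> u \<le> t \<Longrightarrow> t \<le> v \<Longrightarrow> v \<le> 1 \<Longrightarrow> v - u < d2 \<Longrightarrow>
        \<eta> ` {u..v} \<subseteq> U \<Longrightarrow> AC_on u v (\<phi> \<circ> \<eta>)"
      using loc[OF t c] by blast
    have "\<exists>(U, \<phi>)\<in>charts A. \<eta> ` {u..v} \<subseteq> U \<and> AC_on u v (\<phi> \<circ> \<eta>)"
      if uv: "0 \<le> u" "u \<le> t" "t \<le> v" "v \<le> 1" "v - u < min d1 d2" for u v
    proof -
      have sub: "\<eta> ` {u..v} \<subseteq> U" using d1(2) uv by auto
      then have "AC_on u v (\<phi> \<circ> \<eta>)" using d2(2) uv by simp
      with sub c(1) show ?thesis by blast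
    qed
    then show "\<exists>d>0. \<forall>u v. 0 \<le> u \<and> u \<le> t \<and> t \<le> v \<and> v \<le> 1 \<and> v - u < d \<longrightarrow>
        (\<exists>(U, \<phi>)\<in>charts A. \<eta> ` {u..v} \<subseteq> U \<and> AC_on u v (\<phi> \<circ> \<eta>))"
      using d1(1) d2(1) by (intro exI[of _ "min d1 d2"]) simp
  qed simp
  then show ?thesis using ext cont by (simp add: AC_def)
qed

lemma AC_image:
  fixes A :: "('m, 'e::banach) chart set" and B :: "('n, 'f::banach) chart set"
  assumes A: "smooth_manifold A" and B: "smooth_manifold B" and \<eta>: "\<eta> \<in> AC A"
    and f: "\<And>t. t \<in> {0..1} \<Longrightarrow> C11_map_at A B f (\<eta> t)"
    and cont: "continuous_map (top_of_set {0..1}) (manifold_topology B) (\<lambda>t\<in>{0..1}. f (\<eta> t))"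
  shows "(\<lambda>t\<in>{0..1}. f (\<eta> t)) \<in> AC B"
proof (rule ACI[OF B _ cont])
  let ?\<zeta> = "\<lambda>t\<in>{0..1}. f (\<eta> t)"
  fix t V \<psi> assume t: "t \<in> {0..1}" and d: "(V, \<psi>) \<in> charts B" "?\<zeta> t \<in> V"
  obtain U \<phi> where c: "(U, \<phi>) \<in> charts A" "\<eta> t \<in> U" using chart_around[OF A AC_points[OF A \<eta> t]] by metis
  have ft: "f (\<eta> t) \<in> V" using d(2) t by simp
  note F = C11_map_at_charts[OF A B f[OF t] c d(1) ft]
  have "\<forall>\<^sub>F y in nhds (\<phi> (\<eta> t)). C11_at (\<psi> \<circ> f \<circ> inv_into U \<phi>) y"
    by (rule C11_at_eventually[OF F(2)])
  then obtain Y where Y: "open Y" "\<phi> (\<eta> t) \<in> Y" "\<And>y. y \<in> Y \<Longrightarrow> C11_at (\<psi> \<circ> f \<circ> inv_into U \<phi>) y"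
    unfolding eventually_nhds by blast
  obtain \<delta> where \<delta>: "\<delta> > 0" "\<forall>s\<in>{0..1}. \<bar>s - t\<bar> < \<delta> \<longrightarrow> \<eta> s \<in> U \<inter> \<phi> -` Y"
    using curve_neighbourhood[OF AC_continuous_map[OF \<eta>] chart_preimage_open[OF A c(1) Y(1)] t] c(2) Y(2) by blast
  have "AC_on u v (\<psi> \<circ> ?\<zeta>)" if uv: "0 \<le> u" "u \<le> t" "t \<le> v" "v \<le> 1" "v - u < \<delta>" for u v
  proof -
    have in_U: "\<eta> s \<in> U" "\<phi> (\<eta> s) \<in> Y" if "s \<in> {u..v}" for s using \<delta>(2) uv that by auto
    have "AC_on u v (\<phi> \<circ> \<eta>)"
      by (rule AC_chart_AC_on[OF A \<eta> c(1)]) (use uv in_U in auto)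
    then show ?thesis
    proof (rule AC_on_chain[rotated])
      fix s assume s: "s \<in> {u..v}"
      show "C11_at (\<psi> \<circ> f \<circ> inv_into U \<phi>) ((\<phi> \<circ> \<eta>) s)" using Y(3) in_U(2)[OF s] by simp
      show "(\<psi> \<circ> f \<circ> inv_into U \<phi>) ((\<phi> \<circ> \<eta>) s) = (\<psi> \<circ> ?\<zeta>) s"
        using chart_inv_into[OF c(1) in_U(1)[OF s]] s uv by simp
    qed (use uv in simp)
  qed
  then show "\<exists>d>0. \<forall>u v. 0 \<le> u \<and> u \<le> t \<and> t \<le> v \<and> v \<le> 1 \<and> v - u < d \<longrightarrow>
      ?\<zeta> ` {u..v} \<subseteq> V \<longrightarrow> AC_on u v (\<psi> \<circ> ?\<zeta>)" using \<delta>(1) by blast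
qed simp

lemma regulated_on_Pair:
  assumes "a \<le> b" "regulated_on a b f" "regulated_on a b g"
  shows "regulated_on a b (\<lambda>t. (f t, g t))"
proof -
  have "regulated_on a b (\<lambda>t. (f t, 0) + (0, g t))"
    by (intro regulated_on_add regulated_on_bounded_linear[OF _ assms(1,2)] regulated_on_bounded_linear[OF _ assms(1,3)]
        bounded_linear_Pair bounded_linear_ident bounded_linear_zero)
  then show ?thesis by simp
qed

lemma AC_on_Pair:
  fixes x :: "real \<Rightarrow> 'e::banach" and y :: "real \<Rightarrow> 'f::banach"
  assumes uv: "u \<le> v" and "AC_on u v x" "AC_on u v y"
  shows "AC_on u v (\<lambda>t. (x t, y t))"
proof -
  obtain \<gamma> \<delta> where \<gamma>: "has_reg_derivative x \<gamma> u v" and \<delta>: "has_reg_derivative y \<delta> u v"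
    using assms by (auto simp: AC_on_def)
  obtain D where D: "countable D" "\<And>t. t \<in> {u<..<v} - D \<Longrightarrow> (x has_vector_derivative \<gamma> t) (at t)"
    by (rule has_reg_derivative_imp_derivative[OF uv \<gamma>]) blast
  obtain D' where D': "countable D'" "\<And>t. t \<in> {u<..<v} - D' \<Longrightarrow> (y has_vector_derivative \<delta> t) (at t)"
    by (rule has_reg_derivative_imp_derivative[OF uv \<delta>]) blast
  have "has_reg_derivative (\<lambda>t. (x t, y t)) (\<lambda>t. (\<gamma> t, \<delta> t)) u v"
    using \<gamma> \<delta> D D'
    by (intro has_reg_derivativeI[where D = "D \<union> D'"] continuous_on_Pair regulated_on_Pair uv has_vector_derivative_Pair)
      (auto simp: has_reg_derivative_def)
  then show ?thesis by (auto simp: AC_on_def)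
qed

lemma AC_Pair:
  fixes A :: "('m, 'e::banach) chart set" and B :: "('n, 'f::banach) chart set"
  assumes A: "smooth_manifold A" and B: "smooth_manifold B" and \<eta>: "\<eta> \<in> AC A" and \<zeta>: "\<zeta> \<in> AC B"
  shows "(\<lambda>t\<in>{0..1}. (\<eta> t, \<zeta> t)) \<in> AC (prod_atlas A B)"
proof -
  let ?\<theta> = "\<lambda>t\<in>{0..1}. (\<eta> t, \<zeta> t)"
  note M = smooth_manifold_prod_atlas[OF A B]
  have "continuous_map (top_of_set {0..1}) (manifold_topology (prod_atlas A B)) (\<lambda>t. (\<eta> t, \<zeta> t))"
    unfolding manifold_topology_prod_atlas[OF A B]
    by (intro continuous_map_pairedI AC_continuous_map \<eta> \<zeta>)
  then have cont: "continuous_map (top_of_set {0..1}) (manifold_topology (prod_atlas A B)) ?\<theta>"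
    by (rule continuous_map_eq) auto
  have "\<exists>P. partition_of 0 1 P \<and> (\<forall>u v. consecutive P u v \<longrightarrow>
      (\<exists>(U, \<phi>)\<in>charts (prod_atlas A B). ?\<theta> ` {u..v} \<subseteq> U \<and> AC_on u v (\<phi> \<circ> ?\<theta>)))"
  proof (rule partition_exists)
    fix t :: real assume t: "t \<in> {0..1}"
    obtain U \<phi> where c: "(U, \<phi>) \<in> charts A" "\<eta> t \<in> U" using chart_around[OF A AC_points[OF A \<eta> t]] by metis
    obtain V \<psi> where d: "(V, \<psi>) \<in> charts B" "\<zeta> t \<in> V" using chart_around[OF B AC_points[OF B \<zeta> t]] by metis
    obtain d1 where d1: "d1 > 0" "\<forall>s\<in>{0..1}. \<bar>s - t\<bar> < d1 \<longrightarrow> \<eta> s \<in> U"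
      using curve_neighbourhood[OF AC_continuous_map[OF \<eta>] chart_domain_open[OF A c(1)] t c(2)] by blast
    obtain d2 where d2: "d2 > 0" "\<forall>s\<in>{0..1}. \<bar>s - t\<bar> < d2 \<longrightarrow> \<zeta> s \<in> V"
      using curve_neighbourhood[OF AC_continuous_map[OF \<zeta>] chart_domain_open[OF B d(1)] t d(2)] by blast
    have "\<exists>(U, \<phi>)\<in>charts (prod_atlas A B). ?\<theta> ` {u..v} \<subseteq> U \<and> AC_on u v (\<phi> \<circ> ?\<theta>)"
      if uv: "0 \<le> u" "u \<le> t" "t \<le> v" "v \<le> 1" "v - u < min d1 d2" for u v
    proof (rule bexI[OF _ prod_chart_in_charts[OF A B c(1) d(1)]], unfold prod.case, rule conjI)
      have uv': "u \<le> v" using uv by simp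
      have sub: "\<eta> ` {u..v} \<subseteq> U" "\<zeta> ` {u..v} \<subseteq> V" using d1(2) d2(2) uv by auto
      then show "?\<theta> ` {u..v} \<subseteq> U \<times> V" using uv by auto
      have "AC_on u v (\<lambda>t. ((\<phi> \<circ> \<eta>) t, (\<psi> \<circ> \<zeta>) t))"
        by (intro AC_on_Pair uv' AC_chart_AC_on[OF A \<eta> c(1)] AC_chart_AC_on[OF B \<zeta> d(1)] sub uv)
      then show "AC_on u v (map_prod \<phi> \<psi> \<circ> ?\<theta>)"
        unfolding AC_on_def by (elim exE) (rule exI, erule has_reg_derivative_cong, use uv in auto)
    qed
    then show "\<exists>d>0. \<forall>u v. 0 \<le> u \<and> u \<le> t \<and> t \<le> v \<and> v \<le> 1 \<and> v - u < d \<longrightarrow>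
        (\<exists>(U, \<phi>)\<in>charts (prod_atlas A B). ?\<theta> ` {u..v} \<subseteq> U \<and> AC_on u v (\<phi> \<circ> ?\<theta>))"
      using d1(1) d2(1) by (intro exI[of _ "min d1 d2"]) simp
  qed simp
  then show ?thesis using cont by (simp add: AC_def)
qed

section \<open>Ordinary differential equations with regulated controls\<close>

lemma integral_norm_le_length:
  fixes f :: "real \<Rightarrow> 'e::banach"
  assumes "a \<le> b" "f integrable_on {a..b}" "\<And>t. t \<in> {a..b} \<Longrightarrow> norm (f t) \<le> B"
  shows "norm (integral {a..b} f) \<le> (b - a) * B"
proof -
  have "norm (integral {a..b} f) \<le> integral {a..b} (\<lambda>_. B)"
    by (rule integral_norm_bound_integral) (use assms in auto)
  then show ?thesis using assms(1) by simp
qed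

text \<open>Picard iteration. The equation is linear in the control, so jumps of \<gamma> do no
  harm; bound and Lipschitz constant of \<open>A\<close> give invariance of the ball and contraction
  by the factor 1/2 under the two smallness conditions.\<close>

theorem regulated_ODE_solution:
  fixes A :: "'e::banach \<Rightarrow> 'v::real_normed_vector \<Rightarrow>\<^sub>L 'e" and \<gamma> :: "real \<Rightarrow> 'v"
  assumes ab: "a \<le> b" and r: "r > 0" and K: "K \<ge> 0"
    and bd: "\<And>x. x \<in> cball p r \<Longrightarrow> norm (A x) \<le> K"
    and lip: "\<And>x y. x \<in> cball p r \<Longrightarrow> y \<in> cball p r \<Longrightarrow> norm (A x - A y) \<le> K * norm (x - y)"
    and \<gamma>: "regulated_on a b \<gamma>" and M: "M \<ge> 0" "\<And>t. t \<in> {a..b} \<Longrightarrow> norm (\<gamma> t) \<le> M"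
    and small: "(b - a) * (K * M) \<le> r" "(b - a) * (K * M) \<le> 1 / 2"
  obtains u where "u a = p" "\<And>t. t \<in> {a..b} \<Longrightarrow> u t \<in> cball p r"
    "has_reg_derivative u (\<lambda>t. A (u t) (\<gamma> t)) a b"
proof -
  \<comment> \<open>Clamping the time extends curves on \<open>{a..b}\<close> to the whole line, so
    that the fixed point can be sought among the bounded continuous functions.\<close>
  define c where "c t = max a (min b t)" for t
  have c: "c t \<in> {a..b}" for t using ab by (auto simp: c_def)
  have cid: "t \<in> {a..b} \<Longrightarrow> c t = t" for t by (auto simp: c_def)
  define S where "S = {u :: real \<Rightarrow>\<^sub>C 'e. \<forall>t. u t \<in> cball p r}"
  define P where "P u t = p + integral {a..c t} (\<lambda>s. A (u s) (\<gamma> s))" for u :: "real \<Rightarrow>\<^sub>C 'e" and t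
  have Acont: "continuous_on (cball p r) A"
    by (rule lipschitz_on_continuous_on[of K], rule lipschitz_onI) (use lip K in \<open>auto simp: dist_norm\<close>)
  have reg: "regulated_on a b (\<lambda>s. A (u s) (\<gamma> s))" if "u \<in> S" for u
  proof (rule regulated_on_blinfun[OF ab _ \<gamma>])
    show "continuous_on {a..b} (\<lambda>s. A (u s))"
      by (rule continuous_on_compose2[OF Acont])
        (use that in \<open>auto simp: S_def intro!: continuous_on_apply_bcontfun continuous_intros\<close>)
  qed
  have int: "(\<lambda>s. A (u s) (\<gamma> s)) integrable_on {a..t}" if "u \<in> S" "t \<in> {a..b}" for u t
    by (rule regulated_on_integrable, use that in simp, rule regulated_on_subinterval[OF reg[OF that(1)]])
      (use that in auto)
  have Pc: "continuous_on UNIV (P u)" if "u \<in> S" for u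
  proof -
    have "continuous_on {a..b} (\<lambda>t. integral {a..t} (\<lambda>s. A (u s) (\<gamma> s)))"
      using indefinite_integral_continuous_1[OF int[OF that]] ab by simp
    then have "continuous_on UNIV (\<lambda>t. integral {a..c t} (\<lambda>s. A (u s) (\<gamma> s)))"
      by (rule continuous_on_compose2[where f = c]) (use c in \<open>auto simp: c_def intro!: continuous_intros\<close>)
    then show ?thesis unfolding P_def[abs_def] by (intro continuous_intros)
  qed
  have KM: "(c t - a) * (K * M) \<le> (b - a) * (K * M)" for t
    using c[of t] K M(1) by (intro mult_right_mono) auto
  have Pin: "P u t \<in> cball p r" if u: "u \<in> S" for u t
  proof -
    have "norm (integral {a..c t} (\<lambda>s. A (u s) (\<gamma> s))) \<le> (c t - a) * (K * M)"
    proof (rule integral_norm_le_length[OF _ int[OF u c]])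
      fix s assume "s \<in> {a..c t}"
      then have "s \<in> {a..b}" using c[of t] by auto
      moreover have "u s \<in> cball p r" using u by (auto simp: S_def)
      ultimately show "norm (A (u s) (\<gamma> s)) \<le> K * M"
        using norm_blinfun[of "A (u s)" "\<gamma> s"] mult_mono[OF bd M(2) K norm_ge_zero] by (meson order_trans)
    qed (use c[of t] in simp)
    then show ?thesis using KM[of t] small(1) by (simp add: P_def dist_norm)
  qed
  have Pb: "P u \<in> bcontfun" if "u \<in> S" for u
  proof (rule bcontfun_normI)
    show "norm (P u t) \<le> norm p + r" for t
      using Pin[OF that, of t] norm_triangle_sub[of "P u t" p] by (simp add: dist_norm norm_minus_commute)
  qed (rule Pc[OF that])
  have PB: "apply_bcontfun (Bcontfun (P u)) = P u" if "u \<in> S" for u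
    using Bcontfun_inverse[OF Pb[OF that]] .
  have "\<exists>!u\<in>S. Bcontfun (P u) = u"
  proof (rule Banach_fix[of S "1/2"])
    \<comment> \<open>This form shows that \<open>S\<close> is closed in the space of bounded
      continuous functions, hence complete.\<close>
    have "S = PiC UNIV (\<lambda>_. cball p r)" by (auto simp: S_def mem_PiC_iff Pi_iff)
    then show "complete S" by (simp add: closed_PiC complete_eq_closed)
    have "const_bcontfun p \<in> S" using r by (simp add: S_def)
    then show "S \<noteq> {}" by blast
    show "(\<lambda>u. Bcontfun (P u)) ` S \<subseteq> S" using PB Pin by (auto simp: S_def)
    show "dist (Bcontfun (P u)) (Bcontfun (P w)) \<le> 1 / 2 * dist u w" if u: "u \<in> S" and w: "w \<in> S" for u w
    proof (rule dist_bound)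
      fix t
      have "P u t - P w t = integral {a..c t} (\<lambda>s. A (u s) (\<gamma> s) - A (w s) (\<gamma> s))"
        using Henstock_Kurzweil_Integration.integral_diff[OF int[OF u c] int[OF w c], of t] by (simp add: P_def)
      also have "norm \<dots> \<le> (c t - a) * (K * M * dist u w)"
      proof (rule integral_norm_le_length)
        show "(\<lambda>s. A (u s) (\<gamma> s) - A (w s) (\<gamma> s)) integrable_on {a..c t}"
          by (intro integrable_diff int u w c)
        fix s assume "s \<in> {a..c t}"
        then have s: "s \<in> {a..b}" using c[of t] by auto
        have "norm (A (u s) (\<gamma> s) - A (w s) (\<gamma> s)) \<le> norm (A (u s) - A (w s)) * norm (\<gamma> s)"
          using norm_blinfun[of "A (u s) - A (w s)" "\<gamma> s"] by (simp add: blinfun.diff_left)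
        also have "\<dots> \<le> (K * norm (u s - w s)) * M"
          by (intro mult_mono lip M(2) s mult_nonneg_nonneg K) (use u w in \<open>auto simp: S_def\<close>)
        also have "\<dots> \<le> (K * dist u w) * M"
          using dist_fun_lt_imp_dist_val_lt dist_bounded[of u s w] K M(1)
          by (intro mult_right_mono mult_left_mono) (auto simp: dist_norm)
        finally show "norm (A (u s) (\<gamma> s) - A (w s) (\<gamma> s)) \<le> K * M * dist u w" by (simp add: mult_ac)
      qed (use c[of t] in simp)
      also have "\<dots> = (c t - a) * (K * M) * dist u w" by simp
      also have "\<dots> \<le> 1 / 2 * dist u w"
        using KM[of t] small(2) by (intro mult_right_mono) auto
      finally show "dist (Bcontfun (P u) t) (Bcontfun (P w) t) \<le> 1 / 2 * dist u w"
        by (simp add: PB u w dist_norm)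
    qed
  qed auto
  then obtain u where u: "u \<in> S" "Bcontfun (P u) = u" by blast
  have ueq: "u t = P u t" for t using PB[OF u(1)] u(2) by simp
  have ut: "u t - u a = integral {a..t} (\<lambda>s. A (u s) (\<gamma> s))" and ua: "u a = p" if "t \<in> {a..b}" for t
    using ueq[of t] ueq[of a] cid[OF that] cid[of a] ab by (simp_all add: P_def)
  show ?thesis
  proof (rule that[of u])
    show "u a = p" by (rule ua[of a]) (use ab in simp)
    show "u t \<in> cball p r" for t using u(1) by (simp add: S_def)
    show "has_reg_derivative u (\<lambda>t. A (u t) (\<gamma> t)) a b"
      unfolding has_reg_derivative_def
    proof (intro conjI reg[OF u(1)] ballI)
      show "continuous_on {a..b} u" by (intro continuous_on_apply_bcontfun continuous_intros)
      fix s assume s: "s \<in> {a..b}"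
      show "((\<lambda>t. A (u t) (\<gamma> t)) has_integral u s - u a) {a..s}"
        unfolding ut[OF s] by (rule integrable_integral[OF int[OF u(1) s]])
    qed
  qed
qed

section \<open>Banach--Lie groups in charts\<close>

lemma has_vector_derivative_eventually_cong:
  assumes "(f has_vector_derivative d) (at t)" "\<forall>\<^sub>F s in nhds t. f s = g s"
  shows "(g has_vector_derivative d) (at t)"
  using assms(1) unfolding has_vector_derivative_def
  by (rule has_derivative_transform_eventually)
    (use assms(2) eventually_nhds_x_imp_x[OF assms(2)] in \<open>auto simp: eventually_nhds_conv_at\<close>)

text \<open>The chart \<kappa> identifies the Lie algebra with the model space. It is not
  normalized: the unit has the coordinate \<open>\<kappa> \<one>\<close>, which may differ from
  0.\<close>

locale banach_lie_group = group L for L :: "('m, 'e::banach) mgroup" (structure) +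
  fixes K :: "'m set" and \<kappa> :: "'m \<Rightarrow> 'e"
  assumes lie: "Lie_group L" and kappa: "(K, \<kappa>) \<in> charts (atlas L)" and one_K: "\<one> \<in> K"
begin

lemma mani: "smooth_manifold (atlas L)" and pts: "points (atlas L) = carrier L"
  using lie by (auto simp: Lie_group_def)

lemmas mani2 = smooth_manifold_prod_atlas[OF mani mani]

section \<open>Regularity of the group operations\<close>

lemma C11_map_at_mult:
  assumes B: "smooth_manifold B" and f: "C11_map_at B (atlas L) f x" and g: "C11_map_at B (atlas L) g x"
  shows "C11_map_at B (atlas L) (\<lambda>x. f x \<otimes> g x) x"
proof -
  have "smooth_map (prod_atlas (atlas L) (atlas L)) (atlas L) (\<lambda>(x, y). x \<otimes> y)"
    using lie by (simp add: Lie_group_def)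
  then have "C11_map_at (prod_atlas (atlas L) (atlas L)) (atlas L) (\<lambda>(x, y). x \<otimes> y) (f x, g x)"
    by (rule smooth_map_imp_C11_map_at[OF mani2 mani])
      (use C11_map_atD_points(2)[OF f] C11_map_atD_points(2)[OF g] in \<open>simp add: points_prod_atlas\<close>)
  from C11_map_at_compose[OF B mani2 mani C11_map_at_Pair[OF B mani mani f g] this]
  show ?thesis by simp
qed

lemma C11_map_at_inv:
  assumes B: "smooth_manifold B" and f: "C11_map_at B (atlas L) f x"
  shows "C11_map_at B (atlas L) (\<lambda>x. inv (f x)) x"
proof -
  have "smooth_map (atlas L) (atlas L) (\<lambda>x. inv x)" using lie by (simp add: Lie_group_def)
  then have "C11_map_at (atlas L) (atlas L) (\<lambda>x. inv x) (f x)"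
    by (rule smooth_map_imp_C11_map_at[OF mani mani _ C11_map_atD_points(2)[OF f]])
  from C11_map_at_compose[OF B mani mani f this] show ?thesis by simp
qed

lemma continuous_map_mult:
  assumes f: "continuous_map X (group_topology L) f" and g: "continuous_map X (group_topology L) g"
  shows "continuous_map X (group_topology L) (\<lambda>x. f x \<otimes> g x)"
proof -
  have "continuous_map (prod_topology (group_topology L) (group_topology L)) (group_topology L) (\<lambda>(x, y). x \<otimes> y)"
    using lie by (simp add: Lie_group_def smooth_map_def manifold_topology_prod_atlas[OF mani mani])
  from continuous_map_compose[OF continuous_map_pairedI[OF f g] this] show ?thesis by (simp add: o_def)
qed

lemma continuous_map_inv:
  assumes f: "continuous_map X (group_topology L) f"
  shows "continuous_map X (group_topology L) (\<lambda>x. inv (f x))"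
proof -
  have "continuous_map (group_topology L) (group_topology L) (\<lambda>x. inv x)"
    using lie by (simp add: Lie_group_def smooth_map_def)
  from continuous_map_compose[OF f this] show ?thesis by (simp add: o_def)
qed

lemma chart_carrier: "(U, \<phi>) \<in> charts (atlas L) \<Longrightarrow> x \<in> U \<Longrightarrow> x \<in> carrier L"
  using chart_points pts by blast

definition quotient_in_chart :: "'m set \<Rightarrow> ('m \<Rightarrow> 'e) \<Rightarrow> 'e \<times> 'e \<times> 'e \<Rightarrow> 'e" where
  "quotient_in_chart U \<phi> = (\<lambda>(x, z, y). \<phi> (inv (inv_into K \<kappa> x) \<otimes> (inv_into U \<phi> z \<otimes> inv_into K \<kappa> y)))"

lemma C11_at_quotient_in_chart:
  assumes c: "(U, \<phi>) \<in> charts (atlas L)" and h: "h \<in> U"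
  shows "C11_at (quotient_in_chart U \<phi>) (\<kappa> \<one>, \<phi> h, \<kappa> \<one>)"
proof -
  let ?A = "atlas L"
  let ?M = "prod_atlas ?A (prod_atlas ?A ?A)"
  note M = smooth_manifold_prod_atlas[OF mani mani2]
  have hc: "h \<in> carrier L" by (rule chart_carrier[OF c h])
  have x: "(\<one>, h, \<one>) \<in> points ?M" using hc by (simp add: points_prod_atlas pts)
  let ?f = "\<lambda>x. inv (fst x) \<otimes> (fst (snd x) \<otimes> snd (snd x))"
  have x2: "snd (\<one>, h, \<one>) \<in> points (prod_atlas ?A ?A)" using hc by (simp add: points_prod_atlas pts)
  have snd: "C11_map_at ?M (prod_atlas ?A ?A) snd (\<one>, h, \<one>)"
    by (rule C11_map_at_fst(2)[OF mani mani2 x])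
  have f: "C11_map_at ?M ?A ?f (\<one>, h, \<one>)"
    by (intro C11_map_at_mult C11_map_at_inv M C11_map_at_fst(1)[OF mani mani2 x]
        C11_map_at_compose[OF M mani2 mani snd C11_map_at_fst(1)[OF mani mani x2]]
        C11_map_at_compose[OF M mani2 mani snd C11_map_at_fst(2)[OF mani mani x2]])
  note d1 = prod_chart_in_charts[OF mani mani c kappa]
  note d = prod_chart_in_charts[OF mani mani2 kappa d1]
  have fh: "?f (\<one>, h, \<one>) \<in> U" using h hc by simp
  have "(\<one>, h, \<one>) \<in> K \<times> U \<times> K" using h one_K by simp
  from C11_map_at_charts(2)[OF M mani f d this c fh]
  have "C11_at (\<phi> \<circ> ?f \<circ> inv_into (K \<times> U \<times> K) (map_prod \<kappa> (map_prod \<phi> \<kappa>))) (\<kappa> \<one>, \<phi> h, \<kappa> \<one>)"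
    by (simp only: map_prod_simp)
  moreover have "\<forall>\<^sub>F p in nhds (\<kappa> \<one>, \<phi> h, \<kappa> \<one>). p \<in> \<kappa> ` K \<times> \<phi> ` U \<times> \<kappa> ` K"
    using one_K h by (intro eventually_nhds_in_open open_Times chart_open_image[OF kappa] chart_open_image[OF c]) auto
  then have "\<forall>\<^sub>F p in nhds (\<kappa> \<one>, \<phi> h, \<kappa> \<one>).
      (\<phi> \<circ> ?f \<circ> inv_into (K \<times> U \<times> K) (map_prod \<kappa> (map_prod \<phi> \<kappa>))) p = quotient_in_chart U \<phi> p"
  proof eventually_elim
    case (elim p)
    then obtain x z y where p: "p = (x, z, y)" "x \<in> \<kappa> ` K" "z \<in> \<phi> ` U" "y \<in> \<kappa> ` K" by auto
    have "inv_into (U \<times> K) (map_prod \<phi> \<kappa>) (z, y) = (inv_into U \<phi> z, inv_into K \<kappa> y)"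
      by (rule inv_into_map_prod[OF chart_inj[OF c] chart_inj[OF kappa] p(3,4)])
    moreover have "(z, y) \<in> map_prod \<phi> \<kappa> ` (U \<times> K)" using p by auto
    ultimately have "inv_into (K \<times> U \<times> K) (map_prod \<kappa> (map_prod \<phi> \<kappa>)) p = (inv_into K \<kappa> x, inv_into U \<phi> z, inv_into K \<kappa> y)"
      using inv_into_map_prod[OF chart_inj[OF kappa] chart_inj[OF d1] p(2)] p(1) by simp
    then show ?case by (simp add: quotient_in_chart_def p(1))
  qed
  ultimately show ?thesis by (rule C11_at_cong)
qed

text \<open>Velocity, in the chart \<open>\<phi>\<close>, of \<open>\<eta>\<^sub>0(t)\<^sup>-\<^sup>1 \<eta>(t)\<close> at a point \<open>z\<close> of the chart, as a function of the
  logarithmic derivatives of \<open>\<eta>\<^sub>0\<close> and \<open>\<eta>\<close>.\<close>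

definition quotient_velocity :: "'m set \<Rightarrow> ('m \<Rightarrow> 'e) \<Rightarrow> 'e \<Rightarrow> ('e \<times> 'e) \<Rightarrow>\<^sub>L 'e" where
  "quotient_velocity U \<phi> z = fderiv (quotient_in_chart U \<phi>) (\<kappa> \<one>, z, \<kappa> \<one>) o\<^sub>L Blinfun (\<lambda>p. (fst p, 0, snd p))"

lemma Blinfun_pad: "blinfun_apply (Blinfun (\<lambda>p :: 'e \<times> 'e. (fst p, 0 :: 'e, snd p))) = (\<lambda>p. (fst p, 0, snd p))"
  by (rule bounded_linear_Blinfun_apply)
    (intro bounded_linear_Pair bounded_linear_fst bounded_linear_snd bounded_linear_zero)

lemma norm_Blinfun_pad: "norm (Blinfun (\<lambda>p :: 'e \<times> 'e. (fst p, 0 :: 'e, snd p))) \<le> 1"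
  by (rule norm_blinfun_bound) (auto simp: Blinfun_pad norm_Pair)

lemma quotient_velocity_apply:
  "quotient_velocity U \<phi> z p = fderiv (quotient_in_chart U \<phi>) (\<kappa> \<one>, z, \<kappa> \<one>) (fst p, 0, snd p)"
  by (simp add: quotient_velocity_def Blinfun_pad)

text \<open>These are the estimates that Picard iteration and the Gronwall argument consume; they
  come from the C11 property of \<open>quotient_in_chart\<close> at the point where both increments
  are trivial.\<close>

lemma quotient_velocity_lipschitz:
  assumes c: "(U, \<phi>) \<in> charts (atlas L)" and h: "h \<in> U"
  obtains r C where "r > 0" "C \<ge> 0" "ball (\<phi> h) r \<subseteq> \<phi> ` U"
    "\<And>z. z \<in> ball (\<phi> h) r \<Longrightarrow> norm (quotient_velocity U \<phi> z) \<le> C"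
    "\<And>z w. z \<in> ball (\<phi> h) r \<Longrightarrow> w \<in> ball (\<phi> h) r \<Longrightarrow>
       norm (quotient_velocity U \<phi> z - quotient_velocity U \<phi> w) \<le> C * norm (z - w)"
proof -
  obtain r0 where r0: "r0 > 0" "ball (\<phi> h) r0 \<subseteq> \<phi> ` U"
    using chart_open_image[OF c] h unfolding open_contains_ball by blast
  let ?F = "fderiv (quotient_in_chart U \<phi>)"
  obtain r C where r: "r > 0" "r \<le> r0" "C \<ge> 0"
    "\<And>y z. y \<in> ball (\<kappa> \<one>, \<phi> h, \<kappa> \<one>) r \<Longrightarrow> z \<in> ball (\<kappa> \<one>, \<phi> h, \<kappa> \<one>) r \<Longrightarrow> norm (?F y - ?F z) \<le> C * norm (y - z)"
    "\<And>y. y \<in> ball (\<kappa> \<one>, \<phi> h, \<kappa> \<one>) r \<Longrightarrow> norm (?F y) \<le> C"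
    by (rule C11_atE[OF C11_at_quotient_in_chart[OF c h] r0(1)]) metis
  have mem: "(\<kappa> \<one>, z, \<kappa> \<one>) \<in> ball (\<kappa> \<one>, \<phi> h, \<kappa> \<one>) r" if "z \<in> ball (\<phi> h) r" for z
    using that by (simp add: dist_Pair_Pair)
  have le: "norm (T o\<^sub>L Blinfun (\<lambda>p :: 'e \<times> 'e. (fst p, 0 :: 'e, snd p))) \<le> norm T" for T :: "('e \<times> 'e \<times> 'e) \<Rightarrow>\<^sub>L 'e"
    using norm_blinfun_compose[of T "Blinfun (\<lambda>p :: 'e \<times> 'e. (fst p, 0 :: 'e, snd p))"]
      mult_left_mono[OF norm_Blinfun_pad, of "norm T"] by simp
  show ?thesis
  proof (rule that[OF r(1,3)])
    show "ball (\<phi> h) r \<subseteq> \<phi> ` U" using r0 r(2) by (meson ball_subset_ball_iff order_trans subset_ball)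
    fix z assume z: "z \<in> ball (\<phi> h) r"
    show "norm (quotient_velocity U \<phi> z) \<le> C"
      unfolding quotient_velocity_def using le r(5)[OF mem[OF z]] by (rule order_trans)
    fix w assume w: "w \<in> ball (\<phi> h) r"
    have "quotient_velocity U \<phi> z - quotient_velocity U \<phi> w =
        (?F (\<kappa> \<one>, z, \<kappa> \<one>) - ?F (\<kappa> \<one>, w, \<kappa> \<one>)) o\<^sub>L Blinfun (\<lambda>p. (fst p, 0, snd p))"
      by (rule blinfun_eqI) (simp add: quotient_velocity_def blinfun.diff_left)
    then have "norm (quotient_velocity U \<phi> z - quotient_velocity U \<phi> w) \<le> norm (?F (\<kappa> \<one>, z, \<kappa> \<one>) - ?F (\<kappa> \<one>, w, \<kappa> \<one>))"
      using le by simp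
    also have "\<dots> \<le> C * norm ((\<kappa> \<one>, z, \<kappa> \<one>) - (\<kappa> \<one>, w, \<kappa> \<one>))" by (rule r(4)[OF mem[OF z] mem[OF w]])
    finally show "norm (quotient_velocity U \<phi> z - quotient_velocity U \<phi> w) \<le> C * norm (z - w)"
      by (simp add: norm_Pair)
  qed
qed

lemma continuous_on_quotient_velocity:
  assumes c: "(U, \<phi>) \<in> charts (atlas L)"
  shows "continuous_on (\<phi> ` U) (quotient_velocity U \<phi>)"
proof (rule continuous_at_imp_continuous_on, clarify)
  fix h assume h: "h \<in> U"
  obtain r C where r: "r > 0" "C \<ge> 0" "\<And>z w. z \<in> ball (\<phi> h) r \<Longrightarrow> w \<in> ball (\<phi> h) r \<Longrightarrow>
       norm (quotient_velocity U \<phi> z - quotient_velocity U \<phi> w) \<le> C * norm (z - w)"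
    by (rule quotient_velocity_lipschitz[OF c h]) metis
  have "C-lipschitz_on (ball (\<phi> h) r) (quotient_velocity U \<phi>)"
    by (rule lipschitz_onI) (use r in \<open>auto simp: dist_norm\<close>)
  then have "continuous_on (ball (\<phi> h) r) (quotient_velocity U \<phi>)" by (rule lipschitz_on_continuous_on)
  then show "isCont (quotient_velocity U \<phi>) (\<phi> h)" using r(1) by (simp add: continuous_on_eq_continuous_at)
qed

text \<open>The logarithmic derivative at \<open>t\<close>, read from the increment
  \<open>inv (\<eta> t) \<otimes> \<eta> s\<close> in the fixed chart at the unit. Left translations
  leave this increment unchanged and homomorphisms map it to the increment of the image curve, so
  that no chart around \<open>\<eta> t\<close> enters.\<close>

definition log_deriv_at :: "(real \<Rightarrow> 'm) \<Rightarrow> real \<Rightarrow> 'e \<Rightarrow> bool" where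
  "log_deriv_at \<eta> t v \<longleftrightarrow> (\<forall>\<^sub>F s in nhds t. \<eta> s \<in> carrier L \<and> inv (\<eta> t) \<otimes> \<eta> s \<in> K) \<and>
     ((\<lambda>s. \<kappa> (inv (\<eta> t) \<otimes> \<eta> s)) has_vector_derivative v) (at t)"

lemma log_deriv_at_carrier: "log_deriv_at \<eta> t v \<Longrightarrow> \<eta> t \<in> carrier L"
  unfolding log_deriv_at_def using eventually_nhds_x_imp_x by blast

lemma log_deriv_at_unique: "log_deriv_at \<eta> t v \<Longrightarrow> log_deriv_at \<eta> t w \<Longrightarrow> v = w"
  unfolding log_deriv_at_def using vector_derivative_unique_at by blast

lemma log_deriv_at_cong:
  assumes \<eta>: "log_deriv_at \<eta> t v" and eq: "\<forall>\<^sub>F s in nhds t. \<eta> s = \<zeta> s"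
  shows "log_deriv_at \<zeta> t v"
proof -
  have t: "\<zeta> t = \<eta> t" using eventually_nhds_x_imp_x[OF eq] by simp
  have "\<forall>\<^sub>F s in nhds t. \<zeta> s \<in> carrier L \<and> inv (\<zeta> t) \<otimes> \<zeta> s \<in> K"
    using \<eta>[unfolded log_deriv_at_def, THEN conjunct1] eq by eventually_elim (simp add: t)
  moreover have "((\<lambda>s. \<kappa> (inv (\<zeta> t) \<otimes> \<zeta> s)) has_vector_derivative v) (at t)"
    using \<eta>[unfolded log_deriv_at_def, THEN conjunct2]
    by (rule has_vector_derivative_eventually_cong) (use eq t in \<open>auto elim: eventually_mono\<close>)
  ultimately show ?thesis by (simp add: log_deriv_at_def)
qed

lemma log_deriv_at_left_mult:
  assumes \<eta>: "log_deriv_at \<eta> t v" and a: "a \<in> carrier L"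
  shows "log_deriv_at (\<lambda>s. a \<otimes> \<eta> s) t v"
proof -
  note c = log_deriv_at_carrier[OF \<eta>]
  have eq: "inv (a \<otimes> \<eta> t) \<otimes> (a \<otimes> x) = inv (\<eta> t) \<otimes> x" if "x \<in> carrier L" for x
  proof -
    have "inv a \<otimes> (a \<otimes> x) = x" using a that by (simp add: m_assoc[symmetric])
    then show ?thesis using a c that by (simp add: inv_mult_group m_assoc)
  qed
  have ev: "\<forall>\<^sub>F s in nhds t. a \<otimes> \<eta> s \<in> carrier L \<and> inv (a \<otimes> \<eta> t) \<otimes> (a \<otimes> \<eta> s) = inv (\<eta> t) \<otimes> \<eta> s \<and> inv (\<eta> t) \<otimes> \<eta> s \<in> K"
    using \<eta>[unfolded log_deriv_at_def, THEN conjunct1] by eventually_elim (use a eq in simp)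
  have "((\<lambda>s. \<kappa> (inv (a \<otimes> \<eta> t) \<otimes> (a \<otimes> \<eta> s))) has_vector_derivative v) (at t)"
    using \<eta>[unfolded log_deriv_at_def, THEN conjunct2]
    by (rule has_vector_derivative_eventually_cong) (use ev in \<open>auto elim: eventually_mono\<close>)
  moreover have "\<forall>\<^sub>F s in nhds t. a \<otimes> \<eta> s \<in> carrier L \<and> inv (a \<otimes> \<eta> t) \<otimes> (a \<otimes> \<eta> s) \<in> K"
    using ev by eventually_elim simp
  ultimately show ?thesis by (simp add: log_deriv_at_def)
qed

lemma log_deriv_at_const:
  assumes a: "a \<in> carrier L" shows "log_deriv_at (\<lambda>_. a) t 0"
  unfolding log_deriv_at_def using a one_K by simp

text \<open>Near \<open>t\<close> the two curves enter only through their increments, whose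
  derivatives are \<open>v0\<close> and \<open>v\<close> by definition of
  \<open>log_deriv_at\<close>; the middle argument of \<open>quotient_in_chart\<close> is constant
  and contributes 0.\<close>

theorem quotient_derivative:
  assumes c: "(U, \<phi>) \<in> charts (atlas L)"
    and \<eta>0: "log_deriv_at \<eta>0 t v0" and \<eta>: "log_deriv_at \<eta> t v" and U: "inv (\<eta>0 t) \<otimes> \<eta> t \<in> U"
  shows "((\<lambda>s. \<phi> (inv (\<eta>0 s) \<otimes> \<eta> s)) has_vector_derivative
      quotient_velocity U \<phi> (\<phi> (inv (\<eta>0 t) \<otimes> \<eta> t)) (v0, v)) (at t)"
proof -
  let ?h = "inv (\<eta>0 t) \<otimes> \<eta> t"
  let ?w = "\<lambda>s. \<kappa> (inv (\<eta>0 t) \<otimes> \<eta>0 s)" and ?x = "\<lambda>s. \<kappa> (inv (\<eta> t) \<otimes> \<eta> s)"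
  note car = log_deriv_at_carrier[OF \<eta>0] log_deriv_at_carrier[OF \<eta>]
  let ?y = "\<lambda>s. (?w s, \<phi> ?h, ?x s)"
  have y: "(?y has_vector_derivative (v0, 0, v)) (at t)"
    by (rule has_vector_derivative_Pair[OF \<eta>0[unfolded log_deriv_at_def, THEN conjunct2]
          has_vector_derivative_Pair[OF has_vector_derivative_const \<eta>[unfolded log_deriv_at_def, THEN conjunct2]]])
  have yt: "?y t = (\<kappa> \<one>, \<phi> ?h, \<kappa> \<one>)" using car by simp
  have "((\<lambda>s. quotient_in_chart U \<phi> (?y s)) has_vector_derivative
      fderiv (quotient_in_chart U \<phi>) (?y t) (v0, 0, v)) (at t)"
    by (rule vector_derivative_chain_C11[OF _ y], unfold yt, rule C11_at_quotient_in_chart[OF c U])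
  then have D: "((\<lambda>s. quotient_in_chart U \<phi> (?y s)) has_vector_derivative
      quotient_velocity U \<phi> (\<phi> ?h) (v0, v)) (at t)"
    by (simp only: yt quotient_velocity_apply fst_conv snd_conv)
  have ev: "\<forall>\<^sub>F s in nhds t. quotient_in_chart U \<phi> (?y s) = \<phi> (inv (\<eta>0 s) \<otimes> \<eta> s)"
    using \<eta>0[unfolded log_deriv_at_def, THEN conjunct1] \<eta>[unfolded log_deriv_at_def, THEN conjunct1]
  proof eventually_elim
    case (elim s)
    have a: "inv (inv (\<eta>0 t) \<otimes> \<eta>0 s) = inv (\<eta>0 s) \<otimes> \<eta>0 t"
      using elim car by (simp add: inv_mult_group)
    have b: "\<eta> t \<otimes> (inv (\<eta> t) \<otimes> \<eta> s) = \<eta> s" using elim car by (simp add: m_assoc[symmetric])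
    have c': "\<eta>0 t \<otimes> (inv (\<eta>0 t) \<otimes> \<eta> s) = \<eta> s" using elim car by (simp add: m_assoc[symmetric])
    have "inv (inv (\<eta>0 t) \<otimes> \<eta>0 s) \<otimes> (?h \<otimes> (inv (\<eta> t) \<otimes> \<eta> s)) = inv (\<eta>0 s) \<otimes> \<eta> s"
      unfolding a using elim car by (simp add: m_assoc b c')
    then show ?case
      using elim by (simp add: quotient_in_chart_def chart_inv_into[OF kappa] chart_inv_into[OF c U])
  qed
  show ?thesis
    using D ev by (rule has_vector_derivative_eventually_cong)
qed

text \<open>The case of the constant curve \<one> as \<open>\<eta>0\<close>. The resulting velocity
  is the left invariant vector field of \<open>v\<close>, in the chart \<phi>.\<close>

corollary curve_derivative:
  assumes c: "(U, \<phi>) \<in> charts (atlas L)" and \<eta>: "log_deriv_at \<eta> t v" and U: "\<eta> t \<in> U"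
  shows "((\<phi> \<circ> \<eta>) has_vector_derivative quotient_velocity U \<phi> (\<phi> (\<eta> t)) (0, v)) (at t)"
proof -
  have ct: "\<eta> t \<in> carrier L" by (rule log_deriv_at_carrier[OF \<eta>])
  have ev: "\<forall>\<^sub>F s in nhds t. \<phi> (inv \<one> \<otimes> \<eta> s) = (\<phi> \<circ> \<eta>) s"
    using \<eta>[unfolded log_deriv_at_def, THEN conjunct1] by eventually_elim simp
  have "((\<lambda>s. \<phi> (inv \<one> \<otimes> \<eta> s)) has_vector_derivative quotient_velocity U \<phi> (\<phi> (inv \<one> \<otimes> \<eta> t)) (0, v)) (at t)"
    by (rule quotient_derivative[OF c log_deriv_at_const[OF one_closed] \<eta>]) (use U ct in simp)
  then have "((\<lambda>s. \<phi> (inv \<one> \<otimes> \<eta> s)) has_vector_derivative quotient_velocity U \<phi> (\<phi> (\<eta> t)) (0, v)) (at t)"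
    using ct by simp
  then show ?thesis using ev by (rule has_vector_derivative_eventually_cong)
qed

text \<open>The quotient of a curve by itself is constant. Consequently the velocity of a quotient
  near the unit is governed by the distance to the unit and by the difference of the two
  controls.\<close>

lemma quotient_velocity_diagonal:
  assumes c: "(U, \<phi>) \<in> charts (atlas L)" and U: "\<one> \<in> U"
  shows "quotient_velocity U \<phi> (\<phi> \<one>) (w, w) = 0"
proof -
  let ?\<eta> = "\<lambda>s. inv_into K \<kappa> (\<kappa> \<one> + s *\<^sub>R w)"
  have ev: "\<forall>\<^sub>F s in nhds 0. \<kappa> \<one> + s *\<^sub>R w \<in> \<kappa> ` K"
    by (rule eventually_line_in_open[OF chart_open_image[OF kappa]]) (use one_K in simp)
  have 0: "?\<eta> 0 = \<one>" using chart_inv_into[OF kappa one_K] by simp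
  have ev2: "\<forall>\<^sub>F s in nhds 0. ?\<eta> s \<in> K \<and> ?\<eta> s \<in> carrier L \<and> \<kappa> (?\<eta> s) = \<kappa> \<one> + s *\<^sub>R w"
    using ev by eventually_elim (auto simp: inv_into_into f_inv_into_f intro: chart_carrier[OF kappa inv_into_into])
  have "log_deriv_at ?\<eta> 0 w"
    unfolding log_deriv_at_def 0
  proof
    show "\<forall>\<^sub>F s in nhds 0. ?\<eta> s \<in> carrier L \<and> inv \<one> \<otimes> ?\<eta> s \<in> K" using ev2 by eventually_elim simp
    have "((\<lambda>s. \<kappa> \<one> + s *\<^sub>R w) has_vector_derivative w) (at 0)" by (auto intro!: derivative_eq_intros)
    moreover have ev3: "\<forall>\<^sub>F s in nhds 0. \<kappa> \<one> + s *\<^sub>R w = \<kappa> (inv \<one> \<otimes> ?\<eta> s)"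
      using ev2 by eventually_elim simp
    ultimately show "((\<lambda>s. \<kappa> (inv \<one> \<otimes> ?\<eta> s)) has_vector_derivative w) (at 0)"
      by (rule has_vector_derivative_eventually_cong)
  qed
  from quotient_derivative[OF c this this] U
  have D: "((\<lambda>s. \<phi> (inv (?\<eta> s) \<otimes> ?\<eta> s)) has_vector_derivative quotient_velocity U \<phi> (\<phi> \<one>) (w, w)) (at 0)"
    unfolding 0 by simp
  have ev4: "\<forall>\<^sub>F s in nhds 0. \<phi> (inv (?\<eta> s) \<otimes> ?\<eta> s) = \<phi> \<one>"
    using ev2 by eventually_elim simp
  have "((\<lambda>s. \<phi> \<one>) has_vector_derivative quotient_velocity U \<phi> (\<phi> \<one>) (w, w)) (at 0)"
    using D ev4 by (rule has_vector_derivative_eventually_cong)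
  then show ?thesis using vector_derivative_unique_at has_vector_derivative_const by blast
qed

lemma translate_chart_C11:
  assumes c: "(U, \<phi>) \<in> charts (atlas L)" and h: "h \<in> U"
  shows "C11_at (\<lambda>y. \<kappa> (inv h \<otimes> inv_into U \<phi> y)) (\<phi> h)"
    and "\<forall>\<^sub>F y in nhds (\<phi> h). inv h \<otimes> inv_into U \<phi> y \<in> K"
proof -
  have hc: "h \<in> carrier L" by (rule chart_carrier[OF c h])
  have f: "C11_map_at (atlas L) (atlas L) (\<lambda>x. inv h \<otimes> x) h"
    by (intro C11_map_at_mult C11_map_at_const C11_map_at_id mani) (use hc pts in auto)
  have "inv h \<otimes> h \<in> K" using hc one_K by simp
  from C11_map_at_charts[OF mani mani f c h kappa this]
  show "C11_at (\<lambda>y. \<kappa> (inv h \<otimes> inv_into U \<phi> y)) (\<phi> h)"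
    "\<forall>\<^sub>F y in nhds (\<phi> h). inv h \<otimes> inv_into U \<phi> y \<in> K" by (simp_all add: o_def)
qed

text \<open>The derivative at \<open>h\<close> of left translation by \<open>inv h\<close>, from the
  chart \<phi> to \<kappa>; it turns chart velocities into logarithmic derivatives.\<close>

definition log_chart :: "'m set \<Rightarrow> ('m \<Rightarrow> 'e) \<Rightarrow> 'm \<Rightarrow> 'e \<Rightarrow>\<^sub>L 'e" where
  "log_chart U \<phi> h = fderiv (\<lambda>y. \<kappa> (inv h \<otimes> inv_into U \<phi> y)) (\<phi> h)"

lemma log_deriv_at_chart:
  assumes c: "(U, \<phi>) \<in> charts (atlas L)" and U: "\<forall>\<^sub>F s in nhds t. \<eta> s \<in> U"
    and D: "((\<phi> \<circ> \<eta>) has_vector_derivative w) (at t)"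
  shows "log_deriv_at \<eta> t (log_chart U \<phi> (\<eta> t) w)"
proof -
  have t: "\<eta> t \<in> U" by (rule eventually_nhds_x_imp_x[OF U])
  note T = translate_chart_C11[OF c t]
  have "((\<lambda>s. \<kappa> (inv (\<eta> t) \<otimes> inv_into U \<phi> ((\<phi> \<circ> \<eta>) s))) has_vector_derivative log_chart U \<phi> (\<eta> t) w) (at t)"
    using vector_derivative_chain_C11[of "\<lambda>y. \<kappa> (inv (\<eta> t) \<otimes> inv_into U \<phi> y)" "\<phi> \<circ> \<eta>", OF _ D] T(1)
    by (simp add: log_chart_def)
  moreover have ev: "\<forall>\<^sub>F s in nhds t. \<kappa> (inv (\<eta> t) \<otimes> inv_into U \<phi> ((\<phi> \<circ> \<eta>) s)) = \<kappa> (inv (\<eta> t) \<otimes> \<eta> s)"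
    using U by eventually_elim (simp add: chart_inv_into[OF c])
  ultimately have 1: "((\<lambda>s. \<kappa> (inv (\<eta> t) \<otimes> \<eta> s)) has_vector_derivative log_chart U \<phi> (\<eta> t) w) (at t)"
    by (rule has_vector_derivative_eventually_cong)
  have "isCont (\<phi> \<circ> \<eta>) t" by (rule has_vector_derivative_continuous[OF D])
  then have "filterlim (\<phi> \<circ> \<eta>) (nhds (\<phi> (\<eta> t))) (nhds t)"
    using tendsto_at_iff_tendsto_nhds[of "\<phi> \<circ> \<eta>" t] by (simp add: isCont_def)
  from eventually_compose_filterlim[OF T(2) this] U
  have "\<forall>\<^sub>F s in nhds t. \<eta> s \<in> carrier L \<and> inv (\<eta> t) \<otimes> \<eta> s \<in> K"
    by eventually_elim (use chart_inv_into[OF c] chart_carrier[OF c] in simp)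
  with 1 show ?thesis by (simp add: log_deriv_at_def)
qed

text \<open>Both identities come from uniqueness of derivatives along a test curve: the left
  translate by \<open>h\<close> of a straight line in \<kappa> for the first, a straight line in the
  chart \<phi> for the second.\<close>

lemma log_chart_inverse:
  assumes c: "(U, \<phi>) \<in> charts (atlas L)" and h: "h \<in> U"
  shows "log_chart U \<phi> h (quotient_velocity U \<phi> (\<phi> h) (0, v)) = v"
    and "quotient_velocity U \<phi> (\<phi> h) (0, log_chart U \<phi> h w) = w"
proof -
  let ?\<eta> = "\<lambda>w s. inv_into U \<phi> (\<phi> h + s *\<^sub>R w)"
  have inU: "\<forall>\<^sub>F s in nhds 0. ?\<eta> w s \<in> U \<and> \<phi> (?\<eta> w s) = \<phi> h + s *\<^sub>R w" for w
    using eventually_line_in_open[OF chart_open_image[OF c], of "\<phi> h" w] h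
    by (auto elim!: eventually_mono simp: inv_into_into f_inv_into_f)
  have h0: "?\<eta> w 0 = h" for w using chart_inv_into[OF c h] by simp
  have D: "((\<phi> \<circ> ?\<eta> w) has_vector_derivative w) (at 0)" for w
  proof -
    have "((\<lambda>s. \<phi> h + s *\<^sub>R w) has_vector_derivative w) (at 0)" by (auto intro!: derivative_eq_intros)
    moreover have ev: "\<forall>\<^sub>F s in nhds 0. \<phi> h + s *\<^sub>R w = (\<phi> \<circ> ?\<eta> w) s" using inU[of w] by eventually_elim simp
    ultimately show ?thesis by (rule has_vector_derivative_eventually_cong)
  qed
  have lw: "log_deriv_at (?\<eta> w) 0 (log_chart U \<phi> h w)" for w
  proof -
    have "\<forall>\<^sub>F s in nhds 0. ?\<eta> w s \<in> U" using inU[of w] by eventually_elim simp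
    from log_deriv_at_chart[OF c this D[of w]] show ?thesis unfolding h0 .
  qed
  have "((\<phi> \<circ> ?\<eta> w) has_vector_derivative quotient_velocity U \<phi> (\<phi> h) (0, log_chart U \<phi> h w)) (at 0)"
    using curve_derivative[OF c lw[of w]] h unfolding h0 by blast
  then show "quotient_velocity U \<phi> (\<phi> h) (0, log_chart U \<phi> h w) = w"
    by (rule vector_derivative_unique_at[OF _ D])
  have hc: "h \<in> carrier L" by (rule chart_carrier[OF c h])
  let ?\<zeta> = "\<lambda>s. h \<otimes> inv_into K \<kappa> (\<kappa> \<one> + s *\<^sub>R v)"
  have ev: "\<forall>\<^sub>F s in nhds 0. inv_into K \<kappa> (\<kappa> \<one> + s *\<^sub>R v) \<in> K \<and> \<kappa> (inv_into K \<kappa> (\<kappa> \<one> + s *\<^sub>R v)) = \<kappa> \<one> + s *\<^sub>R v"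
    using eventually_line_in_open[OF chart_open_image[OF kappa], of "\<kappa> \<one>" v] one_K
    by (auto elim!: eventually_mono simp: inv_into_into f_inv_into_f)
  have z0: "?\<zeta> 0 = h" using chart_inv_into[OF kappa one_K] hc by simp
  have "log_deriv_at ?\<zeta> 0 v"
    unfolding log_deriv_at_def z0
  proof
    have eq: "inv h \<otimes> (h \<otimes> x) = x" if "x \<in> K" for x
      using chart_carrier[OF kappa that] hc by (simp add: m_assoc[symmetric])
    show "\<forall>\<^sub>F s in nhds 0. ?\<zeta> s \<in> carrier L \<and> inv h \<otimes> ?\<zeta> s \<in> K"
      using ev by eventually_elim (use eq hc chart_carrier[OF kappa] in auto)
    have "((\<lambda>s. \<kappa> \<one> + s *\<^sub>R v) has_vector_derivative v) (at 0)" by (auto intro!: derivative_eq_intros)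
    moreover have ev3: "\<forall>\<^sub>F s in nhds 0. \<kappa> \<one> + s *\<^sub>R v = \<kappa> (inv h \<otimes> ?\<zeta> s)"
      using ev by eventually_elim (simp add: eq)
    ultimately show "((\<lambda>s. \<kappa> (inv h \<otimes> ?\<zeta> s)) has_vector_derivative v) (at 0)"
      by (rule has_vector_derivative_eventually_cong)
  qed
  note lv = this
  let ?w = "quotient_velocity U \<phi> (\<phi> h) (0, v)"
  have Dz: "((\<phi> \<circ> ?\<zeta>) has_vector_derivative ?w) (at 0)"
    using curve_derivative[OF c lv] h unfolding z0 by blast
  have f: "C11_map_at (atlas L) (atlas L) (\<lambda>x. h \<otimes> x) \<one>"
    by (intro C11_map_at_mult C11_map_at_const C11_map_at_id mani) (use hc pts in auto)
  have "h \<otimes> \<one> \<in> U" using h hc by simp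
  from C11_map_at_charts(1)[OF mani mani f kappa one_K c this]
  have "\<forall>\<^sub>F y in nhds (\<kappa> \<one>). h \<otimes> inv_into K \<kappa> y \<in> U" .
  moreover have "filterlim (\<lambda>s. \<kappa> \<one> + s *\<^sub>R v) (nhds (\<kappa> \<one>)) (nhds 0)"
  proof -
    have "isCont (\<lambda>s. \<kappa> \<one> + s *\<^sub>R v) 0" by (intro continuous_intros)
    then show ?thesis using tendsto_at_iff_tendsto_nhds[of "\<lambda>s. \<kappa> \<one> + s *\<^sub>R v" 0] by (simp add: isCont_def)
  qed
  ultimately have "\<forall>\<^sub>F s in nhds 0. ?\<zeta> s \<in> U" by (rule eventually_compose_filterlim)
  from log_deriv_at_chart[OF c this Dz] show "log_chart U \<phi> h ?w = v"
    using log_deriv_at_unique[OF lv] unfolding z0 by metis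
qed

end

section \<open>Evolution in Banach--Lie groups\<close>

text \<open>Instead of differentiating the norm, the maximum \<open>m\<close> of the weighted
  deviation is estimated. The weight decays at the rate \<open>2 * k\<close>, so integrating the
  term with \<open>k\<close> returns only \<open>m / 2\<close>; absorbing it gives
  \<open>m \<le> 2 * d\<close>.\<close>

lemma weighted_gronwall:
  fixes x :: "real \<Rightarrow> 'e::banach"
  assumes x: "has_reg_derivative x g 0 s" and s: "0 \<le> s" "s \<le> 1" and k: "k > 0" and d: "d \<ge> 0"
    and Z: "negligible Z" "\<And>t. t \<in> {0<..<s} - Z \<Longrightarrow> norm (g t) \<le> k * norm (x t - x 0) + d"
    and t: "t \<in> {0..s}"
  shows "norm (x t - x 0) \<le> 2 * d * exp (2 * k)"
proof -
  define w where "w t = norm (x t - x 0)" for t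
  have cx: "continuous_on {0..s} x" using x by (simp add: has_reg_derivative_def)
  have cw: "continuous_on {0..s} w" unfolding w_def by (intro continuous_intros cx)
  have "continuous_on {0..s} (\<lambda>t. exp (- (2 * k * t)) * w t)" by (intro continuous_intros cw)
  then obtain t0 where t0: "t0 \<in> {0..s}" "\<And>t. t \<in> {0..s} \<Longrightarrow> exp (- (2 * k * t)) * w t \<le> exp (- (2 * k * t0)) * w t0"
    using continuous_attains_sup[of "{0..s}" "\<lambda>t. exp (- (2 * k * t)) * w t"] s by auto
  define m where "m = exp (- (2 * k * t0)) * w t0"
  have m0: "m \<ge> 0" by (simp add: m_def w_def)
  have wm: "w t \<le> m * exp (2 * k * t)" if "t \<in> {0..s}" for t
  proof -
    have "exp (2 * k * t) * (exp (- (2 * k * t)) * w t) \<le> exp (2 * k * t) * m"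
      unfolding m_def by (rule mult_left_mono[OF t0(2)[OF that]]) simp
    moreover have "exp (2 * k * t) * (exp (- (2 * k * t)) * w t) = w t"
      by (simp add: mult.assoc[symmetric] exp_add[symmetric])
    ultimately have "w t \<le> exp (2 * k * t) * m" by linarith
    then show ?thesis by (simp only: mult.commute[of m])
  qed
  have "m \<le> d + m / 2"
  proof -
    let ?G = "\<lambda>t. k * (m * exp (2 * k * t)) + d"
    have "(?G has_integral ((m / 2) * exp (2 * k * t0) + d * t0 - ((m / 2) * exp (2 * k * 0) + d * 0))) {0..t0}"
      by (rule fundamental_theorem_of_calculus)
        (use t0 k in \<open>auto intro!: derivative_eq_intros simp: has_real_derivative_iff_has_vector_derivative[symmetric]\<close>)
    then have G: "?G integrable_on {0..t0}" "integral {0..t0} ?G = (m / 2) * exp (2 * k * t0) + d * t0 - m / 2"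
      by (auto simp: integral_unique)
    have "w t0 \<le> integral {0..t0} ?G"
      unfolding w_def
    proof (rule has_reg_derivative_norm_bound[OF x t0(1) G(1) Z(1)])
      fix t assume t: "t \<in> {0<..<t0} - Z"
      have "k * norm (x t - x 0) \<le> k * (m * exp (2 * k * t))"
        using wm[of t] t t0(1) k by (simp add: w_def)
      then show "norm (g t) \<le> ?G t" using Z(2)[of t] t t0(1) by auto
    qed (use k m0 d in auto)
    also have "\<dots> \<le> (m / 2) * exp (2 * k * t0) + d"
      unfolding G(2) using m0 d t0(1) s mult_left_mono[of t0 1 d] by simp
    also have "\<dots> \<le> (m / 2) * exp (2 * k * t0) + d * exp (2 * k * t0)"
      using d k t0(1) mult_left_mono[of 1 "exp (2 * k * t0)" d] by simp
    finally have "exp (- (2 * k * t0)) * w t0 \<le> exp (- (2 * k * t0)) * ((m / 2 + d) * exp (2 * k * t0))"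
      by (intro mult_left_mono) (auto simp: algebra_simps)
    also have "\<dots> = m / 2 + d" by (simp add: exp_minus field_simps)
    finally show ?thesis by (simp add: m_def)
  qed
  then have m2: "m \<le> 2 * d" by simp
  have "w t \<le> m * exp (2 * k * t)" by (rule wm[OF t])
  also have "\<dots> \<le> 2 * d * exp (2 * k)"
    using m2 m0 d t s k by (intro mult_mono) auto
  finally show ?thesis by (simp add: w_def)
qed

lemma continuous_map_from_chart:
  assumes A: "smooth_manifold A" and c: "(U, \<phi>) \<in> charts A"
    and u: "continuous_on S u" "u ` S \<subseteq> \<phi> ` U"
  shows "continuous_map (top_of_set S) (manifold_topology A) (\<lambda>t. inv_into U \<phi> (u t))"
  unfolding continuous_map_def
proof (intro conjI allI impI)
  show "(\<lambda>t. inv_into U \<phi> (u t)) \<in> topspace (top_of_set S) \<rightarrow> topspace (manifold_topology A)"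
    unfolding topspace_manifold_topology[OF A]
  proof (rule Pi_I)
    fix t assume "t \<in> topspace (top_of_set S)"
    then have "u t \<in> \<phi> ` U" using u(2) by auto
    from inv_into_into[OF this] show "inv_into U \<phi> (u t) \<in> points A" by (rule subsetD[OF chart_points[OF c]])
  qed
  fix W assume W: "openin (manifold_topology A) W"
  have "openin (top_of_set S) (S \<inter> u -` (\<phi> ` (W \<inter> U)))"
    by (rule continuous_openin_preimage_gen[OF u(1) chart_image_open[OF A c W]])
  also have "S \<inter> u -` (\<phi> ` (W \<inter> U)) = {t \<in> topspace (top_of_set S). inv_into U \<phi> (u t) \<in> W}"
  proof (rule Set.set_eqI)
    fix t
    show "t \<in> S \<inter> u -` (\<phi> ` (W \<inter> U)) \<longleftrightarrow> t \<in> {t \<in> topspace (top_of_set S). inv_into U \<phi> (u t) \<in> W}"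
    proof (cases "t \<in> S")
      case True
      then obtain h where h: "h \<in> U" "u t = \<phi> h" using u(2) by blast
      have "\<phi> h \<in> \<phi> ` (W \<inter> U) \<longleftrightarrow> h \<in> W" using h(1) chart_inj[OF c] by (auto dest: inj_onD)
      then show ?thesis using True h chart_inv_into[OF c h(1)] by simp
    qed simp
  qed
  finally show "openin (top_of_set S) {t \<in> topspace (top_of_set S). inv_into U \<phi> (u t) \<in> W}" .
qed

context banach_lie_group
begin

section \<open>Evolutions as solutions of the logarithmic differential equation\<close>

abbreviation curve :: "real \<Rightarrow> real \<Rightarrow> (real \<Rightarrow> 'm) \<Rightarrow> bool" where
  "curve a b \<eta> \<equiv> continuous_map (top_of_set {a..b}) (group_topology L) \<eta>"

lemma topspace_L: "topspace (group_topology L) = carrier L"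
  by (simp add: topspace_manifold_topology[OF mani] pts)

lemma curve_carrier: "curve a b \<eta> \<Longrightarrow> t \<in> {a..b} \<Longrightarrow> \<eta> t \<in> carrier L"
  using topspace_L by (auto simp: continuous_map_def)

lemma curve_const: "h \<in> carrier L \<Longrightarrow> curve a b (\<lambda>_. h)"
  by (simp add: topspace_L)

text \<open>The control is a function and not a class in \<open>regR\<close>, because twisting by
  \<open>daction\<close> acts on functions.\<close>

definition evolution :: "(real \<Rightarrow> 'e) \<Rightarrow> (real \<Rightarrow> 'm) \<Rightarrow> bool" where
  "evolution \<gamma> \<eta> \<longleftrightarrow> \<eta> \<in> AC (atlas L) \<and> \<eta> 0 = \<one> \<and>
     (AE t in lebesgue_on {0..1}. log_deriv_at \<eta> t (\<gamma> t))"

lemma AC_mult: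
  assumes "\<eta> \<in> AC (atlas L)" "\<zeta> \<in> AC (atlas L)"
  shows "pw_mult L \<eta> \<zeta> \<in> AC (atlas L)"
proof -
  let ?\<theta> = "\<lambda>t\<in>{0..1}. (\<eta> t, \<zeta> t)"
  have \<theta>: "?\<theta> \<in> AC (prod_atlas (atlas L) (atlas L))" by (rule AC_Pair[OF mani mani assms])
  have "(\<lambda>t\<in>{0..1}. (\<lambda>p. fst p \<otimes> snd p) (?\<theta> t)) \<in> AC (atlas L)"
  proof (rule AC_image[OF mani2 mani \<theta>])
    fix t :: real assume t: "t \<in> {0..1}"
    note x = AC_points[OF mani2 \<theta> t]
    show "C11_map_at (prod_atlas (atlas L) (atlas L)) (atlas L) (\<lambda>p. fst p \<otimes> snd p) (?\<theta> t)"
      by (intro C11_map_at_mult mani2 C11_map_at_fst[OF mani mani x])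
  next
    have "curve 0 1 (\<lambda>t. \<eta> t \<otimes> \<zeta> t)"
      by (intro continuous_map_mult AC_continuous_map assms)
    then show "curve 0 1 (\<lambda>t\<in>{0..1}. (\<lambda>p. fst p \<otimes> snd p) (?\<theta> t))"
      by (rule continuous_map_eq) simp
  qed
  moreover have "(\<lambda>t\<in>{0..1}. (\<lambda>p. fst p \<otimes> snd p) (?\<theta> t)) = pw_mult L \<eta> \<zeta>"
    by (auto simp: pw_mult_def)
  ultimately show ?thesis by simp
qed

lemma AC_inv:
  assumes "\<eta> \<in> AC (atlas L)" shows "(\<lambda>t\<in>{0..1}. inv (\<eta> t)) \<in> AC (atlas L)"
proof (rule AC_image[OF mani mani assms])
  show "C11_map_at (atlas L) (atlas L) (m_inv L) (\<eta> t)" if "t \<in> {0..1}" for t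
    by (intro C11_map_at_inv mani C11_map_at_id AC_points[OF mani assms that])
  have "curve 0 1 (\<lambda>t. inv (\<eta> t))" by (intro continuous_map_inv AC_continuous_map assms)
  then show "curve 0 1 (\<lambda>t\<in>{0..1}. inv (\<eta> t))" by (rule continuous_map_eq) simp
qed

definition quotient_curve :: "(real \<Rightarrow> 'm) \<Rightarrow> (real \<Rightarrow> 'm) \<Rightarrow> (real \<Rightarrow> 'm)" where
  "quotient_curve \<eta>0 \<eta> = (\<lambda>t\<in>{0..1}. inv (\<eta>0 t) \<otimes> \<eta> t)"

lemma AC_quotient_curve:
  assumes "\<eta>0 \<in> AC (atlas L)" "\<eta> \<in> AC (atlas L)"
  shows "quotient_curve \<eta>0 \<eta> \<in> AC (atlas L)"
proof -
  have "pw_mult L (\<lambda>t\<in>{0..1}. inv (\<eta>0 t)) \<eta> = quotient_curve \<eta>0 \<eta>"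
    by (auto simp: pw_mult_def quotient_curve_def)
  then show ?thesis using AC_mult[OF AC_inv[OF assms(1)] assms(2)] by simp
qed

lemma regulated_quotient_velocity:
  assumes c: "(U, \<phi>) \<in> charts (atlas L)" and uv: "u \<le> v"
    and x: "continuous_on {u..v} x" "x ` {u..v} \<subseteq> \<phi> ` U"
    and \<gamma>: "regulated_on u v \<gamma>0" "regulated_on u v \<gamma>"
  shows "regulated_on u v (\<lambda>t. quotient_velocity U \<phi> (x t) (\<gamma>0 t, \<gamma> t))"
  by (intro regulated_on_blinfun[OF uv] regulated_on_Pair[OF uv] \<gamma>
      continuous_on_compose2[OF continuous_on_quotient_velocity[OF c] x])

text \<open>A derivative known almost everywhere would not determine the quotient, so absolute
  continuity comes first: it supplies some regulated derivative, which
  \<open>quotient_derivative\<close> identifies almost everywhere with the stated one.\<close>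

lemma quotient_has_reg_derivative:
  assumes c: "(U, \<phi>) \<in> charts (atlas L)"
    and \<eta>0: "\<eta>0 \<in> AC (atlas L)" "AE t in lebesgue_on {0..1}. log_deriv_at \<eta>0 t (\<gamma>0 t)" "regulated_on 0 1 \<gamma>0"
    and \<eta>: "\<eta> \<in> AC (atlas L)" "AE t in lebesgue_on {0..1}. log_deriv_at \<eta> t (\<gamma> t)" "regulated_on 0 1 \<gamma>"
    and uv: "0 \<le> u" "u \<le> v" "v \<le> 1" and U: "\<And>t. t \<in> {u..v} \<Longrightarrow> inv (\<eta>0 t) \<otimes> \<eta> t \<in> U"
  shows "has_reg_derivative (\<phi> \<circ> quotient_curve \<eta>0 \<eta>)
     (\<lambda>t. quotient_velocity U \<phi> (\<phi> (quotient_curve \<eta>0 \<eta> t)) (\<gamma>0 t, \<gamma> t)) u v"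
proof -
  let ?\<zeta> = "quotient_curve \<eta>0 \<eta>"
  have \<zeta>: "?\<zeta> \<in> AC (atlas L)" by (rule AC_quotient_curve[OF \<eta>0(1) \<eta>(1)])
  have \<zeta>t: "?\<zeta> t = inv (\<eta>0 t) \<otimes> \<eta> t" if "t \<in> {0..1}" for t using that by (simp add: quotient_curve_def)
  have \<zeta>U: "?\<zeta> ` {u..v} \<subseteq> U" using U uv \<zeta>t by auto
  obtain \<gamma>' where \<gamma>': "has_reg_derivative (\<phi> \<circ> ?\<zeta>) \<gamma>' u v"
    using AC_chart_AC_on[OF mani \<zeta> c uv \<zeta>U] by (auto simp: AC_on_def)
  obtain D where D: "countable D" "\<And>t. t \<in> {u<..<v} - D \<Longrightarrow> ((\<phi> \<circ> ?\<zeta>) has_vector_derivative \<gamma>' t) (at t)"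
    by (rule has_reg_derivative_imp_derivative[OF uv(2) \<gamma>']) blast
  obtain Z where Z: "negligible Z" "\<And>t. t \<in> {0..1} - Z \<Longrightarrow> log_deriv_at \<eta>0 t (\<gamma>0 t)"
    using \<eta>0(2) unfolding AE_lebesgue_on_iff_negligible by blast
  obtain Z' where Z': "negligible Z'" "\<And>t. t \<in> {0..1} - Z' \<Longrightarrow> log_deriv_at \<eta> t (\<gamma> t)"
    using \<eta>(2) unfolding AE_lebesgue_on_iff_negligible by blast
  show ?thesis
  proof (rule has_reg_derivative_spike[OF \<gamma>'])
    have "continuous_on {u..v} (\<phi> \<circ> ?\<zeta>)" using \<gamma>' by (simp add: has_reg_derivative_def)
    from regulated_quotient_velocity[OF c uv(2) this _ regulated_on_subinterval[OF \<eta>0(3) uv] regulated_on_subinterval[OF \<eta>(3) uv]]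
    show "regulated_on u v (\<lambda>t. quotient_velocity U \<phi> (\<phi> (?\<zeta> t)) (\<gamma>0 t, \<gamma> t))"
      using \<zeta>U by fastforce
    show "negligible (D \<union> (Z \<union> Z'))"
      using D(1) Z(1) Z'(1) by (auto simp: negligible_iff_null_sets intro: countable_imp_null_set_lborel null_sets_completionI)
    fix t assume t: "t \<in> {u<..<v} - (D \<union> (Z \<union> Z'))"
    then have t01: "t \<in> {0..1}" "t \<in> {u..v}" using uv by auto
    have "((\<lambda>s. \<phi> (inv (\<eta>0 s) \<otimes> \<eta> s)) has_vector_derivative
        quotient_velocity U \<phi> (\<phi> (inv (\<eta>0 t) \<otimes> \<eta> t)) (\<gamma>0 t, \<gamma> t)) (at t)"
      by (rule quotient_derivative[OF c Z(2) Z'(2) U]) (use t t01 in auto)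
    moreover have "\<forall>\<^sub>F s in nhds t. s \<in> {u<..<v}" using t by (intro eventually_nhds_in_open) auto
    then have "\<forall>\<^sub>F s in nhds t. \<phi> (inv (\<eta>0 s) \<otimes> \<eta> s) = (\<phi> \<circ> ?\<zeta>) s"
      by eventually_elim (use uv in \<open>simp add: \<zeta>t\<close>)
    ultimately have "((\<phi> \<circ> ?\<zeta>) has_vector_derivative
        quotient_velocity U \<phi> (\<phi> (inv (\<eta>0 t) \<otimes> \<eta> t)) (\<gamma>0 t, \<gamma> t)) (at t)"
      by (rule has_vector_derivative_eventually_cong)
    moreover have "((\<phi> \<circ> ?\<zeta>) has_vector_derivative \<gamma>' t) (at t)" by (rule D(2)) (use t in auto)
    ultimately show "quotient_velocity U \<phi> (\<phi> (?\<zeta> t)) (\<gamma>0 t, \<gamma> t) = \<gamma>' t"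
      unfolding \<zeta>t[OF t01(1)] by (rule vector_derivative_unique_at)
  qed
qed

text \<open>Here the exceptional set is countable, so absolute continuity becomes a conclusion: in
  every chart \<open>curve_derivative\<close> provides the regulated derivative.\<close>

lemma AC_if_log_deriv:
  assumes ext: "\<eta> \<in> extensional {0..1}" and cont: "curve 0 1 \<eta>" and \<gamma>: "regulated_on 0 1 \<gamma>"
    and D: "countable D" "\<And>t. t \<in> {0<..<1} - D \<Longrightarrow> log_deriv_at \<eta> t (\<gamma> t)"
  shows "\<eta> \<in> AC (atlas L)"
proof (rule ACI[OF mani ext cont])
  fix t U \<phi> assume t: "t \<in> {0..1}" and c: "(U, \<phi>) \<in> charts (atlas L)" and "\<eta> t \<in> U"
  have "AC_on u v (\<phi> \<circ> \<eta>)" if uv: "0 \<le> u" "u \<le> v" "v \<le> 1" and U: "\<eta> ` {u..v} \<subseteq> U" for u v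
  proof -
    have x: "continuous_on {u..v} (\<phi> \<circ> \<eta>)"
      by (rule curve_in_chart_continuous[OF mani c cont _ U]) (use uv in auto)
    have "has_reg_derivative (\<phi> \<circ> \<eta>) (\<lambda>t. quotient_velocity U \<phi> ((\<phi> \<circ> \<eta>) t) (0, \<gamma> t)) u v"
    proof (rule has_reg_derivativeI[OF x _ D(1)])
      show "regulated_on u v (\<lambda>t. quotient_velocity U \<phi> ((\<phi> \<circ> \<eta>) t) (0, \<gamma> t))"
        by (rule regulated_quotient_velocity[OF c uv(2) x _ regulated_on_const[OF uv(2)] regulated_on_subinterval[OF \<gamma> uv]])
          (use U in auto)
      show "((\<phi> \<circ> \<eta>) has_vector_derivative quotient_velocity U \<phi> ((\<phi> \<circ> \<eta>) t) (0, \<gamma> t)) (at t)"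
        if "t \<in> {u<..<v} - D" for t
      proof -
        have "log_deriv_at \<eta> t (\<gamma> t)" by (rule D(2)) (use that uv in auto)
        moreover have "\<eta> t \<in> U" using U that by auto
        ultimately show ?thesis using curve_derivative[OF c] by simp
      qed
    qed
    then show ?thesis by (auto simp: AC_on_def)
  qed
  then show "\<exists>d>0. \<forall>u v. 0 \<le> u \<and> u \<le> t \<and> t \<le> v \<and> v \<le> 1 \<and> v - u < d \<longrightarrow>
      \<eta> ` {u..v} \<subseteq> U \<longrightarrow> AC_on u v (\<phi> \<circ> \<eta>)" by (intro exI[of _ 1]) auto
qed

text \<open>Picard iteration in the chart \<kappa>. The constant \<open>c\<close> is fixed before
  interval and control; this gives steps of uniform length for a given control and, for constant
  controls, segments over unit time that stay near the unit.\<close>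

lemma local_evolution:
  assumes \<rho>: "\<rho> > 0"
  obtains c where "c > 0" "\<And>a b \<gamma> M. a \<le> b \<Longrightarrow> M \<ge> 0 \<Longrightarrow> (b - a) * M \<le> c \<Longrightarrow> regulated_on a b \<gamma> \<Longrightarrow>
      (\<And>t. t \<in> {a..b} \<Longrightarrow> norm (\<gamma> t) \<le> M) \<Longrightarrow>
      \<exists>\<eta>. curve a b \<eta> \<and> \<eta> a = \<one> \<and> (\<forall>t\<in>{a..b}. \<eta> t \<in> K \<and> \<kappa> (\<eta> t) \<in> cball (\<kappa> \<one>) \<rho>) \<and>
        (\<exists>D. countable D \<and> (\<forall>t\<in>{a<..<b} - D. log_deriv_at \<eta> t (\<gamma> t)))"
proof -
  obtain r C where r: "r > 0" "C \<ge> 0" "ball (\<kappa> \<one>) r \<subseteq> \<kappa> ` K"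
    "\<And>z. z \<in> ball (\<kappa> \<one>) r \<Longrightarrow> norm (quotient_velocity K \<kappa> z) \<le> C"
    "\<And>z w. z \<in> ball (\<kappa> \<one>) r \<Longrightarrow> w \<in> ball (\<kappa> \<one>) r \<Longrightarrow>
       norm (quotient_velocity K \<kappa> z - quotient_velocity K \<kappa> w) \<le> C * norm (z - w)"
    by (rule quotient_velocity_lipschitz[OF kappa one_K]) blast
  \<comment> \<open>Half of \<open>r\<close>, so that the closed ball of the iteration lies in the
    open ball where the estimates hold; \<rho> limits how far the solution may move.\<close>
  define R where "R = min (r / 2) \<rho>"
  have R: "R > 0" using r(1) \<rho> by (simp add: R_def)
  have sub: "cball (\<kappa> \<one>) R \<subseteq> ball (\<kappa> \<one>) r" using r(1) by (auto simp: R_def)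
  \<comment> \<open>Chosen so that \<open>(b - a) * (C * M) \<le> min R (1 / 2)\<close>, which
    contains both smallness conditions of \<open>regulated_ODE_solution\<close>;
    \<open>C + 1\<close> avoids a division by 0.\<close>
  define c where "c = min R (1 / 2) / (C + 1)"
  have c: "c > 0" using R r(2) by (simp add: c_def)
  have Cc: "x * (C * M) \<le> min R (1 / 2)" if "x * M \<le> c" "x \<ge> 0" "M \<ge> 0" for x M
  proof -
    have "x * (C * M) = C * (x * M)" by simp
    also have "\<dots> \<le> C * c" by (intro mult_left_mono that r(2))
    also have "\<dots> \<le> (C + 1) * c" using c by (simp add: algebra_simps)
    also have "\<dots> = min R (1 / 2)" using r(2) by (simp add: c_def)
    finally show ?thesis .
  qed
  show ?thesis
  proof (rule that[OF c])
    fix a b M :: real and \<gamma> :: "real \<Rightarrow> 'e"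
    assume ab: "a \<le> b" and M: "M \<ge> 0" "(b - a) * M \<le> c" and \<gamma>: "regulated_on a b \<gamma>"
      and bd: "\<And>t. t \<in> {a..b} \<Longrightarrow> norm (\<gamma> t) \<le> M"
    have small: "(b - a) * (C * M) \<le> R" "(b - a) * (C * M) \<le> 1 / 2"
      using Cc[OF M(2) _ M(1)] ab by auto
    have \<gamma>0: "regulated_on a b (\<lambda>t. (0 :: 'e, \<gamma> t))"
      by (intro regulated_on_Pair ab regulated_on_const \<gamma>)
    obtain u where u: "u a = \<kappa> \<one>" "\<And>t. t \<in> {a..b} \<Longrightarrow> u t \<in> cball (\<kappa> \<one>) R"
      "has_reg_derivative u (\<lambda>t. quotient_velocity K \<kappa> (u t) (0, \<gamma> t)) a b"
    proof (rule regulated_ODE_solution[of a b R C "\<kappa> \<one>" "quotient_velocity K \<kappa>" "\<lambda>t. (0, \<gamma> t)" M, OF ab R r(2) _ _ \<gamma>0 M(1) _ small])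
      show "norm (quotient_velocity K \<kappa> z) \<le> C" if "z \<in> cball (\<kappa> \<one>) R" for z
        by (rule r(4)[OF subsetD[OF sub that]])
      show "norm (quotient_velocity K \<kappa> z - quotient_velocity K \<kappa> w) \<le> C * norm (z - w)"
        if "z \<in> cball (\<kappa> \<one>) R" "w \<in> cball (\<kappa> \<one>) R" for z w
        by (rule r(5)[OF subsetD[OF sub that(1)] subsetD[OF sub that(2)]])
      show "norm (0 :: 'e, \<gamma> t) \<le> M" if "t \<in> {a..b}" for t using bd[OF that] by (simp add: norm_Pair)
    qed blast
    let ?\<eta> = "\<lambda>t. inv_into K \<kappa> (u t)"
    have uK: "u t \<in> \<kappa> ` K" if "t \<in> {a..b}" for t using u(2)[OF that] sub r(3) by blast
    have \<eta>K: "?\<eta> t \<in> K" "\<kappa> (?\<eta> t) = u t" if "t \<in> {a..b}" for t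
      using uK[OF that] by (auto simp: inv_into_into f_inv_into_f)
    obtain D where D: "countable D" "\<And>t. t \<in> {a<..<b} - D \<Longrightarrow>
        (u has_vector_derivative quotient_velocity K \<kappa> (u t) (0, \<gamma> t)) (at t)"
      by (rule has_reg_derivative_imp_derivative[OF ab u(3)]) blast
    have "log_deriv_at ?\<eta> t (\<gamma> t)" if t: "t \<in> {a<..<b} - D" for t
    proof -
      have tab: "t \<in> {a..b}" using t by auto
      have ev: "\<forall>\<^sub>F s in nhds t. s \<in> {a<..<b}" using t by (intro eventually_nhds_in_open) auto
      have 1: "\<forall>\<^sub>F s in nhds t. ?\<eta> s \<in> K" using ev by eventually_elim (use \<eta>K(1) in simp)
      have "\<forall>\<^sub>F s in nhds t. u s = (\<kappa> \<circ> ?\<eta>) s" using ev by eventually_elim (use \<eta>K(2) in simp)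
      with D(2)[OF t] have "((\<kappa> \<circ> ?\<eta>) has_vector_derivative quotient_velocity K \<kappa> (u t) (0, \<gamma> t)) (at t)"
        by (rule has_vector_derivative_eventually_cong)
      from log_deriv_at_chart[OF kappa 1 this]
      show ?thesis using log_chart_inverse(1)[OF kappa \<eta>K(1)[OF tab]] \<eta>K(2)[OF tab] by simp
    qed
    moreover have "curve a b ?\<eta>"
      by (rule continuous_map_from_chart[OF mani kappa])
        (use u(3) uK in \<open>auto simp: has_reg_derivative_def\<close>)
    moreover have "?\<eta> a = \<one>" using u(1) chart_inv_into[OF kappa one_K] by simp
    moreover have "\<forall>t\<in>{a..b}. ?\<eta> t \<in> K \<and> \<kappa> (?\<eta> t) \<in> cball (\<kappa> \<one>) \<rho>"
      using \<eta>K u(2) by (auto simp: R_def)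
    ultimately show "\<exists>\<eta>. curve a b \<eta> \<and> \<eta> a = \<one> \<and> (\<forall>t\<in>{a..b}. \<eta> t \<in> K \<and> \<kappa> (\<eta> t) \<in> cball (\<kappa> \<one>) \<rho>) \<and>
        (\<exists>D. countable D \<and> (\<forall>t\<in>{a<..<b} - D. log_deriv_at \<eta> t (\<gamma> t)))"
      using D(1) by blast
  qed
qed

lemma evolutionI:
  assumes cont: "curve 0 1 \<eta>" and \<eta>0: "\<eta> 0 = \<one>" and \<gamma>: "regulated_on 0 1 \<gamma>"
    and D: "countable D" "\<And>t. t \<in> {0<..<1} - D \<Longrightarrow> log_deriv_at \<eta> t (\<gamma> t)"
  shows "evolution \<gamma> (restrict \<eta> {0..1})"
proof -
  have ld: "log_deriv_at (restrict \<eta> {0..1}) t (\<gamma> t)" if "t \<in> {0<..<1} - D" for t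
  proof (rule log_deriv_at_cong[OF D(2)[OF that]])
    have "\<forall>\<^sub>F s in nhds t. s \<in> {0<..<1}" using that by (intro eventually_nhds_in_open) auto
    then show "\<forall>\<^sub>F s in nhds t. \<eta> s = restrict \<eta> {0..1} s" by eventually_elim simp
  qed
  have cont': "curve 0 1 (restrict \<eta> {0..1})" using cont by (rule continuous_map_eq) simp
  have "restrict \<eta> {0..1} \<in> AC (atlas L)" by (rule AC_if_log_deriv[OF _ cont' \<gamma> D(1) ld]) auto
  moreover have "negligible (insert 0 (insert 1 D))"
    using D(1) by (auto simp: negligible_iff_null_sets intro: countable_imp_null_set_lborel null_sets_completionI)
  then have "AE t in lebesgue_on {0..1}. log_deriv_at (restrict \<eta> {0..1}) t (\<gamma> t)"
    unfolding AE_lebesgue_on_iff_negligible using ld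
    by (intro exI[of _ "insert 0 (insert 1 D)"]) auto
  ultimately show ?thesis using \<eta>0 by (simp add: evolution_def)
qed

text \<open>On every subinterval the solution is normalized to start at the unit. When two pieces
  are glued, left invariance permits translating the second one to the endpoint of the
  first.\<close>

theorem evolution_exists:
  assumes \<gamma>: "regulated_on 0 1 \<gamma>" shows "\<exists>\<eta>. evolution \<gamma> \<eta>"
proof -
  obtain M where M: "\<And>t. t \<in> {0..1} \<Longrightarrow> norm (\<gamma> t) \<le> M" using regulated_on_bounded[OF \<gamma>] by blast
  have M0: "M \<ge> 0" using order_trans[OF norm_ge_zero M[of 0]] by simp
  obtain c where c: "c > 0" "\<And>a b \<gamma> M. a \<le> b \<Longrightarrow> M \<ge> 0 \<Longrightarrow> (b - a) * M \<le> c \<Longrightarrow> regulated_on a b \<gamma> \<Longrightarrow>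
      (\<And>t. t \<in> {a..b} \<Longrightarrow> norm (\<gamma> t) \<le> M) \<Longrightarrow>
      \<exists>\<eta>. curve a b \<eta> \<and> \<eta> a = \<one> \<and> (\<forall>t\<in>{a..b}. \<eta> t \<in> K \<and> \<kappa> (\<eta> t) \<in> cball (\<kappa> \<one>) 1) \<and>
        (\<exists>D. countable D \<and> (\<forall>t\<in>{a<..<b} - D. log_deriv_at \<eta> t (\<gamma> t)))"
    by (rule local_evolution[OF zero_less_one]) blast
  let ?P = "\<lambda>x y. 0 \<le> x \<longrightarrow> y \<le> 1 \<longrightarrow> (\<exists>\<eta>. curve x y \<eta> \<and> \<eta> x = \<one> \<and>
      (\<exists>D. countable D \<and> (\<forall>t\<in>{x<..<y} - D. log_deriv_at \<eta> t (\<gamma> t))))"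
  have "?P 0 1"
  proof (rule Bolzano[where P = ?P, OF zero_le_one])
    fix x y z assume 1: "?P x y" and 2: "?P y z" and le: "x \<le> y" "y \<le> z"
    show "?P x z"
    proof (intro impI)
      assume xz: "0 \<le> x" "z \<le> 1"
      have y01: "0 \<le> y" "y \<le> 1" using le xz by auto
      obtain \<eta> D where \<eta>: "curve x y \<eta>" "\<eta> x = \<one>" "countable D" "\<And>t. t \<in> {x<..<y} - D \<Longrightarrow> log_deriv_at \<eta> t (\<gamma> t)"
        using 1 xz(1) y01(2) by blast
      obtain \<zeta> D' where \<zeta>: "curve y z \<zeta>" "\<zeta> y = \<one>" "countable D'" "\<And>t. t \<in> {y<..<z} - D' \<Longrightarrow> log_deriv_at \<zeta> t (\<gamma> t)"
        using 2 xz(2) y01(1) by blast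
      have \<eta>y: "\<eta> y \<in> carrier L" by (rule curve_carrier[OF \<eta>(1)]) (use le in simp)
      let ?\<theta> = "\<lambda>s. if s \<le> y then \<eta> s else \<eta> y \<otimes> \<zeta> s"
      have "curve x z ?\<theta>"
      proof (rule continuous_map_cases_le)
        have "{s \<in> topspace (top_of_set {x..z}). s \<le> y} = {x..y}"
          "{s \<in> topspace (top_of_set {x..z}). y \<le> s} = {y..z}" using le by auto
        then show "continuous_map (subtopology (top_of_set {x..z}) {s \<in> topspace (top_of_set {x..z}). s \<le> y}) (group_topology L) \<eta>"
          "continuous_map (subtopology (top_of_set {x..z}) {s \<in> topspace (top_of_set {x..z}). y \<le> s}) (group_topology L) (\<lambda>s. \<eta> y \<otimes> \<zeta> s)"
          using \<eta>(1) continuous_map_mult[OF curve_const[OF \<eta>y] \<zeta>(1)] le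
          by (simp_all add: subtopology_subtopology Int_absorb1)
        show "\<eta> s = \<eta> y \<otimes> \<zeta> s" if "s \<in> topspace (top_of_set {x..z})" "s = y" for s
          using that \<zeta>(2) \<eta>y by simp
      qed auto
      moreover have "?\<theta> x = \<one>" using \<eta>(2) le by simp
      moreover have "log_deriv_at ?\<theta> t (\<gamma> t)" if t: "t \<in> {x<..<z} - insert y (D \<union> D')" for t
      proof (cases "t < y")
        case True
        have "\<forall>\<^sub>F s in nhds t. s \<in> {x<..<y}" using t True by (intro eventually_nhds_in_open) auto
        then have "\<forall>\<^sub>F s in nhds t. \<eta> s = ?\<theta> s" by eventually_elim simp
        moreover have "log_deriv_at \<eta> t (\<gamma> t)" using \<eta>(4) t True by auto
        ultimately show ?thesis by (rule log_deriv_at_cong[rotated])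
      next
        case False
        then have "t > y" using t by auto
        then have "\<forall>\<^sub>F s in nhds t. s \<in> {y<..<z}" using t by (intro eventually_nhds_in_open) auto
        then have "\<forall>\<^sub>F s in nhds t. \<eta> y \<otimes> \<zeta> s = ?\<theta> s" by eventually_elim simp
        moreover have "log_deriv_at (\<lambda>s. \<eta> y \<otimes> \<zeta> s) t (\<gamma> t)"
          by (rule log_deriv_at_left_mult[OF \<zeta>(4) \<eta>y]) (use t \<open>t > y\<close> in auto)
        ultimately show ?thesis by (rule log_deriv_at_cong[rotated])
      qed
      moreover have "countable (insert y (D \<union> D'))" using \<eta>(3) \<zeta>(3) by simp
      ultimately show "\<exists>\<eta>. curve x z \<eta> \<and> \<eta> x = \<one> \<and>
          (\<exists>D. countable D \<and> (\<forall>t\<in>{x<..<z} - D. log_deriv_at \<eta> t (\<gamma> t)))" by blast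
    qed
  next
    fix t :: real assume t: "0 \<le> t" "t \<le> 1"
    \<comment> \<open>The step length depends on \<open>c\<close> and the global bound
      \<open>M\<close>, not on the point reached so far.\<close>
    define d where "d = c / (M + 1)"
    have d: "d > 0" using c(1) M0 by (simp add: d_def)
    have "?P x y" if xy: "x \<le> t" "t \<le> y" "y - x < d" for x y
    proof (intro impI)
      assume "0 \<le> x" "y \<le> 1"
      have "(y - x) * M \<le> d * (M + 1)" using xy M0 by (intro mult_mono) auto
      then have "(y - x) * M \<le> c" using M0 by (simp add: d_def)
      moreover have "regulated_on x y \<gamma>" using regulated_on_subinterval[OF \<gamma>] \<open>0 \<le> x\<close> \<open>y \<le> 1\<close> xy by simp
      ultimately obtain \<eta> where "curve x y \<eta>" "\<eta> x = \<one>"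
        "\<exists>D. countable D \<and> (\<forall>t\<in>{x<..<y} - D. log_deriv_at \<eta> t (\<gamma> t))"
        using c(2)[of x y M \<gamma>] M M0 \<open>0 \<le> x\<close> \<open>y \<le> 1\<close> xy by force
      then show "\<exists>\<eta>. curve x y \<eta> \<and> \<eta> x = \<one> \<and>
          (\<exists>D. countable D \<and> (\<forall>t\<in>{x<..<y} - D. log_deriv_at \<eta> t (\<gamma> t)))" by blast
    qed
    then show "\<exists>d>0. \<forall>x y. x \<le> t \<and> t \<le> y \<and> y - x < d \<longrightarrow> ?P x y" using d by blast
  qed
  then obtain \<eta> D where "curve 0 1 \<eta>" "\<eta> 0 = \<one>" "countable D" "\<And>t. t \<in> {0<..<1} - D \<Longrightarrow> log_deriv_at \<eta> t (\<gamma> t)"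
    by auto
  from evolutionI[OF this(1,2) \<gamma> this(3,4)] show ?thesis by blast
qed

section \<open>Stability and uniqueness of evolutions\<close>

lemma curve_quotient_at:
  assumes \<zeta>: "curve a b \<zeta>" and t: "t \<in> {a..b}" and Q: "openin (group_topology L) Q" "\<one> \<in> Q"
  shows "\<exists>d>0. \<forall>s\<in>{a..b}. \<bar>s - t\<bar> < d \<longrightarrow> inv (\<zeta> s) \<otimes> \<zeta> t \<in> Q"
proof -
  have tc: "\<zeta> t \<in> carrier L" by (rule curve_carrier[OF \<zeta> t])
  have "curve a b (\<lambda>s. inv (\<zeta> s) \<otimes> \<zeta> t)"
    by (intro continuous_map_mult continuous_map_inv \<zeta> curve_const tc)
  from curve_neighbourhood[OF this Q(1) t] show ?thesis using Q(2) tc by simp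
qed

lemma one_neighbourhood_square:
  assumes V: "openin (group_topology L) V" "\<one> \<in> V"
  obtains Q where "openin (group_topology L) Q" "\<one> \<in> Q" "Q \<subseteq> V" "\<And>x y. x \<in> Q \<Longrightarrow> y \<in> Q \<Longrightarrow> x \<otimes> y \<in> V"
proof -
  let ?X = "prod_topology (group_topology L) (group_topology L)"
  have "continuous_map ?X (group_topology L) (\<lambda>p. fst p \<otimes> snd p)"
    by (intro continuous_map_mult continuous_map_fst continuous_map_snd)
  from openin_continuous_map_preimage[OF this V(1)]
  have o: "openin ?X {p \<in> topspace ?X. fst p \<otimes> snd p \<in> V}" .
  have m: "(\<one>, \<one>) \<in> {p \<in> topspace ?X. fst p \<otimes> snd p \<in> V}" using V(2) by (simp add: topspace_L)
  obtain A B where AB: "openin (group_topology L) A" "openin (group_topology L) B" "\<one> \<in> A" "\<one> \<in> B"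
    "A \<times> B \<subseteq> {p \<in> topspace ?X. fst p \<otimes> snd p \<in> V}"
    using openin_prod_topology_alt[THEN iffD1, rule_format, OF o m] by (elim exE conjE)
  show ?thesis
  proof (rule that[of "A \<inter> B \<inter> V"])
    show "x \<otimes> y \<in> V" if "x \<in> A \<inter> B \<inter> V" "y \<in> A \<inter> B \<inter> V" for x y
      using subsetD[OF AB(5), of "(x, y)"] that by auto
  qed (use AB V in auto)
qed

text \<open>A continuation argument. While the quotient stays in \<open>V\<close>, Gronwall bounds
  its deviation in the chart by \<open>E * \<delta>\<close>, which is below \<open>r'\<close> and so
  forces it into the smaller set \<open>Q\<close>. To include the supremum \<open>T\<close> of such
  times, products of two elements of \<open>Q\<close> lie in \<open>V\<close>: the value at
  \<open>T\<close> is an earlier value in \<open>Q\<close> times an increment in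
  \<open>Q\<close>.\<close>

theorem evolution_stability:
  assumes c: "(U, \<phi>) \<in> charts (atlas L)" and U: "\<one> \<in> U" and M: "M \<ge> 0"
  obtains \<delta>0 B where "\<delta>0 > 0" "B \<ge> 0"
    "\<And>\<gamma>0 \<gamma> \<eta>0 \<eta> \<delta>. regulated_on 0 1 \<gamma>0 \<Longrightarrow> regulated_on 0 1 \<gamma> \<Longrightarrow> evolution \<gamma>0 \<eta>0 \<Longrightarrow> evolution \<gamma> \<eta> \<Longrightarrow>
      AE t in lebesgue_on {0..1}. norm (\<gamma>0 t) \<le> M \<Longrightarrow> AE t in lebesgue_on {0..1}. norm (\<gamma> t - \<gamma>0 t) \<le> \<delta> \<Longrightarrow>
      0 \<le> \<delta> \<Longrightarrow> \<delta> \<le> \<delta>0 \<Longrightarrow>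
      (\<forall>t\<in>{0..1}. quotient_curve \<eta>0 \<eta> t \<in> U \<and> norm (\<phi> (quotient_curve \<eta>0 \<eta> t) - \<phi> \<one>) \<le> B * \<delta>) \<and>
      (AE t in lebesgue_on {0..1}. norm (quotient_velocity U \<phi> (\<phi> (quotient_curve \<eta>0 \<eta> t)) (\<gamma>0 t, \<gamma> t)) \<le> B * \<delta>)"
proof -
  obtain r C where r: "r > 0" "C \<ge> 0" "ball (\<phi> \<one>) r \<subseteq> \<phi> ` U"
    "\<And>z. z \<in> ball (\<phi> \<one>) r \<Longrightarrow> norm (quotient_velocity U \<phi> z) \<le> C"
    "\<And>z w. z \<in> ball (\<phi> \<one>) r \<Longrightarrow> w \<in> ball (\<phi> \<one>) r \<Longrightarrow>
       norm (quotient_velocity U \<phi> z - quotient_velocity U \<phi> w) \<le> C * norm (z - w)"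
    by (rule quotient_velocity_lipschitz[OF c U]) blast
  define V where "V = U \<inter> \<phi> -` ball (\<phi> \<one>) r"
  have V: "openin (group_topology L) V" "\<one> \<in> V"
    unfolding V_def using chart_preimage_open[OF mani c open_ball] U r(1) by auto
  obtain Q where Q: "openin (group_topology L) Q" "\<one> \<in> Q" "Q \<subseteq> V" "\<And>x y. x \<in> Q \<Longrightarrow> y \<in> Q \<Longrightarrow> x \<otimes> y \<in> V"
    by (rule one_neighbourhood_square[OF V]) blast
  have "open (\<phi> ` (Q \<inter> U))" by (rule chart_image_open[OF mani c Q(1)])
  then obtain r' where r': "r' > 0" "ball (\<phi> \<one>) r' \<subseteq> \<phi> ` (Q \<inter> U)"
    using Q(2) U unfolding open_contains_ball by blast
  have inQ: "h \<in> Q" if "h \<in> U" "norm (\<phi> h - \<phi> \<one>) < r'" for h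
  proof -
    have "\<phi> h \<in> ball (\<phi> \<one>) r'" using that by (simp add: dist_norm norm_minus_commute)
    then have "\<phi> h \<in> \<phi> ` (Q \<inter> U)" using r'(2) by blast
    then show ?thesis using chart_inj[OF c] that(1) by (auto dest: inj_onD)
  qed
  \<comment> \<open>\<open>2 * C * M\<close> is the Lipschitz constant \<open>C\<close> times the
    bound \<open>2 * M\<close> for the pair \<open>(\<gamma>0 t, \<gamma>0 t)\<close>; the summand 1
    makes \<open>k\<close> positive.\<close>
  define k where "k = 2 * C * M + 1"
  have k: "k > 0" using r(2) M by (simp add: k_def add_nonneg_pos)
  \<comment> \<open>The bound of \<open>weighted_gronwall\<close> for the inhomogeneity
    \<open>C * \<delta>\<close>, without the factor \<delta>.\<close>
  define E where "E = 2 * C * exp (2 * k)"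
  have E: "E \<ge> 0" using r(2) by (simp add: E_def)
  define B where "B = k * E + C + E"
  have B: "B \<ge> E" "B \<ge> k * E + C" "B \<ge> 0" using r(2) k E by (auto simp: B_def)
  \<comment> \<open>Up to this size of \<delta> the deviation \<open>E * \<delta>\<close> stays
    strictly below \<open>r'\<close>.\<close>
  define \<delta>0 where "\<delta>0 = r' / (2 * (E + 1))"
  have \<delta>0: "\<delta>0 > 0" "E * \<delta>0 < r'"
  proof -
    show "\<delta>0 > 0" using r'(1) E by (simp add: \<delta>0_def)
    have "E * r' < r' * (2 * (E + 1))" using r'(1) E by (simp add: algebra_simps add_nonneg_pos)
    then show "E * \<delta>0 < r'" using E unfolding \<delta>0_def by (simp add: divide_less_eq)
  qed
  show ?thesis
  proof (rule that[OF \<delta>0(1) B(3)])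
    fix \<gamma>0 \<gamma> \<eta>0 \<eta> \<delta>
    assume \<gamma>: "regulated_on 0 1 \<gamma>0" "regulated_on 0 1 \<gamma>" and ev: "evolution \<gamma>0 \<eta>0" "evolution \<gamma> \<eta>"
      and bd: "AE t in lebesgue_on {0..1}. norm (\<gamma>0 t) \<le> M" "AE t in lebesgue_on {0..1}. norm (\<gamma> t - \<gamma>0 t) \<le> \<delta>"
      and \<delta>: "0 \<le> \<delta>" "\<delta> \<le> \<delta>0"
    let ?\<zeta> = "quotient_curve \<eta>0 \<eta>"
    let ?x = "\<phi> \<circ> ?\<zeta>"
    have AC: "\<eta>0 \<in> AC (atlas L)" "\<eta> \<in> AC (atlas L)" using ev by (auto simp: evolution_def)
    have \<zeta>: "curve 0 1 ?\<zeta>" by (rule AC_continuous_map[OF AC_quotient_curve[OF AC]])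
    have \<zeta>t: "?\<zeta> t = inv (\<eta>0 t) \<otimes> \<eta> t" if "t \<in> {0..1}" for t using that by (simp add: quotient_curve_def)
    have \<zeta>0: "?\<zeta> 0 = \<one>" using ev by (simp add: \<zeta>t evolution_def)
    have Er': "E * \<delta> < r'" using mult_left_mono[OF \<delta>(2) E] \<delta>0(2) by linarith
    obtain Z where Z: "negligible Z" "\<And>t. t \<in> {0..1} - Z \<Longrightarrow> norm (\<gamma>0 t) \<le> M"
      using bd(1) unfolding AE_lebesgue_on_iff_negligible by blast
    obtain Z' where Z': "negligible Z'" "\<And>t. t \<in> {0..1} - Z' \<Longrightarrow> norm (\<gamma> t - \<gamma>0 t) \<le> \<delta>"
      using bd(2) unfolding AE_lebesgue_on_iff_negligible by blast
    have vel: "norm (quotient_velocity U \<phi> (?x t) (\<gamma>0 t, \<gamma> t)) \<le> k * norm (?x t - \<phi> \<one>) + C * \<delta>"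
      if t: "t \<in> {0..1} - (Z \<union> Z')" and tV: "?\<zeta> t \<in> V" for t
    proof -
      let ?q = "quotient_velocity U \<phi>"
      have xb: "?x t \<in> ball (\<phi> \<one>) r" using tV by (simp add: V_def)
      \<comment> \<open>The diagonal part of the control has velocity 0 at the unit, hence elsewhere
        a velocity bounded by a multiple of the deviation; the difference of the controls alone
        gives the inhomogeneity.\<close>
      have "(\<gamma>0 t, \<gamma> t) = (\<gamma>0 t, \<gamma>0 t) + (0, \<gamma> t - \<gamma>0 t)" by simp
      then have "?q (?x t) (\<gamma>0 t, \<gamma> t) = (?q (?x t) - ?q (\<phi> \<one>)) (\<gamma>0 t, \<gamma>0 t) + ?q (?x t) (0, \<gamma> t - \<gamma>0 t)"
        using quotient_velocity_diagonal[OF c U] by (simp only: blinfun.add_right blinfun.diff_left diff_0_right)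
      then have eq: "?q (?x t) (\<gamma>0 t, \<gamma> t) = (?q (?x t) - ?q (\<phi> \<one>)) (\<gamma>0 t, \<gamma>0 t) + ?q (?x t) (0, \<gamma> t - \<gamma>0 t)" .
      have "norm ((?q (?x t) - ?q (\<phi> \<one>)) (\<gamma>0 t, \<gamma>0 t)) \<le> norm (?q (?x t) - ?q (\<phi> \<one>)) * norm (\<gamma>0 t, \<gamma>0 t)"
        by (rule norm_blinfun)
      also have "\<dots> \<le> (C * norm (?x t - \<phi> \<one>)) * (2 * M)"
      proof (rule mult_mono)
        show "norm (?q (?x t) - ?q (\<phi> \<one>)) \<le> C * norm (?x t - \<phi> \<one>)" by (rule r(5)[OF xb]) (use r(1) in simp)
        show "norm (\<gamma>0 t, \<gamma>0 t) \<le> 2 * M" using norm_Pair_le[of "\<gamma>0 t" "\<gamma>0 t"] Z(2)[of t] t by simp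
      qed (use r(2) in simp_all)
      finally have 1: "norm ((?q (?x t) - ?q (\<phi> \<one>)) (\<gamma>0 t, \<gamma>0 t)) \<le> (C * norm (?x t - \<phi> \<one>)) * (2 * M)" .
      have "norm (?q (?x t) (0, \<gamma> t - \<gamma>0 t)) \<le> norm (?q (?x t)) * norm (0 :: 'e, \<gamma> t - \<gamma>0 t)"
        by (rule norm_blinfun)
      also have "\<dots> \<le> C * \<delta>"
      proof (rule mult_mono)
        show "norm (?q (?x t)) \<le> C" by (rule r(4)[OF xb])
        show "norm (0 :: 'e, \<gamma> t - \<gamma>0 t) \<le> \<delta>" using Z'(2)[of t] t by (simp add: norm_Pair)
      qed (use r(2) in simp_all)
      finally have 2: "norm (?q (?x t) (0, \<gamma> t - \<gamma>0 t)) \<le> C * \<delta>" .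
      have "norm (?q (?x t) (\<gamma>0 t, \<gamma> t)) \<le> (C * norm (?x t - \<phi> \<one>)) * (2 * M) + C * \<delta>"
        unfolding eq by (rule norm_triangle_le[OF add_mono[OF 1 2]])
      also have "\<dots> \<le> k * norm (?x t - \<phi> \<one>) + C * \<delta>" by (simp add: k_def algebra_simps)
      finally show ?thesis .
    qed
    have est: "norm (?x t - \<phi> \<one>) \<le> E * \<delta>" if s: "s \<in> {0..1}" and sV: "\<And>t. t \<in> {0..s} \<Longrightarrow> ?\<zeta> t \<in> V" and t: "t \<in> {0..s}" for s t
    proof -
      have D: "has_reg_derivative ?x (\<lambda>t. quotient_velocity U \<phi> (\<phi> (?\<zeta> t)) (\<gamma>0 t, \<gamma> t)) 0 s"
        by (rule quotient_has_reg_derivative[OF c AC(1) _ \<gamma>(1) AC(2) _ \<gamma>(2)])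
          (use ev s sV \<zeta>t in \<open>auto simp: evolution_def V_def\<close>)
      have "norm (?x t - ?x 0) \<le> 2 * (C * \<delta>) * exp (2 * k)"
      proof (rule weighted_gronwall[OF D _ _ k])
        show "negligible (Z \<union> Z')" using Z(1) Z'(1) by simp
        show "norm (quotient_velocity U \<phi> (\<phi> (?\<zeta> t)) (\<gamma>0 t, \<gamma> t)) \<le> k * norm (?x t - ?x 0) + C * \<delta>"
          if "t \<in> {0<..<s} - (Z \<union> Z')" for t
          using vel[of t] sV[of t] that s \<zeta>0 by simp
      qed (use s t r(2) \<delta> in auto)
      then show ?thesis using \<zeta>0 by (simp add: E_def mult_ac)
    qed
    \<comment> \<open>The times up to which the quotient has remained in \<open>V\<close>; the
      supremum is shown to belong to \<open>J\<close> and then to equal 1.\<close>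
    define J where "J = {s \<in> {0..1}. \<forall>t\<in>{0..s}. ?\<zeta> t \<in> V}"
    define T where "T = Sup J"
    have J0: "0 \<in> J" using V(2) \<zeta>0 by (simp add: J_def)
    have bdd: "bdd_above J" by (auto simp: J_def bdd_above_def)
    have "J \<noteq> {}" using J0 by blast
    then have "T \<le> 1" unfolding T_def by (rule cSup_least) (simp add: J_def)
    then have T01: "0 \<le> T" "T \<le> 1" using cSup_upper[OF J0 bdd] by (simp_all add: T_def)
    have less: "?\<zeta> s \<in> Q" if s: "0 \<le> s" "s < T" for s
    proof -
      obtain j where j: "j \<in> J" "s < j" using less_cSupD[of J s] \<open>J \<noteq> {}\<close> s(2) unfolding T_def by auto
      have "norm (?x s - \<phi> \<one>) \<le> E * \<delta>" by (rule est[of j]) (use j s in \<open>auto simp: J_def\<close>)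
      moreover have "?\<zeta> s \<in> U" using j s by (auto simp: J_def V_def)
      ultimately show ?thesis using inQ Er' by simp
    qed
    have TV: "?\<zeta> T \<in> V"
    proof (cases "T = 0")
      case False
      then have T: "T > 0" using T01 by simp
      obtain d where d: "d > 0" "\<forall>s\<in>{0..1}. \<bar>s - T\<bar> < d \<longrightarrow> inv (?\<zeta> s) \<otimes> ?\<zeta> T \<in> Q"
        using curve_quotient_at[OF \<zeta> _ Q(1,2), of T] T01 by auto
      define s where "s = max 0 (T - d / 2)"
      have s: "0 \<le> s" "s < T" "s \<in> {0..1}" "\<bar>s - T\<bar> < d" using T T01 d(1) by (auto simp: s_def max_def)
      have "?\<zeta> s \<otimes> (inv (?\<zeta> s) \<otimes> ?\<zeta> T) \<in> V" by (rule Q(4)) (use less s d(2) in auto)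
      moreover have "?\<zeta> s \<in> carrier L" "?\<zeta> T \<in> carrier L" using curve_carrier[OF \<zeta>] s T01 by auto
      ultimately show ?thesis by (simp add: m_assoc[symmetric])
    qed (use \<zeta>0 V in simp)
    have "?\<zeta> t \<in> V" if t: "t \<in> {0..T}" for t
    proof (cases "t = T")
      case False
      then have "?\<zeta> t \<in> Q" using less[of t] t by simp
      then show ?thesis using Q(3) by (rule subsetD[rotated])
    qed (use TV in simp)
    then have TJ: "T \<in> J" using T01 by (simp add: J_def)
    have "T = 1"
    proof (rule ccontr)
      assume "T \<noteq> 1"
      then have T: "T < 1" using T01 by simp
      obtain d where d: "d > 0" "\<forall>s\<in>{0..1}. \<bar>s - T\<bar> < d \<longrightarrow> ?\<zeta> s \<in> V"
        using curve_neighbourhood[OF \<zeta> V(1), of T] T01 TV by auto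
      define s where "s = min 1 (T + d / 2)"
      have s: "s \<in> {0..1}" "T < s" "s < T + d" using T T01 d(1) by (auto simp: s_def min_def)
      have "?\<zeta> t \<in> V" if "t \<in> {0..s}" for t
        using that s d(2) TJ by (cases "t \<le> T") (auto simp: J_def)
      then have "s \<in> J" using s by (simp add: J_def)
      then have "s \<le> T" unfolding T_def using bdd by (rule cSup_upper)
      then show False using s by simp
    qed
    then have all: "?\<zeta> t \<in> V" if "t \<in> {0..1}" for t using TJ that by (auto simp: J_def)
    have est1: "norm (?x t - \<phi> \<one>) \<le> E * \<delta>" if "t \<in> {0..1}" for t using est[of 1 t] all that by simp
    have "?\<zeta> t \<in> U \<and> norm (\<phi> (?\<zeta> t) - \<phi> \<one>) \<le> B * \<delta>" if "t \<in> {0..1}" for t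
      using all[OF that] est1[OF that] mult_right_mono[OF B(1) \<delta>(1)] by (auto simp: V_def)
    moreover have "norm (quotient_velocity U \<phi> (\<phi> (?\<zeta> t)) (\<gamma>0 t, \<gamma> t)) \<le> B * \<delta>" if "t \<in> {0..1} - (Z \<union> Z')" for t
    proof -
      have "norm (quotient_velocity U \<phi> (\<phi> (?\<zeta> t)) (\<gamma>0 t, \<gamma> t)) \<le> k * norm (?x t - \<phi> \<one>) + C * \<delta>"
        using vel[OF that all] that by simp
      also have "\<dots> \<le> k * (E * \<delta>) + C * \<delta>" using est1[of t] that k by simp
      also have "\<dots> = (k * E + C) * \<delta>" by (simp add: algebra_simps)
      also have "\<dots> \<le> B * \<delta>" by (rule mult_right_mono[OF B(2) \<delta>(1)])
      finally show ?thesis .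
    qed
    then have "AE t in lebesgue_on {0..1}. norm (quotient_velocity U \<phi> (\<phi> (?\<zeta> t)) (\<gamma>0 t, \<gamma> t)) \<le> B * \<delta>"
      unfolding AE_lebesgue_on_iff_negligible using Z(1) Z'(1) by (intro exI[of _ "Z \<union> Z'"]) auto
    ultimately show "(\<forall>t\<in>{0..1}. ?\<zeta> t \<in> U \<and> norm (\<phi> (?\<zeta> t) - \<phi> \<one>) \<le> B * \<delta>) \<and>
      (AE t in lebesgue_on {0..1}. norm (quotient_velocity U \<phi> (\<phi> (?\<zeta> t)) (\<gamma>0 t, \<gamma> t)) \<le> B * \<delta>)" by blast
  qed
qed

text \<open>Stability for equal controls, with \<delta> equal to 0: the quotient has the coordinate
  of the unit at all times.\<close>

theorem evolution_unique:
  assumes \<gamma>: "regulated_on 0 1 \<gamma>" and ev: "evolution \<gamma> \<eta>0" "evolution \<gamma> \<eta>"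
  shows "\<eta>0 = \<eta>"
proof -
  obtain M where M: "\<And>t. t \<in> {0..1} \<Longrightarrow> norm (\<gamma> t) \<le> M" using regulated_on_bounded[OF \<gamma>] by blast
  have M0: "M \<ge> 0" using order_trans[OF norm_ge_zero M[of 0]] by simp
  have bd: "AE t in lebesgue_on {0..1}. norm (\<gamma> t) \<le> M" using M by (intro AE_I2) auto
  obtain \<delta>0 B where \<delta>: "\<delta>0 > 0"
    and st: "\<And>\<gamma>0 \<gamma> \<eta>0 \<eta> \<delta>. regulated_on 0 1 \<gamma>0 \<Longrightarrow> regulated_on 0 1 \<gamma> \<Longrightarrow> evolution \<gamma>0 \<eta>0 \<Longrightarrow> evolution \<gamma> \<eta> \<Longrightarrow>
      AE t in lebesgue_on {0..1}. norm (\<gamma>0 t) \<le> M \<Longrightarrow> AE t in lebesgue_on {0..1}. norm (\<gamma> t - \<gamma>0 t) \<le> \<delta> \<Longrightarrow>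
      0 \<le> \<delta> \<Longrightarrow> \<delta> \<le> \<delta>0 \<Longrightarrow>
      (\<forall>t\<in>{0..1}. quotient_curve \<eta>0 \<eta> t \<in> K \<and> norm (\<kappa> (quotient_curve \<eta>0 \<eta> t) - \<kappa> \<one>) \<le> B * \<delta>)"
    by (rule evolution_stability[OF kappa one_K M0]) blast
  have "\<forall>t\<in>{0..1}. quotient_curve \<eta>0 \<eta> t \<in> K \<and> norm (\<kappa> (quotient_curve \<eta>0 \<eta> t) - \<kappa> \<one>) \<le> B * 0"
    by (rule st[OF \<gamma> \<gamma> ev bd]) (use \<delta> in auto)
  then have q: "quotient_curve \<eta>0 \<eta> t = \<one>" if "t \<in> {0..1}" for t
    using that one_K chart_inj[OF kappa] by (auto dest: inj_onD)
  have AC: "\<eta>0 \<in> AC (atlas L)" "\<eta> \<in> AC (atlas L)" using ev by (auto simp: evolution_def)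
  show ?thesis
  proof (rule extensionalityI[OF AC_extensional[OF AC(1)] AC_extensional[OF AC(2)]])
    fix t :: real assume t: "t \<in> {0..1}"
    have car: "\<eta>0 t \<in> carrier L" "\<eta> t \<in> carrier L" using AC_points[OF mani _ t] AC pts by auto
    have "inv (\<eta>0 t) \<otimes> \<eta> t = \<one>" using q[OF t] t by (simp add: quotient_curve_def)
    then have "inv (\<eta> t) = inv (\<eta>0 t)" by (rule inv_equality[OF _ car(2)]) (use car in simp)
    then show "\<eta>0 t = \<eta> t" using car by (metis inv_inv)
  qed
qed

end

section \<open>The topology on absolutely continuous curves and continuity of the evolution\<close>

lemma abs_rep_regR: "abs_regR (rep_regR c) = c"
  by (rule Quotient3_abs_rep[OF Quotient3_regR])

lemma rep_abs_regR_AE: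
  assumes "regulated_on 0 1 f" shows "AE t in lebesgue_on {0..1}. rep_regR (abs_regR f) t = f t"
  using rep_abs_rsp_left[OF Quotient3_regR, of f f] assms by simp

lemma norm_abs_regR: "regulated_on 0 1 f \<Longrightarrow> norm (abs_regR f) = real_of_ereal (essnorm f)"
  by (simp add: norm_regR.abs_eq)

lemma norm_regR_AE: "AE t in lebesgue_on {0..1}. norm (rep_regR c t) \<le> norm c"
proof -
  have reg: "regulated_on 0 1 (rep_regR c)" by (rule regulated_on_rep_regR)
  have "essnorm (rep_regR c) = ereal (norm c)"
    using norm_abs_regR[OF reg] essnorm_finite[OF reg] by (simp add: abs_rep_regR ereal_real)
  then show ?thesis
    using esssup_AE[of "\<lambda>t. ereal (norm (rep_regR c t))" "lebesgue_on {0..1}"]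
    by (simp add: essnorm_def)
qed

lemma norm_regR_le:
  assumes "AE t in lebesgue_on {0..1}. norm (rep_regR c t) \<le> B"
  shows "norm c \<le> B"
proof -
  have reg: "regulated_on 0 1 (rep_regR c)" by (rule regulated_on_rep_regR)
  have "essnorm (rep_regR c) \<le> ereal B" unfolding essnorm_def
    by (rule esssup_I[OF ereal_norm_measurable[OF reg]]) (use assms in simp)
  moreover have "essnorm (rep_regR c) = ereal (norm c)"
    using norm_abs_regR[OF reg] essnorm_finite[OF reg] by (simp add: abs_rep_regR ereal_real)
  ultimately show ?thesis by simp
qed

lemma rep_regR_diff_AE: "AE t in lebesgue_on {0..1}. rep_regR (c - d) t = rep_regR c t - rep_regR d t"
proof -
  have "c - d = abs_regR (\<lambda>t. rep_regR c t - rep_regR d t)"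
    using minus_regR.abs_eq[of "rep_regR c" "rep_regR d"] by (simp add: abs_rep_regR regulated_on_rep_regR)
  then show ?thesis
    using rep_abs_regR_AE[OF regulated_on_diff[OF regulated_on_rep_regR regulated_on_rep_regR, of c d]] by simp
qed

lemma norm_diff_regR_AE: "AE t in lebesgue_on {0..1}. norm (rep_regR c t - rep_regR d t) \<le> norm (c - d)"
  using norm_regR_AE[of "c - d"] rep_regR_diff_AE[of c d] by eventually_elim simp

lemma AC_coord_eq:
  fixes f :: "real \<Rightarrow> 'e::banach"
  assumes "has_reg_derivative f (rep_regR c) 0 1"
  shows "AC_coord f = (f 0, c)"
proof -
  have "AC_on 0 1 f" using assms by (auto simp: AC_on_def)
  from has_reg_derivative_unique[OF AC_on_AC_coord[OF this] assms]
  have "snd (AC_coord f) = c"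
    by (intro Quotient3_rel_rep[OF Quotient3_regR, THEN iffD1]) (simp add: regulated_on_rep_regR)
  then show ?thesis by (simp add: AC_coord_def)
qed

lemma fst_AC_coord: "fst (AC_coord f) = f 0"
  by (simp add: AC_coord_def)

lemma norm_AC_coord_le:
  fixes f :: "real \<Rightarrow> 'e::banach"
  assumes f: "has_reg_derivative f g 0 1" and B: "AE t in lebesgue_on {0..1}. norm (g t) \<le> B"
  shows "norm (snd (AC_coord f)) \<le> B"
proof (rule norm_regR_le)
  have "AC_on 0 1 f" using f by (auto simp: AC_on_def)
  from has_reg_derivative_unique[OF AC_on_AC_coord[OF this] f] B
  show "AE t in lebesgue_on {0..1}. norm (rep_regR (snd (AC_coord f)) t) \<le> B"
    by eventually_elim simp
qed

lemma has_reg_derivative_primitive: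
  fixes x :: "'e::banach"
  shows "has_reg_derivative (\<lambda>t. x + integral {0..t} (rep_regR c)) (rep_regR c) 0 1"
proof -
  have reg: "regulated_on 0 1 (rep_regR c)" by (rule regulated_on_rep_regR)
  have int: "rep_regR c integrable_on {0..s}" if "s \<in> {0..1}" for s
    by (rule regulated_on_integrable[OF _ regulated_on_subinterval[OF reg]]) (use that in auto)
  show ?thesis unfolding has_reg_derivative_def
    using int by (auto intro!: continuous_intros indefinite_integral_continuous_1 reg integrable_integral)
qed

context banach_lie_group
begin

lemma symmetric_chartsD:
  assumes "(U, \<phi>) \<in> symmetric_charts L" shows "(U, \<phi>) \<in> charts (atlas L)" "\<one> \<in> U"
  using assms by (auto simp: symmetric_charts_def)

lemma AC_in_AC_on:
  assumes c: "(U, \<phi>) \<in> charts (atlas L)" and \<zeta>: "\<zeta> \<in> AC_in (atlas L) U"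
  shows "AC_on 0 1 (\<phi> \<circ> \<zeta>)"
  using AC_chart_AC_on[OF mani _ c] \<zeta> by (simp add: AC_in_def)

lemma AC_coord_inj:
  assumes c: "(U, \<phi>) \<in> charts (atlas L)"
  shows "inj_on (\<lambda>\<zeta>. AC_coord (\<phi> \<circ> \<zeta>)) (AC_in (atlas L) U)"
proof (rule inj_onI)
  fix \<zeta> \<xi> assume \<zeta>: "\<zeta> \<in> AC_in (atlas L) U" and \<xi>: "\<xi> \<in> AC_in (atlas L) U"
    and eq: "AC_coord (\<phi> \<circ> \<zeta>) = AC_coord (\<phi> \<circ> \<xi>)"
  have AC: "\<zeta> \<in> AC (atlas L)" "\<xi> \<in> AC (atlas L)" using \<zeta> \<xi> by (auto simp: AC_in_def)
  show "\<zeta> = \<xi>"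
  proof (rule extensionalityI[OF AC_extensional[OF AC(1)] AC_extensional[OF AC(2)]])
    fix t :: real assume t: "t \<in> {0..1}"
    have "\<phi> (\<zeta> t) = \<phi> (\<xi> t)"
      using AC_coord_eq_imp[OF AC_in_AC_on[OF c \<zeta>] AC_in_AC_on[OF c \<xi>] eq t] by simp
    moreover have "\<zeta> t \<in> U" "\<xi> t \<in> U" using \<zeta> \<xi> t by (auto simp: AC_in_def)
    ultimately show "\<zeta> t = \<xi> t" using chart_inj[OF c] by (auto dest: inj_onD)
  qed
qed

text \<open>Integration recovers a curve from its initial value and derivative, so nearby
  coordinates give uniformly close curves. The compact range of the given curve keeps a positive
  distance from the complement of the chart image, hence nearby curves in the model space pull back
  to the group.\<close>

lemma open_AC_coord_image:
  assumes c: "(U, \<phi>) \<in> charts (atlas L)"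
  shows "open ((\<lambda>\<zeta>. AC_coord (\<phi> \<circ> \<zeta>)) ` AC_in (atlas L) U)" (is "open ?O")
  unfolding open_dist
proof
  fix z assume "z \<in> ?O"
  then obtain \<zeta> where \<zeta>: "\<zeta> \<in> AC_in (atlas L) U" "z = AC_coord (\<phi> \<circ> \<zeta>)" by blast
  let ?y = "\<phi> \<circ> \<zeta>"
  have y: "has_reg_derivative ?y (rep_regR (snd z)) 0 1"
    using AC_on_AC_coord[OF AC_in_AC_on[OF c \<zeta>(1)]] \<zeta>(2) by simp
  have yc: "continuous_on {0..1} ?y" using y by (simp add: has_reg_derivative_def)
  have sub: "?y ` {0..1} \<subseteq> \<phi> ` U" using \<zeta>(1) by (auto simp: AC_in_def)
  obtain d where d: "d > 0" "\<And>x. x \<in> ?y ` {0..1} \<Longrightarrow> ball x d \<subseteq> \<phi> ` U"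
    by (rule Heine_Borel_lemma[of "?y ` {0..1}" "{\<phi> ` U}"])
      (use compact_continuous_image[OF yc] chart_open_image[OF c] sub in auto)
  have inU: "w \<in> \<phi> ` U" if "t \<in> {0..1}" "dist (?y t) w < d" for t w
    using subsetD[OF d(2), of "?y t" w] that by simp
  \<comment> \<open>The radius \<open>d / 2\<close> is spent twice, on the initial value and on the
    derivative.\<close>
  have "q \<in> ?O" if q: "dist q z < d / 2" for q
  proof -
    define x where "x t = fst q + integral {0..t} (rep_regR (snd q))" for t
    have x: "has_reg_derivative x (rep_regR (snd q)) 0 1"
      unfolding x_def[abs_def] by (rule has_reg_derivative_primitive)
    have x0: "x 0 = fst q" by (simp add: x_def)
    have diff: "has_reg_derivative (\<lambda>t. x t - ?y t) (\<lambda>t. rep_regR (snd q) t - rep_regR (snd z) t) 0 1"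
      unfolding has_reg_derivative_def
    proof (intro conjI ballI)
      show "continuous_on {0..1} (\<lambda>t. x t - ?y t)"
        using x y by (intro continuous_on_diff) (simp_all add: has_reg_derivative_def)
      show "regulated_on 0 1 (\<lambda>t. rep_regR (snd q) t - rep_regR (snd z) t)"
        by (intro regulated_on_diff regulated_on_rep_regR)
      fix s :: real assume s: "s \<in> {0..1}"
      have "((\<lambda>t. rep_regR (snd q) t - rep_regR (snd z) t) has_integral ((x s - x 0) - (?y s - ?y 0))) {0..s}"
        using x y s by (intro has_integral_diff) (simp_all add: has_reg_derivative_def)
      then show "((\<lambda>t. rep_regR (snd q) t - rep_regR (snd z) t) has_integral (x s - ?y s - (x 0 - ?y 0))) {0..s}"
        by (simp add: algebra_simps)
    qed
    obtain Z where Z: "negligible Z" "\<And>t. t \<in> {0..1} - Z \<Longrightarrow> norm (rep_regR (snd q) t - rep_regR (snd z) t) \<le> norm (snd q - snd z)"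
      using norm_diff_regR_AE[of "snd q" "snd z"] unfolding AE_lebesgue_on_iff_negligible by blast
    have dd: "dist (fst q) (fst z) < d / 2" "norm (snd q - snd z) < d / 2"
      using dist_fst_le[of q z] dist_snd_le[of q z] q by (simp_all add: dist_norm)
    have near: "dist (?y t) (x t) < d" if t: "t \<in> {0..1}" for t
    proof -
      have "norm (x t - ?y t - (x 0 - ?y 0)) \<le> integral {0..t} (\<lambda>_. norm (snd q - snd z))"
        by (rule has_reg_derivative_norm_bound[OF diff t _ Z(1)]) (use Z(2) t in auto)
      also have "\<dots> \<le> norm (snd q - snd z)" using t by (simp add: mult_left_le_one_le)
      finally have 1: "norm (x t - ?y t - (x 0 - ?y 0)) < d / 2" using dd(2) by simp
      have "?y 0 = fst z" using \<zeta>(2) by (simp add: fst_AC_coord)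
      then have 2: "norm (x 0 - ?y 0) < d / 2" using dd(1) x0 by (simp add: dist_norm)
      have "norm (x t - ?y t) \<le> norm (x t - ?y t - (x 0 - ?y 0)) + norm (x 0 - ?y 0)"
        using norm_triangle_ineq[of "x t - ?y t - (x 0 - ?y 0)" "x 0 - ?y 0"] by simp
      then show ?thesis using 1 2 by (simp add: dist_norm norm_minus_commute)
    qed
    let ?\<xi> = "\<lambda>t\<in>{0..1}. inv_into U \<phi> (x t)"
    have xU: "x t \<in> \<phi> ` U" if "t \<in> {0..1}" for t by (rule inU[OF that near[OF that]])
    have \<xi>: "?\<xi> t \<in> U" "\<phi> (?\<xi> t) = x t" if "t \<in> {0..1}" for t
      using xU[OF that] that by (auto simp: inv_into_into f_inv_into_f)
    have rd: "has_reg_derivative (\<phi> \<circ> ?\<xi>) (rep_regR (snd q)) 0 1"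
      by (rule has_reg_derivative_cong[OF x]) (use \<xi>(2) in auto)
    have "curve 0 1 (\<lambda>t. inv_into U \<phi> (x t))"
      by (rule continuous_map_from_chart[OF mani c]) (use x xU in \<open>auto simp: has_reg_derivative_def\<close>)
    then have cont: "curve 0 1 ?\<xi>" by (rule continuous_map_eq) simp
    have "?\<xi> \<in> AC (atlas L)"
      unfolding AC_def mem_Collect_eq
    proof (intro conjI cont exI[of _ "{0, 1}"] allI impI)
      fix u v assume "consecutive {0, 1 :: real} u v"
      then have "u = 0" "v = 1" by (auto simp: consecutive_def)
      moreover have "AC_on 0 1 (\<phi> \<circ> ?\<xi>)" using rd by (auto simp: AC_on_def)
      ultimately show "\<exists>(U, \<phi>)\<in>charts (atlas L). ?\<xi> ` {u..v} \<subseteq> U \<and> AC_on u v (\<phi> \<circ> ?\<xi>)"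
        using c \<xi>(1) by (intro bexI[OF _ c]) auto
    qed (auto simp: partition_of_def)
    then have "?\<xi> \<in> AC_in (atlas L) U" using \<xi>(1) by (auto simp: AC_in_def)
    moreover have "AC_coord (\<phi> \<circ> ?\<xi>) = q"
      using AC_coord_eq[OF rd] \<xi>(2)[of 0] x0 by simp
    ultimately show ?thesis by force
  qed
  then show "\<exists>e>0. \<forall>q. dist q z < e \<longrightarrow> q \<in> ?O" using d(1) by (intro exI[of _ "d / 2"]) simp
qed

text \<open>The predicate under \<open>topology\<close> can be unfolded only once it is known to
  define a topology; for intersections this rests on injectivity of the coordinate map.\<close>

lemma openin_AC_topology:
  "openin (AC_topology L) W \<longleftrightarrow> W \<subseteq> AC (atlas L) \<and>
     (\<forall>\<eta>\<in>AC (atlas L). \<forall>(U, \<phi>)\<in>symmetric_charts L.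
        open ((\<lambda>\<zeta>. AC_coord (\<phi> \<circ> \<zeta>)) ` {\<zeta> \<in> AC_in (atlas L) U. pw_mult L \<eta> \<zeta> \<in> W}))"
proof -
  let ?S = "\<lambda>\<eta> U W. {\<zeta> \<in> AC_in (atlas L) U. pw_mult L \<eta> \<zeta> \<in> W}"
  let ?P = "\<lambda>W. W \<subseteq> AC (atlas L) \<and> (\<forall>\<eta>\<in>AC (atlas L). \<forall>c\<in>symmetric_charts L.
        open (snd (AC_chart L c) ` {\<zeta> \<in> fst (AC_chart L c). pw_mult L \<eta> \<zeta> \<in> W}))"
  have P: "?P W \<longleftrightarrow> W \<subseteq> AC (atlas L) \<and> (\<forall>\<eta>\<in>AC (atlas L). \<forall>(U, \<phi>)\<in>symmetric_charts L.
        open ((\<lambda>\<zeta>. AC_coord (\<phi> \<circ> \<zeta>)) ` ?S \<eta> U W))" for W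
    by (simp add: AC_chart_def split_beta)
  have "istopology ?P"
    unfolding istopology_def
  proof (intro conjI allI impI)
    fix W W' assume W: "?P W" and W': "?P W'"
    then show "W \<inter> W' \<subseteq> AC (atlas L)" by blast
    show "\<forall>\<eta>\<in>AC (atlas L). \<forall>c\<in>symmetric_charts L.
        open (snd (AC_chart L c) ` {\<zeta> \<in> fst (AC_chart L c). pw_mult L \<eta> \<zeta> \<in> W \<inter> W'})"
    proof (intro ballI)
      fix \<eta> c assume \<eta>: "\<eta> \<in> AC (atlas L)" and c: "c \<in> symmetric_charts L"
      let ?T = "\<lambda>W. {\<zeta> \<in> fst (AC_chart L c). pw_mult L \<eta> \<zeta> \<in> W}"
      have inj: "inj_on (snd (AC_chart L c)) (fst (AC_chart L c))"
        using AC_coord_inj[of "fst c" "snd c"] symmetric_chartsD(1)[of "fst c" "snd c"] c by (simp add: AC_chart_def)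
      have "snd (AC_chart L c) ` ?T (W \<inter> W') = snd (AC_chart L c) ` (?T W \<inter> ?T W')"
        by (rule arg_cong[where f = "image _"]) auto
      also have "\<dots> = snd (AC_chart L c) ` ?T W \<inter> snd (AC_chart L c) ` ?T W'"
        by (rule inj_on_image_Int[OF inj]) auto
      finally show "open (snd (AC_chart L c) ` ?T (W \<inter> W'))" using W W' \<eta> c by auto
    qed
  next
    fix \<W> assume \<W>: "\<forall>W\<in>\<W>. ?P W"
    then show "\<Union> \<W> \<subseteq> AC (atlas L)" by blast
    show "\<forall>\<eta>\<in>AC (atlas L). \<forall>c\<in>symmetric_charts L.
        open (snd (AC_chart L c) ` {\<zeta> \<in> fst (AC_chart L c). pw_mult L \<eta> \<zeta> \<in> \<Union> \<W>})"
    proof (intro ballI)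
      fix \<eta> c assume \<eta>: "\<eta> \<in> AC (atlas L)" and c: "c \<in> symmetric_charts L"
      have "snd (AC_chart L c) ` {\<zeta> \<in> fst (AC_chart L c). pw_mult L \<eta> \<zeta> \<in> \<Union> \<W>} =
          (\<Union>W\<in>\<W>. snd (AC_chart L c) ` {\<zeta> \<in> fst (AC_chart L c). pw_mult L \<eta> \<zeta> \<in> W})" by auto
      then show "open (snd (AC_chart L c) ` {\<zeta> \<in> fst (AC_chart L c). pw_mult L \<eta> \<zeta> \<in> \<Union> \<W>})"
        using \<W> \<eta> c by (auto intro!: open_UN)
    qed
  qed
  then have "openin (AC_topology L) W \<longleftrightarrow> ?P W"
    unfolding AC_topology_def by (subst topology_inverse') auto
  then show ?thesis by (simp only: P)
qed

lemma topspace_AC_topology: "topspace (AC_topology L) = AC (atlas L)"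
proof -
  have "openin (AC_topology L) (AC (atlas L))"
    unfolding openin_AC_topology
  proof (intro conjI ballI, simp, clarify)
    fix \<eta> U \<phi> assume \<eta>: "\<eta> \<in> AC (atlas L)" and c: "(U, \<phi>) \<in> symmetric_charts L"
    have "{\<zeta> \<in> AC_in (atlas L) U. pw_mult L \<eta> \<zeta> \<in> AC (atlas L)} = AC_in (atlas L) U"
      using AC_mult[OF \<eta>] by (auto simp: AC_in_def)
    then show "open ((\<lambda>\<zeta>. AC_coord (\<phi> \<circ> \<zeta>)) ` {\<zeta> \<in> AC_in (atlas L) U. pw_mult L \<eta> \<zeta> \<in> AC (atlas L)})"
      using open_AC_coord_image[OF symmetric_chartsD(1)[OF c]] by simp
  qed
  moreover have "W \<subseteq> AC (atlas L)" if "openin (AC_topology L) W" for W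
    using that by (simp add: openin_AC_topology)
  ultimately show ?thesis by (metis openin_subset openin_topspace subset_antisym)
qed

lemma pw_mult_quotient_curve:
  assumes AC: "\<eta>0 \<in> AC (atlas L)" "\<eta> \<in> AC (atlas L)"
  shows "pw_mult L \<eta>0 (quotient_curve \<eta>0 \<eta>) = \<eta>"
proof (rule extensionalityI[OF _ AC_extensional[OF AC(2)]])
  show "pw_mult L \<eta>0 (quotient_curve \<eta>0 \<eta>) \<in> extensional {0..1}" by (simp add: pw_mult_def)
  fix t :: real assume t: "t \<in> {0..1}"
  have "\<eta>0 t \<in> carrier L" "\<eta> t \<in> carrier L" using AC_points[OF mani _ t] AC pts by auto
  then show "pw_mult L \<eta>0 (quotient_curve \<eta>0 \<eta>) t = \<eta> t"
    using t by (simp add: pw_mult_def quotient_curve_def m_assoc[symmetric])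
qed

text \<open>Openness of \<open>W\<close> is tested in a single chart, translated by
  \<open>\<eta>0\<close>: the quotient of \<open>\<eta>0\<close> and \<eta> has first coordinate
  \<open>\<phi> \<one>\<close> and a second one of norm at most \<open>B * \<delta>\<close>, so it
  tends to the coordinates of the constant curve \<one>.\<close>

theorem evolution_continuous:
  assumes \<gamma>0: "regulated_on 0 1 \<gamma>0" and ev0: "evolution \<gamma>0 \<eta>0"
    and W: "openin (AC_topology L) W" "\<eta>0 \<in> W"
  obtains \<delta> where "\<delta> > 0" "\<And>\<gamma> \<eta>. regulated_on 0 1 \<gamma> \<Longrightarrow> evolution \<gamma> \<eta> \<Longrightarrow>
      AE t in lebesgue_on {0..1}. norm (\<gamma> t - \<gamma>0 t) \<le> \<delta> \<Longrightarrow> \<eta> \<in> W"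
proof -
  obtain U \<phi> where c: "(U, \<phi>) \<in> symmetric_charts L" using Lie_group_symmetric_chart[OF lie] by (metis surj_pair)
  note c' = symmetric_chartsD[OF c]
  obtain M where M: "\<And>t. t \<in> {0..1} \<Longrightarrow> norm (\<gamma>0 t) \<le> M" using regulated_on_bounded[OF \<gamma>0] by blast
  have M0: "M \<ge> 0" using order_trans[OF norm_ge_zero M[of 0]] by simp
  have bd: "AE t in lebesgue_on {0..1}. norm (\<gamma>0 t) \<le> M" using M by (intro AE_I2) auto
  obtain \<delta>0 B where \<delta>0: "\<delta>0 > 0" and B: "B \<ge> 0"
    and st: "\<And>\<gamma>0 \<gamma> \<eta>0 \<eta> \<delta>. regulated_on 0 1 \<gamma>0 \<Longrightarrow> regulated_on 0 1 \<gamma> \<Longrightarrow> evolution \<gamma>0 \<eta>0 \<Longrightarrow> evolution \<gamma> \<eta> \<Longrightarrow>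
      AE t in lebesgue_on {0..1}. norm (\<gamma>0 t) \<le> M \<Longrightarrow> AE t in lebesgue_on {0..1}. norm (\<gamma> t - \<gamma>0 t) \<le> \<delta> \<Longrightarrow>
      0 \<le> \<delta> \<Longrightarrow> \<delta> \<le> \<delta>0 \<Longrightarrow>
      (\<forall>t\<in>{0..1}. quotient_curve \<eta>0 \<eta> t \<in> U \<and> norm (\<phi> (quotient_curve \<eta>0 \<eta> t) - \<phi> \<one>) \<le> B * \<delta>) \<and>
      (AE t in lebesgue_on {0..1}. norm (quotient_velocity U \<phi> (\<phi> (quotient_curve \<eta>0 \<eta> t)) (\<gamma>0 t, \<gamma> t)) \<le> B * \<delta>)"
    by (rule evolution_stability[OF c' M0]) blast
  have AC0: "\<eta>0 \<in> AC (atlas L)" using ev0 by (simp add: evolution_def)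
  let ?S = "{\<zeta> \<in> AC_in (atlas L) U. pw_mult L \<eta>0 \<zeta> \<in> W}"
  let ?O = "(\<lambda>\<zeta>. AC_coord (\<phi> \<circ> \<zeta>)) ` ?S"
  have O: "open ?O" using W(1) AC0 c unfolding openin_AC_topology by blast
  have quot: "quotient_curve \<eta>0 \<eta> \<in> AC_in (atlas L) U \<and> fst (AC_coord (\<phi> \<circ> quotient_curve \<eta>0 \<eta>)) = \<phi> \<one> \<and>
      norm (snd (AC_coord (\<phi> \<circ> quotient_curve \<eta>0 \<eta>))) \<le> B * \<delta>"
    if \<gamma>: "regulated_on 0 1 \<gamma>" and ev: "evolution \<gamma> \<eta>"
      and cl: "AE t in lebesgue_on {0..1}. norm (\<gamma> t - \<gamma>0 t) \<le> \<delta>" and \<delta>: "0 \<le> \<delta>" "\<delta> \<le> \<delta>0" for \<gamma> \<eta> \<delta>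
  proof -
    let ?\<zeta> = "quotient_curve \<eta>0 \<eta>"
    have AC: "\<eta> \<in> AC (atlas L)" using ev by (simp add: evolution_def)
    have S: "?\<zeta> t \<in> U" if "t \<in> {0..1}" for t
      using st[OF \<gamma>0 \<gamma> ev0 ev bd cl \<delta>] that by blast
    have V: "AE t in lebesgue_on {0..1}. norm (quotient_velocity U \<phi> (\<phi> (?\<zeta> t)) (\<gamma>0 t, \<gamma> t)) \<le> B * \<delta>"
      using st[OF \<gamma>0 \<gamma> ev0 ev bd cl \<delta>] by blast
    have D: "has_reg_derivative (\<phi> \<circ> ?\<zeta>) (\<lambda>t. quotient_velocity U \<phi> (\<phi> (?\<zeta> t)) (\<gamma>0 t, \<gamma> t)) 0 1"
    proof (rule quotient_has_reg_derivative[OF c'(1) AC0 _ \<gamma>0 AC _ \<gamma>])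
      show "inv (\<eta>0 t) \<otimes> \<eta> t \<in> U" if "t \<in> {0..1}" for t
        using S[OF that] that by (simp add: quotient_curve_def)
    qed (use ev0 ev in \<open>auto simp: evolution_def\<close>)
    have "?\<zeta> 0 = \<one>" using ev0 ev by (simp add: quotient_curve_def evolution_def)
    then show ?thesis
      using AC_quotient_curve[OF AC0 AC] S norm_AC_coord_le[OF D V] by (auto simp: AC_in_def fst_AC_coord)
  qed
  \<comment> \<open>The estimate with \<delta> equal to 0 locates the centre: the quotient of
    \<open>\<eta>0\<close> by itself has coordinates \<open>(\<phi> \<one>, 0)\<close>.\<close>
  have "AE t in lebesgue_on {0..1}. norm (\<gamma>0 t - \<gamma>0 t) \<le> 0" by simp
  note q0 = quot[OF \<gamma>0 ev0 this]
  have "snd (AC_coord (\<phi> \<circ> quotient_curve \<eta>0 \<eta>0)) = 0" using q0 \<delta>0 by simp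
  then have z0: "AC_coord (\<phi> \<circ> quotient_curve \<eta>0 \<eta>0) = (\<phi> \<one>, 0)"
    using q0 \<delta>0 by (simp add: prod_eq_iff)
  have "quotient_curve \<eta>0 \<eta>0 \<in> ?S" using q0 \<delta>0 W(2) pw_mult_quotient_curve[OF AC0 AC0] by simp
  then have "(\<phi> \<one>, 0) \<in> ?O" using z0 by (metis (no_types, lifting) image_eqI)
  then obtain e where e: "e > 0" "\<And>q. dist q (\<phi> \<one>, 0) < e \<Longrightarrow> q \<in> ?O"
    using O unfolding open_dist by blast
  \<comment> \<open>The second bound ensures \<open>B * \<delta> < e\<close>; \<open>B + 1\<close>
    covers the case that \<open>B\<close> is 0.\<close>
  define \<delta> where "\<delta> = min \<delta>0 (e / (2 * (B + 1)))"
  have \<delta>: "\<delta> > 0" "\<delta> \<le> \<delta>0" using \<delta>0 e(1) B by (auto simp: \<delta>_def)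
  have "\<delta> \<le> e / (2 * (B + 1))" by (simp add: \<delta>_def)
  then have "\<delta> * (2 * (B + 1)) \<le> e" using B by (subst (asm) pos_le_divide_eq) auto
  moreover have "0 \<le> B * \<delta>" using B \<delta>(1) by simp
  ultimately have Be: "B * \<delta> < e" using \<delta>(1) by (simp add: algebra_simps)
  show ?thesis
  proof (rule that[OF \<delta>(1)])
    fix \<gamma> \<eta> assume \<gamma>: "regulated_on 0 1 \<gamma>" and ev: "evolution \<gamma> \<eta>"
      and cl: "AE t in lebesgue_on {0..1}. norm (\<gamma> t - \<gamma>0 t) \<le> \<delta>"
    let ?\<zeta> = "quotient_curve \<eta>0 \<eta>"
    have AC: "\<eta> \<in> AC (atlas L)" using ev by (simp add: evolution_def)
    have q: "?\<zeta> \<in> AC_in (atlas L) U" "fst (AC_coord (\<phi> \<circ> ?\<zeta>)) = \<phi> \<one>" "norm (snd (AC_coord (\<phi> \<circ> ?\<zeta>))) \<le> B * \<delta>"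
      using quot[OF \<gamma> ev cl _ \<delta>(2)] \<delta>(1) by auto
    have "dist (AC_coord (\<phi> \<circ> ?\<zeta>)) (\<phi> \<one>, 0) = norm (snd (AC_coord (\<phi> \<circ> ?\<zeta>)))"
      using q(2) by (simp add: dist_prod_def dist_norm)
    then have "AC_coord (\<phi> \<circ> ?\<zeta>) \<in> ?O" using e(2) q(3) Be by simp
    then obtain \<xi> where \<xi>: "\<xi> \<in> AC_in (atlas L) U" "pw_mult L \<eta>0 \<xi> \<in> W" "AC_coord (\<phi> \<circ> ?\<zeta>) = AC_coord (\<phi> \<circ> \<xi>)"
      by blast
    have "?\<zeta> = \<xi>" using inj_onD[OF AC_coord_inj[OF c'(1)] \<xi>(3) q(1) \<xi>(1)] .
    then show "\<eta> \<in> W" using \<xi>(2) pw_mult_quotient_curve[OF AC0 AC] by simp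
  qed
qed

end

section \<open>Continuity of the linearized action\<close>

context banach_lie_group
begin

text \<open>At the unit, \<open>log_chart\<close> for the chart \<kappa> is the derivative of the
  identity map. Thus near the unit a control \<open>w\<close> moves a curve with velocity close to
  \<open>w\<close>.\<close>

lemma quotient_velocity_one: "quotient_velocity K \<kappa> (\<kappa> \<one>) (0, w) = w"
proof -
  have "log_chart K \<kappa> \<one> = fderiv (\<lambda>y. y) (\<kappa> \<one>)"
    unfolding log_chart_def
  proof (rule fderiv_cong[OF translate_chart_C11(1)[OF kappa one_K]])
    show "\<forall>\<^sub>F y in nhds (\<kappa> \<one>). \<kappa> (inv \<one> \<otimes> inv_into K \<kappa> y) = y"
      using chart_eventually[OF kappa one_K]
      by eventually_elim (use chart_carrier[OF kappa] in auto)
  qed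
  then have "log_chart K \<kappa> \<one> w = w" by (simp add: fderiv_id)
  then show ?thesis using log_chart_inverse(2)[OF kappa one_K, of w] by simp
qed

end

locale semidirect_lie_group =
  N: banach_lie_group N KN \<kappa>N + G: banach_lie_group G KG \<kappa>G
  for N :: "('n, 'e::banach) mgroup" and KN :: "'n set" and \<kappa>N :: "'n \<Rightarrow> 'e"
    and G :: "('g, 'f::banach) mgroup" and KG :: "'g set" and \<kappa>G :: "'g \<Rightarrow> 'f" +
  fixes \<pi> :: "'g \<Rightarrow> 'n \<Rightarrow> 'n"
  assumes hom: "\<pi> \<in> hom G (Lie_Aut N)"
    and cont: "continuous_map (prod_topology (group_topology G) (group_topology N)) (group_topology N) (\<lambda>(g, n). \<pi> g n)"
begin

section \<open>The action on \<open>N\<close> and its linearization at the unit\<close>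

lemma action:
  assumes g: "g \<in> carrier G"
  shows action_auto: "\<pi> g \<in> auto N" and action_smooth: "smooth_map (atlas N) (atlas N) (\<pi> g)"
proof -
  have "\<pi> g \<in> carrier (Lie_Aut N)" using hom g by (auto simp: hom_def)
  then show "\<pi> g \<in> auto N" "smooth_map (atlas N) (atlas N) (\<pi> g)" by (auto simp: Lie_Aut_def)
qed

lemma action_hom: "g \<in> carrier G \<Longrightarrow> \<pi> g \<in> hom N N"
  and action_Bij: "g \<in> carrier G \<Longrightarrow> \<pi> g \<in> Bij (carrier N)"
  using action_auto by (auto simp: auto_def)

lemma action_closed: "g \<in> carrier G \<Longrightarrow> n \<in> carrier N \<Longrightarrow> \<pi> g n \<in> carrier N"
  using action_hom by (auto simp: hom_def)

lemma action_mult: "g \<in> carrier G \<Longrightarrow> n \<in> carrier N \<Longrightarrow> m \<in> carrier N \<Longrightarrow> \<pi> g (n \<otimes>\<^bsub>N\<^esub> m) = \<pi> g n \<otimes>\<^bsub>N\<^esub> \<pi> g m"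
  using action_hom by (auto simp: hom_def)

lemma action_inj: "g \<in> carrier G \<Longrightarrow> inj_on (\<pi> g) (carrier N)"
  using action_Bij by (auto simp: Bij_def bij_betw_def)

lemma action_group_hom: "g \<in> carrier G \<Longrightarrow> group_hom N N (\<pi> g)"
  by (simp add: group_hom_def group_hom_axioms_def action_hom N.is_group)

lemma action_one: "g \<in> carrier G \<Longrightarrow> \<pi> g \<one>\<^bsub>N\<^esub> = \<one>\<^bsub>N\<^esub>"
  using group_hom.hom_one[OF action_group_hom] .

lemma action_inv: "g \<in> carrier G \<Longrightarrow> n \<in> carrier N \<Longrightarrow> \<pi> g (inv\<^bsub>N\<^esub> n) = inv\<^bsub>N\<^esub> (\<pi> g n)"
  using group_hom.hom_inv[OF action_group_hom] .

lemma action_compose: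
  assumes g: "g \<in> carrier G" "h \<in> carrier G" and n: "n \<in> carrier N"
  shows "\<pi> (g \<otimes>\<^bsub>G\<^esub> h) n = \<pi> g (\<pi> h n)"
proof -
  have "\<pi> (g \<otimes>\<^bsub>G\<^esub> h) = \<pi> g \<otimes>\<^bsub>Lie_Aut N\<^esub> \<pi> h" using hom g by (simp add: hom_def)
  also have "\<dots> = compose (carrier N) (\<pi> g) (\<pi> h)"
    using action_Bij g by (simp add: Lie_Aut_def AutoGroup_def BijGroup_def)
  finally show ?thesis using n by (simp add: compose_def)
qed

lemma action_identity:
  assumes n: "n \<in> carrier N" shows "\<pi> \<one>\<^bsub>G\<^esub> n = n"
proof (rule inj_onD[OF action_inj[OF G.one_closed]])
  show "\<pi> \<one>\<^bsub>G\<^esub> (\<pi> \<one>\<^bsub>G\<^esub> n) = \<pi> \<one>\<^bsub>G\<^esub> n"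
    using action_compose[OF G.one_closed G.one_closed n] by simp
qed (use n action_closed in auto)

lemma action_inverse: "g \<in> carrier G \<Longrightarrow> n \<in> carrier N \<Longrightarrow> \<pi> (inv\<^bsub>G\<^esub> g) (\<pi> g n) = n"
  "g \<in> carrier G \<Longrightarrow> n \<in> carrier N \<Longrightarrow> \<pi> g (\<pi> (inv\<^bsub>G\<^esub> g) n) = n"
  using action_compose[of "inv\<^bsub>G\<^esub> g" g n] action_compose[of g "inv\<^bsub>G\<^esub> g" n] action_identity by simp_all

lemma action_C11: "g \<in> carrier G \<Longrightarrow> n \<in> carrier N \<Longrightarrow> C11_map_at (atlas N) (atlas N) (\<pi> g) n"
  by (rule smooth_map_imp_C11_map_at[OF N.mani N.mani action_smooth]) (simp_all add: N.pts)

text \<open>The tangent map of the automorphism \<open>\<pi> g\<close> at the unit of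
  \<open>N\<close>, read in the chart that identifies the Lie algebra with the model space.\<close>

definition daction :: "'g \<Rightarrow> 'e \<Rightarrow>\<^sub>L 'e" where
  "daction g = fderiv (\<lambda>y. \<kappa>N (\<pi> g (inv_into KN \<kappa>N y))) (\<kappa>N \<one>\<^bsub>N\<^esub>)"

lemma action_chart:
  assumes g: "g \<in> carrier G"
  shows "\<forall>\<^sub>F y in nhds (\<kappa>N \<one>\<^bsub>N\<^esub>). \<pi> g (inv_into KN \<kappa>N y) \<in> KN"
    and "C11_at (\<lambda>y. \<kappa>N (\<pi> g (inv_into KN \<kappa>N y))) (\<kappa>N \<one>\<^bsub>N\<^esub>)"
proof -
  have "\<pi> g \<one>\<^bsub>N\<^esub> \<in> KN" using action_one[OF g] N.one_K by simp
  from C11_map_at_charts[OF N.mani N.mani action_C11[OF g N.one_closed] N.kappa N.one_K N.kappa this]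
  show "\<forall>\<^sub>F y in nhds (\<kappa>N \<one>\<^bsub>N\<^esub>). \<pi> g (inv_into KN \<kappa>N y) \<in> KN"
    "C11_at (\<lambda>y. \<kappa>N (\<pi> g (inv_into KN \<kappa>N y))) (\<kappa>N \<one>\<^bsub>N\<^esub>)" by (simp_all add: o_def)
qed

text \<open>A homomorphism maps increments to increments, so the derivative of
  \<open>\<pi> g\<close> enters at the unit only, for a fixed \<open>g\<close>.\<close>

lemma log_deriv_at_action:
  assumes g: "g \<in> carrier G" and \<alpha>: "N.log_deriv_at \<alpha> t v"
  shows "N.log_deriv_at (\<lambda>s. \<pi> g (\<alpha> s)) t (daction g v)"
proof -
  let ?x = "\<lambda>s. \<kappa>N (inv\<^bsub>N\<^esub> (\<alpha> t) \<otimes>\<^bsub>N\<^esub> \<alpha> s)"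
  have at: "\<alpha> t \<in> carrier N" by (rule N.log_deriv_at_carrier[OF \<alpha>])
  have ev: "\<forall>\<^sub>F s in nhds t. \<alpha> s \<in> carrier N \<and> inv\<^bsub>N\<^esub> (\<alpha> t) \<otimes>\<^bsub>N\<^esub> \<alpha> s \<in> KN"
    and D: "(?x has_vector_derivative v) (at t)"
    using \<alpha> by (auto simp: N.log_deriv_at_def)
  have xt: "?x t = \<kappa>N \<one>\<^bsub>N\<^esub>" using at by simp
  have "isCont ?x t" by (rule has_vector_derivative_continuous[OF D])
  then have lim: "filterlim ?x (nhds (\<kappa>N \<one>\<^bsub>N\<^esub>)) (nhds t)"
    using tendsto_at_iff_tendsto_nhds[of ?x t] xt by (simp add: isCont_def)
  have eq: "\<forall>\<^sub>F s in nhds t. \<alpha> s \<in> carrier N \<and> inv_into KN \<kappa>N (?x s) = inv\<^bsub>N\<^esub> (\<alpha> t) \<otimes>\<^bsub>N\<^esub> \<alpha> s \<and>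
      inv\<^bsub>N\<^esub> (\<pi> g (\<alpha> t)) \<otimes>\<^bsub>N\<^esub> \<pi> g (\<alpha> s) = \<pi> g (inv\<^bsub>N\<^esub> (\<alpha> t) \<otimes>\<^bsub>N\<^esub> \<alpha> s)"
    using ev by eventually_elim (use chart_inv_into[OF N.kappa] action_mult action_inv at g in simp)
  have "\<forall>\<^sub>F s in nhds t. \<pi> g (\<alpha> s) \<in> carrier N \<and> inv\<^bsub>N\<^esub> (\<pi> g (\<alpha> t)) \<otimes>\<^bsub>N\<^esub> \<pi> g (\<alpha> s) \<in> KN"
    using eventually_compose_filterlim[OF action_chart(1)[OF g] lim] eq
    by eventually_elim (use action_closed[OF g] in simp)
  moreover have "((\<lambda>s. \<kappa>N (inv\<^bsub>N\<^esub> (\<pi> g (\<alpha> t)) \<otimes>\<^bsub>N\<^esub> \<pi> g (\<alpha> s))) has_vector_derivative daction g v) (at t)"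
  proof (rule has_vector_derivative_eventually_cong)
    have "C11_at (\<lambda>y. \<kappa>N (\<pi> g (inv_into KN \<kappa>N y))) (?x t)" unfolding xt by (rule action_chart(2)[OF g])
    from vector_derivative_chain_C11[OF this D]
    show "((\<lambda>s. \<kappa>N (\<pi> g (inv_into KN \<kappa>N (?x s)))) has_vector_derivative daction g v) (at t)"
      unfolding xt daction_def .
    show "\<forall>\<^sub>F s in nhds t. \<kappa>N (\<pi> g (inv_into KN \<kappa>N (?x s))) = \<kappa>N (inv\<^bsub>N\<^esub> (\<pi> g (\<alpha> t)) \<otimes>\<^bsub>N\<^esub> \<pi> g (\<alpha> s))"
      using eq by eventually_elim simp
  qed
  ultimately show ?thesis by (simp add: N.log_deriv_at_def)
qed

lemma daction_mult:
  assumes g: "g \<in> carrier G" "h \<in> carrier G"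
  shows "daction (g \<otimes>\<^bsub>G\<^esub> h) = daction g o\<^sub>L daction h"
proof -
  let ?F = "\<lambda>g y. \<kappa>N (\<pi> g (inv_into KN \<kappa>N y))"
  have h1: "?F h (\<kappa>N \<one>\<^bsub>N\<^esub>) = \<kappa>N \<one>\<^bsub>N\<^esub>" using chart_inv_into[OF N.kappa N.one_K] action_one[OF g(2)] by simp
  have C: "C11_at (?F g) (?F h (\<kappa>N \<one>\<^bsub>N\<^esub>))" unfolding h1 by (rule action_chart(2)[OF g(1)])
  have "\<forall>\<^sub>F y in nhds (\<kappa>N \<one>\<^bsub>N\<^esub>). (?F g \<circ> ?F h) y = ?F (g \<otimes>\<^bsub>G\<^esub> h) y"
    using action_chart(1)[OF g(2)] chart_eventually[OF N.kappa N.one_K]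
    by eventually_elim (use g N.chart_carrier[OF N.kappa] in \<open>simp add: chart_inv_into[OF N.kappa] action_compose\<close>)
  from fderiv_cong[OF C11_at_compose[OF action_chart(2)[OF g(2)] C] this]
  have "fderiv (?F g \<circ> ?F h) (\<kappa>N \<one>\<^bsub>N\<^esub>) = daction (g \<otimes>\<^bsub>G\<^esub> h)" by (simp only: daction_def)
  moreover from fderiv_compose[OF action_chart(2)[OF g(2)] C]
  have "fderiv (?F g \<circ> ?F h) (\<kappa>N \<one>\<^bsub>N\<^esub>) = daction g o\<^sub>L daction h" by (simp only: daction_def h1)
  ultimately show ?thesis by (simp only:)
qed

lemma daction_one: "daction \<one>\<^bsub>G\<^esub> v = v"
proof -
  have "\<forall>\<^sub>F y in nhds (\<kappa>N \<one>\<^bsub>N\<^esub>). \<kappa>N (\<pi> \<one>\<^bsub>G\<^esub> (inv_into KN \<kappa>N y)) = y"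
    using chart_eventually[OF N.kappa N.one_K]
    by eventually_elim (use N.chart_carrier[OF N.kappa] action_identity in simp)
  from fderiv_cong[OF action_chart(2)[OF G.one_closed] this] show ?thesis
    by (simp add: daction_def fderiv_id)
qed

lemma daction_inverse: "g \<in> carrier G \<Longrightarrow> daction (inv\<^bsub>G\<^esub> g) (daction g v) = v"
  using daction_mult[of "inv\<^bsub>G\<^esub> g" g] daction_one[of v] by (metis G.inv_closed G.l_inv blinfun_apply_blinfun_compose)

text \<open>The automorphism \<open>\<pi> g\<close> maps the one-parameter group \<open>e\<close> with velocity \<open>v\<close> to the one with
  velocity \<open>d\<pi>(g) v\<close>, and the remainder of a one-parameter group in the chart is quadratic, uniformly
  for bounded velocities. So continuity of the action on \<open>N\<close> turns into estimates for \<open>d\<pi>(g) v\<close>.\<close>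

lemma action_expansion:
  obtains W c R B where "openin (group_topology G) W" "\<one>\<^bsub>G\<^esub> \<in> W" "c > 0" "R \<ge> 0" "B \<ge> 0"
    "\<And>v. norm v \<le> c \<Longrightarrow> \<exists>e. (\<forall>s\<in>{0..1}. e s \<in> KN) \<and>
       (\<forall>g\<in>W. norm (daction g v) \<le> R \<and> (\<forall>s\<in>{0..1}. norm (\<kappa>N (\<pi> g (e s)) - \<kappa>N \<one>\<^bsub>N\<^esub> - s *\<^sub>R daction g v) \<le> B * s * s))"
proof -
  let ?p = "\<kappa>N \<one>\<^bsub>N\<^esub>" and ?q = "N.quotient_velocity KN \<kappa>N"
  obtain r C where r: "r > 0" "C \<ge> 0" "ball ?p r \<subseteq> \<kappa>N ` KN"
    "\<And>z w. z \<in> ball ?p r \<Longrightarrow> w \<in> ball ?p r \<Longrightarrow> norm (?q z - ?q w) \<le> C * norm (z - w)"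
    by (rule N.quotient_velocity_lipschitz[OF N.kappa N.one_K]) blast
  \<comment> \<open>Within this radius the left invariant field of \<open>w\<close> differs from
    \<open>w\<close> by at most half of the norm of \<open>w\<close>.\<close>
  define R where "R = min r (1 / (2 * (C + 1)))"
  have R: "R > 0" "R \<le> r" "C * R \<le> 1 / 2"
  proof -
    show "R > 0" "R \<le> r" using r(1,2) by (auto simp: R_def)
    have "R \<le> 1 / (2 * (C + 1))" by (simp add: R_def)
    then have "R * (2 * (C + 1)) \<le> 1" using r(2) by (subst (asm) pos_le_divide_eq) auto
    then show "C * R \<le> 1 / 2" using \<open>R > 0\<close> by (simp add: algebra_simps)
  qed
  have q: "norm (?q z (0, w) - w) \<le> C * norm (z - ?p) * norm w" if "z \<in> ball ?p R" for z w
  proof -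
    have "?q z (0, w) - w = (?q z - ?q ?p) (0, w)" by (simp add: blinfun.diff_left N.quotient_velocity_one)
    also have "norm \<dots> \<le> norm (?q z - ?q ?p) * norm (0 :: 'e, w)" by (rule norm_blinfun)
    also have "\<dots> \<le> C * norm (z - ?p) * norm w"
      using r(4)[of z ?p] that R(2) r(1) by (auto simp: norm_Pair intro!: mult_right_mono)
    finally show ?thesis .
  qed
  define O' where "O' = KN \<inter> \<kappa>N -` ball ?p R"
  have O': "openin (group_topology N) O'" "\<one>\<^bsub>N\<^esub> \<in> O'"
    unfolding O'_def using chart_preimage_open[OF N.mani N.kappa open_ball] N.one_K R(1) by auto
  let ?X = "prod_topology (group_topology G) (group_topology N)"
  have o: "openin ?X {p \<in> topspace ?X. (case p of (g, n) \<Rightarrow> \<pi> g n) \<in> O'}"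
    by (rule openin_continuous_map_preimage[OF cont O'(1)])
  have m: "(\<one>\<^bsub>G\<^esub>, \<one>\<^bsub>N\<^esub>) \<in> {p \<in> topspace ?X. (case p of (g, n) \<Rightarrow> \<pi> g n) \<in> O'}"
    using O'(2) action_one[of "\<one>\<^bsub>G\<^esub>"] by (simp add: G.topspace_L N.topspace_L)
  \<comment> \<open>Joint continuity of the action at the pair of units gives one \<open>W\<close>
    for all points of \<open>Q\<close>; this makes the later bounds uniform in
    \<open>g\<close>.\<close>
  obtain W Q where WQ: "openin (group_topology G) W" "openin (group_topology N) Q" "\<one>\<^bsub>G\<^esub> \<in> W" "\<one>\<^bsub>N\<^esub> \<in> Q"
    "W \<times> Q \<subseteq> {p \<in> topspace ?X. (case p of (g, n) \<Rightarrow> \<pi> g n) \<in> O'}"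
    using openin_prod_topology_alt[THEN iffD1, rule_format, OF o m] by (elim exE conjE)
  have WQ': "g \<in> carrier G \<and> \<pi> g n \<in> O'" if "g \<in> W" "n \<in> Q" for g n
    using subsetD[OF WQ(5), of "(g, n)"] that by (simp add: G.topspace_L)
  have "open (\<kappa>N ` (Q \<inter> KN))" by (rule chart_image_open[OF N.mani N.kappa WQ(2)])
  then obtain \<rho> where \<rho>: "\<rho> > 0" "cball ?p \<rho> \<subseteq> \<kappa>N ` (Q \<inter> KN)"
    using WQ(4) N.one_K unfolding open_contains_cball by blast
  have inQ: "n \<in> Q" if "n \<in> KN" "\<kappa>N n \<in> cball ?p \<rho>" for n
  proof -
    have "\<kappa>N n \<in> \<kappa>N ` (Q \<inter> KN)" using that \<rho>(2) by blast
    then show ?thesis using chart_inj[OF N.kappa] that(1) by (auto dest: inj_onD)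
  qed
  obtain c where c: "c > 0" "\<And>a b \<gamma> M. a \<le> b \<Longrightarrow> M \<ge> 0 \<Longrightarrow> (b - a) * M \<le> c \<Longrightarrow> regulated_on a b \<gamma> \<Longrightarrow>
      (\<And>t. t \<in> {a..b} \<Longrightarrow> norm (\<gamma> t) \<le> M) \<Longrightarrow>
      \<exists>\<eta>. N.curve a b \<eta> \<and> \<eta> a = \<one>\<^bsub>N\<^esub> \<and> (\<forall>t\<in>{a..b}. \<eta> t \<in> KN \<and> \<kappa>N (\<eta> t) \<in> cball ?p \<rho>) \<and>
        (\<exists>D. countable D \<and> (\<forall>t\<in>{a<..<b} - D. N.log_deriv_at \<eta> t (\<gamma> t)))"
    by (rule N.local_evolution[OF \<rho>(1)]) blast
  show ?thesis
  \<comment> \<open>\<open>2 * R\<close> bounds the norm of \<open>daction g v\<close>. The factor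
    \<open>6 * C * R * R\<close> is \<open>C\<close> times the bound \<open>3 * R * s\<close> for
    the displacement times \<open>2 * R\<close>, with the power of \<open>s\<close> split
    off.\<close>
  proof (rule that[OF WQ(1,3) c(1), of "2 * R" "6 * C * R * R"])
    fix v :: 'e assume v: "norm v \<le> c"
    obtain e D where e: "N.curve 0 1 e" "e 0 = \<one>\<^bsub>N\<^esub>" "\<forall>t\<in>{0..1}. e t \<in> KN \<and> \<kappa>N (e t) \<in> cball ?p \<rho>"
      and D: "countable D" "\<forall>t\<in>{0<..<1} - D. N.log_deriv_at e t v"
      using c(2)[of 0 1 "norm v" "\<lambda>_. v"] v by (auto simp: regulated_on_const)
    have main: "norm (daction g v) \<le> 2 * R \<and> (\<forall>s\<in>{0..1}. norm (\<kappa>N (\<pi> g (e s)) - ?p - s *\<^sub>R daction g v) \<le> 6 * C * R * R * s * s)"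
      if g: "g \<in> W" for g
    proof -
      let ?w = "daction g v"
      let ?u = "\<lambda>s. \<kappa>N (\<pi> g (e s))"
      have gc: "g \<in> carrier G" using WQ'[OF g WQ(4)] by simp
      have O: "\<pi> g (e s) \<in> KN" "?u s \<in> ball ?p R" if "s \<in> {0..1}" for s
        using WQ'[OF g inQ] e(3) that by (auto simp: O'_def)
      have cu: "N.curve 0 1 (\<lambda>s. \<pi> g (e s))"
      proof -
        have "continuous_map (group_topology N) (group_topology N) (\<pi> g)"
          using action_smooth[OF gc] by (simp add: smooth_map_def)
        from continuous_map_compose[OF e(1) this] show ?thesis by (simp add: o_def)
      qed
      have uc: "continuous_on {0..1} ?u"
        using curve_in_chart_continuous[OF N.mani N.kappa cu subset_refl image_subsetI[OF O(1)]] by (simp add: o_def)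
      have u0: "?u 0 = ?p" using e(2) action_one[OF gc] by simp
      have du: "has_reg_derivative ?u (\<lambda>s. ?q (?u s) (0, ?w)) 0 1"
      proof (rule has_reg_derivativeI[OF uc _ D(1)])
        show "regulated_on 0 1 (\<lambda>s. ?q (?u s) (0, ?w))"
          by (rule N.regulated_quotient_velocity[OF N.kappa _ uc]) (use O(1) in \<open>auto intro: regulated_on_const\<close>)
        fix t assume t: "t \<in> {0<..<1} - D"
        have "N.log_deriv_at (\<lambda>s. \<pi> g (e s)) t ?w"
          by (rule log_deriv_at_action[OF gc]) (use D(2) t in blast)
        from N.curve_derivative[OF N.kappa this] O(1)[of t] t
        show "(?u has_vector_derivative ?q (?u t) (0, ?w)) (at t)" by (simp add: o_def)
      qed
      have dy: "has_reg_derivative (\<lambda>s. ?u s - s *\<^sub>R ?w) (\<lambda>s. ?q (?u s) (0, ?w) - ?w) 0 1"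
        unfolding has_reg_derivative_def
      proof (intro conjI ballI)
        show "continuous_on {0..1} (\<lambda>s. ?u s - s *\<^sub>R ?w)" by (intro continuous_intros uc)
        show "regulated_on 0 1 (\<lambda>s. ?q (?u s) (0, ?w) - ?w)"
          using du by (intro regulated_on_diff regulated_on_const) (auto simp: has_reg_derivative_def)
        fix s :: real assume s: "s \<in> {0..1}"
        have "((\<lambda>s. ?q (?u s) (0, ?w) - ?w) has_integral ((?u s - ?u 0) - (s - 0) *\<^sub>R ?w)) {0..s}"
          using du s has_integral_const_real[of ?w 0 s] by (intro has_integral_diff) (auto simp: has_reg_derivative_def)
        then show "((\<lambda>s. ?q (?u s) (0, ?w) - ?w) has_integral (?u s - s *\<^sub>R ?w - (?u 0 - 0 *\<^sub>R ?w))) {0..s}"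
          by (simp add: algebra_simps)
      qed
      have half: "norm (?q (?u s) (0, ?w) - ?w) \<le> norm ?w / 2" if "s \<in> {0..1}" for s
      proof -
        have "norm (?u s - ?p) \<le> R" using O(2)[OF that] by (simp add: dist_norm norm_minus_commute)
        then have "C * norm (?u s - ?p) * norm ?w \<le> (1 / 2) * norm ?w"
          using R(3) mult_left_mono[of "norm (?u s - ?p)" R C] r(2) by (intro mult_right_mono) auto
        then show ?thesis using q[OF O(2)[OF that], of ?w] by simp
      qed
      \<comment> \<open>In unit time the curve moves by at most \<open>R\<close>, while its velocity
        stays within half the norm of \<open>?w\<close> from \<open>?w\<close>; hence the norm of
        \<open>?w\<close> is at most \<open>2 * R\<close>.\<close>
      have "norm (?u 1 - 1 *\<^sub>R ?w - (?u 0 - 0 *\<^sub>R ?w)) \<le> integral {0..1::real} (\<lambda>_. norm ?w / 2)"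
        by (rule has_reg_derivative_norm_bound[where Z = "{}", OF dy]) (use half in auto)
      then have "norm (?u 1 - ?p - ?w) \<le> norm ?w / 2" unfolding u0 by (simp add: algebra_simps)
      moreover have "norm (?u 1 - ?p) \<le> R" using O(2)[of 1] by (simp add: dist_norm norm_minus_commute)
      moreover have "norm ?w \<le> norm (?u 1 - ?p) + norm (?u 1 - ?p - ?w)"
        using norm_triangle_ineq4[of "?u 1 - ?p" "?u 1 - ?p - ?w"] by simp
      ultimately have w: "norm ?w \<le> 2 * R" by simp
      have lin: "norm (?u s - ?p) \<le> 3 * R * s" if s: "s \<in> {0..1}" for s
      proof -
        have "norm (?u s - ?u 0) \<le> integral {0..s} (\<lambda>_. 3 * R)"
        proof (rule has_reg_derivative_norm_bound[where Z = "{}", OF du s])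
          fix t assume "t \<in> {0<..<s} - {}"
          then have "norm (?q (?u t) (0, ?w) - ?w) \<le> norm ?w / 2" using half s by simp
          then show "norm (?q (?u t) (0, ?w)) \<le> 3 * R"
            using norm_triangle_sub[of "?q (?u t) (0, ?w)" ?w] w by linarith
        qed (use R(1) in auto)
        then show ?thesis unfolding u0 using s by (simp add: mult_ac)
      qed
      have "norm (?u s - ?p - s *\<^sub>R ?w) \<le> 6 * C * R * R * s * s" if s: "s \<in> {0..1}" for s
      proof -
        have "norm (?u s - s *\<^sub>R ?w - (?u 0 - 0 *\<^sub>R ?w)) \<le> integral {0..s} (\<lambda>_. 6 * C * R * R * s)"
        proof (rule has_reg_derivative_norm_bound[where Z = "{}", OF dy s])
          fix t assume t: "t \<in> {0<..<s} - {}"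
          then have t01: "t \<in> {0..1}" using s by auto
          have "norm (?q (?u t) (0, ?w) - ?w) \<le> C * norm (?u t - ?p) * norm ?w" by (rule q[OF O(2)[OF t01]])
          also have "\<dots> \<le> C * (3 * R * s) * (2 * R)"
          proof (rule mult_mono)
            have "3 * R * t \<le> 3 * R * s" using t R(1) by simp
            then have "norm (?u t - ?p) \<le> 3 * R * s" using lin[OF t01] by linarith
            then show "C * norm (?u t - ?p) \<le> C * (3 * R * s)" using r(2) by (rule mult_left_mono)
          qed (use w r(2) R(1) s in auto)
          finally show "norm (?q (?u t) (0, ?w) - ?w) \<le> 6 * C * R * R * s" by (simp add: mult_ac)
        qed (use R(1) r(2) s in auto)
        then show ?thesis unfolding u0 using s by (simp add: algebra_simps)
      qed
      with w show ?thesis by blast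
    qed
    show "\<exists>e. (\<forall>s\<in>{0..1}. e s \<in> KN) \<and> (\<forall>g\<in>W. norm (daction g v) \<le> 2 * R \<and>
        (\<forall>s\<in>{0..1}. norm (\<kappa>N (\<pi> g (e s)) - ?p - s *\<^sub>R daction g v) \<le> 6 * C * R * R * s * s))"
      using e(3) main by (intro exI[of _ e]) simp
  qed (use R(1) r(2) in auto)
qed

text \<open>The expansion bounds \<open>daction g v\<close> by \<open>R\<close> for all
  \<open>v\<close> of norm at most \<open>c\<close>; by homogeneity this is the operator bound
  \<open>R / c\<close>.\<close>

lemma daction_bounded_near_one:
  obtains W B where "openin (group_topology G) W" "\<one>\<^bsub>G\<^esub> \<in> W" "B \<ge> 0"
    "\<And>g v. g \<in> W \<Longrightarrow> norm (daction g v) \<le> B * norm v"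
proof -
  obtain W c R B where W: "openin (group_topology G) W" "\<one>\<^bsub>G\<^esub> \<in> W" "c > 0" "R \<ge> 0"
    and *: "\<And>v. norm v \<le> c \<Longrightarrow> \<exists>e. (\<forall>s\<in>{0..1::real}. e s \<in> KN) \<and>
       (\<forall>g\<in>W. norm (daction g v) \<le> R \<and> (\<forall>s\<in>{0..1}. norm (\<kappa>N (\<pi> g (e s)) - \<kappa>N \<one>\<^bsub>N\<^esub> - s *\<^sub>R daction g v) \<le> B * s * s))"
    by (rule action_expansion) blast
  show ?thesis
  proof (rule that[OF W(1,2), of "R / c"])
    show "R / c \<ge> 0" using W by simp
    fix g v assume g: "g \<in> W"
    show "norm (daction g v) \<le> R / c * norm v"
    proof (cases "v = 0")
      case False
      have "norm ((c / norm v) *\<^sub>R v) \<le> c" using False W(3) by simp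
      from *[OF this] g have "norm (daction g ((c / norm v) *\<^sub>R v)) \<le> R" by blast
      then have "c / norm v * norm (daction g v) \<le> R" using W(3) by (simp add: blinfun.scaleR_right)
      then show ?thesis using W(3) False by (simp add: field_simps)
    qed simp
  qed
qed

text \<open>Up to an error of at most \<open>B * s\<close>, uniform in \<open>g\<close>, the scaled
  vector is mapped by \<open>daction g\<close> to the difference quotient of the transported segment
  at time \<open>s\<close>. With \<open>s\<close> fixed first, continuity of the action at the
  single point \<open>e s\<close> remains; taking the unit for \<open>g\<close> gives the vector
  itself.\<close>

lemma daction_continuous_at_one:
  assumes \<epsilon>: "\<epsilon> > 0"
  obtains W where "openin (group_topology G) W" "\<one>\<^bsub>G\<^esub> \<in> W" "\<And>g. g \<in> W \<Longrightarrow> norm (daction g v - v) \<le> \<epsilon>"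
proof -
  obtain W c R B where W: "openin (group_topology G) W" "\<one>\<^bsub>G\<^esub> \<in> W" "c > 0" "B \<ge> 0"
    and *: "\<And>v. norm v \<le> c \<Longrightarrow> \<exists>e. (\<forall>s\<in>{0..1::real}. e s \<in> KN) \<and>
       (\<forall>g\<in>W. norm (daction g v) \<le> R \<and> (\<forall>s\<in>{0..1}. norm (\<kappa>N (\<pi> g (e s)) - \<kappa>N \<one>\<^bsub>N\<^esub> - s *\<^sub>R daction g v) \<le> B * s * s))"
    by (rule action_expansion) blast
  \<comment> \<open>Scales \<open>v\<close> into the range of norms covered by the
    expansion.\<close>
  define k where "k = c / (norm v + 1)"
  have nv: "norm v + 1 > 0" by (simp add: add_nonneg_pos)
  have k: "k > 0" using W(3) nv by (simp add: k_def)
  have "norm (k *\<^sub>R v) = c * (norm v / (norm v + 1))" using W(3) nv by (simp add: k_def)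
  also have "\<dots> \<le> c * 1" using W(3) nv by (intro mult_left_mono) auto
  finally have "norm (k *\<^sub>R v) \<le> c" by simp
  from *[OF this] obtain e where e: "\<And>s. s \<in> {0..1::real} \<Longrightarrow> e s \<in> KN"
    "\<And>g s. g \<in> W \<Longrightarrow> s \<in> {0..1} \<Longrightarrow> norm (\<kappa>N (\<pi> g (e s)) - \<kappa>N \<one>\<^bsub>N\<^esub> - s *\<^sub>R daction g (k *\<^sub>R v)) \<le> B * s * s"
    by blast
  define \<epsilon>' where "\<epsilon>' = k * \<epsilon> / 2"
  have \<epsilon>': "\<epsilon>' > 0" using k \<epsilon> by (simp add: \<epsilon>'_def)
  \<comment> \<open>Small enough that the two remainders, for \<open>g\<close> and for the unit,
    together cost at most \<open>s * \<epsilon>'\<close>.\<close>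
  define s where "s = min 1 (\<epsilon>' / (2 * B + 1))"
  have s: "0 < s" "s \<le> 1" using \<epsilon>' W(4) by (auto simp: s_def)
  have "s \<le> \<epsilon>' / (2 * B + 1)" by (simp add: s_def)
  then have "s * (2 * B + 1) \<le> \<epsilon>'" using W(4) by (subst (asm) pos_le_divide_eq) auto
  then have Bs: "2 * B * s \<le> \<epsilon>'" using s(1) by (simp add: algebra_simps)
  have s01: "s \<in> {0..1}" using s by simp
  let ?n = "e s"
  have n: "?n \<in> KN" "?n \<in> carrier N" using e(1)[OF s01] N.chart_carrier[OF N.kappa] by auto
  \<comment> \<open>The radius carries the factor \<open>s\<close> because the difference is divided
    by \<open>s\<close> at the end.\<close>
  define Y where "Y = KN \<inter> \<kappa>N -` ball (\<kappa>N ?n) (s * \<epsilon>')"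
  have Y: "openin (group_topology N) Y" "?n \<in> Y"
    unfolding Y_def using chart_preimage_open[OF N.mani N.kappa open_ball] n s(1) \<epsilon>' by auto
  have "continuous_map (group_topology G) (prod_topology (group_topology G) (group_topology N)) (\<lambda>g. (g, ?n))"
    by (intro continuous_map_pairedI continuous_map_id[unfolded id_def]) (simp add: N.topspace_L n)
  from continuous_map_compose[OF this cont]
  have "continuous_map (group_topology G) (group_topology N) (\<lambda>g. \<pi> g ?n)" by (simp add: o_def)
  from openin_continuous_map_preimage[OF this Y(1)]
  have o: "openin (group_topology G) {g \<in> carrier G. \<pi> g ?n \<in> Y}" by (simp add: G.topspace_L)
  show ?thesis
  proof (rule that[of "W \<inter> {g \<in> carrier G. \<pi> g ?n \<in> Y}"])
    show "openin (group_topology G) (W \<inter> {g \<in> carrier G. \<pi> g ?n \<in> Y})" by (rule openin_Int[OF W(1) o])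
    show "\<one>\<^bsub>G\<^esub> \<in> W \<inter> {g \<in> carrier G. \<pi> g ?n \<in> Y}" using W(2) Y(2) n action_identity by simp
    fix g assume g: "g \<in> W \<inter> {g \<in> carrier G. \<pi> g ?n \<in> Y}"
    let ?d = "daction g (k *\<^sub>R v)"
    have 1: "norm (\<kappa>N (\<pi> g ?n) - \<kappa>N \<one>\<^bsub>N\<^esub> - s *\<^sub>R ?d) \<le> B * s * s" using e(2)[OF _ s01] g by simp
    have 2: "norm (\<kappa>N ?n - \<kappa>N \<one>\<^bsub>N\<^esub> - s *\<^sub>R (k *\<^sub>R v)) \<le> B * s * s"
      using e(2)[OF W(2) s01] n action_identity daction_one by simp
    have 3: "norm (\<kappa>N (\<pi> g ?n) - \<kappa>N ?n) \<le> s * \<epsilon>'"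
      using g by (simp add: Y_def dist_norm norm_minus_commute)
    have "s *\<^sub>R (?d - k *\<^sub>R v) = (\<kappa>N (\<pi> g ?n) - \<kappa>N ?n) - ((\<kappa>N (\<pi> g ?n) - \<kappa>N \<one>\<^bsub>N\<^esub> - s *\<^sub>R ?d) - (\<kappa>N ?n - \<kappa>N \<one>\<^bsub>N\<^esub> - s *\<^sub>R (k *\<^sub>R v)))"
      by (simp add: algebra_simps)
    also have "norm \<dots> \<le> s * \<epsilon>' + (B * s * s + B * s * s)"
      by (intro order_trans[OF norm_triangle_ineq4] add_mono 1 2 3)
    also have "\<dots> \<le> s * (2 * \<epsilon>')" using mult_left_mono[OF Bs, of s] s(1) by (simp add: algebra_simps)
    finally have "s * norm (?d - k *\<^sub>R v) \<le> s * (2 * \<epsilon>')" using s(1) by simp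
    then have "norm (?d - k *\<^sub>R v) \<le> 2 * \<epsilon>'" using s(1) by (rule mult_left_le_imp_le)
    moreover have "?d - k *\<^sub>R v = k *\<^sub>R (daction g v - v)" by (simp add: blinfun.scaleR_right scaleR_diff_right)
    ultimately have "k * norm (daction g v - v) \<le> k * \<epsilon>" using k by (simp add: \<epsilon>'_def)
    then show "norm (daction g v - v) \<le> \<epsilon>" using k by (rule mult_left_le_imp_le)
  qed
qed

end

section \<open>Regularity of the semidirect product\<close>

context semidirect_lie_group
begin

section \<open>The linearized action along curves in \<open>G\<close>\<close>

lemma daction_factor:
  assumes "g \<in> carrier G" "h \<in> carrier G"
  shows "daction h v = daction g (daction (inv\<^bsub>G\<^esub> g \<otimes>\<^bsub>G\<^esub> h) v)"
proof -
  have "g \<otimes>\<^bsub>G\<^esub> (inv\<^bsub>G\<^esub> g \<otimes>\<^bsub>G\<^esub> h) = h" using assms by (simp add: G.m_assoc[symmetric])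
  then show ?thesis using daction_mult[of g "inv\<^bsub>G\<^esub> g \<otimes>\<^bsub>G\<^esub> h"] assms by simp
qed

lemma curve_translate_near:
  assumes \<beta>: "G.curve 0 1 \<beta>" and t: "t \<in> {0..1}" and W: "openin (group_topology G) W" "\<one>\<^bsub>G\<^esub> \<in> W"
  shows "\<exists>d>0. \<forall>s\<in>{0..1}. \<bar>s - t\<bar> < d \<longrightarrow> inv\<^bsub>G\<^esub> (\<beta> t) \<otimes>\<^bsub>G\<^esub> \<beta> s \<in> W"
proof -
  have tc: "\<beta> t \<in> carrier G" by (rule G.curve_carrier[OF \<beta> t])
  have "G.curve 0 1 (\<lambda>s. inv\<^bsub>G\<^esub> (\<beta> t) \<otimes>\<^bsub>G\<^esub> \<beta> s)"
    by (intro G.continuous_map_mult \<beta> G.curve_const) (use tc in simp)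
  from curve_neighbourhood[OF this W(1) t] show ?thesis using W(2) tc by simp
qed

text \<open>The bound near the unit is transported to time \<open>t\<close> by factoring
  \<open>daction (\<beta> s)\<close> through \<open>daction (\<beta> t)\<close>.\<close>

lemma daction_curve_locally_bounded:
  assumes \<beta>: "G.curve 0 1 \<beta>" and t: "t \<in> {0..1}"
  shows "\<exists>d>0. \<exists>B. \<forall>s\<in>{0..1}. \<bar>s - t\<bar> < d \<longrightarrow> (\<forall>v. norm (daction (\<beta> s) v) \<le> B * norm v)"
proof -
  obtain W B where W: "openin (group_topology G) W" "\<one>\<^bsub>G\<^esub> \<in> W" and B: "B \<ge> 0"
    "\<And>g v. g \<in> W \<Longrightarrow> norm (daction g v) \<le> B * norm v" by (rule daction_bounded_near_one) blast
  obtain d where d: "d > 0" "\<forall>s\<in>{0..1}. \<bar>s - t\<bar> < d \<longrightarrow> inv\<^bsub>G\<^esub> (\<beta> t) \<otimes>\<^bsub>G\<^esub> \<beta> s \<in> W"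
    using curve_translate_near[OF \<beta> t W] by blast
  have "norm (daction (\<beta> s) v) \<le> norm (daction (\<beta> t)) * B * norm v" if s: "s \<in> {0..1}" "\<bar>s - t\<bar> < d" for s v
  proof -
    have "daction (\<beta> s) v = daction (\<beta> t) (daction (inv\<^bsub>G\<^esub> (\<beta> t) \<otimes>\<^bsub>G\<^esub> \<beta> s) v)"
      by (rule daction_factor) (use G.curve_carrier[OF \<beta>] t s in auto)
    then have "norm (daction (\<beta> s) v) \<le> norm (daction (\<beta> t)) * norm (daction (inv\<^bsub>G\<^esub> (\<beta> t) \<otimes>\<^bsub>G\<^esub> \<beta> s) v)"
      by (simp add: norm_blinfun)
    also have "\<dots> \<le> norm (daction (\<beta> t)) * (B * norm v)"
      by (intro mult_left_mono B(2)) (use d(2) s in auto)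
    finally show ?thesis by (simp add: mult.assoc)
  qed
  then show ?thesis using d(1) by blast
qed

lemma daction_curve_bounded:
  assumes \<beta>: "G.curve 0 1 \<beta>"
  obtains B where "B \<ge> 0" "\<And>t v. t \<in> {0..1} \<Longrightarrow> norm (daction (\<beta> t) v) \<le> B * norm v"
proof -
  let ?P = "\<lambda>x y. 0 \<le> x \<longrightarrow> y \<le> 1 \<longrightarrow> (\<exists>B. \<forall>s\<in>{x..y}. \<forall>v. norm (daction (\<beta> s) v) \<le> B * norm v)"
  have "?P 0 1"
  proof (rule Bolzano[where P = ?P, OF zero_le_one])
    fix x y z assume 1: "?P x y" and 2: "?P y z" and le: "x \<le> y" "y \<le> z"
    show "?P x z"
    proof (intro impI)
      assume xz: "0 \<le> x" "z \<le> 1"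
      obtain B where B: "\<And>s v. s \<in> {x..y} \<Longrightarrow> norm (daction (\<beta> s) v) \<le> B * norm v" using 1 xz le by force
      obtain B' where B': "\<And>s v. s \<in> {y..z} \<Longrightarrow> norm (daction (\<beta> s) v) \<le> B' * norm v" using 2 xz le by force
      have "norm (daction (\<beta> s) v) \<le> max B B' * norm v" if "s \<in> {x..z}" for s v
      proof -
        have "s \<in> {x..y} \<or> s \<in> {y..z}" using that by auto
        then have "norm (daction (\<beta> s) v) \<le> B * norm v \<or> norm (daction (\<beta> s) v) \<le> B' * norm v" using B B' by blast
        moreover have "B * norm v \<le> max B B' * norm v" "B' * norm v \<le> max B B' * norm v"
          by (auto intro: mult_right_mono)
        ultimately show ?thesis by linarith
      qed
      then show "\<exists>B. \<forall>s\<in>{x..z}. \<forall>v. norm (daction (\<beta> s) v) \<le> B * norm v" by blast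
    qed
  next
    fix t :: real assume t: "0 \<le> t" "t \<le> 1"
    obtain d B where d: "d > 0" "\<forall>s\<in>{0..1}. \<bar>s - t\<bar> < d \<longrightarrow> (\<forall>v. norm (daction (\<beta> s) v) \<le> B * norm v)"
      using daction_curve_locally_bounded[OF \<beta>, of t] t by auto
    have "?P x y" if "x \<le> t" "t \<le> y" "y - x < d" for x y
      using d(2) that by (intro impI exI[of _ B]) auto
    then show "\<exists>d>0. \<forall>x y. x \<le> t \<and> t \<le> y \<and> y - x < d \<longrightarrow> ?P x y" using d(1) by blast
  qed
  then have "\<exists>B. \<forall>s\<in>{0..1}. \<forall>v. norm (daction (\<beta> s) v) \<le> B * norm v" by simp
  then obtain B where B: "\<And>s v. s \<in> {0..1} \<Longrightarrow> norm (daction (\<beta> s) v) \<le> B * norm v" by blast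
  show ?thesis
  proof (rule that[of "max B 0"])
    show "norm (daction (\<beta> t) v) \<le> max B 0 * norm v" if "t \<in> {0..1}" for t v
      using B[OF that, of v] mult_right_mono[of B "max B 0" "norm v"] by simp
  qed simp
qed

text \<open>Strong continuity along \<beta> reduces to strong continuity at the unit by the same
  factorization, so \<open>regulated_on_linear_family\<close> applies.\<close>

lemma regulated_daction:
  assumes \<beta>: "G.curve 0 1 \<beta>" and \<gamma>: "regulated_on 0 1 \<gamma>"
  shows "regulated_on 0 1 (\<lambda>t. daction (\<beta> t) (\<gamma> t))"
proof (rule regulated_on_linear_family[where T = "\<lambda>t. blinfun_apply (daction (\<beta> t))", OF zero_le_one \<gamma>])
  show "linear (blinfun_apply (daction (\<beta> t)))" for t
    by (rule bounded_linear.linear[OF blinfun.bounded_linear_right])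
  show "\<exists>d>0. \<exists>K. \<forall>s\<in>{0..1}. \<bar>s - t\<bar> < d \<longrightarrow> (\<forall>x. norm (daction (\<beta> s) x) \<le> K * norm x)"
    if "t \<in> {0..1}" for t by (rule daction_curve_locally_bounded[OF \<beta> that])
  fix x
  show "continuous_on {0..1} (\<lambda>t. daction (\<beta> t) x)"
    unfolding continuous_on_iff
  proof (intro ballI allI impI)
    fix t e :: real assume t: "t \<in> {0..1}" and e: "e > 0"
    define \<epsilon> where "\<epsilon> = e / (2 * (norm (daction (\<beta> t)) + 1))"
    have n: "norm (daction (\<beta> t)) + 1 > 0" by (simp add: add_nonneg_pos)
    have \<epsilon>: "\<epsilon> > 0" using e n by (simp add: \<epsilon>_def)
    obtain W where W: "openin (group_topology G) W" "\<one>\<^bsub>G\<^esub> \<in> W" "\<And>g. g \<in> W \<Longrightarrow> norm (daction g x - x) \<le> \<epsilon>"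
      by (rule daction_continuous_at_one[OF \<epsilon>, of x]) blast
    obtain d where d: "d > 0" "\<forall>s\<in>{0..1}. \<bar>s - t\<bar> < d \<longrightarrow> inv\<^bsub>G\<^esub> (\<beta> t) \<otimes>\<^bsub>G\<^esub> \<beta> s \<in> W"
      using curve_translate_near[OF \<beta> t W(1,2)] by blast
    have "dist (daction (\<beta> s) x) (daction (\<beta> t) x) < e" if s: "s \<in> {0..1}" "dist s t < d" for s
    proof -
      let ?g = "inv\<^bsub>G\<^esub> (\<beta> t) \<otimes>\<^bsub>G\<^esub> \<beta> s"
      have "daction (\<beta> s) x = daction (\<beta> t) (daction ?g x)"
        by (rule daction_factor) (use G.curve_carrier[OF \<beta>] t s in auto)
      then have "norm (daction (\<beta> s) x - daction (\<beta> t) x) = norm (daction (\<beta> t) (daction ?g x - x))"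
        by (simp add: blinfun.diff_right)
      also have "\<dots> \<le> norm (daction (\<beta> t)) * norm (daction ?g x - x)" by (rule norm_blinfun)
      also have "\<dots> \<le> norm (daction (\<beta> t)) * \<epsilon>"
        by (intro mult_left_mono W(3)) (use d(2) s in \<open>auto simp: dist_real_def\<close>)
      also have "\<dots> < (norm (daction (\<beta> t)) + 1) * (2 * \<epsilon>)"
        using \<epsilon> n by (intro mult_strict_mono') auto
      also have "\<dots> = e" using n by (simp add: \<epsilon>_def field_split_simps)
      finally show ?thesis by (simp add: dist_norm)
    qed
    then show "\<exists>d>0. \<forall>s\<in>{0..1}. dist s t < d \<longrightarrow> dist (daction (\<beta> s) x) (daction (\<beta> t) x) < e"
      using d(1) by blast
  qed
qed

text \<open>Strong continuity offers a common neighbourhood for finitely many vectors; that suffices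
  because step functions take finitely many values.\<close>

lemma daction_uniformly_continuous_at_one:
  assumes "finite F" "\<epsilon> > 0"
  obtains W where "openin (group_topology G) W" "\<one>\<^bsub>G\<^esub> \<in> W" "\<And>g x. g \<in> W \<Longrightarrow> x \<in> F \<Longrightarrow> norm (daction g x - x) \<le> \<epsilon>"
proof -
  have "\<exists>W. openin (group_topology G) W \<and> \<one>\<^bsub>G\<^esub> \<in> W \<and> (\<forall>g\<in>W. \<forall>x\<in>F. norm (daction g x - x) \<le> \<epsilon>)"
    using assms(1)
  proof induction
    case empty
    show ?case using openin_topspace[of "group_topology G"] by (intro exI[of _ "carrier G"]) (simp add: G.topspace_L)
  next
    case (insert x F)
    then obtain W where W: "openin (group_topology G) W" "\<one>\<^bsub>G\<^esub> \<in> W" "\<forall>g\<in>W. \<forall>x\<in>F. norm (daction g x - x) \<le> \<epsilon>" by blast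
    obtain V where V: "openin (group_topology G) V" "\<one>\<^bsub>G\<^esub> \<in> V" "\<And>g. g \<in> V \<Longrightarrow> norm (daction g x - x) \<le> \<epsilon>"
      by (rule daction_continuous_at_one[OF assms(2), of x]) blast
    show ?case using W V by (intro exI[of _ "W \<inter> V"]) auto
  qed
  then show ?thesis using that by blast
qed

text \<open>Without norm continuity, \<open>daction (\<beta> t)\<close> and
  \<open>daction (\<beta>0 t)\<close> cannot be compared on all vectors at once. The control
  \<open>\<gamma>1\<close> is replaced by a step function \<sigma>, on whose finite range the
  quotient of the two curves acts almost trivially; the bound of \<open>daction\<close> near the
  unit absorbs the error of the replacement.\<close>

lemma daction_evolution_continuous:
  assumes \<gamma>0: "regulated_on 0 1 \<gamma>1" "regulated_on 0 1 \<gamma>2" and ev0: "G.evolution \<gamma>2 \<beta>0" and \<epsilon>: "\<epsilon> > 0"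
  obtains \<delta> where "\<delta> > 0" "\<And>\<xi> \<zeta> \<beta>. regulated_on 0 1 \<xi> \<Longrightarrow> regulated_on 0 1 \<zeta> \<Longrightarrow> G.evolution \<zeta> \<beta> \<Longrightarrow>
      AE t in lebesgue_on {0..1}. norm (\<xi> t - \<gamma>1 t) \<le> \<delta> \<Longrightarrow> AE t in lebesgue_on {0..1}. norm (\<zeta> t - \<gamma>2 t) \<le> \<delta> \<Longrightarrow>
      AE t in lebesgue_on {0..1}. norm (daction (\<beta> t) (\<xi> t) - daction (\<beta>0 t) (\<gamma>1 t)) \<le> \<epsilon>"
proof -
  have AC0: "\<beta>0 \<in> AC (atlas G)" using ev0 by (simp add: G.evolution_def)
  have c0: "G.curve 0 1 \<beta>0" by (rule AC_continuous_map[OF AC0])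
  obtain B where B: "B \<ge> 0" "\<And>t v. t \<in> {0..1} \<Longrightarrow> norm (daction (\<beta>0 t) v) \<le> B * norm v"
    by (rule daction_curve_bounded[OF c0]) blast
  obtain W B' where W: "openin (group_topology G) W" "\<one>\<^bsub>G\<^esub> \<in> W" and B': "B' \<ge> 0"
    "\<And>g v. g \<in> W \<Longrightarrow> norm (daction g v) \<le> B' * norm v" by (rule daction_bounded_near_one) blast
  \<comment> \<open>The total error is \<open>B\<close> times four terms, two of size
    \<open>B' * \<epsilon>1\<close> and two of size \<open>\<epsilon>1\<close>; \<open>B + 1\<close>
    keeps the denominator positive.\<close>
  define \<epsilon>1 where "\<epsilon>1 = \<epsilon> / ((B + 1) * (2 * B' + 2))"
  have den: "(B + 1) * (2 * B' + 2) > 0" using B(1) B'(1) by simp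
  have \<epsilon>1: "\<epsilon>1 > 0" using \<epsilon> den by (simp add: \<epsilon>1_def)
  have "\<epsilon>1 * ((B + 1) * (2 * B' + 2)) = \<epsilon>"
    unfolding \<epsilon>1_def by (rule nonzero_eq_divide_eq[THEN iffD1, OF _ refl]) (use den in linarith)
  moreover have "0 \<le> (2 * B' + 2) * \<epsilon>1" using \<epsilon>1 B'(1) by simp
  ultimately have tot: "B * ((2 * B' + 2) * \<epsilon>1) \<le> \<epsilon>" by (simp add: algebra_simps)
  obtain \<sigma> where \<sigma>: "step_on 0 1 \<sigma>" "\<And>s. s \<in> {0..1} \<Longrightarrow> norm (\<gamma>1 s - \<sigma> s) \<le> \<epsilon>1"
    by (rule step_approximation[OF \<gamma>0(1) \<epsilon>1]) blast
  obtain W' where W': "openin (group_topology G) W'" "\<one>\<^bsub>G\<^esub> \<in> W'"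
    "\<And>g x. g \<in> W' \<Longrightarrow> x \<in> \<sigma> ` {0..1} \<Longrightarrow> norm (daction g x - x) \<le> \<epsilon>1"
    by (rule daction_uniformly_continuous_at_one[OF step_on_finite_range[OF \<sigma>(1)] \<epsilon>1]) blast
  have "open (\<kappa>G ` (W \<inter> W' \<inter> KG))"
    by (rule chart_image_open[OF G.mani G.kappa openin_Int[OF W(1) W'(1)]])
  then obtain \<rho> where \<rho>: "\<rho> > 0" "ball (\<kappa>G \<one>\<^bsub>G\<^esub>) \<rho> \<subseteq> \<kappa>G ` (W \<inter> W' \<inter> KG)"
    using W(2) W'(2) G.one_K unfolding open_contains_ball by blast
  have inW: "g \<in> W \<inter> W'" if "g \<in> KG" "norm (\<kappa>G g - \<kappa>G \<one>\<^bsub>G\<^esub>) < \<rho>" for g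
  proof -
    have "\<kappa>G g \<in> ball (\<kappa>G \<one>\<^bsub>G\<^esub>) \<rho>" using that by (simp add: dist_norm norm_minus_commute)
    then have "\<kappa>G g \<in> \<kappa>G ` (W \<inter> W' \<inter> KG)" using \<rho>(2) by blast
    then show ?thesis using chart_inj[OF G.kappa] that(1) by (auto dest: inj_onD)
  qed
  obtain M where M: "\<And>t. t \<in> {0..1} \<Longrightarrow> norm (\<gamma>2 t) \<le> M" using regulated_on_bounded[OF \<gamma>0(2)] by blast
  have M0: "M \<ge> 0" using order_trans[OF norm_ge_zero M[of 0]] by simp
  have bd: "AE t in lebesgue_on {0..1}. norm (\<gamma>2 t) \<le> M" using M by (intro AE_I2) auto
  obtain \<delta>0 E where \<delta>0: "\<delta>0 > 0" and E: "E \<ge> 0"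
    and st: "\<And>\<gamma>0 \<gamma> \<eta>0 \<eta> \<delta>. regulated_on 0 1 \<gamma>0 \<Longrightarrow> regulated_on 0 1 \<gamma> \<Longrightarrow> G.evolution \<gamma>0 \<eta>0 \<Longrightarrow> G.evolution \<gamma> \<eta> \<Longrightarrow>
      AE t in lebesgue_on {0..1}. norm (\<gamma>0 t) \<le> M \<Longrightarrow> AE t in lebesgue_on {0..1}. norm (\<gamma> t - \<gamma>0 t) \<le> \<delta> \<Longrightarrow>
      0 \<le> \<delta> \<Longrightarrow> \<delta> \<le> \<delta>0 \<Longrightarrow>
      \<forall>t\<in>{0..1}. G.quotient_curve \<eta>0 \<eta> t \<in> KG \<and> norm (\<kappa>G (G.quotient_curve \<eta>0 \<eta> t) - \<kappa>G \<one>\<^bsub>G\<^esub>) \<le> E * \<delta>"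
    by (rule G.evolution_stability[OF G.kappa G.one_K M0]) blast
  \<comment> \<open>The three bounds serve closeness of the first components, applicability of
    stability in \<open>G\<close>, and the quotient of \<open>\<beta>0\<close> and \<beta> staying
    in the neighbourhood of the unit found above.\<close>
  define \<delta> where "\<delta> = min \<epsilon>1 (min \<delta>0 (\<rho> / (2 * E + 1)))"
  have \<delta>: "\<delta> > 0" "\<delta> \<le> \<epsilon>1" "\<delta> \<le> \<delta>0" using \<epsilon>1 \<delta>0 \<rho>(1) E by (auto simp: \<delta>_def)
  have "\<delta> \<le> \<rho> / (2 * E + 1)" by (simp add: \<delta>_def)
  then have "\<delta> * (2 * E + 1) \<le> \<rho>" using E by (subst (asm) pos_le_divide_eq) auto
  moreover have "0 \<le> E * \<delta>" using E \<delta>(1) by simp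
  ultimately have E\<delta>: "E * \<delta> < \<rho>" using \<delta>(1) by (simp add: algebra_simps)
  show ?thesis
  proof (rule that[OF \<delta>(1)])
    fix \<xi> \<zeta> \<beta> assume reg: "regulated_on 0 1 \<xi>" "regulated_on 0 1 \<zeta>" and ev: "G.evolution \<zeta> \<beta>"
      and cl: "AE t in lebesgue_on {0..1}. norm (\<xi> t - \<gamma>1 t) \<le> \<delta>" "AE t in lebesgue_on {0..1}. norm (\<zeta> t - \<gamma>2 t) \<le> \<delta>"
    have AC: "\<beta> \<in> AC (atlas G)" using ev by (simp add: G.evolution_def)
    have near: "G.quotient_curve \<beta>0 \<beta> t \<in> W \<inter> W'" if t: "t \<in> {0..1}" for t
      using st[OF \<gamma>0(2) reg(2) ev0 ev bd cl(2) _ \<delta>(3)] \<delta>(1) t inW E\<delta> by force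
    have est: "norm (daction (\<beta> t) (\<xi> t) - daction (\<beta>0 t) (\<gamma>1 t)) \<le> \<epsilon>"
      if t: "t \<in> {0..1}" and cl: "norm (\<xi> t - \<gamma>1 t) \<le> \<delta>" for t
    proof -
      let ?g = "inv\<^bsub>G\<^esub> (\<beta>0 t) \<otimes>\<^bsub>G\<^esub> \<beta> t"
      have g: "?g \<in> W" "?g \<in> W'" using near[OF t] t by (auto simp: G.quotient_curve_def)
      have "daction (\<beta> t) (\<xi> t) = daction (\<beta>0 t) (daction ?g (\<xi> t))"
        by (rule daction_factor) (use AC_points[OF G.mani AC0 t] AC_points[OF G.mani AC t] in \<open>simp_all add: G.pts\<close>)
      then have "norm (daction (\<beta> t) (\<xi> t) - daction (\<beta>0 t) (\<gamma>1 t)) = norm (daction (\<beta>0 t) (daction ?g (\<xi> t) - \<gamma>1 t))"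
        by (simp add: blinfun.diff_right)
      also have "\<dots> \<le> B * norm (daction ?g (\<xi> t) - \<gamma>1 t)" by (rule B(2)[OF t])
      also have "\<dots> \<le> B * ((2 * B' + 2) * \<epsilon>1)"
      proof (rule mult_left_mono[OF _ B(1)])
        have "norm (daction ?g (\<xi> t - \<gamma>1 t)) \<le> B' * \<epsilon>1"
          using B'(2)[OF g(1), of "\<xi> t - \<gamma>1 t"] mult_left_mono[OF order_trans[OF cl \<delta>(2)] B'(1)] by linarith
        moreover have "norm (daction ?g (\<gamma>1 t - \<sigma> t)) \<le> B' * \<epsilon>1"
          using B'(2)[OF g(1), of "\<gamma>1 t - \<sigma> t"] mult_left_mono[OF \<sigma>(2)[OF t] B'(1)] by linarith
        moreover have "norm (daction ?g (\<sigma> t) - \<sigma> t) \<le> \<epsilon>1" using W'(3)[OF g(2)] t by blast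
        moreover have "norm (\<gamma>1 t - \<sigma> t) \<le> \<epsilon>1" by (rule \<sigma>(2)[OF t])
        \<comment> \<open>Four terms: change of the control, passage to \<sigma>, motion of a value
          of \<sigma>, and return to \<open>\<gamma>1\<close>.\<close>
        moreover have "daction ?g (\<xi> t) - \<gamma>1 t =
            (daction ?g (\<xi> t - \<gamma>1 t) + daction ?g (\<gamma>1 t - \<sigma> t)) + ((daction ?g (\<sigma> t) - \<sigma> t) - (\<gamma>1 t - \<sigma> t))"
          by (simp add: blinfun.diff_right)
        moreover have "norm (a + b + (c - d)) \<le> norm a + norm b + (norm c + norm d)" for a b c d :: 'e
          by (intro norm_triangle_mono norm_triangle_ineq norm_triangle_ineq4)
        ultimately have "norm (daction ?g (\<xi> t) - \<gamma>1 t) \<le> B' * \<epsilon>1 + B' * \<epsilon>1 + (\<epsilon>1 + \<epsilon>1)"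
          by (smt (verit))
        then show "norm (daction ?g (\<xi> t) - \<gamma>1 t) \<le> (2 * B' + 2) * \<epsilon>1" by (simp add: algebra_simps)
      qed
      finally show ?thesis using tot by simp
    qed
    obtain Z where Z: "negligible Z" "\<forall>t\<in>{0..1} - Z. norm (\<xi> t - \<gamma>1 t) \<le> \<delta>"
      using cl(1) unfolding AE_lebesgue_on_iff_negligible by blast
    then have "\<forall>t\<in>{0..1} - Z. norm (daction (\<beta> t) (\<xi> t) - daction (\<beta>0 t) (\<gamma>1 t)) \<le> \<epsilon>"
      using est by simp
    with Z(1) show "AE t in lebesgue_on {0..1}. norm (daction (\<beta> t) (\<xi> t) - daction (\<beta>0 t) (\<gamma>1 t)) \<le> \<epsilon>"
      unfolding AE_lebesgue_on_iff_negligible by blast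
  qed
qed

section \<open>The half-Lie group H and logarithmic derivatives of its curves\<close>

abbreviation H :: "('n \<times> 'g, 'e \<times> 'f) mgroup" where "H \<equiv> semidirect N G \<pi>"

lemma H_simps [simp]:
  "carrier H = carrier N \<times> carrier G" "\<one>\<^bsub>H\<^esub> = (\<one>\<^bsub>N\<^esub>, \<one>\<^bsub>G\<^esub>)" "atlas H = prod_atlas (atlas N) (atlas G)"
  "x \<otimes>\<^bsub>H\<^esub> y = (fst x \<otimes>\<^bsub>N\<^esub> \<pi> (snd x) (fst y), snd x \<otimes>\<^bsub>G\<^esub> snd y)"
  by (simp_all add: semidirect_def split_beta)

lemma group_H: "group H"
proof (rule groupI)
  fix x y z assume "x \<in> carrier H" "y \<in> carrier H" "z \<in> carrier H"
  then show "x \<otimes>\<^bsub>H\<^esub> y \<otimes>\<^bsub>H\<^esub> z = x \<otimes>\<^bsub>H\<^esub> (y \<otimes>\<^bsub>H\<^esub> z)"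
    by (auto simp: N.m_assoc G.m_assoc action_mult action_compose action_closed)
next
  fix x assume x: "x \<in> carrier H"
  then show "\<exists>y\<in>carrier H. y \<otimes>\<^bsub>H\<^esub> x = \<one>\<^bsub>H\<^esub>"
    by (intro bexI[of _ "(\<pi> (inv\<^bsub>G\<^esub> (snd x)) (inv\<^bsub>N\<^esub> (fst x)), inv\<^bsub>G\<^esub> (snd x))"])
      (auto simp: action_closed action_mult[symmetric] action_one)
qed (auto simp: action_closed action_identity)

lemma inv_H:
  assumes "h \<in> carrier H"
  shows "inv\<^bsub>H\<^esub> h = (\<pi> (inv\<^bsub>G\<^esub> (snd h)) (inv\<^bsub>N\<^esub> (fst h)), inv\<^bsub>G\<^esub> (snd h))"
  by (rule group.inv_equality[OF group_H])
    (use assms in \<open>auto simp: action_closed action_mult[symmetric] action_one\<close>)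

text \<open>For fixed \<open>h\<close> the element \<open>snd h\<close> is frozen, so left
  translation involves a single automorphism and is smooth in \<open>x\<close>. Logarithmic
  derivatives in H rest on this, as right translations are in general only continuous.\<close>

lemma left_translation_H:
  assumes h: "h \<in> carrier H" and x: "x \<in> carrier H"
  shows "inv\<^bsub>H\<^esub> h \<otimes>\<^bsub>H\<^esub> x =
    (\<pi> (inv\<^bsub>G\<^esub> (snd h)) (inv\<^bsub>N\<^esub> (fst h) \<otimes>\<^bsub>N\<^esub> fst x), inv\<^bsub>G\<^esub> (snd h) \<otimes>\<^bsub>G\<^esub> snd x)"
  using assms by (auto simp: inv_H action_mult)

lemmas mani_H = smooth_manifold_prod_atlas[OF N.mani G.mani]

lemma points_H: "points (prod_atlas (atlas N) (atlas G)) = carrier N \<times> carrier G"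
  by (simp add: points_prod_atlas N.pts G.pts)

lemma left_translation_C11:
  assumes h: "h \<in> carrier H"
  shows "C11_map_at (prod_atlas (atlas N) (atlas G)) (prod_atlas (atlas N) (atlas G)) (\<lambda>x. inv\<^bsub>H\<^esub> h \<otimes>\<^bsub>H\<^esub> x) h"
proof -
  let ?A = "prod_atlas (atlas N) (atlas G)"
  let ?n = "\<pi> (inv\<^bsub>G\<^esub> (snd h)) (inv\<^bsub>N\<^esub> (fst h))" and ?g = "inv\<^bsub>G\<^esub> (snd h)"
  have hc: "fst h \<in> carrier N" "snd h \<in> carrier G" "h \<in> points ?A" using h by (auto simp: points_H)
  note fs = C11_map_at_fst[OF N.mani G.mani hc(3)]
  have "C11_map_at ?A ?A (\<lambda>x. (?n \<otimes>\<^bsub>N\<^esub> \<pi> ?g (fst x), ?g \<otimes>\<^bsub>G\<^esub> snd x)) h"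
    by (intro C11_map_at_Pair[OF mani_H N.mani G.mani] N.C11_map_at_mult[OF mani_H] G.C11_map_at_mult[OF mani_H]
        C11_map_at_const[OF mani_H N.mani hc(3)] C11_map_at_const[OF mani_H G.mani hc(3)]
        C11_map_at_compose[OF mani_H N.mani N.mani fs(1)] fs(2) action_C11)
      (use hc action_closed in \<open>auto simp: N.pts G.pts\<close>)
  moreover have "(\<lambda>x. inv\<^bsub>H\<^esub> h \<otimes>\<^bsub>H\<^esub> x) = (\<lambda>x. (?n \<otimes>\<^bsub>N\<^esub> \<pi> ?g (fst x), ?g \<otimes>\<^bsub>G\<^esub> snd x))"
    using h by (simp only: H_simps inv_H fst_conv snd_conv)
  ultimately show ?thesis by (simp only:)
qed

abbreviation \<kappa>H :: "('n \<times> 'g, 'e \<times> 'f) chart" where "\<kappa>H \<equiv> prod_chart (KN, \<kappa>N) (KG, \<kappa>G)"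

text \<open>The increment of \<eta> at \<open>t\<close> has as first component an increment in
  \<open>N\<close>, moved by the automorphism of the inverse of \<open>snd (\<eta> t)\<close>. This
  automorphism is frozen while \<open>s\<close> varies; undoing it with
  \<open>\<pi> (snd (\<eta> t))\<close> recovers the first component of \<eta> and puts
  \<open>daction (snd (\<eta> t))\<close> in front of \<open>fst v\<close>.\<close>

lemma log_deriv_components:
  assumes c: "(U, \<phi>) \<in> charts (prod_atlas (atlas N) (atlas G))" and U: "\<forall>\<^sub>F s in nhds t. \<eta> s \<in> U"
    and D: "((\<phi> \<circ> \<eta>) has_vector_derivative w) (at t)"
  defines "v \<equiv> tangent_map (U, \<phi>) \<kappa>H (\<lambda>x. inv\<^bsub>H\<^esub> (\<eta> t) \<otimes>\<^bsub>H\<^esub> x) (\<eta> t) w"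
  shows "G.log_deriv_at (\<lambda>s. snd (\<eta> s)) t (snd v)"
    and "N.log_deriv_at (\<lambda>s. fst (\<eta> s)) t (daction (snd (\<eta> t)) (fst v))"
proof -
  let ?l = "\<lambda>x. inv\<^bsub>H\<^esub> (\<eta> t) \<otimes>\<^bsub>H\<^esub> x"
  have t: "\<eta> t \<in> U" by (rule eventually_nhds_x_imp_x[OF U])
  have carU: "x \<in> carrier H" if "x \<in> U" for x using chart_points[OF c] that points_H by auto
  have ht: "\<eta> t \<in> carrier H" by (rule carU[OF t])
  then have nt: "fst (\<eta> t) \<in> carrier N" and gt: "snd (\<eta> t) \<in> carrier G" by auto
  note C = left_translation_C11[OF ht]
  have d: "(KN \<times> KG, map_prod \<kappa>N \<kappa>G) \<in> charts (prod_atlas (atlas N) (atlas G))"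
    by (rule prod_chart_in_charts[OF N.mani G.mani N.kappa G.kappa])
  have "?l (\<eta> t) = (\<one>\<^bsub>N\<^esub>, \<one>\<^bsub>G\<^esub>)" using group.l_inv[OF group_H ht] by simp
  then have one: "?l (\<eta> t) \<in> KN \<times> KG" using N.one_K G.one_K by simp
  note T = C11_map_at_charts[OF mani_H mani_H C c t d one]
  \<comment> \<open>\<open>tangent_map\<close> is a directional derivative. Since left translation
    is C11, it is a value of the Frechet derivative, and the chain rule along \<eta>
    applies.\<close>
  have veq: "v = fderiv (map_prod \<kappa>N \<kappa>G \<circ> ?l \<circ> inv_into U \<phi>) (\<phi> (\<eta> t)) w"
    unfolding v_def tangent_map_def prod_chart_def fst_conv snd_conv
    by (rule has_derivative_imp_dir_deriv[OF C11_at_has_derivative[OF T(2)]])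
  have "isCont (\<phi> \<circ> \<eta>) t" by (rule has_vector_derivative_continuous[OF D])
  then have lim: "filterlim (\<phi> \<circ> \<eta>) (nhds (\<phi> (\<eta> t))) (nhds t)"
    using tendsto_at_iff_tendsto_nhds[of "\<phi> \<circ> \<eta>" t] by (simp add: isCont_def)
  have ev: "\<forall>\<^sub>F s in nhds t. \<eta> s \<in> carrier H \<and> ?l (\<eta> s) \<in> KN \<times> KG \<and> inv_into U \<phi> ((\<phi> \<circ> \<eta>) s) = \<eta> s"
    using eventually_compose_filterlim[OF T(1) lim] U
    by eventually_elim (use carU chart_inv_into[OF c] in simp)
  let ?a = "\<lambda>s. \<pi> (inv\<^bsub>G\<^esub> (snd (\<eta> t))) (inv\<^bsub>N\<^esub> (fst (\<eta> t)) \<otimes>\<^bsub>N\<^esub> fst (\<eta> s))"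
  let ?b = "\<lambda>s. inv\<^bsub>G\<^esub> (snd (\<eta> t)) \<otimes>\<^bsub>G\<^esub> snd (\<eta> s)"
  have ev2: "\<forall>\<^sub>F s in nhds t. fst (\<eta> s) \<in> carrier N \<and> snd (\<eta> s) \<in> carrier G \<and> ?a s \<in> KN \<and> ?b s \<in> KG \<and>
      (map_prod \<kappa>N \<kappa>G \<circ> ?l \<circ> inv_into U \<phi>) ((\<phi> \<circ> \<eta>) s) = (\<kappa>N (?a s), \<kappa>G (?b s))"
    using ev
  proof eventually_elim
    case (elim s)
    then show ?case using left_translation_H[OF ht, of "\<eta> s"] by (auto simp del: H_simps(4))
  qed
  have "((\<lambda>s. (map_prod \<kappa>N \<kappa>G \<circ> ?l \<circ> inv_into U \<phi>) ((\<phi> \<circ> \<eta>) s)) has_vector_derivative v) (at t)"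
    using vector_derivative_chain_C11[OF _ D, of "map_prod \<kappa>N \<kappa>G \<circ> ?l \<circ> inv_into U \<phi>"] T(2)
    unfolding veq by (simp only: comp_apply)
  then have P: "((\<lambda>s. (\<kappa>N (?a s), \<kappa>G (?b s))) has_vector_derivative v) (at t)"
    by (rule has_vector_derivative_eventually_cong) (use ev2 in \<open>auto elim: eventually_mono\<close>)
  have Pb: "((\<lambda>s. \<kappa>G (?b s)) has_vector_derivative snd v) (at t)"
    using bounded_linear.has_vector_derivative[OF bounded_linear_snd P] by simp
  have Pa: "((\<lambda>s. \<kappa>N (?a s)) has_vector_derivative fst v) (at t)"
    using bounded_linear.has_vector_derivative[OF bounded_linear_fst P] by simp
  have "\<forall>\<^sub>F s in nhds t. snd (\<eta> s) \<in> carrier G \<and> ?b s \<in> KG" using ev2 by eventually_elim simp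
  with Pb show "G.log_deriv_at (\<lambda>s. snd (\<eta> s)) t (snd v)" by (simp add: G.log_deriv_at_def)
  let ?\<alpha> = "\<lambda>s. \<pi> (inv\<^bsub>G\<^esub> (snd (\<eta> t))) (fst (\<eta> s))"
  have ev3: "\<forall>\<^sub>F s in nhds t. ?\<alpha> s \<in> carrier N \<and> inv\<^bsub>N\<^esub> (?\<alpha> t) \<otimes>\<^bsub>N\<^esub> ?\<alpha> s \<in> KN \<and>
      ?a s = inv\<^bsub>N\<^esub> (?\<alpha> t) \<otimes>\<^bsub>N\<^esub> ?\<alpha> s \<and> \<pi> (snd (\<eta> t)) (?\<alpha> s) = fst (\<eta> s)"
    using ev2
  proof eventually_elim
    case (elim s)
    then have "?a s = inv\<^bsub>N\<^esub> (?\<alpha> t) \<otimes>\<^bsub>N\<^esub> ?\<alpha> s"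
      using nt gt by (simp add: action_mult action_inv action_closed)
    then show ?case using elim nt gt by (simp add: action_closed action_inverse del: action_mult)
  qed
  have "((\<lambda>s. \<kappa>N (inv\<^bsub>N\<^esub> (?\<alpha> t) \<otimes>\<^bsub>N\<^esub> ?\<alpha> s)) has_vector_derivative fst v) (at t)"
    by (rule has_vector_derivative_eventually_cong[OF Pa]) (use ev3 in \<open>auto elim: eventually_mono\<close>)
  moreover have "\<forall>\<^sub>F s in nhds t. ?\<alpha> s \<in> carrier N \<and> inv\<^bsub>N\<^esub> (?\<alpha> t) \<otimes>\<^bsub>N\<^esub> ?\<alpha> s \<in> KN"
    using ev3 by eventually_elim simp
  ultimately have "N.log_deriv_at ?\<alpha> t (fst v)" by (simp add: N.log_deriv_at_def)
  from log_deriv_at_action[OF gt this]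
  show "N.log_deriv_at (\<lambda>s. fst (\<eta> s)) t (daction (snd (\<eta> t)) (fst v))"
    by (rule N.log_deriv_at_cong) (use ev3 in \<open>auto elim: eventually_mono\<close>)
qed

section \<open>Evolutions in H as pairs of evolutions\<close>

definition fst_curve :: "(real \<Rightarrow> 'n \<times> 'g) \<Rightarrow> real \<Rightarrow> 'n" where
  "fst_curve \<eta> = (\<lambda>t\<in>{0..1}. fst (\<eta> t))"

definition snd_curve :: "(real \<Rightarrow> 'n \<times> 'g) \<Rightarrow> real \<Rightarrow> 'g" where
  "snd_curve \<eta> = (\<lambda>t\<in>{0..1}. snd (\<eta> t))"

lemma AC_components:
  assumes \<eta>: "\<eta> \<in> AC (atlas H)"
  shows "fst_curve \<eta> \<in> AC (atlas N)" "snd_curve \<eta> \<in> AC (atlas G)"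
proof -
  note \<eta>' = \<eta>[unfolded H_simps]
  have c: "continuous_map (top_of_set {0..1}) (prod_topology (group_topology N) (group_topology G)) \<eta>"
    using AC_continuous_map[OF \<eta>'] by (simp add: manifold_topology_prod_atlas[OF N.mani G.mani])
  have "N.curve 0 1 (fst \<circ> \<eta>)" "G.curve 0 1 (snd \<circ> \<eta>)"
    by (rule continuous_map_compose[OF c continuous_map_fst], rule continuous_map_compose[OF c continuous_map_snd])
  then have cc: "N.curve 0 1 (\<lambda>t\<in>{0..1}. fst (\<eta> t))" "G.curve 0 1 (\<lambda>t\<in>{0..1}. snd (\<eta> t))"
    by (auto elim!: continuous_map_eq)
  show "fst_curve \<eta> \<in> AC (atlas N)" unfolding fst_curve_def
    by (rule AC_image[OF mani_H N.mani \<eta>' _ cc(1)]) (rule C11_map_at_fst(1)[OF N.mani G.mani AC_points[OF mani_H \<eta>']])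
  show "snd_curve \<eta> \<in> AC (atlas G)" unfolding snd_curve_def
    by (rule AC_image[OF mani_H G.mani \<eta>' _ cc(2)]) (rule C11_map_at_fst(2)[OF N.mani G.mani AC_points[OF mani_H \<eta>']])
qed

lemma log_deriv_curves:
  assumes c: "(U, \<phi>) \<in> charts (atlas H)" and uv: "0 \<le> u" "v \<le> 1" and U: "\<eta> ` {u..v} \<subseteq> U" and t: "t \<in> {u<..<v}"
    and D: "((\<phi> \<circ> \<eta>) has_vector_derivative w) (at t)"
    and x: "x = tangent_map (U, \<phi>) \<kappa>H (\<lambda>x. inv\<^bsub>H\<^esub> (\<eta> t) \<otimes>\<^bsub>H\<^esub> x) (\<eta> t) w"
  shows "G.log_deriv_at (snd_curve \<eta>) t (snd x)"
    and "N.log_deriv_at (fst_curve \<eta>) t (daction (snd_curve \<eta> t) (fst x))"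
proof -
  have ev: "\<forall>\<^sub>F s in nhds t. s \<in> {u<..<v}" using t by (intro eventually_nhds_in_open) auto
  have 1: "\<forall>\<^sub>F s in nhds t. \<eta> s \<in> U" using ev by eventually_elim (use U in auto)
  have 2: "\<forall>\<^sub>F s in nhds t. snd (\<eta> s) = snd_curve \<eta> s" "\<forall>\<^sub>F s in nhds t. fst (\<eta> s) = fst_curve \<eta> s"
    using ev uv by (auto simp: snd_curve_def fst_curve_def elim!: eventually_mono)
  have st: "snd_curve \<eta> t = snd (\<eta> t)" using t uv by (simp add: snd_curve_def)
  note L = log_deriv_components[OF c[unfolded H_simps(3)] 1 D, folded x]
  show "G.log_deriv_at (snd_curve \<eta>) t (snd x)" by (rule G.log_deriv_at_cong[OF L(1) 2(1)])
  show "N.log_deriv_at (fst_curve \<eta>) t (daction (snd_curve \<eta> t) (fst x))"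
    unfolding st by (rule N.log_deriv_at_cong[OF L(2) 2(2)])
qed

lemma countable_imp_negligible: "countable D \<Longrightarrow> negligible (D :: real set)"
  by (auto simp: negligible_iff_null_sets intro: countable_imp_null_set_lborel null_sets_completionI)

text \<open>Each piece of the partition contributes its own null set; their finite union, together
  with the partition points, is a null set outside of which both component equations hold.\<close>

lemma evolution_components:
  assumes ev: "is_evolution H \<kappa>H \<gamma> \<eta>"
  shows "G.evolution (\<lambda>t. snd (rep_regR \<gamma> t)) (snd_curve \<eta>)"
    and "N.evolution (\<lambda>t. daction (snd_curve \<eta> t) (fst (rep_regR \<gamma> t))) (fst_curve \<eta>)"
proof -
  have \<eta>: "\<eta> \<in> AC (atlas H)" "\<eta> 0 = (\<one>\<^bsub>N\<^esub>, \<one>\<^bsub>G\<^esub>)" and ld: "has_log_derivative H \<kappa>H \<eta> \<gamma>"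
    using ev by (auto simp: is_evolution_def)
  let ?Q = "\<lambda>t. G.log_deriv_at (snd_curve \<eta>) t (snd (rep_regR \<gamma> t)) \<and>
      N.log_deriv_at (fst_curve \<eta>) t (daction (snd_curve \<eta> t) (fst (rep_regR \<gamma> t)))"
  obtain P where P: "partition_of 0 1 P" "\<And>u v. consecutive P u v \<Longrightarrow>
      \<exists>(U, \<phi>)\<in>charts (atlas H). \<exists>\<gamma>'. \<eta> ` {u..v} \<subseteq> U \<and> has_reg_derivative (\<phi> \<circ> \<eta>) \<gamma>' u v \<and>
         (AE t in lebesgue_on {u..v}. rep_regR \<gamma> t =
            tangent_map (U, \<phi>) \<kappa>H (\<lambda>x. inv\<^bsub>H\<^esub> (\<eta> t) \<otimes>\<^bsub>H\<^esub> x) (\<eta> t) (\<gamma>' t))"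
    using ld unfolding has_log_derivative_def by blast
  have "\<exists>Z. negligible Z \<and> (\<forall>t\<in>{u<..<v} - Z. ?Q t)" if uv: "consecutive P u v" for u v
  proof -
    have uv01: "0 \<le> u" "u \<le> v" "v \<le> 1" using uv P(1) by (auto simp: consecutive_def partition_of_def)
    obtain U \<phi> \<gamma>' where c: "(U, \<phi>) \<in> charts (atlas H)" and U: "\<eta> ` {u..v} \<subseteq> U" and r: "has_reg_derivative (\<phi> \<circ> \<eta>) \<gamma>' u v"
      and ae: "AE t in lebesgue_on {u..v}. rep_regR \<gamma> t =
            tangent_map (U, \<phi>) \<kappa>H (\<lambda>x. inv\<^bsub>H\<^esub> (\<eta> t) \<otimes>\<^bsub>H\<^esub> x) (\<eta> t) (\<gamma>' t)"
      using P(2)[OF uv] by (elim bexE exE conjE case_prodE) simp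
    obtain D where D: "countable D" "\<And>t. t \<in> {u<..<v} - D \<Longrightarrow> ((\<phi> \<circ> \<eta>) has_vector_derivative \<gamma>' t) (at t)"
      by (rule has_reg_derivative_imp_derivative[OF uv01(2) r]) blast
    obtain Z where Z: "negligible Z" "\<forall>t\<in>{u..v} - Z. rep_regR \<gamma> t =
            tangent_map (U, \<phi>) \<kappa>H (\<lambda>x. inv\<^bsub>H\<^esub> (\<eta> t) \<otimes>\<^bsub>H\<^esub> x) (\<eta> t) (\<gamma>' t)"
      using ae unfolding AE_lebesgue_on_iff_negligible by blast
    have "?Q t" if t: "t \<in> {u<..<v} - (D \<union> Z)" for t
    proof -
      have "t \<in> {u<..<v}" "t \<in> {u<..<v} - D" "t \<in> {u..v} - Z" using t by auto
      from log_deriv_curves[OF c uv01(1,3) U this(1) D(2)[OF this(2)] Z(2)[rule_format, OF this(3)]]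
      show ?thesis by blast
    qed
    moreover have "negligible (D \<union> Z)" using countable_imp_negligible[OF D(1)] Z(1) by simp
    ultimately show ?thesis by blast
  qed
  then obtain Z where Z: "\<And>u v. consecutive P u v \<Longrightarrow> negligible (Z u v) \<and> (\<forall>t\<in>{u<..<v} - Z u v. ?Q t)"
    by metis
  define Y where "Y = P \<union> (\<Union>(u, v)\<in>{(u, v). consecutive P u v}. Z u v)"
  have finP: "finite P" using P(1) by (simp add: partition_of_def)
  have "finite {(u, v). consecutive P u v}"
    by (rule finite_subset[of _ "P \<times> P"]) (auto simp: finP consecutive_def)
  then have "negligible (\<Union>(u, v)\<in>{(u, v). consecutive P u v}. Z u v)"
    by (intro negligible_Union) (use Z in auto)
  then have Y: "negligible Y" using negligible_finite[OF finP] by (simp add: Y_def)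
  have Q: "?Q t" if t: "t \<in> {0..1} - Y" for t
  proof -
    obtain u v where uv: "consecutive P u v" "t \<in> {u<..<v}"
      using step_on_finite_cover[OF P(1), of t] t by (auto simp: Y_def)
    then have "t \<notin> Z u v" using t by (auto simp: Y_def)
    then show ?thesis using Z[OF uv(1)] uv(2) by blast
  qed
  have ae: "AE t in lebesgue_on {0..1}. ?Q t"
    unfolding AE_lebesgue_on_iff_negligible using Y Q by blast
  note AC = AC_components[OF \<eta>(1)]
  show "G.evolution (\<lambda>t. snd (rep_regR \<gamma> t)) (snd_curve \<eta>)"
    using AC(2) ae \<eta>(2) by (auto simp: G.evolution_def snd_curve_def elim: eventually_mono)
  show "N.evolution (\<lambda>t. daction (snd_curve \<eta> t) (fst (rep_regR \<gamma> t))) (fst_curve \<eta>)"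
    using AC(1) ae \<eta>(2) by (auto simp: N.evolution_def fst_curve_def elim: eventually_mono)
qed

text \<open>Absolute continuity of the pair supplies some chart velocity. Its logarithmic derivative
  has components that uniqueness compares with those prescribed for \<alpha> and \<beta>.\<close>

lemma is_evolution_Pair:
  assumes \<beta>: "G.evolution (\<lambda>t. snd (rep_regR \<gamma> t)) \<beta>"
    and \<alpha>: "N.evolution (\<lambda>t. daction (\<beta> t) (fst (rep_regR \<gamma> t))) \<alpha>"
  shows "is_evolution H \<kappa>H \<gamma> (\<lambda>t\<in>{0..1}. (\<alpha> t, \<beta> t))"
proof -
  let ?\<eta> = "\<lambda>t\<in>{0..1}. (\<alpha> t, \<beta> t)"
  have AC: "\<alpha> \<in> AC (atlas N)" "\<beta> \<in> AC (atlas G)" using \<alpha> \<beta> by (auto simp: N.evolution_def G.evolution_def)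
  have \<eta>: "?\<eta> \<in> AC (prod_atlas (atlas N) (atlas G))" by (rule AC_Pair[OF N.mani G.mani AC])
  have cur: "fst_curve ?\<eta> = \<alpha>" "snd_curve ?\<eta> = \<beta>"
    using AC_extensional[OF AC(1)] AC_extensional[OF AC(2)]
    by (auto simp: fst_curve_def snd_curve_def extensional_def)
  obtain P where P: "partition_of 0 1 P" "\<And>u v. consecutive P u v \<Longrightarrow>
      \<exists>(U, \<phi>)\<in>charts (prod_atlas (atlas N) (atlas G)). ?\<eta> ` {u..v} \<subseteq> U \<and> AC_on u v (\<phi> \<circ> ?\<eta>)"
    using \<eta> unfolding AC_def by blast
  obtain Z where Z: "negligible Z" "\<And>t. t \<in> {0..1} - Z \<Longrightarrow> G.log_deriv_at \<beta> t (snd (rep_regR \<gamma> t))"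
    using \<beta> unfolding G.evolution_def AE_lebesgue_on_iff_negligible by blast
  obtain Z' where Z': "negligible Z'" "\<And>t. t \<in> {0..1} - Z' \<Longrightarrow> N.log_deriv_at \<alpha> t (daction (\<beta> t) (fst (rep_regR \<gamma> t)))"
    using \<alpha> unfolding N.evolution_def AE_lebesgue_on_iff_negligible by blast
  have "has_log_derivative H \<kappa>H ?\<eta> \<gamma>"
    unfolding has_log_derivative_def
  proof (intro exI[of _ P] conjI P(1) allI impI)
    fix u v assume uv: "consecutive P u v"
    have uv01: "0 \<le> u" "u \<le> v" "v \<le> 1" using uv P(1) by (auto simp: consecutive_def partition_of_def)
    obtain U \<phi> \<gamma>' where c: "(U, \<phi>) \<in> charts (atlas H)" and U: "?\<eta> ` {u..v} \<subseteq> U" and r: "has_reg_derivative (\<phi> \<circ> ?\<eta>) \<gamma>' u v"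
      using P(2)[OF uv] unfolding AC_on_def H_simps(3) by (elim bexE exE conjE case_prodE) simp
    obtain D where D: "countable D" "\<And>t. t \<in> {u<..<v} - D \<Longrightarrow> ((\<phi> \<circ> ?\<eta>) has_vector_derivative \<gamma>' t) (at t)"
      by (rule has_reg_derivative_imp_derivative[OF uv01(2) r]) blast
    have eq: "rep_regR \<gamma> t = tangent_map (U, \<phi>) \<kappa>H (\<lambda>x. inv\<^bsub>H\<^esub> (?\<eta> t) \<otimes>\<^bsub>H\<^esub> x) (?\<eta> t) (\<gamma>' t)"
      if t: "t \<in> {u..v} - (insert u (insert v (D \<union> (Z \<union> Z'))))" for t
    proof -
      define x where "x = tangent_map (U, \<phi>) \<kappa>H (\<lambda>x. inv\<^bsub>H\<^esub> (?\<eta> t) \<otimes>\<^bsub>H\<^esub> x) (?\<eta> t) (\<gamma>' t)"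
      have t': "t \<in> {u<..<v}" "t \<in> {u<..<v} - D" "t \<in> {0..1} - Z" "t \<in> {0..1} - Z'" "t \<in> {0..1}" using t uv01 by auto
      note L = log_deriv_curves[OF c uv01(1,3) U t'(1) D(2)[OF t'(2)] x_def, unfolded cur]
      have 1: "snd (rep_regR \<gamma> t) = snd x" by (rule G.log_deriv_at_unique[OF Z(2)[OF t'(3)] L(1)])
      have "daction (\<beta> t) (fst (rep_regR \<gamma> t)) = daction (\<beta> t) (fst x)"
        by (rule N.log_deriv_at_unique[OF Z'(2)[OF t'(4)] L(2)])
      \<comment> \<open>\<open>daction (\<beta> t)\<close> is injective, with \<open>daction\<close>
        of the inverse element as left inverse, so the first components agree as well.\<close>
      moreover have "\<beta> t \<in> carrier G" using AC_points[OF G.mani AC(2) t'(5)] by (simp add: G.pts)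
      ultimately have "fst (rep_regR \<gamma> t) = fst x" using daction_inverse by metis
      with 1 show ?thesis unfolding x_def[symmetric] by (simp add: prod_eq_iff)
    qed
    have "negligible (insert u (insert v (D \<union> (Z \<union> Z'))))"
      using countable_imp_negligible[OF D(1)] Z(1) Z'(1) by simp
    then have "AE t in lebesgue_on {u..v}. rep_regR \<gamma> t =
        tangent_map (U, \<phi>) \<kappa>H (\<lambda>x. inv\<^bsub>H\<^esub> (?\<eta> t) \<otimes>\<^bsub>H\<^esub> x) (?\<eta> t) (\<gamma>' t)"
      unfolding AE_lebesgue_on_iff_negligible using eq by blast
    then show "\<exists>(U, \<phi>)\<in>charts (atlas H). \<exists>\<gamma>'. ?\<eta> ` {u..v} \<subseteq> U \<and> has_reg_derivative (\<phi> \<circ> ?\<eta>) \<gamma>' u v \<and>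
         (AE t in lebesgue_on {u..v}. rep_regR \<gamma> t =
            tangent_map (U, \<phi>) \<kappa>H (\<lambda>x. inv\<^bsub>H\<^esub> (?\<eta> t) \<otimes>\<^bsub>H\<^esub> x) (?\<eta> t) (\<gamma>' t))"
      using U r by (intro bexI[OF _ c], unfold prod.case) blast
  qed
  moreover have "?\<eta> 0 = \<one>\<^bsub>H\<^esub>" using \<alpha> \<beta> by (simp add: N.evolution_def G.evolution_def)
  ultimately show ?thesis using \<eta> by (simp add: is_evolution_def)
qed

lemma regulated_fst_snd_rep:
  fixes \<gamma> :: "('e \<times> 'f) regR"
  shows "regulated_on 0 1 (\<lambda>t. fst (rep_regR \<gamma> t))" "regulated_on 0 1 (\<lambda>t. snd (rep_regR \<gamma> t))"
  by (rule regulated_on_bounded_linear[OF bounded_linear_fst zero_le_one regulated_on_rep_regR],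
      rule regulated_on_bounded_linear[OF bounded_linear_snd zero_le_one regulated_on_rep_regR])

lemma regulated_twisted_control:
  fixes \<gamma> :: "('e \<times> 'f) regR"
  assumes "G.evolution \<zeta> \<beta>"
  shows "regulated_on 0 1 (\<lambda>t. daction (\<beta> t) (fst (rep_regR \<gamma> t)))"
proof -
  have "\<beta> \<in> AC (atlas G)" using assms by (simp add: G.evolution_def)
  then show ?thesis by (rule regulated_daction[OF AC_continuous_map regulated_fst_snd_rep(1)])
qed

text \<open>The system is triangular: \<beta> depends on the second component of \<gamma> alone, and
  it determines the control of \<alpha>. Uniqueness follows in the same order.\<close>

theorem semidirect_evolution_unique: "\<exists>!\<eta>. is_evolution H \<kappa>H \<gamma> \<eta>"
proof -
  obtain \<beta> where \<beta>: "G.evolution (\<lambda>t. snd (rep_regR \<gamma> t)) \<beta>"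
    using G.evolution_exists[OF regulated_fst_snd_rep(2)] by blast
  obtain \<alpha> where \<alpha>: "N.evolution (\<lambda>t. daction (\<beta> t) (fst (rep_regR \<gamma> t))) \<alpha>"
    using N.evolution_exists[OF regulated_twisted_control[OF \<beta>]] by blast
  show ?thesis
  proof (rule ex1I[where a = "\<lambda>t\<in>{0..1}. (\<alpha> t, \<beta> t)"])
    show "is_evolution H \<kappa>H \<gamma> (\<lambda>t\<in>{0..1}. (\<alpha> t, \<beta> t))" by (rule is_evolution_Pair[OF \<beta> \<alpha>])
    fix \<eta> assume \<eta>: "is_evolution H \<kappa>H \<gamma> \<eta>"
    note ev = evolution_components[OF \<eta>]
    have s: "snd_curve \<eta> = \<beta>" by (rule G.evolution_unique[OF regulated_fst_snd_rep(2) ev(1) \<beta>])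
    have f: "fst_curve \<eta> = \<alpha>"
      by (rule N.evolution_unique[OF regulated_twisted_control[OF \<beta>] ev(2)[unfolded s] \<alpha>])
    have "\<eta> \<in> extensional {0..1}" using \<eta> AC_extensional unfolding is_evolution_def by blast
    then show "\<eta> = (\<lambda>t\<in>{0..1}. (\<alpha> t, \<beta> t))"
      unfolding s[symmetric] f[symmetric]
      by (intro extensionalityI[of _ "{0..1}"]) (auto simp: fst_curve_def snd_curve_def)
  qed
qed

text \<open>The target topology is pulled back from a product, so the two components can be treated
  separately.\<close>

theorem semidirect_Evol_continuous:
  "continuous_map euclidean (AC_semidirect_topology N G \<pi>) (Evol H \<kappa>H)"
proof -
  let ?E = "Evol H \<kappa>H"
  have E: "is_evolution H \<kappa>H \<gamma> (?E \<gamma>)" for \<gamma>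
    unfolding Evol_def by (rule theI'[OF semidirect_evolution_unique])
  note ev = evolution_components[OF E]
  have close: "AE t in lebesgue_on {0..1}. norm (fst (rep_regR \<gamma> t) - fst (rep_regR \<gamma>0 t)) \<le> \<delta>"
    "AE t in lebesgue_on {0..1}. norm (snd (rep_regR \<gamma> t) - snd (rep_regR \<gamma>0 t)) \<le> \<delta>"
    if "dist \<gamma> \<gamma>0 < \<delta>" for \<gamma> \<gamma>0 :: "('e \<times> 'f) regR" and \<delta>
  proof -
    have le: "norm (fst x - fst y) \<le> norm (x - y)" "norm (snd x - snd y) \<le> norm (x - y)" for x y :: "'e \<times> 'f"
      using dist_fst_le[of x y] dist_snd_le[of x y] by (simp_all add: dist_norm)
    have "norm (\<gamma> - \<gamma>0) \<le> \<delta>" using that by (simp add: dist_norm)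
    then have ae: "AE t in lebesgue_on {0..1}. norm (rep_regR \<gamma> t - rep_regR \<gamma>0 t) \<le> \<delta>"
      using norm_diff_regR_AE[of \<gamma> \<gamma>0] by (elim eventually_mono) (rule order_trans)
    show "AE t in lebesgue_on {0..1}. norm (fst (rep_regR \<gamma> t) - fst (rep_regR \<gamma>0 t)) \<le> \<delta>"
      by (rule eventually_mono[OF ae]) (rule order_trans[OF le(1)])
    show "AE t in lebesgue_on {0..1}. norm (snd (rep_regR \<gamma> t) - snd (rep_regR \<gamma>0 t)) \<le> \<delta>"
      by (rule eventually_mono[OF ae]) (rule order_trans[OF le(2)])
  qed
  have cG: "continuous_map euclidean (AC_topology G) (\<lambda>\<gamma>. snd_curve (?E \<gamma>))"
    unfolding continuous_map_def
  proof (intro conjI allI impI)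
    show "(\<lambda>\<gamma>. snd_curve (?E \<gamma>)) \<in> topspace euclidean \<rightarrow> topspace (AC_topology G)"
      using ev(1) by (simp add: G.topspace_AC_topology G.evolution_def)
    fix W assume W: "openin (AC_topology G) W"
    have "open {\<gamma>. snd_curve (?E \<gamma>) \<in> W}"
      unfolding open_dist
    proof clarify
      fix \<gamma>0 assume "snd_curve (?E \<gamma>0) \<in> W"
      from G.evolution_continuous[OF regulated_fst_snd_rep(2) ev(1) W this]
      obtain \<delta> where \<delta>: "\<delta> > 0" "\<And>\<gamma> \<eta>. regulated_on 0 1 \<gamma> \<Longrightarrow> G.evolution \<gamma> \<eta> \<Longrightarrow>
          AE t in lebesgue_on {0..1}. norm (\<gamma> t - snd (rep_regR \<gamma>0 t)) \<le> \<delta> \<Longrightarrow> \<eta> \<in> W" by blast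
      have "snd_curve (?E \<gamma>) \<in> W" if "dist \<gamma> \<gamma>0 < \<delta>" for \<gamma>
        by (rule \<delta>(2)[OF regulated_fst_snd_rep(2) ev(1) close(2)[OF that]])
      then show "\<exists>e>0. \<forall>\<gamma>. dist \<gamma> \<gamma>0 < e \<longrightarrow> \<gamma> \<in> {\<gamma>. snd_curve (?E \<gamma>) \<in> W}" using \<delta>(1) by blast
    qed
    then show "openin euclidean {\<gamma> \<in> topspace euclidean. snd_curve (?E \<gamma>) \<in> W}" by simp
  qed
  have cN: "continuous_map euclidean (AC_topology N) (\<lambda>\<gamma>. fst_curve (?E \<gamma>))"
    unfolding continuous_map_def
  proof (intro conjI allI impI)
    show "(\<lambda>\<gamma>. fst_curve (?E \<gamma>)) \<in> topspace euclidean \<rightarrow> topspace (AC_topology N)"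
      using ev(2) by (simp add: N.topspace_AC_topology N.evolution_def)
    fix W assume W: "openin (AC_topology N) W"
    have "open {\<gamma>. fst_curve (?E \<gamma>) \<in> W}"
      unfolding open_dist
    proof clarify
      fix \<gamma>0 assume "fst_curve (?E \<gamma>0) \<in> W"
      \<comment> \<open>First \<epsilon> is found for the twisted control in \<open>N\<close>, then
        \<delta> such that moving both components of the control by at most \<delta> moves the
        twisted control by at most \<epsilon>.\<close>
      from N.evolution_continuous[OF regulated_twisted_control[OF ev(1)] ev(2) W this]
      obtain \<epsilon> where \<epsilon>: "\<epsilon> > 0" "\<And>\<gamma> \<eta>. regulated_on 0 1 \<gamma> \<Longrightarrow> N.evolution \<gamma> \<eta> \<Longrightarrow>
          AE t in lebesgue_on {0..1}. norm (\<gamma> t - daction (snd_curve (?E \<gamma>0) t) (fst (rep_regR \<gamma>0 t))) \<le> \<epsilon> \<Longrightarrow> \<eta> \<in> W" by blast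
      obtain \<delta> where \<delta>: "\<delta> > 0" "\<And>\<xi> \<zeta> \<beta>. regulated_on 0 1 \<xi> \<Longrightarrow> regulated_on 0 1 \<zeta> \<Longrightarrow> G.evolution \<zeta> \<beta> \<Longrightarrow>
          AE t in lebesgue_on {0..1}. norm (\<xi> t - fst (rep_regR \<gamma>0 t)) \<le> \<delta> \<Longrightarrow>
          AE t in lebesgue_on {0..1}. norm (\<zeta> t - snd (rep_regR \<gamma>0 t)) \<le> \<delta> \<Longrightarrow>
          AE t in lebesgue_on {0..1}. norm (daction (\<beta> t) (\<xi> t) - daction (snd_curve (?E \<gamma>0) t) (fst (rep_regR \<gamma>0 t))) \<le> \<epsilon>"
        by (rule daction_evolution_continuous[OF regulated_fst_snd_rep ev(1) \<epsilon>(1)]) blast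
      have "fst_curve (?E \<gamma>) \<in> W" if "dist \<gamma> \<gamma>0 < \<delta>" for \<gamma>
        by (rule \<epsilon>(2)[OF regulated_twisted_control[OF ev(1)] ev(2)],
            rule \<delta>(2)[OF regulated_fst_snd_rep ev(1) close[OF that]])
      then show "\<exists>e>0. \<forall>\<gamma>. dist \<gamma> \<gamma>0 < e \<longrightarrow> \<gamma> \<in> {\<gamma>. fst_curve (?E \<gamma>) \<in> W}" using \<delta>(1) by blast
    qed
    then show "openin euclidean {\<gamma> \<in> topspace euclidean. fst_curve (?E \<gamma>) \<in> W}" by simp
  qed
  show ?thesis
    unfolding AC_semidirect_topology_def
  proof (rule continuous_map_pullback')
    have "continuous_map euclidean (prod_topology (AC_topology N) (AC_topology G)) (\<lambda>\<gamma>. (fst_curve (?E \<gamma>), snd_curve (?E \<gamma>)))"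
      by (rule continuous_map_pairedI[OF cN cG])
    then show "continuous_map euclidean (prod_topology (AC_topology N) (AC_topology G))
        ((\<lambda>\<eta>. (\<lambda>t\<in>{0..1}. fst (\<eta> t), \<lambda>t\<in>{0..1}. snd (\<eta> t))) \<circ> ?E)"
      by (simp add: o_def fst_curve_def snd_curve_def)
    show "topspace euclidean \<subseteq> ?E -` AC (atlas H)" using E by (auto simp: is_evolution_def)
  qed
qed

end

text \<open>The charts at the units fix the identification of the Lie algebra of H with the product
  of the model spaces; \<open>euclidean\<close> is the topology of the essential supremum norm on
  \<open>regR\<close>.\<close>

theorem theorem1:
  fixes G :: "('g, 'f::banach) mgroup" and N :: "('n, 'e::banach) mgroup"
    and \<pi> :: "'g \<Rightarrow> 'n \<Rightarrow> 'n"
    and \<kappa>\<^sub>N :: "('n, 'e) chart" and \<kappa>\<^sub>G :: "('g, 'f) chart"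
  assumes "Lie_group G" and "Lie_group N"
    and "\<pi> \<in> hom G (Lie_Aut N)"
    and "continuous_map (prod_topology (group_topology G) (group_topology N)) (group_topology N)
           (\<lambda>(g, n). \<pi> g n)"
    and "\<kappa>\<^sub>N \<in> charts (atlas N)" and "\<one>\<^bsub>N\<^esub> \<in> fst \<kappa>\<^sub>N"
    and "\<kappa>\<^sub>G \<in> charts (atlas G)" and "\<one>\<^bsub>G\<^esub> \<in> fst \<kappa>\<^sub>G"
  shows "(\<forall>\<gamma> :: ('e \<times> 'f) regR.
            \<exists>!\<eta>. is_evolution (semidirect N G \<pi>) (prod_chart \<kappa>\<^sub>N \<kappa>\<^sub>G) \<gamma> \<eta>) \<and>
         continuous_map euclidean (AC_semidirect_topology N G \<pi>)
           (Evol (semidirect N G \<pi>) (prod_chart \<kappa>\<^sub>N \<kappa>\<^sub>G))"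
proof -
  interpret N: banach_lie_group N "fst \<kappa>\<^sub>N" "snd \<kappa>\<^sub>N"
    by (intro banach_lie_group.intro banach_lie_group_axioms.intro) (use assms in \<open>simp_all add: Lie_group_def\<close>)
  interpret G: banach_lie_group G "fst \<kappa>\<^sub>G" "snd \<kappa>\<^sub>G"
    by (intro banach_lie_group.intro banach_lie_group_axioms.intro) (use assms in \<open>simp_all add: Lie_group_def\<close>)
  interpret semidirect_lie_group N "fst \<kappa>\<^sub>N" "snd \<kappa>\<^sub>N" G "fst \<kappa>\<^sub>G" "snd \<kappa>\<^sub>G" \<pi>
    by unfold_locales (rule assms)+
  show ?thesis using semidirect_evolution_unique semidirect_Evol_continuous by simp
qed

end
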